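(* Assume every object of $\mathcal{A}$ is relatively injective. Then the category $\mathrm{pro}\text{-}Sup\,\mathcal{A}$ of pro-supercomplexes, with the cofibrations, weak equivalences and fibrations defined in the context, satisfies Quillen's axioms for a closed model category.
   Context: $\mathcal{A}$ is an additive category closed under finite limits and finite colimits, with a fixed class $\mathcal{J}$ of objects called basic. A map $i:A'\to A$ in $\mathcal{A}$ is a cofibration if $\hom(i,J)$ is surjective for every $J\in\mathcal{J}$; an object $F$ is relatively injective if $\hom(-,F)$ sends cofibrations to surjections (so all objects being relatively injective means that cofibrations of $\mathcal{A}$ are the split injections). $\mathrm{pro}\text{-}\mathcal{C}$ is the category whose objects are inverse systems $\{A_{n+1}\to A_n\}_{n\ge1}$ in $\mathcal{C}$, with $\hom(A,B)=\lim_n\mathrm{colim}_m\hom(A_m,B_n)$; $\mathcal{C}$ is identified with the constant pro-objects. A map $i$ of $\mathrm{pro}\text{-}\mathcal{A}$ is a cofibration if $\hom(i,V)$ is surjective for every relatively injective object $V$ of $\mathcal{A}$ (constant); an object $F$ of $\mathrm{pro}\text{-}\mathcal{A}$ is relatively injective if $\hom(-,F)$ sends cofibrations of $\mathrm{pro}\text{-}\mathcal{A}$ to surjections. $Sup\,\mathcal{A}$ is the category of supercomplexes: $\mathbb{Z}/2$-graded objects of $\mathcal A$ with a square-zero differential of degree 1. $\mathrm{HOM}_{\mathbb{Z}/2}(X,Y)$ is the supercomplex of $\mathbb{Z}/2$-homogeneous maps (of pro-objects when $X$, $Y$ are pro-supercomplexes) with differential $f\mapsto\partial f-(-1)^{|f|}f\partial$.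 A map $f$ in $\mathrm{pro}\text{-}Sup\,\mathcal{A}$ is a cofibration (resp. a weak equivalence) if $\mathrm{HOM}_{\mathbb{Z}/2}(f,Y)$ is surjective (resp. a quasi-isomorphism) for every $Y\in Sup\,\mathcal{A}$ whose components $Y_0,Y_1$ are relatively injective in $\mathcal{A}$. An object $X$ is fibrant if its even and odd components are relatively injective objects of $\mathrm{pro}\text{-}\mathcal{A}$. A map $X\to Y$ is a fibration if in each degree it is a split surjection of $\mathrm{pro}\text{-}\mathcal{A}$ (the splitting need not be a chain map) and its kernel is fibrant. *)

theory Defs
  imports "HOL-Algebra.Product_Groups" "HOL-Library.Z2"
begin

section \<open>Categories, finite limits, additive categories\<close>

record ('o, 'm) cat =
  Ob :: "'o set"
  Ar :: "'m set"
  Dom :: "'m \<Rightarrow> 'o"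
  Cod :: "'m \<Rightarrow> 'o"
  Id :: "'o \<Rightarrow> 'm"
  Comp :: "'m \<Rightarrow> 'm \<Rightarrow> 'm"  (infixr "\<cdot>\<index>" 75)

definition hom_set :: "('o, 'm, 'x) cat_scheme \<Rightarrow> 'o \<Rightarrow> 'o \<Rightarrow> 'm set" where
  "hom_set C a b = {f \<in> Ar C. Dom C f = a \<and> Cod C f = b}"

locale category =
  fixes C :: "('o, 'm, 'x) cat_scheme" (structure)
  assumes Dom_Ob: "f \<in> Ar C \<Longrightarrow> Dom C f \<in> Ob C"
    and Cod_Ob: "f \<in> Ar C \<Longrightarrow> Cod C f \<in> Ob C"
    and Id_hom: "a \<in> Ob C \<Longrightarrow> Id C a \<in> hom_set C a a"
    and Comp_hom: "\<lbrakk>f \<in> hom_set C a b; g \<in> hom_set C b c\<rbrakk> \<Longrightarrow> g \<cdot> f \<in> hom_set C a c"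
    and Comp_assoc: "\<lbrakk>f \<in> hom_set C a b; g \<in> hom_set C b c; h \<in> hom_set C c d\<rbrakk>
                      \<Longrightarrow> (h \<cdot> g) \<cdot> f = h \<cdot> (g \<cdot> f)"
    and Id_left: "f \<in> hom_set C a b \<Longrightarrow> Id C b \<cdot> f = f"
    and Id_right: "f \<in> hom_set C a b \<Longrightarrow> f \<cdot> Id C a = f"

definition opposite :: "('o, 'm, 'x) cat_scheme \<Rightarrow> ('o, 'm) cat" where
  "opposite C = \<lparr>Ob = Ob C, Ar = Ar C, Dom = Cod C, Cod = Dom C, Id = Id C,
                 Comp = (\<lambda>g f. f \<cdot>\<^bsub>C\<^esub> g)\<rparr>"

definition is_functor ::
  "('i, 'u, 'y) cat_scheme \<Rightarrow> ('o, 'm, 'x) cat_scheme \<Rightarrow> ('i \<Rightarrow> 'o) \<Rightarrow> ('u \<Rightarrow> 'm) \<Rightarrow> bool" where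
  "is_functor I C F\<^sub>o F\<^sub>a \<longleftrightarrow>
     (\<forall>i\<in>Ob I. F\<^sub>o i \<in> Ob C \<and> F\<^sub>a (Id I i) = Id C (F\<^sub>o i)) \<and>
     (\<forall>u\<in>Ar I. F\<^sub>a u \<in> hom_set C (F\<^sub>o (Dom I u)) (F\<^sub>o (Cod I u))) \<and>
     (\<forall>u\<in>Ar I. \<forall>v\<in>Ar I. Cod I u = Dom I v \<longrightarrow> F\<^sub>a (v \<cdot>\<^bsub>I\<^esub> u) = F\<^sub>a v \<cdot>\<^bsub>C\<^esub> F\<^sub>a u)"

definition is_cone ::
  "('i, 'u, 'y) cat_scheme \<Rightarrow> ('o, 'm, 'x) cat_scheme \<Rightarrow> ('i \<Rightarrow> 'o) \<Rightarrow> ('u \<Rightarrow> 'm)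
   \<Rightarrow> 'o \<Rightarrow> ('i \<Rightarrow> 'm) \<Rightarrow> bool" where
  "is_cone I C F\<^sub>o F\<^sub>a c t \<longleftrightarrow>
     c \<in> Ob C \<and> (\<forall>i\<in>Ob I. t i \<in> hom_set C c (F\<^sub>o i)) \<and>
     (\<forall>u\<in>Ar I. F\<^sub>a u \<cdot>\<^bsub>C\<^esub> t (Dom I u) = t (Cod I u))"

definition is_limit ::
  "('i, 'u, 'y) cat_scheme \<Rightarrow> ('o, 'm, 'x) cat_scheme \<Rightarrow> ('i \<Rightarrow> 'o) \<Rightarrow> ('u \<Rightarrow> 'm)
   \<Rightarrow> 'o \<Rightarrow> ('i \<Rightarrow> 'm) \<Rightarrow> bool" where
  "is_limit I C F\<^sub>o F\<^sub>a c t \<longleftrightarrow>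
     is_cone I C F\<^sub>o F\<^sub>a c t \<and>
     (\<forall>c' t'. is_cone I C F\<^sub>o F\<^sub>a c' t' \<longrightarrow>
        (\<exists>!h. h \<in> hom_set C c' c \<and> (\<forall>i\<in>Ob I. t i \<cdot>\<^bsub>C\<^esub> h = t' i)))"

text \<open>Every finite category is isomorphic to one whose objects and arrows are natural numbers.\<close>

definition has_finite_limits :: "('o, 'm, 'x) cat_scheme \<Rightarrow> bool" where
  "has_finite_limits C \<longleftrightarrow>
     (\<forall>(I :: (nat, nat) cat) F\<^sub>o F\<^sub>a.
        category I \<and> finite (Ob I) \<and> finite (Ar I) \<and> is_functor I C F\<^sub>o F\<^sub>a
        \<longrightarrow> (\<exists>c t. is_limit I C F\<^sub>o F\<^sub>a c t))"

definition has_finite_colimits :: "('o, 'm, 'x) cat_scheme \<Rightarrow> bool" where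
  "has_finite_colimits C \<longleftrightarrow> has_finite_limits (opposite C)"

record ('o, 'm) addcat = "('o, 'm) cat" +
  Add :: "'m \<Rightarrow> 'm \<Rightarrow> 'm"
  Zer :: "'o \<Rightarrow> 'o \<Rightarrow> 'm"

text \<open>The group of maps from \<open>a\<close> to \<open>b\<close>, written multiplicatively as everywhere in HOL-Algebra.\<close>

definition hom_group :: "('o, 'm, 'x) addcat_scheme \<Rightarrow> 'o \<Rightarrow> 'o \<Rightarrow> 'm monoid" where
  "hom_group C a b = \<lparr>carrier = hom_set C a b, mult = Add C, one = Zer C a b\<rparr>"

locale preadditive_category = category C
  for C :: "('o, 'm, 'x) addcat_scheme" (structure) +
  assumes hom_comm_group: "\<lbrakk>a \<in> Ob C; b \<in> Ob C\<rbrakk> \<Longrightarrow> comm_group (hom_group C a b)"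
    and Comp_Add_left: "\<lbrakk>f \<in> hom_set C a b; g \<in> hom_set C b c; g' \<in> hom_set C b c\<rbrakk>
                         \<Longrightarrow> Add C g g' \<cdot> f = Add C (g \<cdot> f) (g' \<cdot> f)"
    and Comp_Add_right: "\<lbrakk>f \<in> hom_set C a b; f' \<in> hom_set C a b; g \<in> hom_set C b c\<rbrakk>
                         \<Longrightarrow> g \<cdot> Add C f f' = Add C (g \<cdot> f) (g \<cdot> f')"

locale additive_category = preadditive_category C
  for C :: "('o, 'm, 'x) addcat_scheme" (structure) +
  assumes zero_object:
      "\<exists>z\<in>Ob C. \<forall>a\<in>Ob C. (\<exists>!f. f \<in> hom_set C z a) \<and> (\<exists>!f. f \<in> hom_set C a z)"
    and biproducts:
      "\<lbrakk>a \<in> Ob C; b \<in> Ob C\<rbrakk> \<Longrightarrow>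
         \<exists>s\<in>Ob C. \<exists>i\<in>hom_set C a s. \<exists>j\<in>hom_set C b s. \<exists>p\<in>hom_set C s a. \<exists>q\<in>hom_set C s b.
           p \<cdot> i = Id C a \<and> q \<cdot> j = Id C b \<and> p \<cdot> j = Zer C b a \<and> q \<cdot> i = Zer C a b \<and>
           Add C (i \<cdot> p) (j \<cdot> q) = Id C s"

definition is_kernel :: "('o, 'm, 'x) addcat_scheme \<Rightarrow> 'm \<Rightarrow> 'o \<Rightarrow> 'm \<Rightarrow> bool" where
  "is_kernel C f K k \<longleftrightarrow>
     K \<in> Ob C \<and> k \<in> hom_set C K (Dom C f) \<and> f \<cdot>\<^bsub>C\<^esub> k = Zer C K (Cod C f) \<and>
     (\<forall>L\<in>Ob C. \<forall>g\<in>hom_set C L (Dom C f).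
        f \<cdot>\<^bsub>C\<^esub> g = Zer C L (Cod C f) \<longrightarrow> (\<exists>!h. h \<in> hom_set C L K \<and> k \<cdot>\<^bsub>C\<^esub> h = g))"

section \<open>Cofibrations and relative injectivity with respect to a class of objects\<close>

definition hom_into_surj :: "('o, 'm, 'x) cat_scheme \<Rightarrow> 'm \<Rightarrow> 'o \<Rightarrow> bool" where
  "hom_into_surj C i V \<longleftrightarrow>
     (\<lambda>h. h \<cdot>\<^bsub>C\<^esub> i) ` hom_set C (Cod C i) V = hom_set C (Dom C i) V"

definition cofibrations :: "('o, 'm, 'x) cat_scheme \<Rightarrow> 'o set \<Rightarrow> 'm set" where
  "cofibrations C J = {i \<in> Ar C. \<forall>V\<in>J. hom_into_surj C i V}"

definition rel_injectives :: "('o, 'm, 'x) cat_scheme \<Rightarrow> 'o set \<Rightarrow> 'o set" where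
  "rel_injectives C J = {F \<in> Ob C. \<forall>i\<in>cofibrations C J. hom_into_surj C i F}"

section \<open>Closed model categories\<close>

definition is_retract :: "('o, 'm, 'x) cat_scheme \<Rightarrow> 'm \<Rightarrow> 'm \<Rightarrow> bool" where
  "is_retract C f g \<longleftrightarrow>
     (\<exists>s\<in>hom_set C (Dom C f) (Dom C g). \<exists>r\<in>hom_set C (Dom C g) (Dom C f).
      \<exists>s'\<in>hom_set C (Cod C f) (Cod C g). \<exists>r'\<in>hom_set C (Cod C g) (Cod C f).
        r \<cdot>\<^bsub>C\<^esub> s = Id C (Dom C f) \<and> r' \<cdot>\<^bsub>C\<^esub> s' = Id C (Cod C f) \<and>
        g \<cdot>\<^bsub>C\<^esub> s = s' \<cdot>\<^bsub>C\<^esub> f \<and> f \<cdot>\<^bsub>C\<^esub> r = r' \<cdot>\<^bsub>C\<^esub> g)"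

definition has_lifting :: "('o, 'm, 'x) cat_scheme \<Rightarrow> 'm \<Rightarrow> 'm \<Rightarrow> bool" where
  "has_lifting C i p \<longleftrightarrow>
     (\<forall>u\<in>hom_set C (Dom C i) (Dom C p). \<forall>v\<in>hom_set C (Cod C i) (Cod C p).
        p \<cdot>\<^bsub>C\<^esub> u = v \<cdot>\<^bsub>C\<^esub> i \<longrightarrow>
        (\<exists>h\<in>hom_set C (Cod C i) (Dom C p). h \<cdot>\<^bsub>C\<^esub> i = u \<and> p \<cdot>\<^bsub>C\<^esub> h = v))"

text \<open>\<open>W\<close>, \<open>Cof\<close>, \<open>Fib\<close> are the weak equivalences, cofibrations and fibrations; the
  axioms are CM1--CM5 of Quillen's Rational Homotopy Theory.\<close>

locale closed_model_category = category C
  for C :: "('o, 'm, 'x) cat_scheme" (structure) +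
  fixes W Cof Fib :: "'m set"
  assumes W_Ar: "W \<subseteq> Ar C"
    and Cof_Ar: "Cof \<subseteq> Ar C"
    and Fib_Ar: "Fib \<subseteq> Ar C"
    and CM1: "has_finite_limits C" "has_finite_colimits C"
    and CM2: "\<lbrakk>f \<in> Ar C; g \<in> Ar C; Cod C f = Dom C g\<rbrakk> \<Longrightarrow>
        (f \<in> W \<and> g \<in> W \<longrightarrow> g \<cdot> f \<in> W) \<and>
        (f \<in> W \<and> g \<cdot> f \<in> W \<longrightarrow> g \<in> W) \<and>
        (g \<in> W \<and> g \<cdot> f \<in> W \<longrightarrow> f \<in> W)"
    and CM3: "\<lbrakk>f \<in> Ar C; g \<in> Ar C; is_retract C f g\<rbrakk> \<Longrightarrow>
        (g \<in> W \<longrightarrow> f \<in> W) \<and> (g \<in> Cof \<longrightarrow> f \<in> Cof) \<and> (g \<in> Fib \<longrightarrow> f \<in> Fib)"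
    and CM4: "\<lbrakk>i \<in> Cof; p \<in> Fib; i \<in> W \<or> p \<in> W\<rbrakk> \<Longrightarrow> has_lifting C i p"
    and CM5: "f \<in> Ar C \<Longrightarrow>
        (\<exists>i\<in>Cof. \<exists>p\<in>Fib \<inter> W. Cod C i = Dom C p \<and> f = p \<cdot> i) \<and>
        (\<exists>i\<in>Cof \<inter> W. \<exists>p\<in>Fib. Cod C i = Dom C p \<and> f = p \<cdot> i)"

section \<open>Pro-objects\<close>

datatype ('o, 'a) arrow = Arrow (src: 'o) (tgt: 'o) (body: 'a)

text \<open>Inverse systems indexed by the natural numbers: \<open>level X n\<close> is the object with index
  \<open>n + 1\<close>, and \<open>bond X n : level X (n + 1) \<rightarrow> level X n\<close>.\<close>

datatype ('o, 'm) tower = Tower (level: "nat \<Rightarrow> 'o") (bond: "nat \<Rightarrow> 'm")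

text \<open>The structure map from level \<open>n\<close> to level \<open>m\<close>; only meaningful for \<open>m \<le> n\<close>.\<close>

primrec transit :: "('o, 'm, 'x) cat_scheme \<Rightarrow> ('o, 'm) tower \<Rightarrow> nat \<Rightarrow> nat \<Rightarrow> 'm" where
  "transit C X 0 m = Id C (level X 0)"
| "transit C X (Suc n) m =
     (if m \<le> n then transit C X n m \<cdot>\<^bsub>C\<^esub> bond X n else Id C (level X (Suc n)))"

text \<open>\<open>colim_hom C X b\<close> is the colimit over \<open>m\<close> of the maps from \<open>level X m\<close> to \<open>b\<close>, as the
  set of classes of the relation \<open>germ_rel C X b\<close> on pairs (level, map).\<close>

definition germ_rel ::
  "('o, 'm, 'x) cat_scheme \<Rightarrow> ('o, 'm) tower \<Rightarrow> 'o \<Rightarrow> ((nat \<times> 'm) \<times> (nat \<times> 'm)) set" where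
  "germ_rel C X b =
     {((m, f), (m', f')). f \<in> hom_set C (level X m) b \<and> f' \<in> hom_set C (level X m') b \<and>
        (\<exists>k. m \<le> k \<and> m' \<le> k \<and> f \<cdot>\<^bsub>C\<^esub> transit C X k m = f' \<cdot>\<^bsub>C\<^esub> transit C X k m')}"

definition colim_hom ::
  "('o, 'm, 'x) cat_scheme \<Rightarrow> ('o, 'm) tower \<Rightarrow> 'o \<Rightarrow> (nat \<times> 'm) set set" where
  "colim_hom C X b = (SIGMA m:UNIV. hom_set C (level X m) b) // germ_rel C X b"

definition germ ::
  "('o, 'm, 'x) cat_scheme \<Rightarrow> ('o, 'm) tower \<Rightarrow> 'o \<Rightarrow> nat \<Rightarrow> 'm \<Rightarrow> (nat \<times> 'm) set" where
  "germ C X b m f = germ_rel C X b `` {(m, f)}"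

definition postcomp ::
  "('o, 'm, 'x) cat_scheme \<Rightarrow> ('o, 'm) tower \<Rightarrow> 'm \<Rightarrow> (nat \<times> 'm) set \<Rightarrow> (nat \<times> 'm) set" where
  "postcomp C X g c = germ_rel C X (Cod C g) `` ((\<lambda>(m, f). (m, g \<cdot>\<^bsub>C\<^esub> f)) ` c)"

type_synonym ('o, 'm) pro_arrow =
  "(('o, 'm) tower, nat \<Rightarrow> (nat \<times> 'm) set) arrow"

text \<open>A map of pro-objects is an element of the limit over \<open>n\<close> of the sets
  \<open>colim_hom C X (level Y n)\<close>. In \<open>Comp\<close> and \<open>Add\<close> the unions over representatives do not
  depend on choices: all representatives contribute to the same class. The category structure
  of \<open>Pro C\<close> does not use the addition of \<open>C\<close>.\<close>

definition Pro :: "('o, 'm) addcat \<Rightarrow> (('o, 'm) tower, ('o, 'm) pro_arrow) addcat" where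
  "Pro C =
    (let towers = {X. \<forall>n. level X n \<in> Ob C \<and> bond X n \<in> hom_set C (level X (Suc n)) (level X n)}
     in \<lparr>Ob = towers,
         Ar = {Arrow X Y F | X Y F. X \<in> towers \<and> Y \<in> towers \<and>
                 (\<forall>n. F n \<in> colim_hom C X (level Y n) \<and>
                      postcomp C X (bond Y n) (F (Suc n)) = F n)},
         Dom = src,
         Cod = tgt,
         Id = (\<lambda>X. Arrow X X (\<lambda>n. germ C X (level X n) n (Id C (level X n)))),
         Comp = (\<lambda>G F. Arrow (src F) (tgt G)
                   (\<lambda>n. \<Union>(m, g)\<in>body G n. postcomp C (src F) g (body F m))),
         Add = (\<lambda>F G. Arrow (src F) (tgt F)
                   (\<lambda>n. germ_rel C (src F) (level (tgt F) n) ``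
                          {(k, Add C f g) | k f g. (k, f) \<in> body F n \<and> (k, g) \<in> body G n})),
         Zer = (\<lambda>X Y. Arrow X Y
                   (\<lambda>n. germ C X (level Y n) 0 (Zer C (level X 0) (level Y n))))\<rparr>)"

definition const_tower :: "('o, 'm, 'x) cat_scheme \<Rightarrow> 'o \<Rightarrow> ('o, 'm) tower" where
  "const_tower C a = Tower (\<lambda>_. a) (\<lambda>_. Id C a)"

text \<open>Relative injectives of the pro-category: cofibrations there are tested against the
  constant pro-objects on relatively injective objects.\<close>

definition pro_rel_injectives :: "('o, 'm) addcat \<Rightarrow> 'o set \<Rightarrow> ('o, 'm) tower set" where
  "pro_rel_injectives C J = rel_injectives (Pro C) (const_tower C ` rel_injectives C J)"

section \<open>Supercomplexes\<close>

text \<open>The grading group \<open>\<int>/2\<close> is the two-element field \<^typ>\<open>bit\<close>.\<close>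

datatype ('o, 'm) supercx = Supercx (part: "bit \<Rightarrow> 'o") (bdry: "bit \<Rightarrow> 'm")

type_synonym ('o, 'm) sup_arrow =
  "(('o, 'm) supercx, bit \<Rightarrow> 'm) arrow"

definition Sup_cat :: "('o, 'm) addcat \<Rightarrow> (('o, 'm) supercx, ('o, 'm) sup_arrow) addcat" where
  "Sup_cat C =
    (let complexes = {X. \<forall>i. part X i \<in> Ob C \<and> bdry X i \<in> hom_set C (part X i) (part X (i + 1)) \<and>
                             bdry X (i + 1) \<cdot>\<^bsub>C\<^esub> bdry X i = Zer C (part X i) (part X i)}
     in \<lparr>Ob = complexes,
         Ar = {Arrow X Y f | X Y f. X \<in> complexes \<and> Y \<in> complexes \<and>
                 (\<forall>i. f i \<in> hom_set C (part X i) (part Y i) \<and>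
                      bdry Y i \<cdot>\<^bsub>C\<^esub> f i = f (i + 1) \<cdot>\<^bsub>C\<^esub> bdry X i)},
         Dom = src,
         Cod = tgt,
         Id = (\<lambda>X. Arrow X X (\<lambda>i. Id C (part X i))),
         Comp = (\<lambda>g f. Arrow (src f) (tgt g) (\<lambda>i. body g i \<cdot>\<^bsub>C\<^esub> body f i)),
         Add = (\<lambda>f g. Arrow (src f) (tgt f) (\<lambda>i. Add C (body f i) (body g i))),
         Zer = (\<lambda>X Y. Arrow X Y (\<lambda>i. Zer C (part X i) (part Y i)))\<rparr>)"

subsection \<open>Supercomplexes of abelian groups\<close>

record 'a group_supercx =
  grp :: "bit \<Rightarrow> 'a monoid"
  diff :: "bit \<Rightarrow> 'a \<Rightarrow> 'a"

definition cycles :: "'a group_supercx \<Rightarrow> bit \<Rightarrow> 'a set" where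
  "cycles K p = kernel (grp K p) (grp K (p + 1)) (diff K p)"

definition boundaries :: "'a group_supercx \<Rightarrow> bit \<Rightarrow> 'a set" where
  "boundaries K p = diff K (p + 1) ` carrier (grp K (p + 1))"

definition homology :: "'a group_supercx \<Rightarrow> bit \<Rightarrow> 'a set monoid" where
  "homology K p = (grp K p)\<lparr>carrier := cycles K p\<rparr> Mod boundaries K p"

definition homology_map ::
  "'b group_supercx \<Rightarrow> bit \<Rightarrow> ('a \<Rightarrow> 'b) \<Rightarrow> 'a set \<Rightarrow> 'b set" where
  "homology_map L p \<phi> c = (\<Union>x\<in>c. boundaries L p #>\<^bsub>grp L p\<^esub> \<phi> x)"

definition surjective_map ::
  "'a group_supercx \<Rightarrow> 'b group_supercx \<Rightarrow> ('a \<Rightarrow> 'b) \<Rightarrow> bool" where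
  "surjective_map K L \<phi> \<longleftrightarrow> (\<forall>p. \<phi> ` carrier (grp K p) = carrier (grp L p))"

definition quasi_isomorphism ::
  "'a group_supercx \<Rightarrow> 'b group_supercx \<Rightarrow> ('a \<Rightarrow> 'b) \<Rightarrow> bool" where
  "quasi_isomorphism K L \<phi> \<longleftrightarrow> (\<forall>p. homology_map L p \<phi> \<in> iso (homology K p) (homology L p))"

section \<open>Pro-supercomplexes\<close>

text \<open>The component functors from pro-supercomplexes to pro-objects of \<open>A\<close>, and the
  differential of a pro-supercomplex as a map between its components.\<close>

definition pro_part ::
  "(('o, 'm) supercx, ('o, 'm) sup_arrow) tower \<Rightarrow> bit \<Rightarrow> ('o, 'm) tower" where
  "pro_part X i = Tower (\<lambda>n. part (level X n) i) (\<lambda>n. body (bond X n) i)"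

definition pro_part_arrow ::
  "('o, 'm) addcat \<Rightarrow> (('o, 'm) supercx, ('o, 'm) sup_arrow) pro_arrow \<Rightarrow> bit
   \<Rightarrow> ('o, 'm) pro_arrow" where
  "pro_part_arrow A F i =
     Arrow (pro_part (src F) i) (pro_part (tgt F) i)
       (\<lambda>n. germ_rel A (pro_part (src F) i) (part (level (tgt F) n) i) ``
              ((\<lambda>(m, f). (m, body f i)) ` body F n))"

definition pro_bdry ::
  "('o, 'm) addcat \<Rightarrow> (('o, 'm) supercx, ('o, 'm) sup_arrow) tower \<Rightarrow> bit
   \<Rightarrow> ('o, 'm) pro_arrow" where
  "pro_bdry A X i =
     Arrow (pro_part X i) (pro_part X (i + 1))
       (\<lambda>n. germ A (pro_part X i) (part (level X n) (i + 1)) n (bdry (level X n) i))"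

text \<open>An element \<open>f\<close> of degree \<open>p\<close> of \<open>HOM A X Y\<close> has components \<open>f i : X i \<rightarrow> Y (i + p)\<close>;
  its differential is \<open>\<partial> f - (-1)\<^sup>p f \<partial>\<close>.\<close>

definition HOM ::
  "('o, 'm) addcat \<Rightarrow> (('o, 'm) supercx, ('o, 'm) sup_arrow) tower
   \<Rightarrow> (('o, 'm) supercx, ('o, 'm) sup_arrow) tower
   \<Rightarrow> (bit \<Rightarrow> ('o, 'm) pro_arrow) group_supercx" where
  "HOM A X Y =
     \<lparr>grp = (\<lambda>p. product_group UNIV (\<lambda>i. hom_group (Pro A) (pro_part X i) (pro_part Y (i + p)))),
      diff = (\<lambda>p f i.
        let df = pro_bdry A Y (i + p) \<cdot>\<^bsub>Pro A\<^esub> f i;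
            fd = f (i + 1) \<cdot>\<^bsub>Pro A\<^esub> pro_bdry A X i;
            G = hom_group (Pro A) (pro_part X i) (pro_part Y (i + p + 1))
        in df \<otimes>\<^bsub>G\<^esub> (if p = 0 then inv\<^bsub>G\<^esub> fd else fd))\<rparr>"

definition HOM_map ::
  "('o, 'm) addcat \<Rightarrow> (('o, 'm) supercx, ('o, 'm) sup_arrow) pro_arrow
   \<Rightarrow> (bit \<Rightarrow> ('o, 'm) pro_arrow) \<Rightarrow> (bit \<Rightarrow> ('o, 'm) pro_arrow)" where
  "HOM_map A f \<phi> = (\<lambda>i. \<phi> i \<cdot>\<^bsub>Pro A\<^esub> pro_part_arrow A f i)"

definition rel_injective_supercxs :: "('o, 'm) addcat \<Rightarrow> 'o set \<Rightarrow> ('o, 'm) supercx set" where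
  "rel_injective_supercxs A J = {Y \<in> Ob (Sup_cat A). \<forall>i. part Y i \<in> rel_injectives A J}"

definition prosup_cofibrations ::
  "('o, 'm) addcat \<Rightarrow> 'o set \<Rightarrow> (('o, 'm) supercx, ('o, 'm) sup_arrow) pro_arrow set" where
  "prosup_cofibrations A J =
     {f \<in> Ar (Pro (Sup_cat A)). \<forall>Y\<in>rel_injective_supercxs A J.
        surjective_map (HOM A (tgt f) (const_tower (Sup_cat A) Y))
          (HOM A (src f) (const_tower (Sup_cat A) Y)) (HOM_map A f)}"

definition prosup_weak_equivalences ::
  "('o, 'm) addcat \<Rightarrow> 'o set \<Rightarrow> (('o, 'm) supercx, ('o, 'm) sup_arrow) pro_arrow set" where
  "prosup_weak_equivalences A J =
     {f \<in> Ar (Pro (Sup_cat A)). \<forall>Y\<in>rel_injective_supercxs A J.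
        quasi_isomorphism (HOM A (tgt f) (const_tower (Sup_cat A) Y))
          (HOM A (src f) (const_tower (Sup_cat A) Y)) (HOM_map A f)}"

definition prosup_fibrant ::
  "('o, 'm) addcat \<Rightarrow> 'o set \<Rightarrow> (('o, 'm) supercx, ('o, 'm) sup_arrow) tower \<Rightarrow> bool" where
  "prosup_fibrant A J X \<longleftrightarrow>
     X \<in> Ob (Pro (Sup_cat A)) \<and> (\<forall>i. pro_part X i \<in> pro_rel_injectives A J)"

definition prosup_fibrations ::
  "('o, 'm) addcat \<Rightarrow> 'o set \<Rightarrow> (('o, 'm) supercx, ('o, 'm) sup_arrow) pro_arrow set" where
  "prosup_fibrations A J =
     {f \<in> Ar (Pro (Sup_cat A)).
        (\<forall>i. \<exists>s\<in>hom_set (Pro A) (pro_part (tgt f) i) (pro_part (src f) i).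
               pro_part_arrow A f i \<cdot>\<^bsub>Pro A\<^esub> s = Id (Pro A) (pro_part (tgt f) i)) \<and>
        (\<exists>K k. is_kernel (Pro (Sup_cat A)) f K k \<and> prosup_fibrant A J K)}"

end

theory Submission
  imports Defs
begin

text \<open>A pro-supercomplex is the same thing as a supercomplex in the additive category of pro-objects: passing to
  components is fully faithful and, by a kernel construction, essentially surjective. Since all objects of \<open>A\<close> are relatively
  injective, the test objects are the constant towers. Every pro-object \<open>X\<close> is a limit of test objects \<open>V k\<close>, through one of
  which each map from \<open>X\<close> to a test object factors; hence \<open>X\<close> embeds by a cofibration \<open>\<iota>\<close> into the product \<open>E\<close> of the
  \<open>V k\<close>, and the map \<open>q = 1 - shift\<close> on \<open>E\<close> continues \<open>\<iota>\<close> to a relatively injective resolution of length one.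

  Such a resolution, taken for complexes, carries statements about test complexes over to all fibrant ones, which gives both
  lifting properties. The homotopy fibre of \<open>q\<close> is a fibrant replacement of \<open>X\<close>; a homotopy pullback along fibrant
  replacements factors a map into a trivial cofibration and a fibration, and adding the contractible complex on \<open>E\<close> to the
  target factors it into a cofibration and a trivial fibration.\<close>

section \<open>Calculus in preadditive categories\<close>

text \<open>Weak equivalences are tested on constant complexes only, while the kernel of a fibration
  is merely relatively injective among pro-objects. In each degree such an object is a retract of a
  countable product E of constants, but the retraction is a graded map and not a chain map, so
  vanishing of homology cannot simply be pushed along it; the second map q of the resolution is what
  absorbs its boundary. Length one suffices because towers are indexed by the natural numbers: maps
  into a constant object W turn \<iota> and q into the telescope presenting the colimit of the
  groups hom(V k, W), where 1 - shift is injective. This needs maps from E to W to depend on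
  finitely many coordinates, so that they form a direct sum. The homotopy theory is done in an
  abstract additive category with a class of test objects (\<open>pro_model\<close>), where
  differentials satisfy equations between actual maps instead of equations up to a change of level.
  The comparison functor \<open>Phi\<close> is an equivalence and not an isomorphism, so the axiom
  that produces an object, factorization, needs a passage to an isomorphic one.\<close>

declare add_bit_eq_xor [simp del]

text \<open>Degrees are kept in the form \<open>i + 1\<close>; this rule could not fire if addition
  were unfolded to exclusive or.\<close>

lemma bit_add_1_1 [simp]: "(i::bit) + 1 + 1 = i"
  by (cases i) (simp_all add: add_bit_eq_xor)

lemma in_hom_set: "f \<in> hom_set C a b \<longleftrightarrow> f \<in> Ar C \<and> Dom C f = a \<and> Cod C f = b"
  by (simp add: hom_set_def)

context category
begin

lemma Comp_Ar [simp]: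
  assumes "f \<in> Ar C" "g \<in> Ar C" "Dom C g = Cod C f"
  shows "g \<cdot> f \<in> Ar C" "Dom C (g \<cdot> f) = Dom C f" "Cod C (g \<cdot> f) = Cod C g"
  using Comp_hom[of f "Dom C f" "Cod C f" g "Cod C g"] assms by (auto simp: in_hom_set)

lemma Id_Ar [simp]: "a \<in> Ob C \<Longrightarrow> Id C a \<in> Ar C" "a \<in> Ob C \<Longrightarrow> Dom C (Id C a) = a"
  "a \<in> Ob C \<Longrightarrow> Cod C (Id C a) = a"
  using Id_hom[of a] by (auto simp: in_hom_set)

lemma assoc [simp]:
  assumes "f \<in> Ar C" "g \<in> Ar C" "h \<in> Ar C" "Dom C g = Cod C f" "Dom C h = Cod C g"
  shows "(h \<cdot> g) \<cdot> f = h \<cdot> g \<cdot> f"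
  using Comp_assoc[of f "Dom C f" "Cod C f" g "Cod C g" h "Cod C h"] assms by (auto simp: in_hom_set)

lemma Id_comp [simp]: "f \<in> Ar C \<Longrightarrow> a = Cod C f \<Longrightarrow> Id C a \<cdot> f = f"
  using Id_left[of f "Dom C f" "Cod C f"] by (auto simp: in_hom_set)

lemma comp_Id [simp]: "f \<in> Ar C \<Longrightarrow> a = Dom C f \<Longrightarrow> f \<cdot> Id C a = f"
  using Id_right[of f "Dom C f" "Cod C f"] by (auto simp: in_hom_set)

lemma Dom_Cod_Ob [simp]: "f \<in> Ar C \<Longrightarrow> Dom C f \<in> Ob C" "f \<in> Ar C \<Longrightarrow> Cod C f \<in> Ob C"
  using Dom_Ob Cod_Ob by auto

lemma hom_Ob: "f \<in> hom_set C a b \<Longrightarrow> a \<in> Ob C" "f \<in> hom_set C a b \<Longrightarrow> b \<in> Ob C"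
  by (auto simp: in_hom_set)

text \<open>Composites are normalised to the right, which hides \<open>g \<cdot> f\<close> inside a
  longer composite. This turns an equation for \<open>g \<cdot> f\<close> into one with a tail
  \<open>x\<close>.\<close>

lemma comp_rw:
  assumes "g \<cdot> f = t" "x \<in> Ar C" "f \<in> Ar C" "g \<in> Ar C" "Dom C g = Cod C f" "Dom C f = Cod C x"
  shows "g \<cdot> f \<cdot> x = t \<cdot> x"
  using assms assoc[of x f g] by simp

end

text \<open>The group is read off from the domain and codomain of \<open>f\<close>, so calculations
  never have to name a hom-set.\<close>

definition neg :: "('o, 'm, 'x) addcat_scheme \<Rightarrow> 'm \<Rightarrow> 'm" where
  "neg C f = inv\<^bsub>hom_group C (Dom C f) (Cod C f)\<^esub> f"

lemma hom_group_simps [simp]: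
  "carrier (hom_group C a b) = hom_set C a b" "mult (hom_group C a b) = Add C"
  "one (hom_group C a b) = Zer C a b"
  by (simp_all add: hom_group_def)

context preadditive_category
begin

abbreviation add_ar (infixl "\<boxplus>" 65) where "f \<boxplus> g \<equiv> Add C f g"

abbreviation parallel where
  "parallel f g \<equiv> f \<in> Ar C \<and> g \<in> Ar C \<and> Dom C f = Dom C g \<and> Cod C f = Cod C g"


lemma hom_group: "\<lbrakk>a \<in> Ob C; b \<in> Ob C\<rbrakk> \<Longrightarrow> group (hom_group C a b)"
  using hom_comm_group comm_group.axioms(2) by blast

lemma Zer_Ar [simp]:
  assumes "a \<in> Ob C" "b \<in> Ob C"
  shows "Zer C a b \<in> Ar C" "Dom C (Zer C a b) = a" "Cod C (Zer C a b) = b"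
  using monoid.one_closed[OF group.is_monoid[OF hom_group[OF assms]]] by (auto simp: in_hom_set)

lemma Add_Ar [simp]:
  assumes "f \<in> Ar C" "g \<in> Ar C" "Dom C f = Dom C g" "Cod C f = Cod C g"
  shows "f \<boxplus> g \<in> Ar C" "Dom C (f \<boxplus> g) = Dom C g" "Cod C (f \<boxplus> g) = Cod C g"
  using monoid.m_closed[OF group.is_monoid[OF hom_group[of "Dom C f" "Cod C f"]], of f g] assms
  by (auto simp: in_hom_set)

lemma neg_Ar [simp]:
  assumes "f \<in> Ar C"
  shows "neg C f \<in> Ar C" "Dom C (neg C f) = Dom C f" "Cod C (neg C f) = Cod C f"
  using group.inv_closed[OF hom_group[of "Dom C f" "Cod C f"], of f] assms
  by (auto simp: in_hom_set neg_def)

lemma Add_hom: "\<lbrakk>f \<in> hom_set C a b; g \<in> hom_set C a b\<rbrakk> \<Longrightarrow> f \<boxplus> g \<in> hom_set C a b"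
  by (auto simp: in_hom_set)

lemma Zer_hom: "\<lbrakk>a \<in> Ob C; b \<in> Ob C\<rbrakk> \<Longrightarrow> Zer C a b \<in> hom_set C a b"
  by (auto simp: in_hom_set)

lemma Add_assoc:
  assumes "f \<in> Ar C" "g \<in> Ar C" "h \<in> Ar C" "Dom C f = Dom C g" "Cod C f = Cod C g"
    "Dom C g = Dom C h" "Cod C g = Cod C h"
  shows "f \<boxplus> g \<boxplus> h = f \<boxplus> (g \<boxplus> h)"
  using monoid.m_assoc[OF group.is_monoid[OF hom_group[of "Dom C f" "Cod C f"]], of f g h] assms
  by (auto simp: in_hom_set)

lemma Add_commute:
  assumes "f \<in> Ar C" "g \<in> Ar C" "Dom C f = Dom C g" "Cod C f = Cod C g"
  shows "f \<boxplus> g = g \<boxplus> f"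
proof -
  interpret G: comm_group "hom_group C (Dom C f) (Cod C f)" using assms by (simp add: hom_comm_group)
  show ?thesis using G.m_comm[of f g] assms by (auto simp: in_hom_set)
qed

lemma Add_left_commute:
  assumes "f \<in> Ar C" "g \<in> Ar C" "h \<in> Ar C" "Dom C f = Dom C g" "Cod C f = Cod C g"
    "Dom C g = Dom C h" "Cod C g = Cod C h"
  shows "f \<boxplus> (g \<boxplus> h) = g \<boxplus> (f \<boxplus> h)"
  using assms Add_assoc[of f g h] Add_assoc[of g f h] Add_commute[of f g] by simp

lemmas Add_ac = Add_assoc Add_commute Add_left_commute

lemma Add_Zer [simp]:
  assumes "f \<in> Ar C" "a = Dom C f" "b = Cod C f"
  shows "f \<boxplus> Zer C a b = f" "Zer C a b \<boxplus> f = f"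
proof -
  interpret G: comm_group "hom_group C (Dom C f) (Cod C f)" using assms by (simp add: hom_comm_group)
  show "f \<boxplus> Zer C a b = f" "Zer C a b \<boxplus> f = f"
    using G.l_one[of f] G.r_one[of f] assms by (auto simp: in_hom_set)
qed

lemma Add_neg [simp]:
  assumes "f \<in> Ar C"
  shows "f \<boxplus> neg C f = Zer C (Dom C f) (Cod C f)" "neg C f \<boxplus> f = Zer C (Dom C f) (Cod C f)"
proof -
  interpret G: comm_group "hom_group C (Dom C f) (Cod C f)" using assms by (simp add: hom_comm_group)
  show "f \<boxplus> neg C f = Zer C (Dom C f) (Cod C f)" "neg C f \<boxplus> f = Zer C (Dom C f) (Cod C f)"
    using G.r_inv[of f] G.l_inv[of f] assms by (auto simp: in_hom_set neg_def)
qed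

lemma Add_neg_cancel [simp]:
  assumes "f \<in> Ar C" "g \<in> Ar C" "Dom C f = Dom C g" "Cod C f = Cod C g"
  shows "f \<boxplus> (neg C f \<boxplus> g) = g" "neg C f \<boxplus> (f \<boxplus> g) = g"
  using assms by (simp_all flip: Add_assoc)

lemma Add_left_cancel:
  assumes "f \<in> Ar C" "g \<in> Ar C" "h \<in> Ar C" "Dom C f = Dom C g" "Cod C f = Cod C g"
    "Dom C f = Dom C h" "Cod C f = Cod C h"
  shows "f \<boxplus> g = f \<boxplus> h \<longleftrightarrow> g = h"
  by (metis Add_neg_cancel(2) assms)


lemma Add_eq_self:
  assumes "f \<in> Ar C" "g \<in> Ar C" "Dom C f = Dom C g" "Cod C f = Cod C g" "f \<boxplus> g = f"
  shows "g = Zer C (Dom C f) (Cod C f)"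
  using Add_left_cancel[of f g "Zer C (Dom C f) (Cod C f)"] assms by simp

lemma neg_unique:
  assumes "f \<in> Ar C" "g \<in> Ar C" "Dom C f = Dom C g" "Cod C f = Cod C g"
    "f \<boxplus> g = Zer C (Dom C f) (Cod C f)"
  shows "g = neg C f"
  using Add_left_cancel[of f g "neg C f"] assms by simp

lemma neg_neg [simp]: "f \<in> Ar C \<Longrightarrow> neg C (neg C f) = f"
  using neg_unique[of "neg C f" f] by simp

lemma neg_Zer [simp]: "\<lbrakk>a \<in> Ob C; b \<in> Ob C\<rbrakk> \<Longrightarrow> neg C (Zer C a b) = Zer C a b"
  using neg_unique[of "Zer C a b" "Zer C a b"] by simp

lemma neg_Add [simp]:
  assumes "f \<in> Ar C" "g \<in> Ar C" "Dom C f = Dom C g" "Cod C f = Cod C g"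
  shows "neg C (f \<boxplus> g) = neg C f \<boxplus> neg C g"
proof -
  have "(f \<boxplus> g) \<boxplus> (neg C f \<boxplus> neg C g) = (f \<boxplus> neg C f) \<boxplus> (g \<boxplus> neg C g)"
    using assms by (simp add: Add_assoc Add_left_commute[of g "neg C f"] del: Add_neg Add_neg_cancel)
  also have "\<dots> = Zer C (Dom C f) (Cod C f)" using assms by simp
  finally show ?thesis using neg_unique[of "f \<boxplus> g" "neg C f \<boxplus> neg C g"] assms by simp
qed

lemma comp_Add [simp]:
  assumes "f \<in> Ar C" "f' \<in> Ar C" "g \<in> Ar C" "Dom C f = Dom C f'" "Cod C f = Cod C f'" "Dom C g = Cod C f'"
  shows "g \<cdot> (f \<boxplus> f') = g \<cdot> f \<boxplus> g \<cdot> f'"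
  using Comp_Add_right[of f "Dom C f" "Cod C f" f' g "Cod C g"] assms by (simp add: in_hom_set)

lemma Add_comp [simp]:
  assumes "g \<in> Ar C" "g' \<in> Ar C" "f \<in> Ar C" "Dom C g = Dom C g'" "Cod C g = Cod C g'" "Dom C g' = Cod C f"
  shows "(g \<boxplus> g') \<cdot> f = g \<cdot> f \<boxplus> g' \<cdot> f"
  using Comp_Add_left[of f "Dom C f" "Cod C f" g "Cod C g" g'] assms by (simp add: in_hom_set)

lemma Zer_comp [simp]:
  assumes "f \<in> Ar C" "Cod C f = b" "c \<in> Ob C"
  shows "Zer C b c \<cdot> f = Zer C (Dom C f) c"
proof -
  have b: "b \<in> Ob C" using assms by auto
  have "Zer C b c \<cdot> f \<boxplus> Zer C b c \<cdot> f = (Zer C b c \<boxplus> Zer C b c) \<cdot> f"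
    using assms b by (simp del: Add_Zer)
  also have "\<dots> = Zer C b c \<cdot> f" using assms b by simp
  finally show ?thesis using Add_eq_self[of "Zer C b c \<cdot> f" "Zer C b c \<cdot> f"] assms b by simp
qed

lemma comp_Zer [simp]:
  assumes "g \<in> Ar C" "Dom C g = b" "a \<in> Ob C"
  shows "g \<cdot> Zer C a b = Zer C a (Cod C g)"
proof -
  have b: "b \<in> Ob C" using assms by auto
  have "g \<cdot> Zer C a b \<boxplus> g \<cdot> Zer C a b = g \<cdot> (Zer C a b \<boxplus> Zer C a b)"
    using assms b by (simp del: Add_Zer)
  also have "\<dots> = g \<cdot> Zer C a b" using assms b by simp
  finally show ?thesis using Add_eq_self[of "g \<cdot> Zer C a b" "g \<cdot> Zer C a b"] assms b by simp
qed

lemma comp_neg [simp]: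
  assumes "f \<in> Ar C" "g \<in> Ar C" "Dom C g = Cod C f"
  shows "g \<cdot> neg C f = neg C (g \<cdot> f)"
proof -
  have "g \<cdot> f \<boxplus> g \<cdot> neg C f = g \<cdot> (f \<boxplus> neg C f)"
    using assms by (simp del: Add_neg)
  also have "\<dots> = Zer C (Dom C f) (Cod C g)" using assms by simp
  finally show ?thesis using neg_unique[of "g \<cdot> f" "g \<cdot> neg C f"] assms by simp
qed

lemma neg_comp [simp]:
  assumes "f \<in> Ar C" "g \<in> Ar C" "Dom C g = Cod C f"
  shows "neg C g \<cdot> f = neg C (g \<cdot> f)"
proof -
  have "g \<cdot> f \<boxplus> neg C g \<cdot> f = (g \<boxplus> neg C g) \<cdot> f"
    using assms by (simp del: Add_neg)
  also have "\<dots> = Zer C (Dom C f) (Cod C g)" using assms by simp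
  finally show ?thesis using neg_unique[of "g \<cdot> f" "neg C g \<cdot> f"] assms by simp
qed

lemma eq_neg_iff:
  assumes "f \<in> Ar C" "g \<in> Ar C" "Dom C f = Dom C g" "Cod C f = Cod C g"
  shows "f = neg C g \<longleftrightarrow> g \<boxplus> f = Zer C (Dom C f) (Cod C f)"
  using assms neg_unique[of g f] by auto

lemma eq_iff_diff:
  assumes "f \<in> Ar C" "g \<in> Ar C" "Dom C f = Dom C g" "Cod C f = Cod C g"
  shows "f = g \<longleftrightarrow> f \<boxplus> neg C g = Zer C (Dom C f) (Cod C f)"
  using assms eq_neg_iff[of f "neg C g"] Add_commute[of f "neg C g"] by simp

end

section \<open>Resolutions by products of test objects\<close>

text \<open>The map \<open>g\<close> on \<open>V k\<close> precomposed with the \<open>j\<close>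
  bonding maps leading down from \<open>V (k + j)\<close>: the same element of the colimit,
  represented further up.\<close>

primrec pull :: "('o, 'm, 'x) addcat_scheme \<Rightarrow> (nat \<Rightarrow> 'm) \<Rightarrow> nat \<Rightarrow> 'm \<Rightarrow> nat \<Rightarrow> 'm" where
  "pull C t k g 0 = g"
| "pull C t k g (Suc j) = pull C t k g j \<cdot>\<^bsub>C\<^esub> t (k + j)"

text \<open>\<open>X\<close> is the limit of the sequence \<open>V\<close> of objects in \<open>VV\<close>, and the maps from \<open>X\<close> to objects of
  \<open>VV\<close> are the colimit of those from the \<open>V k\<close>.\<close>

definition is_pro_limit ::
  "('o, 'm, 'x) addcat_scheme \<Rightarrow> 'o set \<Rightarrow> 'o \<Rightarrow> (nat \<Rightarrow> 'o) \<Rightarrow> (nat \<Rightarrow> 'm) \<Rightarrow> (nat \<Rightarrow> 'm) \<Rightarrow> bool" where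
  "is_pro_limit C VV X V s t \<longleftrightarrow>
     (\<forall>k. V k \<in> VV \<and> s k \<in> hom_set C X (V k) \<and> t k \<in> hom_set C (V (Suc k)) (V k) \<and>
          t k \<cdot>\<^bsub>C\<^esub> s (Suc k) = s k) \<and>
     (\<forall>T. \<forall>f\<in>hom_set C T X. \<forall>g\<in>hom_set C T X. (\<forall>k. s k \<cdot>\<^bsub>C\<^esub> f = s k \<cdot>\<^bsub>C\<^esub> g) \<longrightarrow> f = g) \<and>
     (\<forall>T f. (\<forall>k. f k \<in> hom_set C T (V k) \<and> t k \<cdot>\<^bsub>C\<^esub> f (Suc k) = f k) \<longrightarrow>
        (\<exists>h\<in>hom_set C T X. \<forall>k. s k \<cdot>\<^bsub>C\<^esub> h = f k)) \<and>
     (\<forall>W\<in>VV. \<forall>g\<in>hom_set C X W. \<exists>k. \<exists>h\<in>hom_set C (V k) W. g = h \<cdot>\<^bsub>C\<^esub> s k) \<and>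
     (\<forall>W\<in>VV. \<forall>k. \<forall>g\<in>hom_set C (V k) W. g \<cdot>\<^bsub>C\<^esub> s k = Zer C X W \<longrightarrow>
        (\<exists>j. pull C t k g j = Zer C (V (k + j)) W))"

text \<open>The last condition says that a map from the product to a test object depends on finitely many
  coordinates only.\<close>

definition is_pro_product ::
  "('o, 'm, 'x) addcat_scheme \<Rightarrow> 'o set \<Rightarrow> 'o \<Rightarrow> (nat \<Rightarrow> 'o) \<Rightarrow> (nat \<Rightarrow> 'm) \<Rightarrow> bool" where
  "is_pro_product C VV E V pr \<longleftrightarrow>
     E \<in> Ob C \<and> (\<forall>k. pr k \<in> hom_set C E (V k)) \<and>
     (\<forall>T\<in>Ob C. \<forall>f. (\<forall>k. f k \<in> hom_set C T (V k)) \<longrightarrow> (\<exists>h\<in>hom_set C T E. \<forall>k. pr k \<cdot>\<^bsub>C\<^esub> h = f k)) \<and>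
     (\<forall>T. \<forall>f\<in>hom_set C T E. \<forall>g\<in>hom_set C T E. (\<forall>k. pr k \<cdot>\<^bsub>C\<^esub> f = pr k \<cdot>\<^bsub>C\<^esub> g) \<longrightarrow> f = g) \<and>
     (\<forall>W\<in>VV. \<forall>g\<in>hom_set C E W. \<exists>n. \<forall>T. \<forall>f\<in>hom_set C T E. \<forall>f'\<in>hom_set C T E.
        (\<forall>k<n. pr k \<cdot>\<^bsub>C\<^esub> f = pr k \<cdot>\<^bsub>C\<^esub> f') \<longrightarrow> g \<cdot>\<^bsub>C\<^esub> f = g \<cdot>\<^bsub>C\<^esub> f')"

context preadditive_category
begin

text \<open>Maps into a test object turn the product into a direct sum and \<open>q\<close> into the
  map 1 - shift of a telescope. That map is injective, which is the last conclusion, and its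
  cokernel is the colimit of the maps out of the \<open>V k\<close>, that is, the maps out of
  \<open>X\<close>; this gives the factorization through \<open>q\<close>.\<close>

lemma pro_product_resolution:
  assumes X: "X \<in> Ob C" and VV: "VV \<subseteq> Ob C"
    and lim: "is_pro_limit C VV X V s t" and prod: "is_pro_product C VV E V pr"
  obtains \<iota> q where "\<iota> \<in> hom_set C X E" "\<And>k. pr k \<cdot> \<iota> = s k"
    "q \<in> hom_set C E E" "\<And>k. pr k \<cdot> q \<boxplus> t k \<cdot> pr (Suc k) = pr k" "q \<cdot> \<iota> = Zer C X E"
    "\<And>W g. \<lbrakk>W \<in> VV; g \<in> hom_set C E W; g \<cdot> \<iota> = Zer C X W\<rbrakk> \<Longrightarrow> \<exists>u\<in>hom_set C E W. u \<cdot> q = g"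
    "\<And>W u. \<lbrakk>W \<in> VV; u \<in> hom_set C E W; u \<cdot> q = Zer C E W\<rbrakk> \<Longrightarrow> u = Zer C E W"
proof -
  have s: "V k \<in> Ob C" "s k \<in> Ar C" "Dom C (s k) = X" "Cod C (s k) = V k"
    "t k \<in> Ar C" "Dom C (t k) = V (Suc k)" "Cod C (t k) = V k" "t k \<cdot> s (Suc k) = s k" for k
    using lim VV by (auto simp: is_pro_limit_def in_hom_set)
  have E: "E \<in> Ob C" "pr k \<in> Ar C" "Dom C (pr k) = E" "Cod C (pr k) = V k" for k
    using prod by (auto simp: is_pro_product_def in_hom_set)
  note [simp] = s E X
  have ex: "\<exists>h\<in>hom_set C T E. \<forall>k. pr k \<cdot> h = f k"
    if "T \<in> Ob C" "\<And>k. f k \<in> Ar C" "\<And>k. Dom C (f k) = T" "\<And>k. Cod C (f k) = V k" for T f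
    using prod that unfolding is_pro_product_def by (simp add: in_hom_set)
  have mono: "f = g" if "\<And>k. pr k \<cdot> f = pr k \<cdot> g" "f \<in> Ar C" "g \<in> Ar C" "Dom C f = Dom C g" "Cod C f = E" "Cod C g = E" for f g
    using prod that unfolding is_pro_product_def by (simp add: in_hom_set)
  have fin: "\<exists>n. \<forall>T. \<forall>f\<in>hom_set C T E. \<forall>f'\<in>hom_set C T E.
        (\<forall>k<n. pr k \<cdot> f = pr k \<cdot> f') \<longrightarrow> g \<cdot> f = g \<cdot> f'" if "W \<in> VV" "g \<in> hom_set C E W" for W g
    using prod that unfolding is_pro_product_def by blast
  obtain \<iota> where i: "\<iota> \<in> Ar C" "Dom C \<iota> = X" "Cod C \<iota> = E" "\<And>k. pr k \<cdot> \<iota> = s k"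
    using ex[of X s] by (auto simp: in_hom_set)
  obtain q where q: "q \<in> Ar C" "Dom C q = E" "Cod C q = E" "\<And>k. pr k \<cdot> q = pr k \<boxplus> neg C (t k \<cdot> pr (Suc k))"
    using ex[of E "\<lambda>k. pr k \<boxplus> neg C (t k \<cdot> pr (Suc k))"] by (auto simp: in_hom_set)
  note [simp] = i q
  have q_pr: "pr k \<cdot> q \<boxplus> t k \<cdot> pr (Suc k) = pr k" for k
    by (simp add: Add_assoc)
  have qi: "q \<cdot> \<iota> = Zer C X E"
  proof (rule mono)
    fix k
    have "pr k \<cdot> q \<cdot> \<iota> = (pr k \<boxplus> neg C (t k \<cdot> pr (Suc k))) \<cdot> \<iota>"
      by (rule comp_rw) simp_all
    then show "pr k \<cdot> q \<cdot> \<iota> = pr k \<cdot> Zer C X E" by simp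
  qed simp_all
  \<comment> \<open>The coordinate inclusions \<open>inc l\<close>. Together with the truncations
    \<open>T n\<close> to the first \<open>n\<close> coordinates, built next, they write a map from
    \<open>E\<close> to a test object as a finite sum of maps on single coordinates.\<close>
  have "\<exists>h. h \<in> Ar C \<and> Dom C h = V l \<and> Cod C h = E \<and> (\<forall>k. pr k \<cdot> h = (if k = l then Id C (V l) else Zer C (V l) (V k)))" for l
  proof -
    have "\<exists>h\<in>hom_set C (V l) E. \<forall>k. pr k \<cdot> h = (if k = l then Id C (V l) else Zer C (V l) (V k))"
      by (rule ex) simp_all
    then show ?thesis by (auto simp only: in_hom_set)
  qed
  then obtain inc where inc: "\<And>l. inc l \<in> Ar C" "\<And>l. Dom C (inc l) = V l" "\<And>l. Cod C (inc l) = E"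
    "\<And>l k. pr k \<cdot> inc l = (if k = l then Id C (V l) else Zer C (V l) (V k))" by metis
  have "\<exists>h. h \<in> Ar C \<and> Dom C h = E \<and> Cod C h = E \<and> (\<forall>k. pr k \<cdot> h = (if k < n then pr k else Zer C E (V k)))" for n
  proof -
    have "\<exists>h\<in>hom_set C E E. \<forall>k. pr k \<cdot> h = (if k < n then pr k else Zer C E (V k))"
      by (rule ex) simp_all
    then show ?thesis by (auto simp only: in_hom_set)
  qed
  then obtain T where T: "\<And>n. T n \<in> Ar C" "\<And>n. Dom C (T n) = E" "\<And>n. Cod C (T n) = E"
    "\<And>n k. pr k \<cdot> T n = (if k < n then pr k else Zer C E (V k))" by metis
  note [simp] = inc T
  have inc_c: "pr k \<cdot> inc l \<cdot> x = (if k = l then x else Zer C (Dom C x) (V k))"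
    if "x \<in> Ar C" "Cod C x = V l" for k l x
    using comp_rw[OF inc(4)[where l = l and k = k], of x] that by simp
  have T0: "T 0 = Zer C E E" by (rule mono) simp_all
  have TSuc: "T (Suc n) = T n \<boxplus> inc n \<cdot> pr n" for n
    by (rule mono) (auto simp: inc_c)
  \<comment> \<open>The finiteness clause of \<open>is_pro_product\<close>, applied to the identity
    and to a truncation: they agree on all coordinates that \<open>g\<close> sees.\<close>
  have T_eq: "\<exists>n. g = g \<cdot> T n" if g: "W \<in> VV" "g \<in> hom_set C E W" for g W
  proof -
    obtain n where "\<forall>Ta. \<forall>f\<in>hom_set C Ta E. \<forall>f'\<in>hom_set C Ta E.
        (\<forall>k<n. pr k \<cdot> f = pr k \<cdot> f') \<longrightarrow> g \<cdot> f = g \<cdot> f'" using fin[OF g] by blast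
    then have "g \<cdot> Id C E = g \<cdot> T n"
      by (rule allE[of _ E]) (simp add: in_hom_set)
    then show ?thesis using g by (auto simp: in_hom_set)
  qed
  \<comment> \<open>On the summand 0 the map \<open>q\<close> is the inclusion, and on the summand
    \<open>Suc l\<close> it is the inclusion minus the bonding map into the summand
    \<open>l\<close>. Hence \<open>u \<cdot> q = 0\<close> forces \<open>u\<close> to vanish on one
    summand after the other.\<close>
  have qinc0: "q \<cdot> inc 0 = inc 0"
  proof (rule mono)
    fix k
    have "pr k \<cdot> q \<cdot> inc 0 = (pr k \<boxplus> neg C (t k \<cdot> pr (Suc k))) \<cdot> inc 0"
      by (rule comp_rw) simp_all
    then show "pr k \<cdot> q \<cdot> inc 0 = pr k \<cdot> inc 0" by simp
  qed simp_all
  have qincS: "q \<cdot> inc (Suc l) \<boxplus> inc l \<cdot> t l = inc (Suc l)" for l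
  proof (rule mono)
    fix k
    have "pr k \<cdot> q \<cdot> inc (Suc l) = (pr k \<boxplus> neg C (t k \<cdot> pr (Suc k))) \<cdot> inc (Suc l)"
      by (rule comp_rw) simp_all
    then show "pr k \<cdot> (q \<cdot> inc (Suc l) \<boxplus> inc l \<cdot> t l) = pr k \<cdot> inc (Suc l)"
      by (auto simp: inc_c)
  qed simp_all
  have epi: "u = Zer C E W" if "W \<in> VV" "u \<in> hom_set C E W" "u \<cdot> q = Zer C E W" for W u
  proof -
    have u [simp]: "u \<in> Ar C" "Dom C u = E" "Cod C u = W" "W \<in> Ob C" using that VV by (auto simp: in_hom_set)
    have uq: "u \<cdot> q \<cdot> x = Zer C (Dom C x) W" if "x \<in> Ar C" "Cod C x = E" for x
      using comp_rw[OF \<open>u \<cdot> q = Zer C E W\<close>, of x] that by simp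
    have z: "u \<cdot> inc k = Zer C (V k) W" for k
    proof (induction k)
      case 0
      have "u \<cdot> inc 0 = u \<cdot> q \<cdot> inc 0" by (simp add: qinc0)
      then show ?case using uq[of "inc 0"] by simp
    next
      case (Suc k)
      have "u \<cdot> inc (Suc k) = u \<cdot> (q \<cdot> inc (Suc k) \<boxplus> inc k \<cdot> t k)" by (simp add: qincS)
      also have "\<dots> = u \<cdot> inc k \<cdot> t k" using uq[of "inc (Suc k)"] by simp
      also have "\<dots> = Zer C (V (Suc k)) W" using comp_rw[OF Suc.IH, of "t k"] by simp
      finally show ?case .
    qed
    have "u \<cdot> T n = Zer C E W" for n
    proof (induction n)
      case 0
      then show ?case by (simp add: T0)
    next
      case (Suc n)
      then show ?case using comp_rw[OF z[of n], of "pr n"] by (simp add: TSuc)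
    qed
    then show ?thesis using T_eq[OF that(1,2)] by metis
  qed
  have fac: "\<exists>u\<in>hom_set C E W. u \<cdot> q = g" if gi: "W \<in> VV" "g \<in> hom_set C E W" "g \<cdot> \<iota> = Zer C X W" for W g
  proof -
    have g [simp]: "g \<in> Ar C" "Dom C g = E" "Cod C g = W" "W \<in> Ob C" using gi VV by (auto simp: in_hom_set)
    have pull_hom: "pull C t k a j \<in> hom_set C (V (k + j)) W" if "a \<in> hom_set C (V k) W" for a k j
      using that by (induction j) (auto simp: in_hom_set)
    \<comment> \<open>Modulo maps that factor through \<open>q\<close>, the projection
      \<open>pr k\<close> equals \<open>t k \<cdot> pr (Suc k)\<close>; so a map on coordinate
      \<open>k\<close> may be moved to coordinate \<open>k + j\<close>.\<close>
    have A: "\<exists>u\<in>hom_set C E W. a \<cdot> pr k = pull C t k a j \<cdot> pr (k + j) \<boxplus> u \<cdot> q"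
      if a: "a \<in> hom_set C (V k) W" for a k j
    proof (induction j)
      case 0
      show ?case using a by (intro bexI[of _ "Zer C E W"]) (auto simp: in_hom_set)
    next
      case (Suc j)
      then obtain u where u: "u \<in> Ar C" "Dom C u = E" "Cod C u = W" "a \<cdot> pr k = pull C t k a j \<cdot> pr (k + j) \<boxplus> u \<cdot> q"
        by (auto simp: in_hom_set)
      let ?b = "pull C t k a j"
      have b: "?b \<in> Ar C" "Dom C ?b = V (k + j)" "Cod C ?b = W" using pull_hom[OF a, of j] by (auto simp: in_hom_set)
      have "?b \<cdot> pr (k + j) = ?b \<cdot> (pr (k + j) \<cdot> q \<boxplus> t (k + j) \<cdot> pr (Suc (k + j)))" by (simp only: q_pr)
      also have "\<dots> = (?b \<cdot> t (k + j)) \<cdot> pr (k + Suc j) \<boxplus> (?b \<cdot> pr (k + j)) \<cdot> q"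
        using b by (simp del: q(4) add: Add_ac)
      finally have eq: "?b \<cdot> pr (k + j) = (?b \<cdot> t (k + j)) \<cdot> pr (k + Suc j) \<boxplus> (?b \<cdot> pr (k + j)) \<cdot> q" .
      have "a \<cdot> pr k = ((?b \<cdot> t (k + j)) \<cdot> pr (k + Suc j) \<boxplus> (?b \<cdot> pr (k + j)) \<cdot> q) \<boxplus> u \<cdot> q"
        unfolding u(4) by (subst eq) (rule refl)
      also have "\<dots> = (?b \<cdot> t (k + j)) \<cdot> pr (k + Suc j) \<boxplus> (?b \<cdot> pr (k + j) \<boxplus> u) \<cdot> q"
        using b u(1-3) by (simp del: q(4) assoc add: Add_assoc)
      finally have "a \<cdot> pr k = (?b \<cdot> t (k + j)) \<cdot> pr (k + Suc j) \<boxplus> (?b \<cdot> pr (k + j) \<boxplus> u) \<cdot> q" .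
      then show ?case using b u by (intro bexI[of _ "?b \<cdot> pr (k + j) \<boxplus> u"]) (simp_all add: in_hom_set)
    qed
    \<comment> \<open>All terms of the finite sum are moved to one common coordinate; in the
      induction the coordinates \<open>m\<close> and \<open>n\<close> meet at \<open>m + n\<close>.
      What remains is a single \<open>b\<close> on \<open>V m\<close> with
      \<open>b \<cdot> s m = 0\<close>, and such a \<open>b\<close> vanishes after being pulled up
      far enough.\<close>
    have B: "\<exists>m. \<exists>b\<in>hom_set C (V m) W. \<exists>u\<in>hom_set C E W. g \<cdot> T n = b \<cdot> pr m \<boxplus> u \<cdot> q" for n
    proof (induction n)
      case 0
      show ?case
        by (rule exI[of _ 0], rule bexI[of _ "Zer C (V 0) W"], rule bexI[of _ "Zer C E W"])
          (simp_all add: T0 in_hom_set)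
    next
      case (Suc n)
      then obtain m b u where b: "b \<in> hom_set C (V m) W" and u: "u \<in> hom_set C E W"
        and eq: "g \<cdot> T n = b \<cdot> pr m \<boxplus> u \<cdot> q" by blast
      obtain u1 where u1: "u1 \<in> hom_set C E W" "b \<cdot> pr m = pull C t m b n \<cdot> pr (m + n) \<boxplus> u1 \<cdot> q"
        using A[OF b] by blast
      have gi: "g \<cdot> inc n \<in> hom_set C (V n) W" by (simp add: in_hom_set)
      obtain u2 where u2: "u2 \<in> hom_set C E W"
        "(g \<cdot> inc n) \<cdot> pr n = pull C t n (g \<cdot> inc n) m \<cdot> pr (n + m) \<boxplus> u2 \<cdot> q"
        using A[OF gi] by blast
      let ?b1 = "pull C t m b n" and ?b2 = "pull C t n (g \<cdot> inc n) m"
      have b1: "?b1 \<in> hom_set C (V (m + n)) W" using pull_hom[OF b] .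
      have b2: "?b2 \<in> hom_set C (V (m + n)) W" using pull_hom[OF gi, of m] by (simp add: add.commute)
      have "g \<cdot> T (Suc n) = g \<cdot> T n \<boxplus> (g \<cdot> inc n) \<cdot> pr n" by (simp add: TSuc)
      also have "\<dots> = (?b1 \<boxplus> ?b2) \<cdot> pr (m + n) \<boxplus> ((u \<boxplus> u1) \<boxplus> u2) \<cdot> q"
        unfolding eq u1(2) u2(2) using b1 b2 u u1(1) u2(1)
        by (simp add: in_hom_set Add_ac add.commute[of n m] del: q(4) assoc)
      finally show ?case using b1 b2 u u1(1) u2(1)
        by (intro exI[of _ "m + n"] bexI[of _ "?b1 \<boxplus> ?b2"] bexI[of _ "(u \<boxplus> u1) \<boxplus> u2"])
          (auto intro!: Add_hom)
    qed
    obtain n where n: "g \<cdot> T n = g" using T_eq[OF gi(1,2)] by metis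
    obtain m b u where b: "b \<in> hom_set C (V m) W" and u: "u \<in> hom_set C E W"
      and eq: "g = b \<cdot> pr m \<boxplus> u \<cdot> q" using B[of n] unfolding n by blast
    have "Zer C X W = (b \<cdot> pr m \<boxplus> u \<cdot> q) \<cdot> \<iota>" using gi(3) eq by simp
    also have "\<dots> = b \<cdot> s m" using b u qi by (simp add: in_hom_set)
    finally have "\<exists>j. pull C t m b j = Zer C (V (m + j)) W"
      using lim b \<open>W \<in> VV\<close> unfolding is_pro_limit_def by simp
    then obtain j where j: "pull C t m b j = Zer C (V (m + j)) W" by blast
    obtain u' where u': "u' \<in> hom_set C E W" "b \<cdot> pr m = pull C t m b j \<cdot> pr (m + j) \<boxplus> u' \<cdot> q"
      using A[OF b] by blast
    have "g = (Zer C (V (m + j)) W \<cdot> pr (m + j) \<boxplus> u' \<cdot> q) \<boxplus> u \<cdot> q"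
      using eq unfolding u'(2) j .
    also have "\<dots> = (u' \<boxplus> u) \<cdot> q" using u'(1) u by (simp add: in_hom_set)
    finally have "g = (u' \<boxplus> u) \<cdot> q" .
    then show ?thesis using u u' by (intro bexI[of _ "u' \<boxplus> u"]) (auto intro!: Add_hom)
  qed
  have "\<iota> \<in> hom_set C X E" "q \<in> hom_set C E E" by (simp_all add: in_hom_set)
  from that[OF this(1) i(4) this(2) q_pr qi fac epi] show thesis .
qed

end

section \<open>Graded maps between supercomplexes\<close>

text \<open>\<open>chain\<close>, \<open>anti\<close> are the cycles and \<open>null\<close>, \<open>anull\<close> the boundaries of degree 0, 1.\<close>

definition deg0 where
  "deg0 C X Y f \<longleftrightarrow> X \<in> Ob (Sup_cat C) \<and> Y \<in> Ob (Sup_cat C) \<and>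
     (\<forall>i. f i \<in> hom_set C (part X i) (part Y i))"

definition deg1 where
  "deg1 C X Y f \<longleftrightarrow> X \<in> Ob (Sup_cat C) \<and> Y \<in> Ob (Sup_cat C) \<and>
     (\<forall>i. f i \<in> hom_set C (part X i) (part Y (i + 1)))"

definition chain where
  "chain C X Y f \<longleftrightarrow> deg0 C X Y f \<and> (\<forall>i. bdry Y i \<cdot>\<^bsub>C\<^esub> f i = f (i + 1) \<cdot>\<^bsub>C\<^esub> bdry X i)"

definition anti where
  "anti C X Y f \<longleftrightarrow> deg1 C X Y f \<and>
     (\<forall>i. bdry Y (i + 1) \<cdot>\<^bsub>C\<^esub> f i = neg C (f (i + 1) \<cdot>\<^bsub>C\<^esub> bdry X i))"

text \<open>The differential of the hom complex on elements of degree 1, and in \<open>bd0\<close>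
  of degree 0; splitting it by degree makes the sign explicit.\<close>

definition bd1 where
  "bd1 C X Y h i = Add C (bdry Y (i + 1) \<cdot>\<^bsub>C\<^esub> h i) (h (i + 1) \<cdot>\<^bsub>C\<^esub> bdry X i)"

definition bd0 where
  "bd0 C X Y e i = Add C (bdry Y i \<cdot>\<^bsub>C\<^esub> e i) (neg C (e (i + 1) \<cdot>\<^bsub>C\<^esub> bdry X i))"

definition null where
  "null C X Y f \<longleftrightarrow> (\<exists>h. deg1 C X Y h \<and> (\<forall>i. f i = bd1 C X Y h i))"

definition anull where
  "anull C X Y f \<longleftrightarrow> (\<exists>e. deg0 C X Y e \<and> (\<forall>i. f i = bd0 C X Y e i))"

text \<open>With this sign the chain maps into the shift of \<open>Y\<close> are exactly the cycles
  of degree 1 into \<open>Y\<close>, so that results in degree 0 also yield those in degree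
  1.\<close>

definition shift where
  "shift C X = Supercx (\<lambda>i. part X (i + 1)) (\<lambda>i. neg C (bdry X (i + 1)))"

lemma part_shift [simp]: "part (shift C X) i = part X (i + 1)"
  and bdry_shift [simp]: "bdry (shift C X) i = neg C (bdry X (i + 1))"
  by (simp_all add: shift_def)

lemma Sup_Ob: "X \<in> Ob (Sup_cat C) \<longleftrightarrow> (\<forall>i. part X i \<in> Ob C \<and>
    bdry X i \<in> hom_set C (part X i) (part X (i + 1)) \<and>
    bdry X (i + 1) \<cdot>\<^bsub>C\<^esub> bdry X i = Zer C (part X i) (part X i))"
  by (simp add: Sup_cat_def Let_def)

text \<open>The record type is fixed because \<open>Pro\<close> and \<open>Sup_cat\<close> accept
  only this type; the locale is instantiated at the base category, at its supercomplexes, at its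
  pro-objects and at pro-supercomplexes.\<close>

locale preadd = preadditive_category C for C :: "('o, 'm) addcat" (structure)
begin

abbreviation "SC \<equiv> Sup_cat C"
abbreviation "PA \<equiv> Pro C"
abbreviation "PS \<equiv> Pro (Sup_cat C)"
abbreviation "tr \<equiv> transit C"
abbreviation "cst \<equiv> const_tower C"
abbreviation "parr \<equiv> pro_part_arrow C"
abbreviation pro_comp (infixr "\<star>" 75) where "g \<star> f \<equiv> Comp (Pro C) g f"

lemma cxD:
  assumes "X \<in> Ob (Sup_cat C)"
  shows "part X i \<in> Ob C" "bdry X i \<in> Ar C" "Dom C (bdry X i) = part X i"
    "Cod C (bdry X i) = part X (i + 1)"
    "bdry X (i + 1) \<cdot> bdry X i = Zer C (part X i) (part X i)"
    "bdry X i \<cdot> bdry X (i + 1) = Zer C (part X (i + 1)) (part X (i + 1))"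
    "\<lbrakk>x \<in> Ar C; Cod C x = part X i\<rbrakk> \<Longrightarrow> bdry X (i + 1) \<cdot> bdry X i \<cdot> x = Zer C (Dom C x) (part X i)"
    "\<lbrakk>x \<in> Ar C; Cod C x = part X (i + 1)\<rbrakk> \<Longrightarrow> bdry X i \<cdot> bdry X (i + 1) \<cdot> x = Zer C (Dom C x) (part X (i + 1))"
proof -
  show *: "part X i \<in> Ob C" "bdry X i \<in> Ar C" "Dom C (bdry X i) = part X i"
    "Cod C (bdry X i) = part X (i + 1)" "bdry X (i + 1) \<cdot> bdry X i = Zer C (part X i) (part X i)" for i
    using assms by (auto simp: Sup_Ob in_hom_set)
  show **: "bdry X i \<cdot> bdry X (i + 1) = Zer C (part X (i + 1)) (part X (i + 1))"
    using *(5)[of "i + 1"] by simp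
  show "\<lbrakk>x \<in> Ar C; Cod C x = part X i\<rbrakk> \<Longrightarrow> bdry X (i + 1) \<cdot> bdry X i \<cdot> x = Zer C (Dom C x) (part X i)"
    using comp_rw[OF *(5)[of i], of x] * by simp
  show "\<lbrakk>x \<in> Ar C; Cod C x = part X (i + 1)\<rbrakk> \<Longrightarrow> bdry X i \<cdot> bdry X (i + 1) \<cdot> x = Zer C (Dom C x) (part X (i + 1))"
    using comp_rw[OF **, of x] * by simp
qed

lemma cxI:
  assumes "\<And>i. part X i \<in> Ob C" "\<And>i. bdry X i \<in> Ar C" "\<And>i. Dom C (bdry X i) = part X i"
    "\<And>i. Cod C (bdry X i) = part X (i + 1)"
    "\<And>i. bdry X (i + 1) \<cdot> bdry X i = Zer C (part X i) (part X i)"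
  shows "X \<in> Ob (Sup_cat C)"
  using assms by (simp add: Sup_Ob in_hom_set)

lemma deg0D:
  assumes "deg0 C X Y f"
  shows "f i \<in> Ar C" "Dom C (f i) = part X i" "Cod C (f i) = part Y i"
  using assms by (auto simp: deg0_def in_hom_set)

lemma deg1D:
  assumes "deg1 C X Y f"
  shows "f i \<in> Ar C" "Dom C (f i) = part X i" "Cod C (f i) = part Y (i + 1)"
  using assms by (auto simp: deg1_def in_hom_set)

lemma deg0_cx: "deg0 C X Y f \<Longrightarrow> X \<in> Ob (Sup_cat C)" "deg0 C X Y f \<Longrightarrow> Y \<in> Ob (Sup_cat C)"
  and deg1_cx: "deg1 C X Y f \<Longrightarrow> X \<in> Ob (Sup_cat C)" "deg1 C X Y f \<Longrightarrow> Y \<in> Ob (Sup_cat C)"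
  by (auto simp: deg0_def deg1_def)

lemma chain_deg0: "chain C X Y f \<Longrightarrow> deg0 C X Y f"
  and anti_deg1: "anti C X Y g \<Longrightarrow> deg1 C X Y g"
  by (auto simp: chain_def anti_def)

lemmas chain_cx = deg0_cx[OF chain_deg0]
lemmas anti_cx = deg1_cx[OF anti_deg1]

lemma chainD:
  assumes "chain C X Y f"
  shows "f i \<in> Ar C" "Dom C (f i) = part X i" "Cod C (f i) = part Y i"
    "bdry Y i \<cdot> f i = f (i + 1) \<cdot> bdry X i"
    "\<lbrakk>x \<in> Ar C; Cod C x = part X i\<rbrakk> \<Longrightarrow> bdry Y i \<cdot> f i \<cdot> x = f (i + 1) \<cdot> bdry X i \<cdot> x"
proof -
  note [simp] = deg0D[OF chain_deg0[OF assms]] cxD[OF chain_cx(1)[OF assms]] cxD[OF chain_cx(2)[OF assms]]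
  show "f i \<in> Ar C" "Dom C (f i) = part X i" "Cod C (f i) = part Y i" by simp_all
  show *: "bdry Y i \<cdot> f i = f (i + 1) \<cdot> bdry X i" using assms by (simp add: chain_def)
  show "\<lbrakk>x \<in> Ar C; Cod C x = part X i\<rbrakk> \<Longrightarrow> bdry Y i \<cdot> f i \<cdot> x = f (i + 1) \<cdot> bdry X i \<cdot> x"
    using comp_rw[OF *, of x] by simp
qed

lemma antiD:
  assumes "anti C X Y f"
  shows "f i \<in> Ar C" "Dom C (f i) = part X i" "Cod C (f i) = part Y (i + 1)"
    "bdry Y (i + 1) \<cdot> f i = neg C (f (i + 1) \<cdot> bdry X i)"
    "bdry Y i \<cdot> f (i + 1) = neg C (f i \<cdot> bdry X (i + 1))"
    "\<lbrakk>x \<in> Ar C; Cod C x = part X i\<rbrakk> \<Longrightarrow> bdry Y (i + 1) \<cdot> f i \<cdot> x = neg C (f (i + 1) \<cdot> bdry X i \<cdot> x)"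
    "\<lbrakk>x \<in> Ar C; Cod C x = part X (i + 1)\<rbrakk> \<Longrightarrow> bdry Y i \<cdot> f (i + 1) \<cdot> x = neg C (f i \<cdot> bdry X (i + 1) \<cdot> x)"
proof -
  note [simp] = deg1D[OF anti_deg1[OF assms]] cxD[OF anti_cx(1)[OF assms]] cxD[OF anti_cx(2)[OF assms]]
  show "f i \<in> Ar C" "Dom C (f i) = part X i" "Cod C (f i) = part Y (i + 1)" by simp_all
  show *: "bdry Y (i + 1) \<cdot> f i = neg C (f (i + 1) \<cdot> bdry X i)" for i using assms by (simp add: anti_def)
  show **: "bdry Y i \<cdot> f (i + 1) = neg C (f i \<cdot> bdry X (i + 1))" using *[of "i + 1"] by simp
  show "\<lbrakk>x \<in> Ar C; Cod C x = part X i\<rbrakk> \<Longrightarrow> bdry Y (i + 1) \<cdot> f i \<cdot> x = neg C (f (i + 1) \<cdot> bdry X i \<cdot> x)"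
    using comp_rw[OF *[of i], of x] by simp
  show "\<lbrakk>x \<in> Ar C; Cod C x = part X (i + 1)\<rbrakk> \<Longrightarrow> bdry Y i \<cdot> f (i + 1) \<cdot> x = neg C (f i \<cdot> bdry X (i + 1) \<cdot> x)"
    using comp_rw[OF **, of x] by simp
qed

lemma deg0I:
  assumes "X \<in> Ob (Sup_cat C)" "Y \<in> Ob (Sup_cat C)"
    "\<And>i. f i \<in> Ar C" "\<And>i. Dom C (f i) = part X i" "\<And>i. Cod C (f i) = part Y i"
  shows "deg0 C X Y f"
  using assms by (simp add: deg0_def in_hom_set)

lemma deg1I:
  assumes "X \<in> Ob (Sup_cat C)" "Y \<in> Ob (Sup_cat C)"
    "\<And>i. f i \<in> Ar C" "\<And>i. Dom C (f i) = part X i" "\<And>i. Cod C (f i) = part Y (i + 1)"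
  shows "deg1 C X Y f"
  using assms by (simp add: deg1_def in_hom_set)

lemma chainI: "deg0 C X Y f \<Longrightarrow> (\<And>i. bdry Y i \<cdot> f i = f (i + 1) \<cdot> bdry X i) \<Longrightarrow> chain C X Y f"
  by (simp add: chain_def)

lemma antiI: "deg1 C X Y f \<Longrightarrow> (\<And>i. bdry Y (i + 1) \<cdot> f i = neg C (f (i + 1) \<cdot> bdry X i)) \<Longrightarrow> anti C X Y f"
  by (simp add: anti_def)

lemma shift_cx: "X \<in> Ob (Sup_cat C) \<Longrightarrow> shift C X \<in> Ob (Sup_cat C)"
  using cxD[of X] by (intro cxI) simp_all

lemma deg0_shift: "Y \<in> Ob (Sup_cat C) \<Longrightarrow> deg0 C X (shift C Y) f \<longleftrightarrow> deg1 C X Y f"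
  and deg1_shift: "Y \<in> Ob (Sup_cat C) \<Longrightarrow> deg1 C X (shift C Y) f \<longleftrightarrow> deg0 C X Y f"
  by (simp_all add: deg0_def deg1_def shift_cx)

lemma chain_shift:
  assumes Y: "Y \<in> Ob (Sup_cat C)" shows "chain C X (shift C Y) f \<longleftrightarrow> anti C X Y f"
proof -
  have "neg C a = b \<longleftrightarrow> a = neg C b" if "a \<in> Ar C" "b \<in> Ar C" for a b
    using that neg_neg by metis
  then show ?thesis
    using deg1D[of X Y f] deg1_cx[of X Y f] cxD[of X] cxD[of Y]
    by (auto simp: chain_def anti_def deg0_shift[OF Y])
qed

lemma neg_deg0: "deg0 C X Y f \<Longrightarrow> deg0 C X Y (\<lambda>i. neg C (f i))"
  using deg0D[of X Y f] by (auto intro!: deg0I simp: deg0_cx)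

lemma bd1_shift:
  assumes "deg0 C X Y e"
  shows "bd1 C X (shift C Y) (\<lambda>i. neg C (e i)) i = bd0 C X Y e i"
    "bd1 C X (shift C Y) e i = bd0 C X Y (\<lambda>i. neg C (e i)) i"
  using deg0D[OF assms] cxD[OF deg0_cx(1)[OF assms]] cxD[OF deg0_cx(2)[OF assms]]
  by (simp_all add: bd1_def bd0_def)

lemma null_shift:
  assumes Y: "Y \<in> Ob (Sup_cat C)" shows "null C X (shift C Y) f \<longleftrightarrow> anull C X Y f"
  unfolding null_def anull_def deg1_shift[OF Y] using neg_deg0 bd1_shift by metis

lemma bd1_chain:
  assumes "deg1 C X Y h" shows "chain C X Y (bd1 C X Y h)"
  using deg1D[OF assms] cxD[OF deg1_cx(1)[OF assms]] cxD[OF deg1_cx(2)[OF assms]] deg1_cx[OF assms]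
  by (intro chainI deg0I) (simp_all add: bd1_def)

lemma bd0_anti:
  assumes "deg0 C X Y h" shows "anti C X Y (bd0 C X Y h)"
  using deg0D[OF assms] cxD[OF deg0_cx(1)[OF assms]] cxD[OF deg0_cx(2)[OF assms]] deg0_cx[OF assms]
  by (intro antiI deg1I) (simp_all add: bd0_def)

end

context preadd
begin

lemma deg0_comp:
  assumes "deg0 C X Y f" "deg0 C Y Z g" shows "deg0 C X Z (\<lambda>i. g i \<cdot> f i)"
  using deg0D[OF assms(1)] deg0D[OF assms(2)] deg0_cx[OF assms(1)] deg0_cx[OF assms(2)]
  by (intro deg0I) simp_all

lemma deg1_comp_right:
  assumes "deg0 C X Y f" "deg1 C Y Z g" shows "deg1 C X Z (\<lambda>i. g i \<cdot> f i)"
  using deg0D[OF assms(1)] deg1D[OF assms(2)] deg0_cx[OF assms(1)] deg1_cx[OF assms(2)]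
  by (intro deg1I) simp_all

lemma deg1_comp_left:
  assumes "deg1 C X Y f" "deg0 C Y Z g" shows "deg1 C X Z (\<lambda>i. g (i + 1) \<cdot> f i)"
  using deg1D[OF assms(1)] deg0D[OF assms(2)] deg1_cx[OF assms(1)] deg0_cx[OF assms(2)]
  by (intro deg1I) simp_all

lemma deg0_Add: "\<lbrakk>deg0 C X Y f; deg0 C X Y g\<rbrakk> \<Longrightarrow> deg0 C X Y (\<lambda>i. f i \<boxplus> g i)"
  using deg0D[of X Y f] deg0D[of X Y g] deg0_cx[of X Y f] by (intro deg0I) simp_all

lemma deg1_Add: "\<lbrakk>deg1 C X Y f; deg1 C X Y g\<rbrakk> \<Longrightarrow> deg1 C X Y (\<lambda>i. f i \<boxplus> g i)"
  using deg1D[of X Y f] deg1D[of X Y g] deg1_cx[of X Y f] by (intro deg1I) simp_all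

lemma neg_deg1: "deg1 C X Y f \<Longrightarrow> deg1 C X Y (\<lambda>i. neg C (f i))"
  using deg1D[of X Y f] deg1_cx[of X Y f] by (intro deg1I) simp_all

lemma bd0_deg1: "deg0 C X Y f \<Longrightarrow> deg1 C X Y (bd0 C X Y f)"
  using bd0_anti anti_deg1 by blast

lemma bd1_deg0: "deg1 C X Y f \<Longrightarrow> deg0 C X Y (bd1 C X Y f)"
  using bd1_chain chain_deg0 by blast

text \<open>The Leibniz rule, here and in the next two lemmas for the degrees that occur; a sign
  appears only when the outer factor has degree 1.\<close>

lemma bd0_comp:
  assumes "deg0 C X Y f" "deg0 C Y Z g"
  shows "bd0 C X Z (\<lambda>i. g i \<cdot> f i) i = bd0 C Y Z g i \<cdot> f i \<boxplus> g (i + 1) \<cdot> bd0 C X Y f i"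
  using deg0D[OF assms(1)] deg0D[OF assms(2)] cxD[OF deg0_cx(1)[OF assms(1)]] cxD[OF deg0_cx(2)[OF assms(1)]]
    cxD[OF deg0_cx(2)[OF assms(2)]]
  by (simp add: bd0_def Add_assoc)

lemma bd1_comp_right:
  assumes "deg0 C X Y f" "deg1 C Y Z g"
  shows "bd1 C X Z (\<lambda>i. g i \<cdot> f i) i = bd1 C Y Z g i \<cdot> f i \<boxplus> neg C (g (i + 1) \<cdot> bd0 C X Y f i)"
  using deg0D[OF assms(1)] deg1D[OF assms(2)] cxD[OF deg0_cx(1)[OF assms(1)]] cxD[OF deg0_cx(2)[OF assms(1)]]
    cxD[OF deg1_cx(2)[OF assms(2)]]
  by (simp add: bd0_def bd1_def Add_assoc)

lemma bd1_comp_left: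
  assumes "deg1 C X Y f" "deg0 C Y Z g"
  shows "bd1 C X Z (\<lambda>i. g (i + 1) \<cdot> f i) i = bd0 C Y Z g (i + 1) \<cdot> f i \<boxplus> g i \<cdot> bd1 C X Y f i"
  using deg1D[OF assms(1)] deg0D[OF assms(2)] cxD[OF deg1_cx(1)[OF assms(1)]] cxD[OF deg1_cx(2)[OF assms(1)]]
    cxD[OF deg0_cx(2)[OF assms(2)]]
  by (simp add: bd0_def bd1_def Add_assoc)

lemma bd0_Add:
  assumes "deg0 C X Y f" "deg0 C X Y g"
  shows "bd0 C X Y (\<lambda>i. f i \<boxplus> g i) i = bd0 C X Y f i \<boxplus> bd0 C X Y g i"
  using deg0D[OF assms(1)] deg0D[OF assms(2)] cxD[OF deg0_cx(1)[OF assms(1)]] cxD[OF deg0_cx(2)[OF assms(1)]]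
  by (simp add: bd0_def Add_ac)

lemma bd1_Add:
  assumes "deg1 C X Y f" "deg1 C X Y g"
  shows "bd1 C X Y (\<lambda>i. f i \<boxplus> g i) i = bd1 C X Y f i \<boxplus> bd1 C X Y g i"
  using deg1D[OF assms(1)] deg1D[OF assms(2)] cxD[OF deg1_cx(1)[OF assms(1)]] cxD[OF deg1_cx(2)[OF assms(1)]]
  by (simp add: bd1_def Add_ac)

lemma bd0_neg:
  assumes "deg0 C X Y f"
  shows "bd0 C X Y (\<lambda>i. neg C (f i)) i = neg C (bd0 C X Y f i)"
  using deg0D[OF assms(1)] cxD[OF deg0_cx(1)[OF assms(1)]] cxD[OF deg0_cx(2)[OF assms(1)]]
  by (simp add: bd0_def)

lemma bd1_neg:
  assumes "deg1 C X Y f"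
  shows "bd1 C X Y (\<lambda>i. neg C (f i)) i = neg C (bd1 C X Y f i)"
  using deg1D[OF assms(1)] cxD[OF deg1_cx(1)[OF assms(1)]] cxD[OF deg1_cx(2)[OF assms(1)]]
  by (simp add: bd1_def)

lemma chain_iff_bd0: "chain C X Y f \<longleftrightarrow> deg0 C X Y f \<and> (\<forall>i. bd0 C X Y f i = Zer C (part X i) (part Y (i + 1)))"
proof -
  have "bdry Y i \<cdot> f i = f (i + 1) \<cdot> bdry X i \<longleftrightarrow> bd0 C X Y f i = Zer C (part X i) (part Y (i + 1))"
    if "deg0 C X Y f" for i
    using deg0D[OF that] cxD[OF deg0_cx(1)[OF that]] cxD[OF deg0_cx(2)[OF that]]
      eq_iff_diff[of "bdry Y i \<cdot> f i" "f (i + 1) \<cdot> bdry X i"]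
    by (simp add: bd0_def)
  then show ?thesis by (auto simp: chain_def)
qed

lemma anti_iff_bd1: "anti C X Y f \<longleftrightarrow> deg1 C X Y f \<and> (\<forall>i. bd1 C X Y f i = Zer C (part X i) (part Y i))"
proof -
  have "bdry Y (i + 1) \<cdot> f i = neg C (f (i + 1) \<cdot> bdry X i) \<longleftrightarrow> bd1 C X Y f i = Zer C (part X i) (part Y i)"
    if "deg1 C X Y f" for i
    using deg1D[OF that] cxD[OF deg1_cx(1)[OF that]] cxD[OF deg1_cx(2)[OF that]]
      eq_neg_iff[of "bdry Y (i + 1) \<cdot> f i" "f (i + 1) \<cdot> bdry X i"]
      Add_commute[of "f (i + 1) \<cdot> bdry X i" "bdry Y (i + 1) \<cdot> f i"]
    by (simp add: bd1_def)
  then show ?thesis by (auto simp: anti_def)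
qed

lemma chain_bd0: "chain C X Y f \<Longrightarrow> bd0 C X Y f i = Zer C (part X i) (part Y (i + 1))"
  by (simp add: chain_iff_bd0)

lemma anti_bd1: "anti C X Y f \<Longrightarrow> bd1 C X Y f i = Zer C (part X i) (part Y i)"
  by (simp add: anti_iff_bd1)

lemma bd0_comp_chain_right:
  assumes "chain C X Y f" "deg0 C Y Z g"
  shows "bd0 C X Z (\<lambda>i. g i \<cdot> f i) i = bd0 C Y Z g i \<cdot> f i"
  using bd0_comp[OF chain_deg0[OF assms(1)] assms(2)] chain_bd0[OF assms(1)] chainD[OF assms(1)]
    deg0D[OF assms(2)] deg1D[OF bd0_deg1[OF assms(2)]] cxD[OF deg0_cx(2)[OF assms(2)]]
    cxD[OF deg0_cx(1)[OF chain_deg0[OF assms(1)]]]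
  by simp

lemma bd0_comp_chain_left:
  assumes "deg0 C X Y f" "chain C Y Z g"
  shows "bd0 C X Z (\<lambda>i. g i \<cdot> f i) i = g (i + 1) \<cdot> bd0 C X Y f i"
  using bd0_comp[OF assms(1) chain_deg0[OF assms(2)]] chain_bd0[OF assms(2)] chainD[OF assms(2)]
    deg0D[OF assms(1)] deg1D[OF bd0_deg1[OF assms(1)]] cxD[OF chain_cx(2)[OF assms(2)]]
    cxD[OF deg0_cx(1)[OF assms(1)]]
  by simp

lemma bd1_comp_chain_right:
  assumes "chain C X Y f" "deg1 C Y Z g"
  shows "bd1 C X Z (\<lambda>i. g i \<cdot> f i) i = bd1 C Y Z g i \<cdot> f i"
  using bd1_comp_right[OF chain_deg0[OF assms(1)] assms(2)] chain_bd0[OF assms(1)] chainD[OF assms(1)]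
    deg1D[OF assms(2)] deg0D[OF bd1_deg0[OF assms(2)]] cxD[OF deg1_cx(2)[OF assms(2)]]
    cxD[OF chain_cx(1)[OF assms(1)]]
  by simp

lemma bd1_comp_chain_left:
  assumes "deg1 C X Y f" "chain C Y Z g"
  shows "bd1 C X Z (\<lambda>i. g (i + 1) \<cdot> f i) i = g i \<cdot> bd1 C X Y f i"
  using bd1_comp_left[OF assms(1) chain_deg0[OF assms(2)]] chain_bd0[OF assms(2)] chainD[OF assms(2)]
    deg1D[OF assms(1)] deg0D[OF bd1_deg0[OF assms(1)]] cxD[OF chain_cx(2)[OF assms(2)]]
    cxD[OF deg1_cx(1)[OF assms(1)]]
  by simp

lemma bd1_anti_comp:
  assumes "deg0 C X Y f" "anti C Y Z g"
  shows "bd1 C X Z (\<lambda>i. g i \<cdot> f i) i = neg C (g (i + 1) \<cdot> bd0 C X Y f i)"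
  using bd1_comp_right[OF assms(1) anti_deg1[OF assms(2)]] anti_bd1[OF assms(2)] antiD[OF assms(2)]
    deg0D[OF assms(1)] deg1D[OF bd0_deg1[OF assms(1)]] cxD[OF anti_cx(2)[OF assms(2)]]
    cxD[OF deg0_cx(1)[OF assms(1)]]
  by simp

lemma chain_comp: "\<lbrakk>chain C X Y f; chain C Y Z g\<rbrakk> \<Longrightarrow> chain C X Z (\<lambda>i. g i \<cdot> f i)"
  using chainD[of X Y f] chainD[of Y Z g] deg0_comp[of X Y f Z g] cxD[OF chain_cx(1)[of X Y f]]
  by (intro chainI) (simp_all add: chain_deg0)

lemma anti_comp_left: "\<lbrakk>anti C X Y f; chain C Y Z g\<rbrakk> \<Longrightarrow> anti C X Z (\<lambda>i. g (i + 1) \<cdot> f i)"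
  using antiD[of X Y f] chainD[of Y Z g] deg1_comp_left[of X Y f Z g] cxD[OF anti_cx(1)[of X Y f]]
    cxD[OF anti_cx(2)[of X Y f]]
  by (intro antiI) (simp_all add: chain_deg0 anti_deg1)

lemma chain_Id: "X \<in> Ob SC \<Longrightarrow> chain C X X (\<lambda>i. Id C (part X i))"
  using cxD[of X] by (intro chainI deg0I) simp_all

lemma chain_Zer: "\<lbrakk>X \<in> Ob SC; Y \<in> Ob SC\<rbrakk> \<Longrightarrow> chain C X Y (\<lambda>i. Zer C (part X i) (part Y i))"
  using cxD[of X] cxD[of Y] by (intro chainI deg0I) simp_all

lemma deg1_Zer: "\<lbrakk>X \<in> Ob SC; Y \<in> Ob SC\<rbrakk> \<Longrightarrow> deg1 C X Y (\<lambda>i. Zer C (part X i) (part Y (i + 1)))"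
  using cxD[of X] cxD[of Y] by (intro deg1I) simp_all

lemma bd1_Zer: "\<lbrakk>X \<in> Ob SC; Y \<in> Ob SC\<rbrakk> \<Longrightarrow> bd1 C X Y (\<lambda>i. Zer C (part X i) (part Y (i + 1))) i = Zer C (part X i) (part Y i)"
  using cxD[of X] cxD[of Y] by (simp add: bd1_def)

lemma chain_diff:
  assumes "deg0 C X Y f" "deg0 C X Y g" "\<And>i. bd0 C X Y f i = bd0 C X Y g i"
  shows "chain C X Y (\<lambda>i. f i \<boxplus> neg C (g i))"
  using assms deg0_Add[OF assms(1) neg_deg0[OF assms(2)]] deg1D[OF bd0_deg1[OF assms(2)]]
  by (simp add: chain_iff_bd0 bd0_Add[OF assms(1) neg_deg0[OF assms(2)]] bd0_neg)

lemma chain_Add: "\<lbrakk>chain C X Y f; chain C X Y g\<rbrakk> \<Longrightarrow> chain C X Y (\<lambda>i. f i \<boxplus> g i)"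
  using cxD[OF chain_cx(1)[of X Y f]] cxD[OF chain_cx(2)[of X Y f]]
  by (simp add: chain_iff_bd0 deg0_Add bd0_Add)

lemma shift_shift: "X \<in> Ob SC \<Longrightarrow> shift C (shift C X) = X"
  using cxD[of X] by (cases X) (simp add: shift_def)

lemma anti_to_shift: "chain C X Y f \<Longrightarrow> anti C X (shift C Y) f"
  using chain_shift[of "shift C Y" X f] chain_cx[of X Y f] by (simp add: shift_shift shift_cx)

lemma chain_from_shift:
  assumes "X \<in> Ob SC"
  shows "chain C (shift C X) Y f \<longleftrightarrow> anti C X Y (\<lambda>i. f (i + 1))"
proof
  assume f: "chain C (shift C X) Y f"
  show "anti C X Y (\<lambda>i. f (i + 1))"
    using cxD[OF assms] chainD[OF f] chain_cx[OF f] assms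
    by (intro antiI deg1I) simp_all
next
  assume f: "anti C X Y (\<lambda>i. f (i + 1))"
  have f': "f i \<in> Ar C" "Dom C (f i) = part X (i + 1)" "Cod C (f i) = part Y i"
     "bdry Y i \<cdot> f i = neg C (f (i + 1) \<cdot> bdry X (i + 1))" for i
    using antiD(1-4)[OF f, of "i + 1"] by simp_all
  show "chain C (shift C X) Y f"
    using cxD[OF assms] f' anti_cx[OF f] assms shift_cx
    by (intro chainI deg0I) simp_all
qed

lemma bd1_from_shift:
  assumes "deg0 C X Y w"
  shows "bd1 C (shift C X) Y (\<lambda>i. w (i + 1)) i = bd0 C X Y w (i + 1)"
  using deg0D[OF assms] cxD[OF deg0_cx(1)[OF assms]] cxD[OF deg0_cx(2)[OF assms]]
  by (simp add: bd1_def bd0_def)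

lemma bd1_to_shift:
  assumes "deg0 C X Y w"
  shows "bd1 C X (shift C Y) w i = neg C (bd0 C X Y w i)"
  using deg0D[OF assms] cxD[OF deg0_cx(1)[OF assms]] cxD[OF deg0_cx(2)[OF assms]]
  by (simp add: bd1_def bd0_def)

end

section \<open>Kernels in preadditive categories\<close>

context preadditive_category
begin

lemma kernelD:
  assumes "is_kernel C f K k" "f \<in> Ar C"
  shows "K \<in> Ob C" "k \<in> Ar C" "Dom C k = K" "Cod C k = Dom C f" "f \<cdot> k = Zer C K (Cod C f)"
  using assms by (auto simp: is_kernel_def in_hom_set)

lemma kernel_mono:
  assumes "is_kernel C f K k" "f \<in> Ar C" "k \<cdot> h = k \<cdot> h'" "h \<in> Ar C" "h' \<in> Ar C"
    "Dom C h = Dom C h'" "Cod C h = K" "Cod C h' = K"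
  shows "h = h'"
proof -
  note k = kernelD[OF assms(1,2)]
  have "f \<cdot> k \<cdot> h = Zer C (Dom C h) (Cod C f)"
    using comp_rw[OF k(5), of h] k assms by simp
  then have "\<exists>!x. x \<in> hom_set C (Dom C h) K \<and> k \<cdot> x = k \<cdot> h"
    using assms(1) k assms(2-8) unfolding is_kernel_def by (auto simp: in_hom_set)
  moreover have "h \<in> hom_set C (Dom C h) K" "h' \<in> hom_set C (Dom C h) K"
    using assms by (auto simp: in_hom_set)
  ultimately show ?thesis using assms(3) by metis
qed

lemma kernel_lift:
  assumes "is_kernel C f K k" "f \<in> Ar C" "f \<cdot> g = Zer C (Dom C g) (Cod C f)" "g \<in> Ar C" "Cod C g = Dom C f"
  shows "\<exists>h. h \<in> Ar C \<and> Dom C h = Dom C g \<and> Cod C h = K \<and> k \<cdot> h = g"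
proof -
  have "\<exists>!h. h \<in> hom_set C (Dom C g) K \<and> k \<cdot> h = g"
    using assms unfolding is_kernel_def by (auto simp: in_hom_set)
  then show ?thesis by (auto simp: in_hom_set)
qed

lemma kernelI:
  assumes "K \<in> Ob C" "k \<in> Ar C" "Dom C k = K" "Cod C k = Dom C f" "f \<cdot> k = Zer C K (Cod C f)"
    and lift: "\<And>g. \<lbrakk>g \<in> Ar C; Cod C g = Dom C f; f \<cdot> g = Zer C (Dom C g) (Cod C f)\<rbrakk> \<Longrightarrow>
        \<exists>h. h \<in> Ar C \<and> Dom C h = Dom C g \<and> Cod C h = K \<and> k \<cdot> h = g"
    and mono: "\<And>h h'. \<lbrakk>h \<in> Ar C; h' \<in> Ar C; Dom C h = Dom C h'; Cod C h = K; Cod C h' = K; k \<cdot> h = k \<cdot> h'\<rbrakk> \<Longrightarrow> h = h'"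
  shows "is_kernel C f K k"
  unfolding is_kernel_def
proof (intro conjI ballI impI)
  fix L g assume g: "g \<in> hom_set C L (Dom C f)" "f \<cdot> g = Zer C L (Cod C f)"
  then have "\<exists>h. h \<in> Ar C \<and> Dom C h = Dom C g \<and> Cod C h = K \<and> k \<cdot> h = g"
    by (intro lift) (auto simp: in_hom_set)
  then obtain h where h: "h \<in> hom_set C L K \<and> k \<cdot> h = g" using g by (auto simp: in_hom_set)
  then show "\<exists>!h. h \<in> hom_set C L K \<and> k \<cdot> h = g"
    by (rule ex1I) (rule mono, use h in \<open>auto simp: in_hom_set\<close>)
qed (use assms in \<open>auto simp: in_hom_set\<close>)

end

section \<open>Relative homotopy theory of supercomplexes\<close>

definition tst where
  "tst C VV V \<longleftrightarrow> V \<in> Ob (Sup_cat C) \<and> (\<forall>i. part V i \<in> VV)"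

definition cof where
  "cof C VV X Y f \<longleftrightarrow> chain C X Y f \<and> (\<forall>i. f i \<in> cofibrations C VV)"

text \<open>Bijectivity on degree 0 homology of the hom complexes, spelled out on cycles. Degree 1
  is recovered from it because the shift of a test complex is a test complex.\<close>

definition weq where
  "weq C VV X Y f \<longleftrightarrow> chain C X Y f \<and> (\<forall>V. tst C VV V \<longrightarrow>
     (\<forall>g. chain C X V g \<longrightarrow> (\<exists>h k. chain C Y V h \<and> deg1 C X V k \<and>
        (\<forall>i. g i = Add C (h i \<cdot>\<^bsub>C\<^esub> f i) (bd1 C X V k i)))) \<and>
     (\<forall>g. chain C Y V g \<and> null C X V (\<lambda>i. g i \<cdot>\<^bsub>C\<^esub> f i) \<longrightarrow> null C Y V g))"

text \<open>The kernel is taken in each degree separately, without a differential;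
  \<open>fibration_kernel\<close> assembles the two into a complex.\<close>

definition fibr where
  "fibr C VV X Y f \<longleftrightarrow> chain C X Y f \<and>
     (\<forall>i. (\<exists>s\<in>hom_set C (part Y i) (part X i). f i \<cdot>\<^bsub>C\<^esub> s = Id C (part Y i)) \<and>
          (\<exists>K k. is_kernel C (f i) K k \<and> K \<in> rel_injectives C VV))"

text \<open>The maps from \<open>B\<close> to \<open>F\<close> killed by \<open>i\<close> form a complex with vanishing homology in degree 0.\<close>

definition nulls where
  "nulls C A B i F \<longleftrightarrow>
     (\<forall>g. chain C B F g \<and> (\<forall>n. g n \<cdot>\<^bsub>C\<^esub> i n = Zer C (part A n) (part F n)) \<longrightarrow>
        (\<exists>h. deg1 C B F h \<and> (\<forall>n. h n \<cdot>\<^bsub>C\<^esub> i n = Zer C (part A n) (part F (n + 1))) \<and>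
             (\<forall>n. g n = bd1 C B F h n)))"

locale additive = preadd C + additive_category C for C :: "('o, 'm) addcat" (structure)

text \<open>\<open>VV\<close> stands for the constant objects and the ambient category for
  pro-objects. The limit presentation is assumed for complexes, so that it respects the
  differential; on complexes with zero differential it yields the presentation of a single
  object.\<close>

locale pro_model = additive C for C :: "('o, 'm) addcat" (structure) +
  fixes VV :: "'o set"
  assumes VV_Ob: "VV \<subseteq> Ob C"
    and kernels: "f \<in> Ar C \<Longrightarrow> \<exists>K k. is_kernel C f K k"
    and towers: "X \<in> Ob (Sup_cat C) \<Longrightarrow> \<exists>V s t. (\<forall>k. V k \<in> Ob (Sup_cat C)) \<and>
        (\<forall>k. chain C X (V k) (s k)) \<and> (\<forall>k. chain C (V (Suc k)) (V k) (t k)) \<and>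
        (\<forall>i. is_pro_limit C VV (part X i) (\<lambda>k. part (V k) i) (\<lambda>k. s k i) (\<lambda>k. t k i))"
    and products: "(\<And>k. V k \<in> VV) \<Longrightarrow> \<exists>E pr. is_pro_product C VV E V pr"
begin

abbreviation "RI \<equiv> rel_injectives C VV"

lemma RI_Ob: "F \<in> RI \<Longrightarrow> F \<in> Ob C"
  by (simp add: rel_injectives_def)

lemma RI_ext:
  assumes "F \<in> RI" "i \<in> cofibrations C VV" "g \<in> Ar C" "Dom C g = Dom C i" "Cod C g = F"
  shows "\<exists>h. h \<in> Ar C \<and> Dom C h = Cod C i \<and> Cod C h = F \<and> h \<cdot> i = g"
proof -
  have "hom_into_surj C i F" using assms by (auto simp: rel_injectives_def)
  moreover have "g \<in> hom_set C (Dom C i) F" using assms by (simp add: in_hom_set)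
  ultimately have "g \<in> (\<lambda>h. h \<cdot> i) ` hom_set C (Cod C i) F" unfolding hom_into_surj_def by simp
  then show ?thesis by (auto simp: in_hom_set)
qed

lemma hom_into_surjI:
  assumes "i \<in> Ar C" "\<And>g. \<lbrakk>g \<in> Ar C; Dom C g = Dom C i; Cod C g = F\<rbrakk> \<Longrightarrow> \<exists>h. h \<in> Ar C \<and> Dom C h = Cod C i \<and> Cod C h = F \<and> h \<cdot> i = g"
  shows "hom_into_surj C i F"
proof -
  have "g \<in> (\<lambda>h. h \<cdot> i) ` hom_set C (Cod C i) F" if "g \<in> hom_set C (Dom C i) F" for g
    using assms(2)[of g] that by (force simp: in_hom_set)
  then show ?thesis using assms(1) by (auto simp: hom_into_surj_def in_hom_set)
qed

lemma cofI:
  assumes "i \<in> Ar C" "\<And>W g. \<lbrakk>W \<in> VV; g \<in> Ar C; Dom C g = Dom C i; Cod C g = W\<rbrakk> \<Longrightarrow> \<exists>h. h \<in> Ar C \<and> Dom C h = Cod C i \<and> Cod C h = W \<and> h \<cdot> i = g"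
  shows "i \<in> cofibrations C VV"
  using assms hom_into_surjI[of i] by (auto simp: cofibrations_def)

lemma RI_I:
  assumes "F \<in> Ob C" "\<And>i g. \<lbrakk>i \<in> cofibrations C VV; i \<in> Ar C; g \<in> Ar C; Dom C g = Dom C i; Cod C g = F\<rbrakk> \<Longrightarrow> \<exists>h. h \<in> Ar C \<and> Dom C h = Cod C i \<and> Cod C h = F \<and> h \<cdot> i = g"
  shows "F \<in> RI"
  using assms hom_into_surjI[of _ F] by (auto simp: rel_injectives_def cofibrations_def)

lemma VV_RI: "V \<in> VV \<Longrightarrow> V \<in> RI"
  using VV_Ob by (auto simp: rel_injectives_def cofibrations_def)

lemma RI_retract:
  assumes F: "F \<in> RI" and s: "s \<in> Ar C" "Cod C s = F" and r: "r \<in> Ar C" "Dom C r = F" "Cod C r = Dom C s"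
    and rs: "r \<cdot> s = Id C (Dom C s)"
  shows "Dom C s \<in> RI"
proof (rule RI_I)
  fix i g assume i: "i \<in> cofibrations C VV" "i \<in> Ar C" and g: "g \<in> Ar C" "Dom C g = Dom C i" "Cod C g = Dom C s"
  obtain h where "h \<in> Ar C" "Dom C h = Cod C i" "Cod C h = F" "h \<cdot> i = s \<cdot> g"
    using RI_ext[OF F i(1), of "s \<cdot> g"] g s by auto
  then show "\<exists>h. h \<in> Ar C \<and> Dom C h = Cod C i \<and> Cod C h = Dom C s \<and> h \<cdot> i = g"
    using s r i g comp_rw[OF rs, of g] by (intro exI[of _ "r \<cdot> h"]) simp
qed (use s in simp)

lemma RI_biproduct:
  assumes "Dom C j \<in> RI" "Dom C k \<in> RI"
    "j \<in> Ar C" "k \<in> Ar C" "p \<in> Ar C" "r \<in> Ar C" "Cod C j = T" "Cod C k = T" "Dom C p = T" "Dom C r = T"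
    "Cod C p = Dom C j" "Cod C r = Dom C k" "j \<cdot> p \<boxplus> k \<cdot> r = Id C T"
  shows "T \<in> RI"
proof (rule RI_I)
  fix i g assume i: "i \<in> cofibrations C VV" "i \<in> Ar C" and g: "g \<in> Ar C" "Dom C g = Dom C i" "Cod C g = T"
  obtain a where a: "a \<in> Ar C" "Dom C a = Cod C i" "Cod C a = Dom C j" "a \<cdot> i = p \<cdot> g"
    using RI_ext[OF assms(1) i(1), of "p \<cdot> g"] g assms by auto
  obtain b where b: "b \<in> Ar C" "Dom C b = Cod C i" "Cod C b = Dom C k" "b \<cdot> i = r \<cdot> g"
    using RI_ext[OF assms(2) i(1), of "r \<cdot> g"] g assms by auto
  have "(j \<cdot> p \<boxplus> k \<cdot> r) \<cdot> g = g" using assms g by (simp del: Add_comp)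
  then have "j \<cdot> p \<cdot> g \<boxplus> k \<cdot> r \<cdot> g = g" using assms(3-12) g by simp
  then show "\<exists>h. h \<in> Ar C \<and> Dom C h = Cod C i \<and> Cod C h = T \<and> h \<cdot> i = g"
    using assms(3-12) a b i g by (intro exI[of _ "j \<cdot> a \<boxplus> k \<cdot> b"]) simp
qed (use assms in auto)

lemma cof_comp_cancel:
  assumes "p \<cdot> i \<in> cofibrations C VV" "i \<in> Ar C" "p \<in> Ar C" "Dom C p = Cod C i"
  shows "i \<in> cofibrations C VV"
proof (rule cofI)
  fix W g assume *: "W \<in> VV" "g \<in> Ar C" "Dom C g = Dom C i" "Cod C g = W"
  obtain h where "h \<in> Ar C" "Dom C h = Cod C p" "Cod C h = W" "h \<cdot> p \<cdot> i = g"
    using RI_ext[OF VV_RI[OF *(1)] assms(1), of g] * assms by auto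
  then show "\<exists>h. h \<in> Ar C \<and> Dom C h = Cod C i \<and> Cod C h = W \<and> h \<cdot> i = g"
    using assms by (intro exI[of _ "h \<cdot> p"]) simp
qed fact

lemma tst_shift: "tst C VV V \<Longrightarrow> tst C VV (shift C V)"
  by (simp add: tst_def shift_cx)

lemma tst_cx: "tst C VV V \<Longrightarrow> V \<in> Ob SC"
  and tst_RI: "tst C VV V \<Longrightarrow> part V i \<in> RI"
  using VV_RI by (auto simp: tst_def)

lemma cof_chain: "cof C VV X Y f \<Longrightarrow> chain C X Y f"
  by (simp add: cof_def)

lemma weq_chain: "weq C VV X Y f \<Longrightarrow> chain C X Y f"
  by (simp add: weq_def)

lemma fibr_chain: "fibr C VV X Y f \<Longrightarrow> chain C X Y f"
  by (simp add: fibr_def)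

text \<open>The extension is chosen degree by degree and need not commute with the differentials;
  removing its boundary is the task of the lifting arguments.\<close>

lemma cof_deg0_ext:
  assumes i: "cof C VV A B i" and F: "\<And>n. part F n \<in> RI" and g: "deg0 C A F g"
  shows "\<exists>h. deg0 C B F h \<and> (\<forall>n. h n \<cdot> i n = g n)"
proof -
  have "\<exists>h. h \<in> Ar C \<and> Dom C h = part B n \<and> Cod C h = part F n \<and> h \<cdot> i n = g n" for n
    using RI_ext[OF F, of "i n" "g n" n] deg0D[OF g] i chainD[OF cof_chain[OF i]] by (auto simp: cof_def)
  then obtain h where "\<And>n. h n \<in> Ar C \<and> Dom C (h n) = part B n \<and> Cod C (h n) = part F n \<and> h n \<cdot> i n = g n"
    by metis
  then show ?thesis
    using deg0_cx[OF g] chain_cx[OF cof_chain[OF i]] by (intro exI[of _ h]) (auto intro!: deg0I)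
qed

lemma cof_deg1_ext:
  assumes i: "cof C VV A B i" and F: "\<And>n. part F n \<in> RI" and g: "deg1 C A F g"
  shows "\<exists>h. deg1 C B F h \<and> (\<forall>n. h n \<cdot> i n = g n)"
  using cof_deg0_ext[OF i, of "shift C F" g] F g deg1_cx[OF g] by (auto simp: deg0_shift)

lemma weq_surj:
  assumes "weq C VV X Y f" "tst C VV V" "chain C X V g"
  obtains h k where "chain C Y V h" "deg1 C X V k" "\<And>i. g i = h i \<cdot> f i \<boxplus> bd1 C X V k i"
  using assms unfolding weq_def by metis

lemma weq_inj:
  assumes "weq C VV X Y f" "tst C VV V" "chain C Y V g" "null C X V (\<lambda>i. g i \<cdot> f i)"
  shows "null C Y V g"
  using assms unfolding weq_def by blast

lemma weq_surj1:
  assumes "weq C VV X Y f" "tst C VV V" "anti C X V g"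
  obtains h k where "anti C Y V h" "deg0 C X V k" "\<And>i. g i = h i \<cdot> f i \<boxplus> bd0 C X V k i"
proof -
  have V: "V \<in> Ob SC" using tst_cx[OF assms(2)] .
  obtain h k where h: "chain C Y (shift C V) h" "deg1 C X (shift C V) k" "\<And>i. g i = h i \<cdot> f i \<boxplus> bd1 C X (shift C V) k i"
    using weq_surj[OF assms(1) tst_shift[OF assms(2)], of g] assms(3) chain_shift[OF V] by metis
  show ?thesis
    by (rule that[of h "\<lambda>i. neg C (k i)"])
      (use h neg_deg0[of X V k] in \<open>simp_all add: chain_shift[OF V] deg1_shift[OF V] bd1_shift(2)\<close>)
qed

lemma weq_inj1:
  assumes "weq C VV X Y f" "tst C VV V" "anti C Y V g" "anull C X V (\<lambda>i. g i \<cdot> f i)"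
  shows "anull C Y V g"
  using weq_inj[OF assms(1) tst_shift[OF assms(2)], of g] assms(3,4) tst_cx[OF assms(2)]
  by (simp add: chain_shift null_shift)

text \<open>A short exact sequence of complexes that splits in each degree: \<open>k\<close> and
  \<open>p\<close> are chain maps, while \<open>r\<close> and \<open>s\<close> are only graded,
  their boundaries carrying the extension class.\<close>

definition splitting where
  "splitting K X Y k r p s \<longleftrightarrow> chain C K X k \<and> chain C X Y p \<and> deg0 C X K r \<and> deg0 C Y X s \<and>
     (\<forall>i. p i \<cdot> k i = Zer C (part K i) (part Y i) \<and> r i \<cdot> k i = Id C (part K i) \<and>
          p i \<cdot> s i = Id C (part Y i) \<and> k i \<cdot> r i \<boxplus> s i \<cdot> p i = Id C (part X i))"

lemma splittingD:
  assumes "splitting K X Y k r p s"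
  shows "chain C K X k" "deg0 C X K r" "deg0 C Y X s"
    "p i \<cdot> k i = Zer C (part K i) (part Y i)" "r i \<cdot> k i = Id C (part K i)"
    "p i \<cdot> s i = Id C (part Y i)" "k i \<cdot> r i \<boxplus> s i \<cdot> p i = Id C (part X i)"
    "\<lbrakk>x \<in> Ar C; Cod C x = part K i\<rbrakk> \<Longrightarrow> p i \<cdot> k i \<cdot> x = Zer C (Dom C x) (part Y i)"
    "\<lbrakk>x \<in> Ar C; Cod C x = part K i\<rbrakk> \<Longrightarrow> r i \<cdot> k i \<cdot> x = x"
    "\<lbrakk>x \<in> Ar C; Cod C x = part Y i\<rbrakk> \<Longrightarrow> p i \<cdot> s i \<cdot> x = x"
    "\<lbrakk>x \<in> Ar C; Dom C x = part X i\<rbrakk> \<Longrightarrow> x \<cdot> k i \<cdot> r i \<boxplus> x \<cdot> s i \<cdot> p i = x"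
    "\<lbrakk>x \<in> Ar C; Cod C x = part X i\<rbrakk> \<Longrightarrow> k i \<cdot> r i \<cdot> x \<boxplus> s i \<cdot> p i \<cdot> x = x"
proof -
  show D: "chain C K X k" "deg0 C X K r" "deg0 C Y X s"
    and 1: "p i \<cdot> k i = Zer C (part K i) (part Y i)" "r i \<cdot> k i = Id C (part K i)"
    "p i \<cdot> s i = Id C (part Y i)" "k i \<cdot> r i \<boxplus> s i \<cdot> p i = Id C (part X i)"
    using assms by (simp_all add: splitting_def)
  have p: "chain C X Y p" using assms by (simp add: splitting_def)
  note [simp] = chainD(1-3)[OF D(1)] chainD(1-3)[OF p] deg0D[OF D(2)] deg0D[OF D(3)] cxD(1)[OF chain_cx(2)[OF p]]
  show "\<lbrakk>x \<in> Ar C; Cod C x = part K i\<rbrakk> \<Longrightarrow> p i \<cdot> k i \<cdot> x = Zer C (Dom C x) (part Y i)"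
    "\<lbrakk>x \<in> Ar C; Cod C x = part K i\<rbrakk> \<Longrightarrow> r i \<cdot> k i \<cdot> x = x"
    "\<lbrakk>x \<in> Ar C; Cod C x = part Y i\<rbrakk> \<Longrightarrow> p i \<cdot> s i \<cdot> x = x"
    using comp_rw[OF 1(1), of x] comp_rw[OF 1(2), of x] comp_rw[OF 1(3), of x] by simp_all
  show "\<lbrakk>x \<in> Ar C; Dom C x = part X i\<rbrakk> \<Longrightarrow> x \<cdot> k i \<cdot> r i \<boxplus> x \<cdot> s i \<cdot> p i = x"
    "\<lbrakk>x \<in> Ar C; Cod C x = part X i\<rbrakk> \<Longrightarrow> k i \<cdot> r i \<cdot> x \<boxplus> s i \<cdot> p i \<cdot> x = x"
    using arg_cong[OF 1(4), of "\<lambda>y. x \<cdot> y"] arg_cong[OF 1(4), of "\<lambda>y. y \<cdot> x"] by simp_all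
qed

text \<open>A section \<open>s\<close> makes \<open>1 - s p\<close> a projector onto the kernel,
  which yields the retraction \<open>r\<close>; the kernels of the two degrees then form a complex
  because \<open>p\<close> commutes with the differentials.\<close>

lemma fibration_kernel:
  assumes p: "fibr C VV X Y p"
  obtains K k r s where "\<And>i. part K i \<in> RI" "splitting K X Y k r p s"
proof -
  note pc = fibr_chain[OF p]
  note [simp] = chainD[OF pc] cxD[OF chain_cx(1)[OF pc]] cxD[OF chain_cx(2)[OF pc]]
  have "\<exists>s K k r. s \<in> Ar C \<and> Dom C s = part Y i \<and> Cod C s = part X i \<and> p i \<cdot> s = Id C (part Y i) \<and>
     K \<in> RI \<and> k \<in> Ar C \<and> Dom C k = K \<and> Cod C k = part X i \<and> p i \<cdot> k = Zer C K (part Y i) \<and>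
     r \<in> Ar C \<and> Dom C r = part X i \<and> Cod C r = K \<and> r \<cdot> k = Id C K \<and> k \<cdot> r \<boxplus> s \<cdot> p i = Id C (part X i)" for i
  proof -
    obtain s K k where s: "s \<in> Ar C" "Dom C s = part Y i" "Cod C s = part X i" "p i \<cdot> s = Id C (part Y i)"
      and K: "is_kernel C (p i) K k" "K \<in> RI" using p unfolding fibr_def Bex_def in_hom_set by blast
    note k = kernelD[OF K(1) chainD(1)[OF pc], unfolded chainD[OF pc]]
    note [simp] = s k
    have ps: "p i \<cdot> s \<cdot> x = x" if "x \<in> Ar C" "Cod C x = part Y i" for x
      using comp_rw[OF s(4), of x] that by simp
    have pk: "p i \<cdot> k \<cdot> x = Zer C (Dom C x) (part Y i)" if "x \<in> Ar C" "Cod C x = K" for x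
      using comp_rw[OF k(5), of x] that by simp
    obtain r where r: "r \<in> Ar C" "Dom C r = part X i" "Cod C r = K" "k \<cdot> r = Id C (part X i) \<boxplus> neg C (s \<cdot> p i)"
      using kernel_lift[OF K(1), of "Id C (part X i) \<boxplus> neg C (s \<cdot> p i)"] ps by auto
    have krk: "k \<cdot> r \<cdot> k = k"
      using comp_rw[OF r(4), of k] r(1-3) by simp
    have "r \<cdot> k = Id C K"
      by (rule kernel_mono[OF K(1)]) (use krk r(1-3) in simp_all)
    moreover have "k \<cdot> r \<boxplus> s \<cdot> p i = Id C (part X i)"
      by (simp add: r(4) Add_assoc)
    ultimately show ?thesis using s k r(1-3) K(2) by blast
  qed
  then obtain s K k r where s [simp]: "\<And>i. s i \<in> Ar C" "\<And>i. Dom C (s i) = part Y i" "\<And>i. Cod C (s i) = part X i"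
    "\<And>i. p i \<cdot> s i = Id C (part Y i)" and K: "\<And>i. K i \<in> RI" and
    k [simp]: "\<And>i. k i \<in> Ar C" "\<And>i. Dom C (k i) = K i" "\<And>i. Cod C (k i) = part X i" "\<And>i. p i \<cdot> k i = Zer C (K i) (part Y i)"
    and r [simp]: "\<And>i. r i \<in> Ar C" "\<And>i. Dom C (r i) = part X i" "\<And>i. Cod C (r i) = K i" "\<And>i. r i \<cdot> k i = Id C (K i)"
    and krs: "\<And>i. k i \<cdot> r i \<boxplus> s i \<cdot> p i = Id C (part X i)" by metis
  have [simp]: "K i \<in> Ob C" for i using K RI_Ob by blast
  let ?K = "Supercx K (\<lambda>i. r (i + 1) \<cdot> bdry X i \<cdot> k i)"
  have pkc: "p i \<cdot> k i \<cdot> x = Zer C (Dom C x) (part Y i)" if "x \<in> Ar C" "Cod C x = K i" for x i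
    using comp_rw[OF k(4), of x i] that by simp
  have kr: "k (i + 1) \<cdot> r (i + 1) \<cdot> bdry X i \<cdot> k i = bdry X i \<cdot> k i" for i
  proof -
    have "p (i + 1) \<cdot> bdry X i \<cdot> k i = bdry Y i \<cdot> p i \<cdot> k i"
      by (rule chainD(5)[OF pc, symmetric]) simp_all
    also have "\<dots> = bdry Y i \<cdot> Zer C (K i) (part Y i)" by (simp only: k(4))
    finally have "p (i + 1) \<cdot> bdry X i \<cdot> k i = Zer C (K i) (part Y (i + 1))" by simp
    then show ?thesis
      using arg_cong[OF krs[of "i + 1"], of "\<lambda>x. x \<cdot> bdry X i \<cdot> k i"] by simp
  qed
  have kr': "k (i + 1) \<cdot> r (i + 1) \<cdot> bdry X i \<cdot> k i \<cdot> x = bdry X i \<cdot> k i \<cdot> x" if "x \<in> Ar C" "Cod C x = K i" for x i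
    using arg_cong[OF kr[of i], of "\<lambda>y. y \<cdot> x"] that by simp
  have K_cx: "?K \<in> Ob SC"
  proof (rule cxI; simp)
    fix i
    have "r i \<cdot> bdry X (i + 1) \<cdot> k (i + 1) \<cdot> r (i + 1) \<cdot> bdry X i \<cdot> k i = r i \<cdot> bdry X (i + 1) \<cdot> bdry X i \<cdot> k i"
      using kr[of i] by simp
    then show "r i \<cdot> bdry X (i + 1) \<cdot> k (i + 1) \<cdot> r (i + 1) \<cdot> bdry X i \<cdot> k i = Zer C (K i) (K i)"
      by simp
  qed
  have "chain C ?K X k"
    using K_cx chain_cx[OF pc] by (intro chainI deg0I) (simp_all add: kr)
  moreover have "deg0 C X ?K r" "deg0 C Y X s"
    using K_cx chain_cx[OF pc] by (auto intro!: deg0I)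
  ultimately have "splitting ?K X Y k r p s" unfolding splitting_def using pc krs by simp
  then show thesis by (intro that[of ?K k r s]) (use K in simp_all)
qed

text \<open>Null homotopies can be chosen for each coordinate by itself: a product, unlike the limit
  defining a pro-object, asks for no compatibility between them. This is the reason for resolving by
  products.\<close>

lemma product_nulls:
  assumes E: "E \<in> Ob SC" and V: "\<And>k. tst C VV (V k)" and pr: "\<And>k. chain C E (V k) (pr k)"
    and prod: "\<And>i. is_pro_product C VV (part E i) (\<lambda>k. part (V k) i) (\<lambda>k. pr k i)"
    and i: "chain C A B i" and null: "\<And>V. tst C VV V \<Longrightarrow> nulls C A B i V"
  shows "nulls C A B i E"
  unfolding nulls_def
proof (intro allI impI, elim conjE)
  fix g assume g: "chain C B E g" and gi: "\<forall>n. g n \<cdot> i n = Zer C (part A n) (part E n)"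
  have V_cx: "V k \<in> Ob SC" for k using V tst_cx by blast
  note [simp] = chainD[OF g] chainD[OF pr] chainD[OF i] cxD[OF chain_cx(1)[OF i]] cxD[OF chain_cx(2)[OF i]] cxD[OF E] cxD[OF V_cx]
  have mono: "f = f'" if "\<And>k. pr k n \<cdot> f = pr k n \<cdot> f'" "f \<in> Ar C" "f' \<in> Ar C" "Dom C f = Dom C f'" "Cod C f = part E n" "Cod C f' = part E n" for f f' n
    using prod[of n] that unfolding is_pro_product_def by (simp add: in_hom_set)
  have "\<exists>h. deg1 C B (V k) h \<and> (\<forall>n. h n \<cdot> i n = Zer C (part A n) (part (V k) (n + 1))) \<and>
      (\<forall>n. pr k n \<cdot> g n = bd1 C B (V k) h n)" for k
    using null[OF V, of k] chain_comp[OF g pr, of k] gi unfolding nulls_def by simp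
  then obtain h where h: "\<And>k. deg1 C B (V k) (h k)" "\<And>k n. h k n \<cdot> i n = Zer C (part A n) (part (V k) (n + 1))"
      "\<And>k n. pr k n \<cdot> g n = bd1 C B (V k) (h k) n" by metis
  note [simp] = deg1D[OF h(1)]
  have "\<exists>H\<in>hom_set C (part B n) (part E (n + 1)). \<forall>k. pr k (n + 1) \<cdot> H = h k n" for n
    using prod[of "n + 1"] unfolding is_pro_product_def by (simp add: in_hom_set)
  then obtain H where H: "\<And>n. H n \<in> Ar C" "\<And>n. Dom C (H n) = part B n" "\<And>n. Cod C (H n) = part E (n + 1)"
     "\<And>k n. pr k (n + 1) \<cdot> H n = h k n" unfolding in_hom_set Bex_def by metis
  note [simp] = H(1-3)
  have H': "pr k n \<cdot> H (n + 1) = h k (n + 1)" for k n using H(4)[of k "n + 1"] by simp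
  have Hc: "pr k (n + 1) \<cdot> H n \<cdot> x = h k n \<cdot> x" if "x \<in> Ar C" "Cod C x = part B n" for k n x
    using comp_rw[OF H(4)[of k n], of x] that by simp
  have Hc': "pr k n \<cdot> H (n + 1) \<cdot> x = h k (n + 1) \<cdot> x" if "x \<in> Ar C" "Cod C x = part B (n + 1)" for k n x
    using comp_rw[OF H'[of k n], of x] that by simp
  have "deg1 C B E H" using chain_cx[OF g] by (intro deg1I) simp_all
  moreover have "H n \<cdot> i n = Zer C (part A n) (part E (n + 1))" for n
    by (rule mono[of "n + 1"]) (simp_all add: Hc h)
  moreover have "g n = bd1 C B E H n" for n
  proof (rule mono[of n])
    fix k
    have "pr k n \<cdot> bdry E (n + 1) \<cdot> H n = bdry (V k) (n + 1) \<cdot> pr k (n + 1) \<cdot> H n"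
      using chainD(5)[OF pr, of "H n" "n + 1" k] by simp
    then have *: "pr k n \<cdot> bdry E (n + 1) \<cdot> H n = bdry (V k) (n + 1) \<cdot> h k n" by (simp add: H del: chainD)
    show "pr k n \<cdot> g n = pr k n \<cdot> bd1 C B E H n"
      by (simp add: h(3) bd1_def * Hc')
  qed (simp_all add: bd1_def)
  ultimately show "\<exists>h. deg1 C B E h \<and> (\<forall>n. h n \<cdot> i n = Zer C (part A n) (part E (n + 1))) \<and> (\<forall>n. g n = bd1 C B E h n)"
    by blast
qed

end

section \<open>Resolutions of complexes\<close>

definition resolution where
  "resolution C VV X E \<iota> q \<longleftrightarrow>
     (\<forall>i. part E i \<in> rel_injectives C VV) \<and> cof C VV X E \<iota> \<and> chain C E E q \<and>
     (\<forall>i. q i \<cdot>\<^bsub>C\<^esub> \<iota> i = Zer C (part X i) (part E i)) \<and>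
     (\<forall>i Z. Z \<in> Ob C \<longrightarrow> (\<forall>g\<in>hom_set C (part E i) Z. g \<cdot>\<^bsub>C\<^esub> \<iota> i = Zer C (part X i) Z \<longrightarrow>
        (\<exists>u\<in>hom_set C (part E i) Z. u \<cdot>\<^bsub>C\<^esub> q i = g))) \<and>
     (\<forall>i Z. \<forall>u\<in>hom_set C (part E i) Z. u \<cdot>\<^bsub>C\<^esub> q i = Zer C (part E i) Z \<longrightarrow> u = Zer C (part E i) Z) \<and>
     (\<forall>A B i. chain C A B i \<longrightarrow> (\<forall>V. tst C VV V \<longrightarrow> nulls C A B i V) \<longrightarrow> nulls C A B i E \<and> nulls C A B i (shift C E))"

text \<open>The clauses of the definition in the form of rules: cone, joint monicity, existence of
  lifts, factorization of maps to test objects, and vanishing at a later stage.\<close>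

lemma is_pro_limitD:
  assumes "is_pro_limit C VV X V s t"
  shows "V k \<in> VV" "s k \<in> hom_set C X (V k)" "t k \<in> hom_set C (V (Suc k)) (V k)"
    "t k \<cdot>\<^bsub>C\<^esub> s (Suc k) = s k"
    "\<lbrakk>f \<in> hom_set C T X; g \<in> hom_set C T X; \<And>k. s k \<cdot>\<^bsub>C\<^esub> f = s k \<cdot>\<^bsub>C\<^esub> g\<rbrakk> \<Longrightarrow> f = g"
    "\<lbrakk>\<And>k. u k \<in> hom_set C T (V k); \<And>k. t k \<cdot>\<^bsub>C\<^esub> u (Suc k) = u k\<rbrakk> \<Longrightarrow> \<exists>h\<in>hom_set C T X. \<forall>k. s k \<cdot>\<^bsub>C\<^esub> h = u k"
    "\<lbrakk>W \<in> VV; w \<in> hom_set C X W\<rbrakk> \<Longrightarrow> \<exists>k. \<exists>h\<in>hom_set C (V k) W. w = h \<cdot>\<^bsub>C\<^esub> s k"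
    "\<lbrakk>W \<in> VV; w \<in> hom_set C (V k) W; w \<cdot>\<^bsub>C\<^esub> s k = Zer C X W\<rbrakk> \<Longrightarrow> \<exists>j. pull C t k w j = Zer C (V (k + j)) W"
  using assms unfolding is_pro_limit_def by blast+

context pro_model
begin

text \<open>The presentation assumed for complexes is applied to the complex with zero
  differential.\<close>

lemma object_pro_limit:
  assumes "Z \<in> Ob C"
  shows "\<exists>V s t. is_pro_limit C VV Z V s t"
proof -
  have "Supercx (\<lambda>_. Z) (\<lambda>_. Zer C Z Z) \<in> Ob SC"
    using assms by (intro cxI) simp_all
  from towers[OF this] show ?thesis by fastforce
qed

lemma complex_product:
  assumes X: "X \<in> Ob SC" and V: "\<And>k. V k \<in> Ob SC"
    and prod: "\<And>i. is_pro_product C VV (E i) (\<lambda>k. part (V k) i) (\<lambda>k. pr k i)"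
  obtains d where "Supercx E d \<in> Ob SC" "\<And>k. chain C (Supercx E d) (V k) (pr k)"
proof -
  have [simp]: "E i \<in> Ob C" "pr k i \<in> Ar C" "Dom C (pr k i) = E i" "Cod C (pr k i) = part (V k) i" for i k
    using prod[of i] by (auto simp: is_pro_product_def in_hom_set)
  note [simp] = cxD[OF V]
  have mono: "f = f'" if "\<And>k. pr k n \<cdot> f = pr k n \<cdot> f'" "f \<in> Ar C" "f' \<in> Ar C" "Dom C f = Dom C f'" "Cod C f = E n" "Cod C f' = E n" for f f' n
    using prod[of n] that unfolding is_pro_product_def by (simp add: in_hom_set)
  have "\<exists>d\<in>hom_set C (E i) (E (i + 1)). \<forall>k. pr k (i + 1) \<cdot> d = bdry (V k) i \<cdot> pr k i" for i
    using prod[of "i + 1"] unfolding is_pro_product_def by (simp add: in_hom_set)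
  then obtain d where d: "\<And>i. d i \<in> Ar C" "\<And>i. Dom C (d i) = E i" "\<And>i. Cod C (d i) = E (i + 1)"
     "\<And>k i. pr k (i + 1) \<cdot> d i = bdry (V k) i \<cdot> pr k i" unfolding in_hom_set Bex_def by metis
  note [simp] = d(1-3)
  have "d (i + 1) \<cdot> d i = Zer C (E i) (E i)" for i
  proof (rule mono[of i])
    fix k
    have "pr k i \<cdot> d (i + 1) \<cdot> d i = (bdry (V k) (i + 1) \<cdot> pr k (i + 1)) \<cdot> d i"
      using comp_rw[OF d(4)[of k "i + 1"], of "d i"] by simp
    then show "pr k i \<cdot> d (i + 1) \<cdot> d i = pr k i \<cdot> Zer C (E i) (E i)"
      by (simp add: d)
  qed simp_all
  then have "Supercx E d \<in> Ob SC" by (intro cxI) simp_all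
  moreover from this have "chain C (Supercx E d) (V k) (pr k)" for k
    using V by (intro chainI deg0I) (simp_all add: d)
  ultimately show thesis by (rule that)
qed

text \<open>Maps into the product are determined by their coordinates, so \<open>\<iota>\<close> and
  \<open>q\<close>, found in each degree separately, are chain maps as soon as this holds after
  every projection, where it reduces to \<open>s k\<close> and \<open>t k\<close> being chain
  maps.\<close>

lemma resolution_ex:
  assumes X: "X \<in> Ob SC"
  shows "\<exists>E \<iota> q. resolution C VV X E \<iota> q"
proof -
  obtain V s t where V: "\<And>k. V k \<in> Ob SC" and s: "\<And>k. chain C X (V k) (s k)"
    and t: "\<And>k. chain C (V (Suc k)) (V k) (t k)"
    and lim: "\<And>i. is_pro_limit C VV (part X i) (\<lambda>k. part (V k) i) (\<lambda>k. s k i) (\<lambda>k. t k i)"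
    using towers[OF X] by metis
  have tV: "tst C VV (V k)" for k
    using V is_pro_limitD(1)[OF lim] by (simp add: tst_def)
  have VVk: "part (V k) i \<in> VV" for k i using tV by (simp add: tst_def)
  obtain E' pr where prod': "\<And>i. is_pro_product C VV (E' i) (\<lambda>k. part (V k) i) (\<lambda>k. pr i k)"
    using products[of "\<lambda>k. part (V k) _"] VVk by metis
  obtain d where E: "Supercx E' d \<in> Ob SC" and pr: "\<And>k. chain C (Supercx E' d) (V k) (\<lambda>i. pr i k)"
    using complex_product[where V = V and pr = "\<lambda>k i. pr i k" and E = E', OF X V prod'] by metis
  define E where "E = Supercx E' d"
  define p where "p = (\<lambda>k i. pr i k)"
  have prod: "is_pro_product C VV (part E i) (\<lambda>k. part (V k) i) (\<lambda>k. p k i)" for i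
    using prod' by (simp add: E_def p_def)
  have E: "E \<in> Ob SC" and p: "\<And>k. chain C E (V k) (p k)"
    using E pr by (simp_all add: E_def p_def)
  have mono: "f = f'" if "\<And>k. p k n \<cdot> f = p k n \<cdot> f'" "f \<in> Ar C" "f' \<in> Ar C" "Dom C f = Dom C f'" "Cod C f = part E n" "Cod C f' = part E n" for f f' n
    using prod[of n] that unfolding is_pro_product_def by (simp add: in_hom_set)
  note [simp] = cxD[OF X] cxD[OF E] cxD[OF V] chainD[OF s] chainD[OF t] chainD[OF p]
  have RI_E: "part E i \<in> RI" for i
  proof (rule RI_I)
    fix j g assume j: "j \<in> cofibrations C VV" "j \<in> Ar C" and g: "g \<in> Ar C" "Dom C g = Dom C j" "Cod C g = part E i"
    have "\<exists>h. h \<in> Ar C \<and> Dom C h = Cod C j \<and> Cod C h = part (V k) i \<and> h \<cdot> j = p k i \<cdot> g" for k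
      using RI_ext[OF VV_RI[OF VVk] j(1), of "p k i \<cdot> g"] g by simp
    then obtain h where h: "\<And>k. h k \<in> Ar C" "\<And>k. Dom C (h k) = Cod C j" "\<And>k. Cod C (h k) = part (V k) i"
      "\<And>k. h k \<cdot> j = p k i \<cdot> g" by metis
    have "\<exists>H\<in>hom_set C (Cod C j) (part E i). \<forall>k. p k i \<cdot> H = h k"
      using prod[of i] h j unfolding is_pro_product_def by (simp add: in_hom_set)
    then obtain H where H: "H \<in> Ar C" "Dom C H = Cod C j" "Cod C H = part E i" "\<And>k. p k i \<cdot> H = h k"
      by (auto simp: in_hom_set)
    have "H \<cdot> j = g"
      by (rule mono[of i]) (use H j g h comp_rw[OF H(4), of j] in simp_all)
    then show "\<exists>h. h \<in> Ar C \<and> Dom C h = Cod C j \<and> Cod C h = part E i \<and> h \<cdot> j = g"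
      using H by blast
  qed simp
  \<comment> \<open>The conclusions of \<open>pro_product_resolution\<close> are packed into one
    predicate, so that \<open>\<iota>\<close> and \<open>q\<close> can be chosen for both degrees at
    once.\<close>
  define R where "R i \<iota> q \<longleftrightarrow> \<iota> \<in> hom_set C (part X i) (part E i) \<and> (\<forall>k. p k i \<cdot> \<iota> = s k i) \<and>
    q \<in> hom_set C (part E i) (part E i) \<and> (\<forall>k. p k i \<cdot> q \<boxplus> t k i \<cdot> p (Suc k) i = p k i) \<and> q \<cdot> \<iota> = Zer C (part X i) (part E i) \<and>
    (\<forall>W g. W \<in> VV \<longrightarrow> g \<in> hom_set C (part E i) W \<longrightarrow> g \<cdot> \<iota> = Zer C (part X i) W \<longrightarrow> (\<exists>u\<in>hom_set C (part E i) W. u \<cdot> q = g)) \<and>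
    (\<forall>W u. W \<in> VV \<longrightarrow> u \<in> hom_set C (part E i) W \<longrightarrow> u \<cdot> q = Zer C (part E i) W \<longrightarrow> u = Zer C (part E i) W)" for i \<iota> q
  have "\<exists>\<iota> q. R i \<iota> q" for i
    unfolding R_def by (rule pro_product_resolution[OF cxD(1)[OF X] VV_Ob lim prod, of i]) blast
  then obtain \<iota> q where "\<And>i. R i (\<iota> i) (q i)" by metis
  note R = this[unfolded R_def]
  have i: "\<And>i. \<iota> i \<in> hom_set C (part X i) (part E i)" "\<And>k i. p k i \<cdot> \<iota> i = s k i"
    and q: "\<And>i. q i \<in> hom_set C (part E i) (part E i)" "\<And>k i. p k i \<cdot> q i \<boxplus> t k i \<cdot> p (Suc k) i = p k i"
    and qi: "\<And>i. q i \<cdot> \<iota> i = Zer C (part X i) (part E i)"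
    using R by blast+
  have fac: "\<And>i W g. \<lbrakk>W \<in> VV; g \<in> hom_set C (part E i) W; g \<cdot> \<iota> i = Zer C (part X i) W\<rbrakk> \<Longrightarrow> \<exists>u\<in>hom_set C (part E i) W. u \<cdot> q i = g"
    and epi: "\<And>i W u. \<lbrakk>W \<in> VV; u \<in> hom_set C (part E i) W; u \<cdot> q i = Zer C (part E i) W\<rbrakk> \<Longrightarrow> u = Zer C (part E i) W"
    using R by blast+
  have [simp]: "\<iota> i \<in> Ar C" "Dom C (\<iota> i) = part X i" "Cod C (\<iota> i) = part E i"
    "q i \<in> Ar C" "Dom C (q i) = part E i" "Cod C (q i) = part E i" for i
    using i(1) q(1) by (simp_all add: in_hom_set)
  have ic: "p k i \<cdot> \<iota> i \<cdot> x = s k i \<cdot> x" if "x \<in> Ar C" "Cod C x = part X i" for x k i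
    using comp_rw[OF i(2), of x] that by simp
  have chain_i: "chain C X E \<iota>"
  proof (intro chainI deg0I X E)
    fix n show "bdry E n \<cdot> \<iota> n = \<iota> (n + 1) \<cdot> bdry X n"
    proof (rule mono[of "n + 1"])
      fix k
      have "p k (n + 1) \<cdot> bdry E n \<cdot> \<iota> n = bdry (V k) n \<cdot> p k n \<cdot> \<iota> n"
        by (rule chainD(5)[OF p, symmetric]) simp_all
      also have "\<dots> = bdry (V k) n \<cdot> s k n" by (simp only: i)
      finally show "p k (n + 1) \<cdot> bdry E n \<cdot> \<iota> n = p k (n + 1) \<cdot> \<iota> (n + 1) \<cdot> bdry X n"
        by (simp add: ic)
    qed simp_all
  qed simp_all
  have qc: "p k i \<cdot> q i \<cdot> x \<boxplus> t k i \<cdot> p (Suc k) i \<cdot> x = p k i \<cdot> x" if "x \<in> Ar C" "Cod C x = part E i" for x k i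
    using arg_cong[OF q(2)[of k i], of "\<lambda>y. y \<cdot> x"] that by simp
  \<comment> \<open>A coordinate of \<open>q\<close> is known only through its sum with the next,
    bonded coordinate; hence that summand is added on both sides and cancelled at the end.\<close>
  have chain_q: "chain C E E q"
  proof (intro chainI deg0I E)
    fix n show "bdry E n \<cdot> q n = q (n + 1) \<cdot> bdry E n"
    proof (rule mono[of "n + 1"])
      fix k
      have "p k (n + 1) \<cdot> bdry E n \<cdot> q n = bdry (V k) n \<cdot> p k n \<cdot> q n"
        by (rule chainD(5)[OF p, symmetric]) simp_all
      then have "t k (n + 1) \<cdot> p (Suc k) (n + 1) \<cdot> bdry E n \<boxplus> p k (n + 1) \<cdot> bdry E n \<cdot> q n
        = bdry (V k) n \<cdot> (p k n \<cdot> q n \<boxplus> t k n \<cdot> p (Suc k) n)"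
        by (simp del: chainD(5)[OF p] chainD(4)[OF p] add: Add_commute)
          (simp add: chainD(4)[OF p])
      also have "\<dots> = p k (n + 1) \<cdot> bdry E n" by (simp add: q)
      also have "\<dots> = t k (n + 1) \<cdot> p (Suc k) (n + 1) \<cdot> bdry E n \<boxplus> p k (n + 1) \<cdot> q (n + 1) \<cdot> bdry E n"
        using qc[of "bdry E n" "n + 1" k] by (simp add: Add_commute)
      finally show "p k (n + 1) \<cdot> bdry E n \<cdot> q n = p k (n + 1) \<cdot> q (n + 1) \<cdot> bdry E n"
        by (simp add: Add_left_cancel)
    qed simp_all
  qed simp_all
  have cof: "cof C VV X E \<iota>"
    unfolding cof_def
  proof (intro conjI chain_i allI)
    fix n show "\<iota> n \<in> cofibrations C VV"
    proof (rule cofI)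
      fix W g assume W: "W \<in> VV" and g: "g \<in> Ar C" "Dom C g = Dom C (\<iota> n)" "Cod C g = W"
      then have "g \<in> hom_set C (part X n) W" by (simp add: in_hom_set)
      with W obtain k h where "h \<in> hom_set C (part (V k) n) W" "g = h \<cdot> s k n"
        using is_pro_limitD(7)[OF lim] by blast
      then show "\<exists>h. h \<in> Ar C \<and> Dom C h = Cod C (\<iota> n) \<and> Cod C h = W \<and> h \<cdot> \<iota> n = g"
        by (intro exI[of _ "h \<cdot> p k n"]) (simp add: in_hom_set i)
    qed simp
  qed
  \<comment> \<open>From test objects to an arbitrary target \<open>Z\<close>: the maps from
    \<open>Z\<close> to its own test objects are jointly monic.\<close>
  have epi': "u = Zer C (part E i) Z" if u: "u \<in> hom_set C (part E i) Z" "u \<cdot> q i = Zer C (part E i) Z" for u i Z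
  proof -
    have [simp]: "Z \<in> Ob C" "u \<in> Ar C" "Dom C u = part E i" "Cod C u = Z" using u(1) hom_Ob by (auto simp: in_hom_set)
    obtain W \<sigma> \<tau> where Z: "is_pro_limit C VV Z W \<sigma> \<tau>" using object_pro_limit[of Z] by auto
    have \<sigma> [simp]: "W k \<in> VV" "W k \<in> Ob C" "\<sigma> k \<in> Ar C" "Dom C (\<sigma> k) = Z" "Cod C (\<sigma> k) = W k" for k
      using is_pro_limitD(1,2)[OF Z, of k] VV_Ob by (auto simp: in_hom_set)
    have "\<sigma> k \<cdot> u = \<sigma> k \<cdot> Zer C (part E i) Z" for k
    proof -
      have "\<sigma> k \<cdot> u = Zer C (part E i) (W k)"
        by (rule epi) (use u(2) in \<open>simp_all add: in_hom_set\<close>)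
      then show ?thesis by simp
    qed
    moreover have "Zer C (part E i) Z \<in> hom_set C (part E i) Z" by (simp add: in_hom_set)
    ultimately show ?thesis using is_pro_limitD(5)[OF Z u(1)] by blast
  qed
  \<comment> \<open>The factorizations of the maps to the \<open>W k\<close> are unique, as
    \<open>q\<close> is epic towards test objects; hence they are compatible and define a map into
    the limit \<open>Z\<close>.\<close>
  have fac': "\<exists>u\<in>hom_set C (part E i) Z. u \<cdot> q i = g" if "Z \<in> Ob C" "g \<in> hom_set C (part E i) Z" "g \<cdot> \<iota> i = Zer C (part X i) Z" for g i Z
  proof -
    have [simp]: "Z \<in> Ob C" "g \<in> Ar C" "Dom C g = part E i" "Cod C g = Z" using that by (auto simp: in_hom_set)
    obtain W \<sigma> \<tau> where Z: "is_pro_limit C VV Z W \<sigma> \<tau>" using object_pro_limit[of Z] by auto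
    have \<sigma> [simp]: "W k \<in> VV" "W k \<in> Ob C" "\<sigma> k \<in> Ar C" "Dom C (\<sigma> k) = Z" "Cod C (\<sigma> k) = W k"
        "\<tau> k \<in> Ar C" "Dom C (\<tau> k) = W (Suc k)" "Cod C (\<tau> k) = W k" "\<tau> k \<cdot> \<sigma> (Suc k) = \<sigma> k" for k
      using is_pro_limitD(1-4)[OF Z, of k] VV_Ob by (auto simp: in_hom_set)
    have "\<exists>u\<in>hom_set C (part E i) (W k). u \<cdot> q i = \<sigma> k \<cdot> g" for k
      by (rule fac) (use that(3) in \<open>simp_all add: in_hom_set\<close>)
    then obtain u where u: "\<And>k. u k \<in> Ar C" "\<And>k. Dom C (u k) = part E i" "\<And>k. Cod C (u k) = W k"
       "\<And>k. u k \<cdot> q i = \<sigma> k \<cdot> g" unfolding in_hom_set Bex_def by metis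
    note [simp] = u(1-3)
    have "\<tau> k \<cdot> u (Suc k) = u k" for k
    proof -
      have "(\<tau> k \<cdot> u (Suc k)) \<cdot> q i = \<sigma> k \<cdot> g"
        using comp_rw[OF \<sigma>(9)[of k], of g] by (simp add: u)
      then have "(\<tau> k \<cdot> u (Suc k) \<boxplus> neg C (u k)) \<cdot> q i = Zer C (part E i) (W k)"
        by (simp add: u)
      from epi[OF _ _ this] have "\<tau> k \<cdot> u (Suc k) \<boxplus> neg C (u k) = Zer C (part E i) (W k)"
        by (simp add: in_hom_set)
      then show ?thesis using eq_iff_diff[of "\<tau> k \<cdot> u (Suc k)" "u k"] by simp
    qed
    then have "\<forall>k. u k \<in> hom_set C (part E i) (W k) \<and> \<tau> k \<cdot> u (Suc k) = u k" by (simp add: in_hom_set)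
    then have "\<exists>v\<in>hom_set C (part E i) Z. \<forall>k. \<sigma> k \<cdot> v = u k"
      using is_pro_limitD(6)[OF Z, of u "part E i"] by blast
    then obtain v where v: "v \<in> Ar C" "Dom C v = part E i" "Cod C v = Z" "\<And>k. \<sigma> k \<cdot> v = u k"
      unfolding in_hom_set Bex_def by blast
    have "\<sigma> k \<cdot> v \<cdot> q i = \<sigma> k \<cdot> g" for k
      using comp_rw[OF v(4)[of k], of "q i"] v(1-3) by (simp add: u)
    moreover have "v \<cdot> q i \<in> hom_set C (part E i) Z" "g \<in> hom_set C (part E i) Z"
      using v(1-3) by (simp_all add: in_hom_set)
    ultimately have "v \<cdot> q i = g" using is_pro_limitD(5)[OF Z, of "v \<cdot> q i" "part E i" g] by blast
    then show ?thesis using v by (auto simp: in_hom_set)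
  qed
  \<comment> \<open>The shift of the product is the product of the shifts, which are test complexes
    again.\<close>
  have N: "nulls C A B i E \<and> nulls C A B i (shift C E)" if "chain C A B i" "\<And>V. tst C VV V \<Longrightarrow> nulls C A B i V" for A B i
  proof
    show "nulls C A B i E" using product_nulls[OF E tV p prod] that by blast
    have p': "chain C (shift C E) (shift C (V k)) (\<lambda>i. p k (i + 1))" for k
      using E V chain_cx shift_cx by (intro chainI deg0I) simp_all
    have prod'': "is_pro_product C VV (part (shift C E) i) (\<lambda>k. part (shift C (V k)) i) (\<lambda>k. p k (i + 1))" for i
      using prod[of "i + 1"] by simp
    show "nulls C A B i (shift C E)"
      by (rule product_nulls[where V = "\<lambda>k. shift C (V k)" and pr = "\<lambda>k i. p k (i + 1)"])
        (use p' prod'' E that tV tst_shift shift_cx in auto)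
  qed
  have "resolution C VV X E \<iota> q"
    unfolding resolution_def using RI_E cof chain_q qi fac' epi' N by blast
  then show ?thesis by blast
qed

end

lemma nullsD:
  assumes "nulls C A B i F" "chain C B F g" "\<And>n. g n \<cdot>\<^bsub>C\<^esub> i n = Zer C (part A n) (part F n)"
  obtains h where "deg1 C B F h" "\<And>n. h n \<cdot>\<^bsub>C\<^esub> i n = Zer C (part A n) (part F (n + 1))" "\<And>n. g n = bd1 C B F h n"
  using assms unfolding nulls_def by blast

lemma resolutionD:
  assumes "resolution C VV X E \<iota> q"
  shows "part E i \<in> rel_injectives C VV" "cof C VV X E \<iota>" "chain C E E q"
    "q i \<cdot>\<^bsub>C\<^esub> \<iota> i = Zer C (part X i) (part E i)"
    "\<lbrakk>Z \<in> Ob C; g \<in> hom_set C (part E i) Z; g \<cdot>\<^bsub>C\<^esub> \<iota> i = Zer C (part X i) Z\<rbrakk> \<Longrightarrow> \<exists>u\<in>hom_set C (part E i) Z. u \<cdot>\<^bsub>C\<^esub> q i = g"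
    "\<lbrakk>u \<in> hom_set C (part E i) Z; u \<cdot>\<^bsub>C\<^esub> q i = Zer C (part E i) Z\<rbrakk> \<Longrightarrow> u = Zer C (part E i) Z"
    "\<lbrakk>chain C A B j; \<And>V. tst C VV V \<Longrightarrow> nulls C A B j V\<rbrakk> \<Longrightarrow> nulls C A B j E"
    "\<lbrakk>chain C A B j; \<And>V. tst C VV V \<Longrightarrow> nulls C A B j V\<rbrakk> \<Longrightarrow> nulls C A B j (shift C E)"
  using assms unfolding resolution_def by blast+

context pro_model
begin

text \<open>A degreewise retraction \<open>r\<close> of \<open>F \<rightarrow> E\<close> exists since \<open>F\<close> is relatively injective; a null homotopy
  of the composite with \<open>E\<close> is pushed forward along \<open>r\<close> and corrected through \<open>q\<close>, the failure of \<open>r\<close> to be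
  a chain map.\<close>

lemma nulls_fibrant:
  assumes i: "chain C A B i" and null: "\<And>V. tst C VV V \<Longrightarrow> nulls C A B i V"
    and F: "F \<in> Ob SC" and RI: "\<And>n. part F n \<in> RI"
  shows "nulls C A B i F"
  unfolding nulls_def
proof (intro allI impI, elim conjE)
  fix c assume c: "chain C B F c" and ci: "\<forall>n. c n \<cdot> i n = Zer C (part A n) (part F n)"
  obtain E \<iota> q where res: "resolution C VV F E \<iota> q" using resolution_ex[OF F] by blast
  note cof = resolutionD(2)[OF res] and q = resolutionD(3)[OF res] and qi = resolutionD(4)[OF res]
    and fac = resolutionD(5)[OF res] and epi = resolutionD(6)[OF res]
    and N = resolutionD(7,8)[OF res i null]
  note \<iota> = cof_chain[OF cof]
  have E: "E \<in> Ob SC" using chain_cx[OF q] by simp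
  have A: "A \<in> Ob SC" and B: "B \<in> Ob SC" using chain_cx[OF i] by simp_all
  note [simp] = cxD[OF A] cxD[OF B] cxD[OF E] cxD[OF F]
    chainD(1-3)[OF i] chainD(1-3)[OF q] chainD(1-3)[OF \<iota>] chainD(1-3)[OF c]
  \<comment> \<open>The identity of \<open>F\<close> extends along \<open>\<iota>\<close> since
    \<open>F\<close> is relatively injective, but only as a graded map.\<close>
  obtain r where r: "deg0 C E F r" "\<And>n. r n \<cdot> \<iota> n = Id C (part F n)"
    using cof_deg0_ext[OF cof RI chain_deg0[OF chain_Id[OF F]]] by blast
  have "(\<iota> n \<cdot> c n) \<cdot> i n = Zer C (part A n) (part E n)" for n by (simp add: ci)
  then obtain e where e: "deg1 C B E e" "\<And>n. e n \<cdot> i n = Zer C (part A n) (part E (n + 1))"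
    "\<And>n. \<iota> n \<cdot> c n = bd1 C B E e n"
    using nullsD[OF N(1) chain_comp[OF c \<iota>]] by blast
  note [simp] = deg0D[OF r(1)] deg1D[OF e(1)] deg1D[OF bd0_deg1[OF r(1)]]
  \<comment> \<open>The boundary of \<open>r\<close> vanishes on \<open>\<iota>\<close>, because
    \<open>r \<cdot> \<iota>\<close> is the identity and hence a chain map; so it factors through
    \<open>q\<close>.\<close>
  have "\<exists>u\<in>hom_set C (part E n) (part F (n + 1)). u \<cdot> q n = bd0 C E F r n" for n
  proof (rule fac)
    have "bd0 C E F r n \<cdot> \<iota> n = bd0 C F F (\<lambda>n. Id C (part F n)) n"
      using bd0_comp_chain_right[OF \<iota> r(1), of n] by (simp add: r(2))
    then show "bd0 C E F r n \<cdot> \<iota> n = Zer C (part F n) (part F (n + 1))"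
      by (simp add: chain_bd0[OF chain_Id[OF F]])
  qed (simp_all add: in_hom_set)
  then obtain S where S: "\<And>n. S n \<in> hom_set C (part E n) (part F (n + 1))" "\<And>n. S n \<cdot> q n = bd0 C E F r n"
    by metis
  have S1: "deg1 C E F S" using S(1) E F by (simp add: deg1_def)
  note [simp] = deg1D[OF S1] deg0D[OF bd1_deg0[OF S1]]
  \<comment> \<open>\<open>S \<cdot> q\<close> is a boundary and \<open>q\<close> is an epimorphism,
    so \<open>S\<close> is itself a cycle.\<close>
  have S_anti: "anti C E F S"
    unfolding anti_iff_bd1
  proof (intro conjI S1 allI)
    fix n
    have "bd1 C E F S n \<cdot> q n = bd1 C E F (bd0 C E F r) n"
      using bd1_comp_chain_right[OF q S1, of n] by (simp add: S(2))
    also have "\<dots> = Zer C (part E n) (part F n)" using anti_bd1[OF bd0_anti[OF r(1)]] by simp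
    finally show "bd1 C E F S n = Zer C (part E n) (part F n)"
      using epi[of "bd1 C E F S n" n "part F n"] by (simp add: in_hom_set)
  qed
  \<comment> \<open>The boundary of \<open>q e\<close> is \<open>q \<iota> c\<close>, which is zero.
    So this is a degree 1 cycle vanishing on \<open>A\<close>, and acyclicity for the shift of
    \<open>E\<close> bounds it by some \<open>e'\<close> that also vanishes on
    \<open>A\<close>.\<close>
  let ?f = "\<lambda>n. q (n + 1) \<cdot> e n"
  have "chain C B (shift C E) ?f"
    unfolding chain_shift[OF E] anti_iff_bd1
  proof (intro conjI allI)
    show "deg1 C B E ?f" using deg1_comp_left[OF e(1) chain_deg0[OF q]] .
    fix n
    have "bd1 C B E ?f n = q n \<cdot> \<iota> n \<cdot> c n"
      using bd1_comp_chain_left[OF e(1) q, of n] by (simp add: e(3))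
    then show "bd1 C B E ?f n = Zer C (part B n) (part E n)"
      using comp_rw[OF qi[of n], of "c n"] by simp
  qed
  moreover have "?f n \<cdot> i n = Zer C (part A n) (part (shift C E) n)" for n by (simp add: e(2))
  ultimately obtain h where h: "deg1 C B (shift C E) h" "\<And>n. h n \<cdot> i n = Zer C (part A n) (part (shift C E) (n + 1))"
    "\<And>n. ?f n = bd1 C B (shift C E) h n"
    using nullsD[OF N(2)] by blast
  define e' where "e' = (\<lambda>n. neg C (h n))"
  have h0: "deg0 C B E h" using h(1) deg1_shift[OF E] by simp
  note [simp] = deg0D[OF h0]
  have e': "deg0 C B E e'" "\<And>n. e' n \<cdot> i n = Zer C (part A n) (part E n)" "\<And>n. ?f n = bd0 C B E e' n"
    using h(2,3) neg_deg0[OF h0] bd1_shift(2)[OF h0] by (simp_all add: e'_def)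
  note [simp] = deg0D[OF e'(1)] deg1D[OF bd0_deg1[OF e'(1)]]
  \<comment> \<open>The boundary of \<open>r e\<close> is \<open>c\<close> plus the error
    \<open>S q e\<close>, and the boundary of \<open>S e'\<close> is minus that error since
    \<open>q e\<close> is the boundary of \<open>e'\<close>.\<close>
  let ?h1 = "\<lambda>n. r (n + 1) \<cdot> e n" and ?h2 = "\<lambda>n. S n \<cdot> e' n"
  have d: "deg1 C B F ?h1" "deg1 C B F ?h2"
    using deg1_comp_left[OF e(1) r(1)] deg1_comp_right[OF e'(1) S1] by simp_all
  have "bd1 C B F (\<lambda>n. ?h1 n \<boxplus> ?h2 n) n = c n" for n
  proof -
    have 1: "bd0 C E F r (n + 1) \<cdot> e n = S (n + 1) \<cdot> bd0 C B E e' n"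
      using arg_cong[OF S(2)[of "n + 1"], of "\<lambda>x. x \<cdot> e n"] e'(3)[of n] by simp
    have 2: "r n \<cdot> bd1 C B E e n = c n"
      using comp_rw[OF r(2)[of n], of "c n"] by (simp flip: e(3))
    have "bd1 C B F (\<lambda>n. ?h1 n \<boxplus> ?h2 n) n = (S (n + 1) \<cdot> bd0 C B E e' n \<boxplus> c n) \<boxplus> neg C (S (n + 1) \<cdot> bd0 C B E e' n)"
      by (simp only: bd1_Add[OF d] bd1_comp_left[OF e(1) r(1)] bd1_anti_comp[OF e'(1) S_anti] 1 2)
    also have "\<dots> = c n" by (simp add: Add_commute[of _ "c n"] Add_assoc)
    finally show ?thesis .
  qed
  moreover have "(?h1 n \<boxplus> ?h2 n) \<cdot> i n = Zer C (part A n) (part F (n + 1))" for n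
    by (simp add: e(2) e'(2))
  ultimately show "\<exists>h. deg1 C B F h \<and> (\<forall>n. h n \<cdot> i n = Zer C (part A n) (part F (n + 1))) \<and> (\<forall>n. c n = bd1 C B F h n)"
    using deg1_Add[OF d] by (intro exI[of _ "\<lambda>n. ?h1 n \<boxplus> ?h2 n"]) simp
qed

text \<open>A null homotopy \<open>h\<close> of \<open>g\<close> exists but may be nonzero on
  \<open>A\<close>. Its restriction is a cycle of degree 1, hence the restriction of a cycle
  \<open>y\<close> on \<open>B\<close> up to the boundary of some \<open>z\<close>; extending
  \<open>z\<close> over \<open>B\<close> and subtracting both corrections makes \<open>h\<close>
  vanish on \<open>A\<close>.\<close>

lemma trivial_cofibration_nulls:
  assumes cof: "cof C VV A B i" and weq: "weq C VV A B i" and V: "tst C VV V"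
  shows "nulls C A B i V"
  unfolding nulls_def
proof (intro allI impI, elim conjE)
  fix g assume g: "chain C B V g" and gi: "\<forall>n. g n \<cdot> i n = Zer C (part A n) (part V n)"
  note i = cof_chain[OF cof]
  have A: "A \<in> Ob SC" and B: "B \<in> Ob SC" and Vc: "V \<in> Ob SC"
    using chain_cx[OF i] tst_cx[OF V] by simp_all
  note [simp] = cxD[OF A] cxD[OF B] cxD[OF Vc] chainD(1-3)[OF i] chainD(1-3)[OF g]
  have "null C A V (\<lambda>n. g n \<cdot> i n)"
    unfolding null_def using deg1_Zer[OF A Vc] bd1_Zer[OF A Vc] gi
    by (intro exI[of _ "\<lambda>i. Zer C (part A i) (part V (i + 1))"]) simp
  then obtain h where h: "deg1 C B V h" "\<And>n. g n = bd1 C B V h n"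
    using weq_inj[OF weq V g] unfolding null_def by blast
  note [simp] = deg1D[OF h(1)]
  have hi: "deg1 C A V (\<lambda>n. h n \<cdot> i n)" using deg1_comp_right[OF chain_deg0[OF i] h(1)] .
  have "anti C A V (\<lambda>n. h n \<cdot> i n)"
    unfolding anti_iff_bd1 bd1_comp_chain_right[OF i h(1)] using hi gi h(2) by simp
  then obtain y z where y: "anti C B V y" and z: "deg0 C A V z"
    and yz: "\<And>n. h n \<cdot> i n = y n \<cdot> i n \<boxplus> bd0 C A V z n"
    using weq_surj1[OF weq V] by blast
  obtain z' where z': "deg0 C B V z'" "\<And>n. z' n \<cdot> i n = z n"
    using cof_deg0_ext[OF cof tst_RI[OF V] z] by blast
  note y1 = anti_deg1[OF y] and b1 = bd0_deg1[OF z'(1)]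
  note [simp] = antiD(1-3)[OF y] deg1D[OF b1] deg1D[OF bd0_deg1[OF z]] deg0D[OF bd1_deg0[OF h(1)]]
  note s1 = deg1_Add[OF y1 b1]
  note s2 = neg_deg1[OF s1]
  have "bd0 C B V z' n \<cdot> i n = bd0 C A V z n" for n
    using bd0_comp_chain_right[OF i z'(1), of n] by (simp add: z')
  then have "(h n \<boxplus> neg C (y n \<boxplus> bd0 C B V z' n)) \<cdot> i n = Zer C (part A n) (part V (n + 1))" for n
    by (simp add: yz del: neg_Add)
  moreover have "bd1 C B V (\<lambda>n. h n \<boxplus> neg C (y n \<boxplus> bd0 C B V z' n)) n = g n" for n
    unfolding bd1_Add[OF h(1) s2] bd1_neg[OF s1] bd1_Add[OF y1 b1] anti_bd1[OF y] anti_bd1[OF bd0_anti[OF z'(1)]]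
    by (simp add: h(2))
  ultimately show "\<exists>h. deg1 C B V h \<and> (\<forall>n. h n \<cdot> i n = Zer C (part A n) (part V (n + 1))) \<and> (\<forall>n. g n = bd1 C B V h n)"
    using deg1_Add[OF h(1) s2] by (intro exI[of _ "\<lambda>n. h n \<boxplus> neg C (y n \<boxplus> bd0 C B V z' n)"]) simp
qed

text \<open>A degree 0 map extending \<open>u\<close> whose boundary lies in \<open>F\<close> can be corrected to a cycle.\<close>

lemma correct_extension:
  assumes cof: "cof C VV A B i" and weq: "weq C VV A B i"
    and F: "F \<in> Ob SC" and RI: "\<And>n. part F n \<in> RI"
    and c: "anti C B F c" and ci: "\<And>n. c n \<cdot> i n = Zer C (part A n) (part F (n + 1))"
  obtains e where "deg0 C B F e" "\<And>n. e n \<cdot> i n = Zer C (part A n) (part F n)" "\<And>n. c n = bd0 C B F e n"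
proof -
  note i = cof_chain[OF cof]
  have A: "A \<in> Ob SC" and B: "B \<in> Ob SC" using chain_cx[OF i] by simp_all
  \<comment> \<open>Passing to the shift turns the degree 1 cycle \<open>c\<close> into a chain map,
    so acyclicity in degree 0 applies to it.\<close>
  have "nulls C A B i (shift C F)"
    by (rule nulls_fibrant[OF i trivial_cofibration_nulls[OF cof weq]]) (use F RI shift_cx in simp_all)
  moreover have "chain C B (shift C F) c" using c chain_shift[OF F] by simp
  ultimately obtain h where "deg1 C B (shift C F) h" "\<And>n. h n \<cdot> i n = Zer C (part A n) (part (shift C F) (n + 1))"
    "\<And>n. c n = bd1 C B (shift C F) h n"
    by (rule nullsD) (simp_all add: ci)
  then have h: "deg1 C B (shift C F) h" "\<And>n. h n \<cdot> i n = Zer C (part A n) (part F n)"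
    "\<And>n. c n = bd1 C B (shift C F) h n" by simp_all
  have h0: "deg0 C B F h" using h(1) deg1_shift[OF F] by simp
  note [simp] = deg0D[OF h0] chainD(1-3)[OF i] cxD[OF A] cxD[OF F]
  show thesis
    by (rule that[of "\<lambda>n. neg C (h n)"]) (use neg_deg0[OF h0] h(2,3) bd1_shift(2)[OF h0] in simp_all)
qed

text \<open>A graded extension \<open>t\<close> of \<open>u\<close> has a boundary that is a cycle
  vanishing on \<open>A\<close>; subtracting a map with the same boundary, also zero on
  \<open>A\<close>, leaves a chain map.\<close>

lemma fibrant_extension:
  assumes cof: "cof C VV A B i" and weq: "weq C VV A B i"
    and RI: "\<And>n. part F n \<in> RI" and u: "chain C A F u"
  obtains w where "chain C B F w" "\<And>n. w n \<cdot> i n = u n"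
proof -
  note i = cof_chain[OF cof]
  have A: "A \<in> Ob SC" and B: "B \<in> Ob SC" and F: "F \<in> Ob SC"
    using chain_cx[OF i] chain_cx[OF u] by simp_all
  obtain t where t: "deg0 C B F t" "\<And>n. t n \<cdot> i n = u n"
    using cof_deg0_ext[OF cof RI chain_deg0[OF u]] by blast
  note [simp] = cxD[OF A] cxD[OF F] chainD(1-3)[OF i] chainD(1-3)[OF u] deg0D[OF t(1)]
  have "bd0 C B F t n \<cdot> i n = Zer C (part A n) (part F (n + 1))" for n
    using bd0_comp_chain_right[OF i t(1), of n] chain_bd0[OF u] by (simp add: t(2))
  then obtain e where e: "deg0 C B F e" "\<And>n. e n \<cdot> i n = Zer C (part A n) (part F n)"
    "\<And>n. bd0 C B F t n = bd0 C B F e n"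
    using correct_extension[OF cof weq F RI bd0_anti[OF t(1)]] by blast
  note [simp] = deg0D[OF e(1)]
  show thesis
    using chain_diff[OF t(1) e(1,3)] by (rule that) (simp add: t(2) e(2))
qed

text \<open>The degreewise splitting of \<open>p\<close> and an extension into its kernel give a
  graded lift \<open>w\<close>. Its boundary is killed by both \<open>p\<close> and
  \<open>i\<close>, so it lives on the kernel, where \<open>correct_extension\<close> removes
  it.\<close>

lemma lift_trivial_cofibration:
  assumes cof: "cof C VV A B i" and weq: "weq C VV A B i" and p: "fibr C VV X Y p"
    and u: "chain C A X u" and v: "chain C B Y v" and pu: "\<And>n. p n \<cdot> u n = v n \<cdot> i n"
  shows "\<exists>w. chain C B X w \<and> (\<forall>n. w n \<cdot> i n = u n) \<and> (\<forall>n. p n \<cdot> w n = v n)"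
proof -
  note i = cof_chain[OF cof] and pc = fibr_chain[OF p]
  obtain K k r s where RI: "\<And>i. part K i \<in> RI" and sp: "splitting K X Y k r p s"
    using fibration_kernel[OF p] by blast
  note k = splittingD(1)[OF sp] and r = splittingD(2)[OF sp] and s = splittingD(3)[OF sp] and pk = splittingD(4)[OF sp]
    and rk = splittingD(5)[OF sp] and ps = splittingD(6)[OF sp] and pkx = splittingD(8)[OF sp] and rkx = splittingD(9)[OF sp]
    and psx = splittingD(10)[OF sp] and krsx = splittingD(12)[OF sp]
  have A: "A \<in> Ob SC" and B: "B \<in> Ob SC" and X: "X \<in> Ob SC" and Y: "Y \<in> Ob SC" and K: "K \<in> Ob SC"
    using chain_cx[OF i] chain_cx[OF u] chain_cx[OF v] chain_cx[OF k] by simp_all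
  note [simp] = cxD[OF A] cxD[OF B] cxD[OF X] cxD[OF Y] cxD[OF K] chainD(1-3)[OF i] chainD(1-3)[OF u] chainD(1-3)[OF v]
    chainD(1-3)[OF k] chainD(1-3)[OF pc] deg0D[OF r] deg0D[OF s] pk rk ps
  obtain t where t: "deg0 C B K t" "\<And>n. t n \<cdot> i n = r n \<cdot> u n"
    using cof_deg0_ext[OF cof RI deg0_comp[OF chain_deg0[OF u] r]] by blast
  note [simp] = deg0D[OF t(1)]
  define w where "w = (\<lambda>n. s n \<cdot> v n \<boxplus> k n \<cdot> t n)"
  have w: "deg0 C B X w"
    unfolding w_def using deg0_Add[OF deg0_comp[OF chain_deg0[OF v] s] deg0_comp[OF t(1) chain_deg0[OF k]]] .
  note [simp] = deg0D[OF w] deg1D[OF bd0_deg1[OF w]]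
  have pw: "p n \<cdot> w n = v n" for n
    by (simp add: w_def pkx psx)
  have wi: "w n \<cdot> i n = u n" for n
  proof -
    have "w n \<cdot> i n = k n \<cdot> r n \<cdot> u n \<boxplus> s n \<cdot> p n \<cdot> u n"
      by (simp add: w_def t(2) pu Add_commute)
    then show ?thesis using krsx[of "u n"] by simp
  qed
  \<comment> \<open>Since \<open>p w = v\<close> is a chain map, the boundary of \<open>w\<close>
    lies in the kernel and is recovered from \<open>c\<close> by \<open>k\<close>.\<close>
  define c where "c = (\<lambda>n. r (n + 1) \<cdot> bd0 C B X w n)"
  have "p (n + 1) \<cdot> bd0 C B X w n = Zer C (part B n) (part Y (n + 1))" for n
    using bd0_comp_chain_left[OF w pc, of n] chain_bd0[OF v] by (simp add: pw)
  then have kc: "k (n + 1) \<cdot> c n = bd0 C B X w n" for n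
    using krsx[of "bd0 C B X w n" "n + 1"] by (simp add: c_def)
  have c1: "deg1 C B K c" unfolding c_def using deg1_comp_left[OF bd0_deg1[OF w] r] .
  note [simp] = deg1D[OF c1] deg0D[OF bd1_deg0[OF c1]]
  have c: "anti C B K c"
    unfolding anti_iff_bd1
  proof (intro conjI c1 allI)
    fix n
    have "k n \<cdot> bd1 C B K c n = Zer C (part B n) (part X n)"
      using bd1_comp_chain_left[OF c1 k, of n] anti_bd1[OF bd0_anti[OF w]] by (simp add: kc)
    then have "r n \<cdot> k n \<cdot> bd1 C B K c n = r n \<cdot> Zer C (part B n) (part X n)" by simp
    then show "bd1 C B K c n = Zer C (part B n) (part K n)"
      by (simp add: rkx)
  qed
  have "bd0 C B X w n \<cdot> i n = Zer C (part A n) (part X (n + 1))" for n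
    using bd0_comp_chain_right[OF i w, of n] chain_bd0[OF u] by (simp add: wi)
  then have "c n \<cdot> i n = Zer C (part A n) (part K (n + 1))" for n
    by (simp add: c_def)
  then obtain e where e: "deg0 C B K e" "\<And>n. e n \<cdot> i n = Zer C (part A n) (part K n)"
    "\<And>n. c n = bd0 C B K e n"
    using correct_extension[OF cof weq K RI c] by blast
  note [simp] = deg0D[OF e(1)]
  have ke: "deg0 C B X (\<lambda>n. k n \<cdot> e n)" using deg0_comp[OF e(1) chain_deg0[OF k]] .
  have "bd0 C B X w n = bd0 C B X (\<lambda>n. k n \<cdot> e n) n" for n
    using bd0_comp_chain_left[OF e(1) k, of n] kc[of n] e(3)[of n] by simp
  then have "chain C B X (\<lambda>n. w n \<boxplus> neg C (k n \<cdot> e n))"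
    by (rule chain_diff[OF w ke])
  then show ?thesis
    by (intro exI[of _ "\<lambda>n. w n \<boxplus> neg C (k n \<cdot> e n)"]) (simp add: wi e(2) pw pkx)
qed

end

section \<open>Trivial fibrations\<close>

context pro_model
begin

text \<open>The long exact sequence at the kernel, by hand. Extend \<open>g\<close> by
  \<open>r\<close> to a graded map on \<open>X\<close>; its boundary descends to a cycle
  \<open>c\<close> on \<open>Y\<close> that bounds on \<open>X\<close>, hence on \<open>Y\<close>.
  With this correction the extension becomes a chain map, so up to homotopy it comes from
  \<open>Y\<close>, and maps that come from \<open>Y\<close> vanish on \<open>K\<close>.\<close>

lemma trivial_fibration_kernel_null:
  assumes p: "weq C VV X Y p" and V: "tst C VV V"
    and sp: "splitting K X Y k r p s"
    and g: "chain C K V g"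
  shows "null C K V g"
proof -
  note pc = weq_chain[OF p]
  note k = splittingD(1)[OF sp] and r = splittingD(2)[OF sp] and s = splittingD(3)[OF sp]
  have X: "X \<in> Ob SC" and Y: "Y \<in> Ob SC" and K: "K \<in> Ob SC" and Vc: "V \<in> Ob SC"
    using chain_cx[OF k] chain_cx[OF pc] tst_cx[OF V] by simp_all
  note [simp] = cxD[OF X] cxD[OF Y] cxD[OF K] cxD[OF Vc] chainD(1-3)[OF g]
    chainD(1-3)[OF k] chainD(1-3)[OF pc] deg0D[OF r] deg0D[OF s] splittingD(4-6)[OF sp]
  define gr where "gr = (\<lambda>n. g n \<cdot> r n)"
  have gr: "deg0 C X V gr" unfolding gr_def using deg0_comp[OF r chain_deg0[OF g]] .
  define b where "b = bd0 C X V gr"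
  have b: "anti C X V b" unfolding b_def by (rule bd0_anti[OF gr])
  note [simp] = deg0D[OF gr] antiD(1-3)[OF b]
  have bk: "b n \<cdot> k n = Zer C (part K n) (part V (n + 1))" for n
    using bd0_comp_chain_right[OF k gr, of n] chain_bd0[OF g] by (simp add: b_def gr_def)
  \<comment> \<open>\<open>b\<close> vanishes on \<open>K\<close>, so it descends along
    \<open>p\<close>; composing with the section computes the descended map.\<close>
  define c where "c = (\<lambda>n. b n \<cdot> s n)"
  have cp: "c n \<cdot> p n = b n" for n
    using splittingD(11)[OF sp, of "b n" n] comp_rw[OF bk, of "r n"] by (simp add: c_def)
  have c1: "deg1 C Y V c" unfolding c_def using deg1_comp_right[OF s anti_deg1[OF b]] .
  note [simp] = deg1D[OF c1] deg0D[OF bd1_deg0[OF c1]]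
  have "anti C Y V c"
    unfolding anti_iff_bd1
  proof (intro conjI c1 allI)
    fix n
    have "bd1 C Y V c n \<cdot> p n = Zer C (part X n) (part V n)"
      using bd1_comp_chain_right[OF pc c1, of n] anti_bd1[OF b] by (simp add: cp)
    then have "(bd1 C Y V c n \<cdot> p n) \<cdot> s n = Zer C (part X n) (part V n) \<cdot> s n" by (rule arg_cong)
    then show "bd1 C Y V c n = Zer C (part Y n) (part V n)" by simp
  qed
  moreover have "anull C X V (\<lambda>n. c n \<cdot> p n)"
    unfolding anull_def using gr by (intro exI[of _ gr]) (simp add: cp b_def)
  ultimately obtain u where u: "deg0 C Y V u" "\<And>n. c n = bd0 C Y V u n"
    using weq_inj1[OF p V] unfolding anull_def by blast
  have up: "deg0 C X V (\<lambda>n. u n \<cdot> p n)" using deg0_comp[OF chain_deg0[OF pc] u(1)] .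
  have "chain C X V (\<lambda>n. gr n \<boxplus> neg C (u n \<cdot> p n))"
    by (rule chain_diff[OF gr up]) (use bd0_comp_chain_right[OF pc u(1)] cp u(2) in \<open>simp add: b_def\<close>)
  then obtain v h where v: "chain C Y V v" "deg1 C X V h"
    "\<And>n. gr n \<boxplus> neg C (u n \<cdot> p n) = v n \<cdot> p n \<boxplus> bd1 C X V h n"
    using weq_surj[OF p V, of "\<lambda>n. gr n \<boxplus> neg C (u n \<cdot> p n)"] by blast
  note [simp] = deg0D[OF u(1)] chainD(1-3)[OF v(1)] deg1D[OF v(2)] deg0D[OF bd1_deg0[OF v(2)]]
  have "g n = bd1 C K V (\<lambda>n. h n \<cdot> k n) n" for n
  proof -
    have "(gr n \<boxplus> neg C (u n \<cdot> p n)) \<cdot> k n = (v n \<cdot> p n \<boxplus> bd1 C X V h n) \<cdot> k n"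
      by (simp only: v(3))
    then have "g n = bd1 C X V h n \<cdot> k n" by (simp add: gr_def)
    then show ?thesis using bd1_comp_chain_right[OF k v(2), of n] by simp
  qed
  then show ?thesis
    unfolding null_def using deg1_comp_right[OF chain_deg0[OF k] v(2)] by blast
qed

text \<open>The kernel is contractible, so as a complex \<open>X\<close> becomes the sum of
  \<open>Y\<close> and the kernel. The \<open>Y\<close> component of the lift is then forced, and a
  contraction turns a graded extension into the kernel into a chain map.\<close>

lemma lift_trivial_fibration:
  assumes cof: "cof C VV A B i" and p: "fibr C VV X Y p" and weq: "weq C VV X Y p"
    and u: "chain C A X u" and v: "chain C B Y v" and pu: "\<And>n. p n \<cdot> u n = v n \<cdot> i n"
  shows "\<exists>w. chain C B X w \<and> (\<forall>n. w n \<cdot> i n = u n) \<and> (\<forall>n. p n \<cdot> w n = v n)"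
proof -
  note i = cof_chain[OF cof] and pc = fibr_chain[OF p]
  obtain K k r s where RI: "\<And>i. part K i \<in> RI" and sp: "splitting K X Y k r p s"
    using fibration_kernel[OF p] by blast
  note k = splittingD(1)[OF sp] and r = splittingD(2)[OF sp] and s = splittingD(3)[OF sp] and pk = splittingD(4)[OF sp]
    and rk = splittingD(5)[OF sp] and ps = splittingD(6)[OF sp] and pkx = splittingD(8)[OF sp]
    and xkrs = splittingD(11)[OF sp]
  have A: "A \<in> Ob SC" and B: "B \<in> Ob SC" and X: "X \<in> Ob SC" and Y: "Y \<in> Ob SC" and K: "K \<in> Ob SC"
    using chain_cx[OF i] chain_cx[OF u] chain_cx[OF v] chain_cx[OF k] by simp_all
  note [simp] = cxD[OF A] cxD[OF B] cxD[OF X] cxD[OF Y] cxD[OF K] chainD(1-3)[OF i] chainD(1-3)[OF u] chainD(1-3)[OF v]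
    chainD(1-3)[OF k] chainD(1-3)[OF pc] deg0D[OF r] deg0D[OF s] pk rk ps
  \<comment> \<open>Every map vanishes on the zero map, so with this choice of \<open>i\<close> the
    predicate \<open>nulls\<close> just says that chain maps are null homotopic; applied to the
    identity of \<open>K\<close> it yields a contraction.\<close>
  let ?z = "\<lambda>i. Zer C (part K i) (part K i)"
  have z: "chain C K K ?z" by (rule chain_Zer[OF K K])
  have "nulls C K K ?z K"
  proof (rule nulls_fibrant[OF z _ K RI])
    fix V assume V: "tst C VV V"
    note Vc = tst_cx[OF V]
    note [simp] = cxD[OF Vc]
    show "nulls C K K ?z V"
      unfolding nulls_def
    proof (intro allI impI, elim conjE)
      fix g assume "chain C K V g"
      from trivial_fibration_kernel_null[OF weq V sp this]
      obtain h where "deg1 C K V h" "\<And>i. g i = bd1 C K V h i" unfolding null_def by blast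
      then show "\<exists>h. deg1 C K V h \<and> (\<forall>n. h n \<cdot> ?z n = Zer C (part K n) (part V (n + 1))) \<and> (\<forall>n. g n = bd1 C K V h n)"
        using deg1D[of K V h] by (intro exI[of _ h]) simp
    qed
  qed
  from nullsD[OF this chain_Id[OF K]] obtain h where h: "deg1 C K K h" "\<And>n. bd1 C K K h n = Id C (part K n)"
    using cxD(1)[OF K] by (metis Zer_Ar Id_comp)
  note [simp] = deg1D[OF h(1)]
  have hr: "deg1 C X K (\<lambda>n. h n \<cdot> r n)" using deg1_comp_right[OF r h(1)] .
  \<comment> \<open>A boundary is a chain map, and on \<open>K\<close> this one is the boundary of
    \<open>h\<close>, the identity; so the graded retraction \<open>r\<close> is replaced by a chain
    retraction.\<close>
  define r' where "r' = bd1 C X K (\<lambda>n. h n \<cdot> r n)"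
  have r': "chain C X K r'" unfolding r'_def by (rule bd1_chain[OF hr])
  note [simp] = chainD(1-3)[OF r']
  have r'k: "r' n \<cdot> k n = Id C (part K n)" for n
    using bd1_comp_chain_right[OF k hr, of n] h(2) by (simp add: r'_def)
  have r'kx: "r' n \<cdot> k n \<cdot> x = x" if "x \<in> Ar C" "Cod C x = part K n" for x n
    using comp_rw[OF r'k[of n], of x] that by simp
  \<comment> \<open>\<open>1 - k r'\<close> kills \<open>K\<close>, so it descends along
    \<open>p\<close> to a section; this one is a chain map because \<open>p\<close> is split epic in
    each degree.\<close>
  define s' where "s' = (\<lambda>n. (Id C (part X n) \<boxplus> neg C (k n \<cdot> r' n)) \<cdot> s n)"
  have s'1: "s' n \<in> Ar C" "Dom C (s' n) = part Y n" "Cod C (s' n) = part X n" for n by (simp_all add: s'_def)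
  note [simp] = s'1
  have s'p: "s' n \<cdot> p n = Id C (part X n) \<boxplus> neg C (k n \<cdot> r' n)" for n
  proof -
    let ?x = "Id C (part X n) \<boxplus> neg C (k n \<cdot> r' n)"
    have "?x \<cdot> k n \<cdot> r n = Zer C (part X n) (part X n)"
      by (simp add: r'kx)
    then show ?thesis using xkrs[of ?x n] by (simp del: Add_comp add: s'_def)
  qed
  have s'0: "deg0 C Y X s'" using Y X by (intro deg0I) simp_all
  note [simp] = deg1D[OF bd0_deg1[OF s'0]]
  have s'c: "chain C Y X s'"
    unfolding chain_iff_bd0
  proof (intro conjI s'0 allI)
    fix n
    have "bd0 C Y X s' n \<cdot> p n = bd0 C X X (\<lambda>n. Id C (part X n) \<boxplus> neg C (k n \<cdot> r' n)) n"
      using bd0_comp_chain_right[OF pc s'0, of n] by (simp add: s'p)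
    also have "\<dots> = Zer C (part X n) (part X (n + 1))"
      using chain_bd0[OF chain_diff[OF chain_deg0[OF chain_Id[OF X]] chain_deg0[OF chain_comp[OF r' k]]]]
      chain_bd0[OF chain_Id[OF X]] chain_bd0[OF chain_comp[OF r' k]] by simp
    finally have "(bd0 C Y X s' n \<cdot> p n) \<cdot> s n = Zer C (part X n) (part X (n + 1)) \<cdot> s n" by (rule arg_cong)
    then show "bd0 C Y X s' n = Zer C (part Y n) (part X (n + 1))" by simp
  qed
  have ps': "p n \<cdot> s' n = Id C (part Y n)" for n by (simp add: s'_def pkx)
  note ru = chain_comp[OF u r']
  obtain t where t: "deg0 C B K t" "\<And>n. t n \<cdot> i n = r' n \<cdot> u n"
    using cof_deg0_ext[OF cof RI chain_deg0[OF ru]] by blast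
  note [simp] = deg0D[OF t(1)]
  have ht: "deg1 C B K (\<lambda>n. h n \<cdot> t n)" using deg1_comp_right[OF t(1) h(1)] .
  \<comment> \<open>The same device as for \<open>r'\<close>: on \<open>A\<close> the boundary of
    \<open>h t\<close> is the boundary of \<open>h r' u\<close>, and this is \<open>r' u\<close>
    because \<open>r' u\<close> is a chain map.\<close>
  define w where "w = bd1 C B K (\<lambda>n. h n \<cdot> t n)"
  have w: "chain C B K w" unfolding w_def by (rule bd1_chain[OF ht])
  note [simp] = chainD(1-3)[OF w]
  have wi: "w n \<cdot> i n = r' n \<cdot> u n" for n
    using bd1_comp_chain_right[OF i ht, of n] bd1_comp_chain_right[OF ru h(1), of n] h(2)
    by (simp add: w_def t(2))
  have "chain C B X (\<lambda>n. s' n \<cdot> v n \<boxplus> k n \<cdot> w n)"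
    by (rule chain_Add[OF chain_comp[OF v s'c] chain_comp[OF w k]])
  moreover have "(s' n \<cdot> v n \<boxplus> k n \<cdot> w n) \<cdot> i n = u n" for n
  proof -
    have "(s' n \<cdot> v n \<boxplus> k n \<cdot> w n) \<cdot> i n = (s' n \<cdot> p n) \<cdot> u n \<boxplus> k n \<cdot> r' n \<cdot> u n"
      by (simp add: wi pu)
    then show ?thesis unfolding s'p by (simp add: Add_assoc)
  qed
  moreover have "p n \<cdot> (s' n \<cdot> v n \<boxplus> k n \<cdot> w n) = v n" for n
    using comp_rw[OF ps'[of n], of "v n"] by (simp add: pkx)
  ultimately show ?thesis by (intro exI[of _ "\<lambda>n. s' n \<cdot> v n \<boxplus> k n \<cdot> w n"]) simp
qed

section \<open>Weak equivalences as bijections on homotopy classes\<close>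

lemma null_comp_right:
  assumes "chain C X Y f" "null C Y V g" shows "null C X V (\<lambda>i. g i \<cdot> f i)"
proof -
  obtain h where "deg1 C Y V h" "\<And>i. g i = bd1 C Y V h i" using assms(2) unfolding null_def by blast
  then show ?thesis
    unfolding null_def using deg1_comp_right[OF chain_deg0[OF assms(1)]] bd1_comp_chain_right[OF assms(1)]
    by (intro exI[of _ "\<lambda>i. h i \<cdot> f i"]) simp
qed

lemma null_Add:
  assumes "null C X V f" "null C X V g" shows "null C X V (\<lambda>i. f i \<boxplus> g i)"
proof -
  obtain h h' where "deg1 C X V h" "\<And>i. f i = bd1 C X V h i" "deg1 C X V h'" "\<And>i. g i = bd1 C X V h' i"
    using assms unfolding null_def by blast
  then show ?thesis
    unfolding null_def using deg1_Add bd1_Add by (intro exI[of _ "\<lambda>i. h i \<boxplus> h' i"]) simp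
qed

lemma null_neg:
  assumes "null C X V f" shows "null C X V (\<lambda>i. neg C (f i))"
proof -
  obtain h where "deg1 C X V h" "\<And>i. f i = bd1 C X V h i" using assms unfolding null_def by blast
  then show ?thesis
    unfolding null_def using neg_deg1 bd1_neg by (intro exI[of _ "\<lambda>i. neg C (h i)"]) simp
qed

lemma null_bd1: "deg1 C X V h \<Longrightarrow> null C X V (bd1 C X V h)"
  unfolding null_def by blast

definition htp where
  "htp X V f g \<longleftrightarrow> chain C X V f \<and> chain C X V g \<and> null C X V (\<lambda>i. f i \<boxplus> neg C (g i))"

lemma htpI:
  assumes "chain C X V g" "deg1 C X V k" "\<And>i. f i = g i \<boxplus> bd1 C X V k i" shows "htp X V f g"
proof -
  have f: "chain C X V (\<lambda>i. g i \<boxplus> bd1 C X V k i)" by (rule chain_Add[OF assms(1) bd1_chain[OF assms(2)]])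
  have f_eq: "f = (\<lambda>i. g i \<boxplus> bd1 C X V k i)" by (rule ext) (rule assms(3))
  note [simp] = chainD(1-3)[OF assms(1)] chainD(1-3)[OF bd1_chain[OF assms(2)]]
  have "null C X V (bd1 C X V k)" by (rule null_bd1[OF assms(2)])
  moreover have eq: "(\<lambda>i. f i \<boxplus> neg C (g i)) = bd1 C X V k"
    by (rule ext) (simp add: f_eq Add_commute Add_assoc)
  ultimately have "null C X V (\<lambda>i. f i \<boxplus> neg C (g i))" by simp
  then show ?thesis using f assms(1) by (simp add: htp_def flip: f_eq)
qed

lemma htpE:
  assumes "htp X V f g" obtains k where "deg1 C X V k" "\<And>i. f i = g i \<boxplus> bd1 C X V k i"
proof -
  have f: "chain C X V f" "chain C X V g" using assms by (auto simp: htp_def)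
  obtain k where k: "deg1 C X V k" "\<And>i. f i \<boxplus> neg C (g i) = bd1 C X V k i"
    using assms unfolding htp_def null_def by blast
  show thesis
    by (rule that[OF k(1)]) (use chainD(1-3)[OF f(1)] chainD(1-3)[OF f(2)] in \<open>simp add: k(2)[symmetric] Add_left_commute\<close>)
qed

lemma htp_sym:
  assumes "htp X V f g" shows "htp X V g f"
proof -
  have f: "chain C X V f" "chain C X V g" using assms by (auto simp: htp_def)
  have "null C X V (\<lambda>i. neg C (f i \<boxplus> neg C (g i)))" using assms null_neg by (simp add: htp_def)
  then show ?thesis using f chainD(1-3)[OF f(1)] chainD(1-3)[OF f(2)] by (simp add: htp_def Add_commute)
qed

lemma htp_trans:
  assumes "htp X V f g" "htp X V g h" shows "htp X V f h"
proof -
  have f: "chain C X V f" "chain C X V g" "chain C X V h" using assms by (auto simp: htp_def)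
  have "null C X V (\<lambda>i. (f i \<boxplus> neg C (g i)) \<boxplus> (g i \<boxplus> neg C (h i)))"
    by (rule null_Add) (use assms in \<open>auto simp: htp_def\<close>)
  then show ?thesis
    using f chainD(1-3)[OF f(1)] chainD(1-3)[OF f(2)] chainD(1-3)[OF f(3)] by (simp add: htp_def Add_assoc)
qed

lemma htp_comp:
  assumes "chain C X Y p" "htp Y V f g" shows "htp X V (\<lambda>i. f i \<cdot> p i) (\<lambda>i. g i \<cdot> p i)"
proof -
  have f: "chain C Y V f" "chain C Y V g" using assms by (auto simp: htp_def)
  have "null C X V (\<lambda>i. (f i \<boxplus> neg C (g i)) \<cdot> p i)"
    using assms by (intro null_comp_right) (auto simp: htp_def)
  then show ?thesis
    using assms(1) f chain_comp[OF assms(1)] chainD(1-3)[OF f(1)] chainD(1-3)[OF f(2)] chainD(1-3)[OF assms(1)]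
    by (simp add: htp_def)
qed

text \<open>Homotopy classes of maps into \<open>V\<close> form a functor, and a weak equivalence is
  a map that this functor sends to a bijection for every test complex. In this form two out of three
  and closure under retracts are formal.\<close>

lemma weq_iff:
  "weq C VV X Y f \<longleftrightarrow> chain C X Y f \<and> (\<forall>V. tst C VV V \<longrightarrow>
     (\<forall>g. chain C X V g \<longrightarrow> (\<exists>h. chain C Y V h \<and> htp X V g (\<lambda>i. h i \<cdot> f i))) \<and>
     (\<forall>g g'. chain C Y V g \<longrightarrow> chain C Y V g' \<longrightarrow> htp X V (\<lambda>i. g i \<cdot> f i) (\<lambda>i. g' i \<cdot> f i) \<longrightarrow> htp Y V g g'))"
    (is "?L \<longleftrightarrow> ?R")
proof
  assume L: ?L
  note f = weq_chain[OF L]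
  show ?R
  proof (intro conjI f allI impI)
    fix V g assume V: "tst C VV V" and g: "chain C X V g"
    obtain h k where "chain C Y V h" "deg1 C X V k" "\<And>i. g i = h i \<cdot> f i \<boxplus> bd1 C X V k i"
      using weq_surj[OF L V g] by blast
    then show "\<exists>h. chain C Y V h \<and> htp X V g (\<lambda>i. h i \<cdot> f i)"
      using htpI[OF chain_comp[OF f]] by blast
  next
    fix V g g' assume V: "tst C VV V" and g: "chain C Y V g" "chain C Y V g'"
      and gg: "htp X V (\<lambda>i. g i \<cdot> f i) (\<lambda>i. g' i \<cdot> f i)"
    note [simp] = chainD(1-3)[OF f] chainD(1-3)[OF g(1)] chainD(1-3)[OF g(2)] cxD[OF chain_cx(1)[OF g(1)]] cxD[OF chain_cx(2)[OF g(1)]]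
    have c: "chain C Y V (\<lambda>i. g i \<boxplus> neg C (g' i))"
      by (rule chain_diff) (simp_all add: chain_deg0 g chain_bd0[OF g(1)] chain_bd0[OF g(2)])
    have "null C X V (\<lambda>i. (g i \<boxplus> neg C (g' i)) \<cdot> f i)" using gg by (simp add: htp_def)
    from weq_inj[OF L V c this] show "htp Y V g g'" using g by (simp add: htp_def)
  qed
next
  assume R: ?R
  then have f: "chain C X Y f" by simp
  show ?L
    unfolding weq_def
  proof (intro conjI f allI impI)
    fix V g assume V: "tst C VV V" and g: "chain C X V g"
    obtain h where h: "chain C Y V h" "htp X V g (\<lambda>i. h i \<cdot> f i)" using R V g by blast
    obtain k where "deg1 C X V k" "\<And>i. g i = h i \<cdot> f i \<boxplus> bd1 C X V k i" using htpE[OF h(2)] by blast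
    then show "\<exists>h k. chain C Y V h \<and> deg1 C X V k \<and> (\<forall>i. g i = h i \<cdot> f i \<boxplus> bd1 C X V k i)"
      using h(1) by blast
  next
    fix V g assume V: "tst C VV V" and g: "chain C Y V g \<and> null C X V (\<lambda>i. g i \<cdot> f i)"
    then have gc: "chain C Y V g" by simp
    note [simp] = cxD[OF chain_cx(1)[OF f]] chainD(1-3)[OF f] chainD(1-3)[OF gc] cxD[OF chain_cx(1)[OF gc]] cxD[OF chain_cx(2)[OF gc]]
    have "htp X V (\<lambda>i. g i \<cdot> f i) (\<lambda>i. Zer C (part Y i) (part V i) \<cdot> f i)"
      using g chain_comp[OF f] chain_Zer[of X V] chain_cx[OF f] chain_cx[OF gc] by (simp add: htp_def)
    then have "htp Y V g (\<lambda>i. Zer C (part Y i) (part V i))"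
      using R V gc chain_Zer[of Y V] chain_cx[OF f] chain_cx[OF gc] by blast
    then show "null C Y V g" by (simp add: htp_def)
  qed
qed

lemma weqD:
  assumes "weq C VV X Y f" "tst C VV V"
  shows "chain C X V g \<Longrightarrow> \<exists>h. chain C Y V h \<and> htp X V g (\<lambda>i. h i \<cdot> f i)"
    "\<lbrakk>chain C Y V h; chain C Y V h'; htp X V (\<lambda>i. h i \<cdot> f i) (\<lambda>i. h' i \<cdot> f i)\<rbrakk> \<Longrightarrow> htp Y V h h'"
  using assms weq_iff[of X Y f] by blast+

lemma weqI:
  assumes "chain C X Y f"
    "\<And>V g. \<lbrakk>tst C VV V; chain C X V g\<rbrakk> \<Longrightarrow> \<exists>h. chain C Y V h \<and> htp X V g (\<lambda>i. h i \<cdot> f i)"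
    "\<And>V g g'. \<lbrakk>tst C VV V; chain C Y V g; chain C Y V g'; htp X V (\<lambda>i. g i \<cdot> f i) (\<lambda>i. g' i \<cdot> f i)\<rbrakk> \<Longrightarrow> htp Y V g g'"
  shows "weq C VV X Y f"
  using assms weq_iff[of X Y f] by blast

lemma comp_chain_assoc:
  assumes "chain C X Y f" "chain C Y Z g" "chain C Z V h"
  shows "(\<lambda>i. h i \<cdot> g i \<cdot> f i) = (\<lambda>i. (h i \<cdot> g i) \<cdot> f i)"
  using chainD(1-3)[OF assms(1)] chainD(1-3)[OF assms(2)] chainD(1-3)[OF assms(3)] by simp

lemma weq_two_of_three:
  assumes f: "chain C X Y f" and g: "chain C Y Z g"
  shows "\<lbrakk>weq C VV X Y f; weq C VV Y Z g\<rbrakk> \<Longrightarrow> weq C VV X Z (\<lambda>i. g i \<cdot> f i)" (is "\<lbrakk>?F; ?G\<rbrakk> \<Longrightarrow> ?H")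
    "\<lbrakk>weq C VV X Y f; weq C VV X Z (\<lambda>i. g i \<cdot> f i)\<rbrakk> \<Longrightarrow> weq C VV Y Z g"
    "\<lbrakk>weq C VV Y Z g; weq C VV X Z (\<lambda>i. g i \<cdot> f i)\<rbrakk> \<Longrightarrow> weq C VV X Y f"
proof -
  have gf: "chain C X Z (\<lambda>i. g i \<cdot> f i)" by (rule chain_comp[OF f g])
  note as = comp_chain_assoc[OF f g]
  show ?H if F: ?F and G: ?G
  proof (rule weqI[OF gf])
    fix V a assume V: "tst C VV V" and a: "chain C X V a"
    obtain b where b: "chain C Y V b" "htp X V a (\<lambda>i. b i \<cdot> f i)" using weqD(1)[OF F V a] by blast
    obtain c where c: "chain C Z V c" "htp Y V b (\<lambda>i. c i \<cdot> g i)" using weqD(1)[OF G V b(1)] by blast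
    have "htp X V a (\<lambda>i. (c i \<cdot> g i) \<cdot> f i)" using htp_trans[OF b(2) htp_comp[OF f c(2)]] .
    then show "\<exists>h. chain C Z V h \<and> htp X V a (\<lambda>i. h i \<cdot> g i \<cdot> f i)" using c(1) as[OF c(1)] by auto
  next
    fix V a a' assume V: "tst C VV V" and a: "chain C Z V a" "chain C Z V a'"
      and "htp X V (\<lambda>i. a i \<cdot> g i \<cdot> f i) (\<lambda>i. a' i \<cdot> g i \<cdot> f i)"
    then have "htp X V (\<lambda>i. (a i \<cdot> g i) \<cdot> f i) (\<lambda>i. (a' i \<cdot> g i) \<cdot> f i)" by (simp only: as[OF a(1)] as[OF a(2)])
    from weqD(2)[OF G V a weqD(2)[OF F V chain_comp[OF g a(1)] chain_comp[OF g a(2)] this]]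
    show "htp Z V a a'" .
  qed
  show "weq C VV Y Z g" if F: ?F and H: ?H
  proof (rule weqI[OF g])
    fix V a assume V: "tst C VV V" and a: "chain C Y V a"
    obtain c where c: "chain C Z V c" "htp X V (\<lambda>i. a i \<cdot> f i) (\<lambda>i. c i \<cdot> g i \<cdot> f i)" using weqD(1)[OF H V chain_comp[OF f a]] by blast
    then have "htp Y V a (\<lambda>i. c i \<cdot> g i)"
      using weqD(2)[OF F V a chain_comp[OF g c(1)]] by (simp only: as[OF c(1)])
    then show "\<exists>h. chain C Z V h \<and> htp Y V a (\<lambda>i. h i \<cdot> g i)" using c(1) by blast
  next
    fix V a a' assume V: "tst C VV V" and a: "chain C Z V a" "chain C Z V a'"
      and "htp Y V (\<lambda>i. a i \<cdot> g i) (\<lambda>i. a' i \<cdot> g i)"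
    then have "htp X V (\<lambda>i. a i \<cdot> g i \<cdot> f i) (\<lambda>i. a' i \<cdot> g i \<cdot> f i)"
      unfolding as[OF a(1)] as[OF a(2)] by (intro htp_comp[OF f])
    from weqD(2)[OF H V a this] show "htp Z V a a'" .
  qed
  show ?F if G: ?G and H: ?H
  proof (rule weqI[OF f])
    fix V a assume V: "tst C VV V" and a: "chain C X V a"
    obtain c where c: "chain C Z V c" "htp X V a (\<lambda>i. c i \<cdot> g i \<cdot> f i)" using weqD(1)[OF H V a] by blast
    then show "\<exists>h. chain C Y V h \<and> htp X V a (\<lambda>i. h i \<cdot> f i)" using chain_comp[OF g c(1)] as[OF c(1)] by auto
  next
    fix V a a' assume V: "tst C VV V" and a: "chain C Y V a" "chain C Y V a'"
      and aa: "htp X V (\<lambda>i. a i \<cdot> f i) (\<lambda>i. a' i \<cdot> f i)"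
    obtain b where b: "chain C Z V b" "htp Y V a (\<lambda>i. b i \<cdot> g i)" using weqD(1)[OF G V a(1)] by blast
    obtain b' where b': "chain C Z V b'" "htp Y V a' (\<lambda>i. b' i \<cdot> g i)" using weqD(1)[OF G V a(2)] by blast
    have "htp X V (\<lambda>i. (b i \<cdot> g i) \<cdot> f i) (\<lambda>i. (b' i \<cdot> g i) \<cdot> f i)"
      using htp_trans[OF htp_trans[OF htp_sym[OF htp_comp[OF f b(2)]] aa] htp_comp[OF f b'(2)]] .
    then have "htp Z V b b'" using weqD(2)[OF H V b(1) b'(1)] by (simp only: as[OF b(1)] as[OF b'(1)])
    then show "htp Y V a a'"
      using htp_trans[OF htp_trans[OF b(2) htp_comp[OF g]] htp_sym[OF b'(2)]] by blast
  qed
qed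

end

text \<open>The extension of \<open>Y\<close> by \<open>K\<close> classified by a degree 1 cycle
  \<open>u\<close>: the graded sum with \<open>u\<close> as off-diagonal part of the differential.
  Cones, homotopy fibres and homotopy pullbacks are instances. It is described by its structure
  maps, the class \<open>u\<close> entering as the boundary of the section \<open>j\<close> and,
  with a sign, of the retraction \<open>r\<close>.\<close>

definition twist where
  "twist C Y K u T j p k r \<longleftrightarrow>
     T \<in> Ob (Sup_cat C) \<and> deg0 C Y T j \<and> chain C T Y p \<and> chain C K T k \<and> deg0 C T K r \<and>
     (\<forall>i. p i \<cdot>\<^bsub>C\<^esub> j i = Id C (part Y i) \<and> r i \<cdot>\<^bsub>C\<^esub> k i = Id C (part K i) \<and>
          p i \<cdot>\<^bsub>C\<^esub> k i = Zer C (part K i) (part Y i) \<and> r i \<cdot>\<^bsub>C\<^esub> j i = Zer C (part Y i) (part K i) \<and>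
          Add C (j i \<cdot>\<^bsub>C\<^esub> p i) (k i \<cdot>\<^bsub>C\<^esub> r i) = Id C (part T i) \<and>
          bd0 C Y T j i = k (i + 1) \<cdot>\<^bsub>C\<^esub> u i \<and> bd0 C T K r i = neg C (u i \<cdot>\<^bsub>C\<^esub> p i))"

context pro_model
begin

lemma weq_retract:
  assumes g: "weq C VV X' Y' g" and f: "chain C X Y f" and s: "chain C X X' s" and r: "chain C X' X r"
    and s': "chain C Y Y' s'" and r': "chain C Y' Y r'"
    and rs: "\<And>i. r i \<cdot> s i = Id C (part X i)" and rs': "\<And>i. r' i \<cdot> s' i = Id C (part Y i)"
    and gs: "\<And>i. g i \<cdot> s i = s' i \<cdot> f i" and fr: "\<And>i. f i \<cdot> r i = r' i \<cdot> g i"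
  shows "weq C VV X Y f"
proof -
  note gc = weq_chain[OF g]
  note [simp] = chainD(1-3)[OF f] chainD(1-3)[OF gc] chainD(1-3)[OF s] chainD(1-3)[OF r] chainD(1-3)[OF s'] chainD(1-3)[OF r']
  show ?thesis
  proof (rule weqI[OF f])
    fix V a assume V: "tst C VV V" and a: "chain C X V a"
    obtain b where b: "chain C Y' V b" "htp X' V (\<lambda>i. a i \<cdot> r i) (\<lambda>i. b i \<cdot> g i)"
      using weqD(1)[OF g V chain_comp[OF r a]] by blast
    note [simp] = chainD(1-3)[OF a] chainD(1-3)[OF b(1)]
    have "(\<lambda>i. (a i \<cdot> r i) \<cdot> s i) = a" by (rule ext) (simp add: rs)
    moreover have "(\<lambda>i. (b i \<cdot> g i) \<cdot> s i) = (\<lambda>i. (b i \<cdot> s' i) \<cdot> f i)" by (rule ext) (simp add: gs)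
    ultimately have "htp X V a (\<lambda>i. (b i \<cdot> s' i) \<cdot> f i)" using htp_comp[OF s b(2)] by simp
    then show "\<exists>h. chain C Y V h \<and> htp X V a (\<lambda>i. h i \<cdot> f i)"
      using chain_comp[OF s' b(1)] by (intro exI[of _ "\<lambda>i. b i \<cdot> s' i"]) blast
  next
    fix V a a' assume V: "tst C VV V" and a: "chain C Y V a" "chain C Y V a'"
      and aa: "htp X V (\<lambda>i. a i \<cdot> f i) (\<lambda>i. a' i \<cdot> f i)"
    note [simp] = chainD(1-3)[OF a(1)] chainD(1-3)[OF a(2)]
    have e: "(\<lambda>i. (b i \<cdot> f i) \<cdot> r i) = (\<lambda>i. (b i \<cdot> r' i) \<cdot> g i)" "(\<lambda>i. (b i \<cdot> r' i) \<cdot> s' i) = b" if "chain C Y V b" for b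
      using chainD(1-3)[OF that] by (auto simp: fr rs' intro!: ext)
    have "htp X' V (\<lambda>i. (a i \<cdot> r' i) \<cdot> g i) (\<lambda>i. (a' i \<cdot> r' i) \<cdot> g i)"
      using htp_comp[OF r aa] unfolding e(1)[OF a(1)] e(1)[OF a(2)] .
    then have "htp Y' V (\<lambda>i. a i \<cdot> r' i) (\<lambda>i. a' i \<cdot> r' i)"
      using weqD(2)[OF g V chain_comp[OF r' a(1)] chain_comp[OF r' a(2)]] by blast
    from htp_comp[OF s' this] show "htp Y V a a'" unfolding e(2)[OF a(1)] e(2)[OF a(2)] .
  qed
qed

lemma cof_retract:
  assumes g: "cof C VV X' Y' g" and f: "chain C X Y f" and s: "chain C X X' s" and r: "chain C X' X r"
    and s': "chain C Y Y' s'" and rs: "\<And>i. r i \<cdot> s i = Id C (part X i)" and gs: "\<And>i. g i \<cdot> s i = s' i \<cdot> f i"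
  shows "cof C VV X Y f"
  unfolding cof_def
proof (intro conjI f allI)
  note gc = cof_chain[OF g]
  note [simp] = chainD(1-3)[OF f] chainD(1-3)[OF gc] chainD(1-3)[OF s] chainD(1-3)[OF r] chainD(1-3)[OF s']
  fix i show "f i \<in> cofibrations C VV"
  proof (rule cofI)
    fix W w assume W: "W \<in> VV" and w: "w \<in> Ar C" "Dom C w = Dom C (f i)" "Cod C w = W"
    have gi: "g i \<in> cofibrations C VV" using g by (simp add: cof_def)
    obtain h where h: "h \<in> Ar C" "Dom C h = part Y' i" "Cod C h = W" "h \<cdot> g i = w \<cdot> r i"
      using RI_ext[OF VV_RI[OF W] gi, of "w \<cdot> r i"] w by auto
    have "h \<cdot> s' i \<cdot> f i = (h \<cdot> g i) \<cdot> s i" using h(1-3) by (simp add: gs)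
    also have "\<dots> = w" using w by (simp add: h(4) rs)
    finally show "\<exists>h. h \<in> Ar C \<and> Dom C h = Cod C (f i) \<and> Cod C h = W \<and> h \<cdot> f i = w"
      using h(1-3) by (intro exI[of _ "h \<cdot> s' i"]) simp
  qed simp
qed

text \<open>The retraction carries over a section, and it makes the kernel of \<open>f\<close> a
  retract of the kernel of \<open>g\<close>.\<close>

lemma fibr_retract:
  assumes g: "fibr C VV X' Y' g" and f: "chain C X Y f" and s: "chain C X X' s" and r: "chain C X' X r"
    and s': "chain C Y Y' s'" and r': "chain C Y' Y r'"
    and rs: "\<And>i. r i \<cdot> s i = Id C (part X i)" and rs': "\<And>i. r' i \<cdot> s' i = Id C (part Y i)"
    and gs: "\<And>i. g i \<cdot> s i = s' i \<cdot> f i" and fr: "\<And>i. f i \<cdot> r i = r' i \<cdot> g i"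
  shows "fibr C VV X Y f"
  unfolding fibr_def
proof (intro conjI f allI)
  note gc = fibr_chain[OF g]
  note [simp] = chainD(1-3)[OF f] chainD(1-3)[OF gc] chainD(1-3)[OF s] chainD(1-3)[OF r] chainD(1-3)[OF s'] chainD(1-3)[OF r']
    cxD[OF chain_cx(1)[OF f]] cxD[OF chain_cx(2)[OF f]] cxD[OF chain_cx(1)[OF gc]] cxD[OF chain_cx(2)[OF gc]]
  fix i
  obtain t K' k' where t: "t \<in> Ar C" "Dom C t = part Y' i" "Cod C t = part X' i" "g i \<cdot> t = Id C (part Y' i)"
    and K': "is_kernel C (g i) K' k'" "K' \<in> RI" using g unfolding fibr_def Bex_def in_hom_set by blast
  note [simp] = t(1-3)
  have frx: "f i \<cdot> r i \<cdot> x = r' i \<cdot> g i \<cdot> x" if "x \<in> Ar C" "Cod C x = part X' i" for x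
    using comp_rw[OF fr[of i], of x] that by simp
  have gsx: "g i \<cdot> s i \<cdot> x = s' i \<cdot> f i \<cdot> x" if "x \<in> Ar C" "Cod C x = part X i" for x
    using comp_rw[OF gs[of i], of x] that by simp
  have "f i \<cdot> r i \<cdot> t \<cdot> s' i = Id C (part Y i)"
    using comp_rw[OF t(4), of "s' i"] by (simp add: frx rs')
  then show "\<exists>s\<in>hom_set C (part Y i) (part X i). f i \<cdot> s = Id C (part Y i)"
    by (intro bexI[of _ "r i \<cdot> t \<cdot> s' i"]) (simp_all add: in_hom_set)
  obtain K k where K: "is_kernel C (f i) K k" using kernels[of "f i"] by auto
  note [simp] = kernelD[OF K chainD(1)[OF f], unfolded chainD[OF f]] kernelD[OF K'(1) chainD(1)[OF gc], unfolded chainD[OF gc]]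
  obtain a where a: "a \<in> Ar C" "Dom C a = K" "Cod C a = K'" "k' \<cdot> a = s i \<cdot> k"
    using kernel_lift[OF K'(1), of "s i \<cdot> k"] gsx[of k] by auto
  obtain b where b: "b \<in> Ar C" "Dom C b = K'" "Cod C b = K" "k \<cdot> b = r i \<cdot> k'"
    using kernel_lift[OF K, of "r i \<cdot> k'"] frx[of k'] by auto
  have "k \<cdot> b \<cdot> a = r i \<cdot> s i \<cdot> k" using comp_rw[OF b(4), of a] a b(1-3) by simp
  also have "\<dots> = k" using comp_rw[OF rs[of i], of k] by simp
  finally have kba: "k \<cdot> b \<cdot> a = k" .
  have "b \<cdot> a = Id C K" by (rule kernel_mono[OF K]) (use kba a b in simp_all)
  then have "K \<in> RI" using RI_retract[OF K'(2), of a b] a b by simp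
  then show "\<exists>K k. is_kernel C (f i) K k \<and> K \<in> RI" using K by blast
qed

end

context additive
begin

lemma twist_ex:
  assumes u: "anti C Y K u"
  shows "\<exists>T j p k r. twist C Y K u T j p k r"
proof -
  have Y: "Y \<in> Ob SC" and K: "K \<in> Ob SC" using anti_cx[OF u] by simp_all
  note [simp] = cxD[OF Y] cxD[OF K] antiD[OF u]
  have "\<exists>T j p k r. T \<in> Ob C \<and> j \<in> Ar C \<and> Dom C j = part Y i \<and> Cod C j = T \<and> p \<in> Ar C \<and> Dom C p = T \<and> Cod C p = part Y i \<and>
      k \<in> Ar C \<and> Dom C k = part K i \<and> Cod C k = T \<and> r \<in> Ar C \<and> Dom C r = T \<and> Cod C r = part K i \<and>
      p \<cdot> j = Id C (part Y i) \<and> r \<cdot> k = Id C (part K i) \<and> p \<cdot> k = Zer C (part K i) (part Y i) \<and> r \<cdot> j = Zer C (part Y i) (part K i) \<and>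
      j \<cdot> p \<boxplus> k \<cdot> r = Id C T" for i
    using biproducts[of "part Y i" "part K i"] unfolding Bex_def in_hom_set by fastforce
  then obtain T j p k r where T [simp]: "\<And>i. T i \<in> Ob C"
    and j [simp]: "\<And>i. j i \<in> Ar C" "\<And>i. Dom C (j i) = part Y i" "\<And>i. Cod C (j i) = T i"
    and p [simp]: "\<And>i. p i \<in> Ar C" "\<And>i. Dom C (p i) = T i" "\<And>i. Cod C (p i) = part Y i"
    and k [simp]: "\<And>i. k i \<in> Ar C" "\<And>i. Dom C (k i) = part K i" "\<And>i. Cod C (k i) = T i"
    and r [simp]: "\<And>i. r i \<in> Ar C" "\<And>i. Dom C (r i) = T i" "\<And>i. Cod C (r i) = part K i"
    and bp [simp]: "\<And>i. p i \<cdot> j i = Id C (part Y i)" "\<And>i. r i \<cdot> k i = Id C (part K i)"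
      "\<And>i. p i \<cdot> k i = Zer C (part K i) (part Y i)" "\<And>i. r i \<cdot> j i = Zer C (part Y i) (part K i)"
    and jpkr: "\<And>i. j i \<cdot> p i \<boxplus> k i \<cdot> r i = Id C (T i)"
    by metis
  have bpx: "p i \<cdot> j i \<cdot> x = x" "r i \<cdot> j i \<cdot> x = Zer C (Dom C x) (part K i)"
    if "x \<in> Ar C" "Cod C x = part Y i" for x i
    using comp_rw[OF bp(1)[of i], of x] comp_rw[OF bp(4)[of i], of x] that by simp_all
  have bpx': "r i \<cdot> k i \<cdot> x = x" "p i \<cdot> k i \<cdot> x = Zer C (Dom C x) (part Y i)"
    if "x \<in> Ar C" "Cod C x = part K i" for x i
    using comp_rw[OF bp(2)[of i], of x] comp_rw[OF bp(3)[of i], of x] that by simp_all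
  \<comment> \<open>The triangular matrix with \<open>u\<close> below the diagonal; its square
    vanishes because \<open>u\<close> anticommutes with the differentials.\<close>
  let ?d = "\<lambda>i. j (i + 1) \<cdot> bdry Y i \<cdot> p i \<boxplus> k (i + 1) \<cdot> (u i \<cdot> p i \<boxplus> bdry K i \<cdot> r i)"
  define T' where "T' = Supercx T ?d"
  have [simp]: "part T' i = T i" "bdry T' i = ?d i" for i by (simp_all add: T'_def)
  have Tc: "T' \<in> Ob SC"
    by (intro cxI) (simp_all add: bpx bpx')
  have "bd0 C T' K r i = neg C (u i \<cdot> p i)" for i
    by (simp add: bd0_def bpx bpx' Add_commute[of "u i \<cdot> p i"])
  moreover have "bd0 C Y T' j i = k (i + 1) \<cdot> u i" for i
    by (simp add: bd0_def Add_commute[of _ "k (i + 1) \<cdot> u i"] Add_assoc)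
  moreover have "deg0 C Y T' j" "deg0 C T' K r" using Tc Y K by (auto intro!: deg0I)
  moreover have "chain C T' Y p" "chain C K T' k"
    using Tc Y K by (auto intro!: chainI deg0I simp: bpx bpx')
  ultimately have "twist C Y K u T' j p k r"
    unfolding twist_def using Tc by (simp add: jpkr)
  then show ?thesis by blast
qed

lemma twistD:
  assumes "twist C Y K u T j p k r"
  shows "T \<in> Ob SC" "deg0 C Y T j" "chain C T Y p" "chain C K T k" "deg0 C T K r"
    "p i \<cdot> j i = Id C (part Y i)" "r i \<cdot> k i = Id C (part K i)"
    "p i \<cdot> k i = Zer C (part K i) (part Y i)" "r i \<cdot> j i = Zer C (part Y i) (part K i)"
    "j i \<cdot> p i \<boxplus> k i \<cdot> r i = Id C (part T i)"
    "bd0 C Y T j i = k (i + 1) \<cdot> u i" "bd0 C T K r i = neg C (u i \<cdot> p i)"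
    "\<lbrakk>x \<in> Ar C; Cod C x = part Y i\<rbrakk> \<Longrightarrow> p i \<cdot> j i \<cdot> x = x"
    "\<lbrakk>x \<in> Ar C; Cod C x = part K i\<rbrakk> \<Longrightarrow> r i \<cdot> k i \<cdot> x = x"
    "\<lbrakk>x \<in> Ar C; Cod C x = part K i\<rbrakk> \<Longrightarrow> p i \<cdot> k i \<cdot> x = Zer C (Dom C x) (part Y i)"
    "\<lbrakk>x \<in> Ar C; Cod C x = part Y i\<rbrakk> \<Longrightarrow> r i \<cdot> j i \<cdot> x = Zer C (Dom C x) (part K i)"
    "\<lbrakk>x \<in> Ar C; Dom C x = part T i\<rbrakk> \<Longrightarrow> x \<cdot> j i \<cdot> p i \<boxplus> x \<cdot> k i \<cdot> r i = x"
proof -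
  show *: "T \<in> Ob SC" "deg0 C Y T j" "chain C T Y p" "chain C K T k" "deg0 C T K r"
    "p i \<cdot> j i = Id C (part Y i)" "r i \<cdot> k i = Id C (part K i)"
    "p i \<cdot> k i = Zer C (part K i) (part Y i)" "r i \<cdot> j i = Zer C (part Y i) (part K i)"
    "j i \<cdot> p i \<boxplus> k i \<cdot> r i = Id C (part T i)"
    "bd0 C Y T j i = k (i + 1) \<cdot> u i" "bd0 C T K r i = neg C (u i \<cdot> p i)" for i
    using assms by (simp_all add: twist_def)
  note [simp] = deg0D[OF *(2)] chainD(1-3)[OF *(3)] chainD(1-3)[OF *(4)] deg0D[OF *(5)]
    cxD[OF chain_cx(1)[OF *(4)]] cxD[OF chain_cx(2)[OF *(3)]]
  show "\<lbrakk>x \<in> Ar C; Cod C x = part Y i\<rbrakk> \<Longrightarrow> p i \<cdot> j i \<cdot> x = x"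
    "\<lbrakk>x \<in> Ar C; Cod C x = part K i\<rbrakk> \<Longrightarrow> r i \<cdot> k i \<cdot> x = x"
    "\<lbrakk>x \<in> Ar C; Cod C x = part K i\<rbrakk> \<Longrightarrow> p i \<cdot> k i \<cdot> x = Zer C (Dom C x) (part Y i)"
    "\<lbrakk>x \<in> Ar C; Cod C x = part Y i\<rbrakk> \<Longrightarrow> r i \<cdot> j i \<cdot> x = Zer C (Dom C x) (part K i)"
    using comp_rw[OF *(6)[of i], of x] comp_rw[OF *(7)[of i], of x]
      comp_rw[OF *(8)[of i], of x] comp_rw[OF *(9)[of i], of x] by simp_all
  show "\<lbrakk>x \<in> Ar C; Dom C x = part T i\<rbrakk> \<Longrightarrow> x \<cdot> j i \<cdot> p i \<boxplus> x \<cdot> k i \<cdot> r i = x"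
    using arg_cong[OF *(10)[of i], of "\<lambda>y. x \<cdot> y"] by simp
qed

end

context pro_model
begin

lemma twist_RI:
  assumes T: "twist C Y K u T j p k r" and RI: "part Y i \<in> RI" "part K i \<in> RI"
  shows "part T i \<in> RI"
  by (rule RI_biproduct[of "j i" "k i" "p i" "r i"])
    (use RI deg0D[OF twistD(2)[OF T]] chainD(1-3)[OF twistD(3)[OF T]] chainD(1-3)[OF twistD(4)[OF T]]
    deg0D[OF twistD(5)[OF T]] twistD(10)[OF T, of i] in simp_all)

lemma twist_fibr:
  assumes T: "twist C Y K u T j p k r" and RI: "\<And>i. part K i \<in> RI"
  shows "fibr C VV T Y p"
  unfolding fibr_def
proof (intro conjI allI)
  note D = twistD[OF T]
  note [simp] = deg0D[OF D(2)] chainD(1-3)[OF D(3)] chainD(1-3)[OF D(4)] deg0D[OF D(5)]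
    cxD[OF chain_cx(1)[OF D(4)]] cxD[OF chain_cx(2)[OF D(3)]] cxD[OF D(1)] D(6-9) D(13-16)
  show "chain C T Y p" by (rule D(3))
  fix i
  show "\<exists>s\<in>hom_set C (part Y i) (part T i). p i \<cdot> s = Id C (part Y i)"
    by (intro bexI[of _ "j i"]) (simp_all add: in_hom_set)
  have "is_kernel C (p i) (part K i) (k i)"
  proof (rule kernelI)
    fix g assume g: "g \<in> Ar C" "Cod C g = Dom C (p i)" "p i \<cdot> g = Zer C (Dom C g) (Cod C (p i))"
    have "k i \<cdot> r i \<cdot> g = g"
      using arg_cong[OF D(10)[of i], of "\<lambda>x. x \<cdot> g"] g by simp
    then show "\<exists>h. h \<in> Ar C \<and> Dom C h = Dom C g \<and> Cod C h = part K i \<and> k i \<cdot> h = g"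
      using g by (intro exI[of _ "r i \<cdot> g"]) simp
  next
    fix h h' assume h: "h \<in> Ar C" "h' \<in> Ar C" "Dom C h = Dom C h'" "Cod C h = part K i" "Cod C h' = part K i" "k i \<cdot> h = k i \<cdot> h'"
    then have "r i \<cdot> k i \<cdot> h = r i \<cdot> k i \<cdot> h'" by simp
    then show "h = h'" using h(1-5) by (simp del: h(6))
  qed simp_all
  then show "\<exists>K k. is_kernel C (p i) K k \<and> K \<in> RI" using RI by blast
qed

text \<open>By its universal property a twisted sum receives a chain map \<open>a\<close> to
  \<open>Y\<close> together with a graded map \<open>b\<close> to \<open>K\<close> that exhibits
  \<open>u a\<close> as a boundary.\<close>

lemma twist_map:
  assumes T: "twist C Y K u T j p k r" and u: "anti C Y K u" and a: "chain C X Y a" and b: "deg0 C X K b"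
    and ab: "\<And>i. u i \<cdot> a i \<boxplus> bd0 C X K b i = Zer C (part X i) (part K (i + 1))"
  shows "chain C X T (\<lambda>i. j i \<cdot> a i \<boxplus> k i \<cdot> b i)"
proof -
  note D = twistD[OF T]
  note [simp] = deg0D[OF D(2)] chainD(1-3)[OF D(3)] chainD(1-3)[OF D(4)] deg0D[OF D(5)]
    cxD[OF chain_cx(1)[OF D(4)]] cxD[OF chain_cx(2)[OF D(3)]] cxD[OF D(1)] chainD(1-3)[OF a] deg0D[OF b] antiD(1-3)[OF u]
    deg1D[OF bd0_deg1[OF b]] cxD[OF chain_cx(1)[OF a]]
  have ja: "deg0 C X T (\<lambda>i. j i \<cdot> a i)" using deg0_comp[OF chain_deg0[OF a] D(2)] .
  have kb: "deg0 C X T (\<lambda>i. k i \<cdot> b i)" using deg0_comp[OF b chain_deg0[OF D(4)]] .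
  show ?thesis
    unfolding chain_iff_bd0
  proof (intro conjI allI)
    show "deg0 C X T (\<lambda>i. j i \<cdot> a i \<boxplus> k i \<cdot> b i)" by (rule deg0_Add[OF ja kb])
    fix i
    have "bd0 C X T (\<lambda>i. j i \<cdot> a i \<boxplus> k i \<cdot> b i) i = k (i + 1) \<cdot> (u i \<cdot> a i \<boxplus> bd0 C X K b i)"
      unfolding bd0_Add[OF ja kb] bd0_comp_chain_right[OF a D(2)] bd0_comp_chain_left[OF b D(4)] D(11) by simp
    then show "bd0 C X T (\<lambda>i. j i \<cdot> a i \<boxplus> k i \<cdot> b i) i = Zer C (part X i) (part T (i + 1))"
      by (simp add: ab)
  qed
qed

lemma weq_homotopy_equivalence:
  assumes p: "chain C X Y p" and j: "chain C Y X j" and pj: "\<And>i. p i \<cdot> j i = Id C (part Y i)"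
    and G: "deg1 C X X G" "\<And>i. Id C (part X i) = j i \<cdot> p i \<boxplus> bd1 C X X G i"
  shows "weq C VV X Y p"
proof (rule weqI[OF p])
  note [simp] = chainD(1-3)[OF p] chainD(1-3)[OF j]
  have h: "htp X X (\<lambda>i. Id C (part X i)) (\<lambda>i. j i \<cdot> p i)"
    by (rule htpI[OF chain_comp[OF p j] G])
  fix V a assume V: "tst C VV V" and a: "chain C X V a"
  note [simp] = chainD(1-3)[OF a]
  note [simp] = deg1D[OF G(1)] deg0D[OF bd1_deg0[OF G(1)]]
  have "a i = (a i \<cdot> j i) \<cdot> p i \<boxplus> bd1 C X V (\<lambda>i. a (i + 1) \<cdot> G i) i" for i
    using arg_cong[OF G(2)[of i], of "\<lambda>x. a i \<cdot> x"] bd1_comp_chain_left[OF G(1) a, of i] by simp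
  then have "htp X V a (\<lambda>i. (a i \<cdot> j i) \<cdot> p i)"
    by (rule htpI[OF chain_comp[OF p chain_comp[OF j a]] deg1_comp_left[OF G(1) chain_deg0[OF a]]])
  then show "\<exists>h. chain C Y V h \<and> htp X V a (\<lambda>i. h i \<cdot> p i)"
    using chain_comp[OF j a] by (intro exI[of _ "\<lambda>i. a i \<cdot> j i"]) blast
next
  note [simp] = chainD(1-3)[OF p] chainD(1-3)[OF j]
  fix V a a' assume V: "tst C VV V" and a: "chain C Y V a" "chain C Y V a'"
    and aa: "htp X V (\<lambda>i. a i \<cdot> p i) (\<lambda>i. a' i \<cdot> p i)"
  note [simp] = chainD(1-3)[OF a(1)] chainD(1-3)[OF a(2)]
  show "htp Y V a a'" using htp_comp[OF j aa] by (simp add: pj)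
qed

text \<open>\<open>Y\<close> is enlarged by the cone \<open>T\<close> of the identity of
  \<open>E\<close>. Being contractible it does not change the homotopy type, and through
  \<open>E\<close> it makes room for the cofibration \<open>\<iota>\<close>.\<close>

lemma factor_cof_trivial_fibr:
  assumes f: "chain C X Y f"
  shows "\<exists>Z i p. cof C VV X Z i \<and> fibr C VV Z Y p \<and> weq C VV Z Y p \<and> (\<forall>n. f n = p n \<cdot> i n)"
proof -
  have X: "X \<in> Ob SC" and Y: "Y \<in> Ob SC" using chain_cx[OF f] by simp_all
  obtain E \<iota> q where res: "resolution C VV X E \<iota> q" using resolution_ex[OF X] by blast
  note \<iota>c = resolutionD(2)[OF res] and RI = resolutionD(1)[OF res]
  note \<iota> = cof_chain[OF \<iota>c]
  have E: "E \<in> Ob SC" using chain_cx[OF \<iota>] by simp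
  note SE = shift_cx[OF E]
  note [simp] = cxD[OF X] cxD[OF Y] cxD[OF E] chainD(1-3)[OF \<iota>] chainD(1-3)[OF f]
  \<comment> \<open>The identity seen as a degree 1 map from the shift of \<open>E\<close> to
    \<open>E\<close>; the sign in the shifted differential makes it a cycle.\<close>
  let ?u = "\<lambda>i. Id C (part E (i + 1))"
  have u: "anti C (shift C E) E ?u"
    using SE E by (intro antiI deg1I) simp_all
  obtain T j p k r where T: "twist C (shift C E) E ?u T j p k r" using twist_ex[OF u] by blast
  note D = twistD[OF T]
  note [simp] = deg0D[OF D(2)] chainD(1-3)[OF D(3)] chainD(1-3)[OF D(4)] deg0D[OF D(5)] cxD[OF D(1)]
  \<comment> \<open>The contraction of the cone: it moves the copy of \<open>E\<close> back to its
    shifted copy, inverting the twisting term.\<close>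
  define H where "H = (\<lambda>i. j (i + 1) \<cdot> r i)"
  have r1: "deg1 C T (shift C E) r" using D(5) deg1_shift[OF E] by simp
  have H: "deg1 C T T H" unfolding H_def by (rule deg1_comp_left[OF r1 D(2)])
  have H1: "bd1 C T T H i = Id C (part T i)" for i
  proof -
    have "bd1 C T T H i = k i \<cdot> r i \<boxplus> j i \<cdot> p i"
      unfolding H_def bd1_comp_left[OF r1 D(2)] D(11) bd1_to_shift[OF D(5)] D(12) by simp
    then show ?thesis using D(10)[of i] by (simp add: Add_commute)
  qed
  have RI_T: "part T i \<in> RI" for i by (rule twist_RI[OF T]) (simp_all add: RI)
  have k\<iota>: "chain C X T (\<lambda>i. k i \<cdot> \<iota> i)" by (rule chain_comp[OF \<iota> D(4)])
  \<comment> \<open>Twisting by zero gives the direct sum of \<open>Y\<close> and \<open>T\<close>,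
    with all four structure maps chain maps.\<close>
  let ?z = "\<lambda>i. Zer C (part Y i) (part T (i + 1))"
  have z: "anti C Y T ?z" using Y D(1) by (intro antiI deg1I) simp_all
  obtain M j' p' k' r' where M: "twist C Y T ?z M j' p' k' r'" using twist_ex[OF z] by blast
  note D' = twistD[OF M]
  note [simp] = deg0D[OF D'(2)] chainD(1-3)[OF D'(3)] chainD(1-3)[OF D'(4)] deg0D[OF D'(5)] cxD[OF D'(1)]
  let ?i = "\<lambda>i. j' i \<cdot> f i \<boxplus> k' i \<cdot> k i \<cdot> \<iota> i"
  have i: "chain C X M ?i"
    by (rule twist_map[OF M z f chain_deg0[OF k\<iota>]]) (simp add: chain_bd0[OF k\<iota>])
  have "cof C VV X M ?i"
    unfolding cof_def
  proof (intro conjI i allI)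
    fix n
    show "?i n \<in> cofibrations C VV"
    \<comment> \<open>Reading off the copy of \<open>E\<close> inside \<open>T\<close> recovers
      \<open>\<iota>\<close>, which is a cofibration.\<close>
    proof (rule cof_comp_cancel[of "r n \<cdot> r' n"])
      have "(r n \<cdot> r' n) \<cdot> ?i n = \<iota> n" using D(14) by (simp add: D'(14,16))
      then show "(r n \<cdot> r' n) \<cdot> ?i n \<in> cofibrations C VV" using \<iota>c by (simp add: cof_def)
    qed simp_all
  qed
  moreover have "fibr C VV M Y p'" by (rule twist_fibr[OF M RI_T])
  moreover have "weq C VV M Y p'"
  proof (rule weq_homotopy_equivalence[OF D'(3)])
    show "chain C Y M j'" unfolding chain_iff_bd0 using D'(2) by (simp add: D'(11))
    show "p' i \<cdot> j' i = Id C (part Y i)" for i by (rule D'(6))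
    have r'c: "chain C M T r'" unfolding chain_iff_bd0 using D'(5) by (simp add: D'(12))
    have Hr: "deg1 C M T (\<lambda>i. H i \<cdot> r' i)" by (rule deg1_comp_right[OF D'(5) H])
    show "deg1 C M M (\<lambda>i. k' (i + 1) \<cdot> H i \<cdot> r' i)" by (rule deg1_comp_left[OF Hr chain_deg0[OF D'(4)]])
    show "Id C (part M i) = j' i \<cdot> p' i \<boxplus> bd1 C M M (\<lambda>i. k' (i + 1) \<cdot> H i \<cdot> r' i) i" for i
      unfolding bd1_comp_chain_left[OF Hr D'(4)] bd1_comp_chain_right[OF r'c H] H1
      using D'(10)[of i] by simp
  qed
  moreover have "f n = p' n \<cdot> ?i n" for n by (simp add: D'(13,15))
  ultimately show ?thesis by (intro exI[of _ M] exI[of _ ?i] exI[of _ p']) blast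
qed

end

section \<open>Fibrant replacement and the second factorization\<close>

context pro_model
begin

text \<open>The fibrant replacement is the homotopy fibre of \<open>q\<close>.\<close>

lemma fibrant_replacement:
  assumes X: "X \<in> Ob SC"
  shows "\<exists>R i. cof C VV X R i \<and> weq C VV X R i \<and> (\<forall>n. part R n \<in> RI)"
proof -
  obtain E \<iota> q where res: "resolution C VV X E \<iota> q" using resolution_ex[OF X] by blast
  note \<iota>c = resolutionD(2)[OF res] and RI = resolutionD(1)[OF res] and q = resolutionD(3)[OF res]
    and qi = resolutionD(4)[OF res] and fac = resolutionD(5)[OF res] and epi = resolutionD(6)[OF res]
  note \<iota> = cof_chain[OF \<iota>c]
  have E: "E \<in> Ob SC" using chain_cx[OF \<iota>] by simp
  note SE = shift_cx[OF E] and qa = anti_to_shift[OF q]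
  note [simp] = cxD[OF X] cxD[OF E] chainD(1-3)[OF \<iota>] chainD(1-3)[OF q]
  \<comment> \<open>\<open>q\<close> is an epimorphism; below, identities between maps out of
    \<open>E\<close> are proved after composing with it.\<close>
  have epi_eq: "u = v" if "u \<cdot> q n = v \<cdot> q n" "u \<in> Ar C" "v \<in> Ar C" "Dom C u = part E n" "Dom C v = part E n" "Cod C u = Cod C v" for u v n
  proof -
    have "(u \<boxplus> neg C v) \<cdot> q n = Zer C (part E n) (Cod C v)" using that by simp
    then have "u \<boxplus> neg C v = Zer C (part E n) (Cod C v)"
      using epi[of "u \<boxplus> neg C v" n "Cod C v"] that by (simp add: in_hom_set)
    then show ?thesis using eq_iff_diff[of u v] that by simp
  qed
  obtain R j p k r where R: "twist C E (shift C E) q R j p k r" using twist_ex[OF qa] by blast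
  note D = twistD[OF R]
  note [simp] = deg0D[OF D(2)] chainD(1-3)[OF D(3)] chainD(1-3)[OF D(4)] deg0D[OF D(5)] cxD[OF D(1)]
  define i where "i = (\<lambda>n. j n \<cdot> \<iota> n)"
  \<comment> \<open>The pair of \<open>\<iota>\<close> and 0 is compatible with the twist because
    \<open>q \<iota> = 0\<close>.\<close>
  have "chain C X R (\<lambda>n. j n \<cdot> \<iota> n \<boxplus> k n \<cdot> Zer C (part X n) (part (shift C E) n))"
    by (rule twist_map[OF R qa \<iota> chain_deg0[OF chain_Zer[OF X SE]]])
      (simp add: qi chain_bd0[OF chain_Zer[OF X SE], simplified])
  then have i: "chain C X R i" by (simp add: i_def)
  have i_cof: "cof C VV X R i"
    unfolding cof_def
  proof (intro conjI i allI)
    fix n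
    have "p n \<cdot> i n = \<iota> n" by (simp add: i_def D(13))
    then have "p n \<cdot> i n \<in> cofibrations C VV" using \<iota>c by (simp add: cof_def)
    then show "i n \<in> cofibrations C VV" by (rule cof_comp_cancel) (simp_all add: i_def)
  qed
  have "weq C VV X R i"
    unfolding weq_def
  proof (intro conjI i allI impI)
    fix V g assume V: "tst C VV V" and g: "chain C X V g"
    note Vc = tst_cx[OF V]
    note [simp] = cxD[OF Vc] chainD(1-3)[OF g]
    \<comment> \<open>Surjectivity: the boundary of a graded extension \<open>a\<close> of
      \<open>g\<close> to \<open>E\<close> vanishes on \<open>X\<close>, so it equals
      \<open>c q\<close>. The map \<open>c\<close> is a cycle as \<open>q\<close> is epic, and
      \<open>a\<close> on \<open>E\<close> with \<open>c\<close> on the shifted copy is a chain map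
      on \<open>R\<close>, since the twist by \<open>q\<close> cancels \<open>c q\<close>.\<close>
    obtain a where a: "deg0 C E V a" "\<And>n. a n \<cdot> \<iota> n = g n"
      using cof_deg0_ext[OF \<iota>c tst_RI[OF V] chain_deg0[OF g]] by blast
    note [simp] = deg0D[OF a(1)] deg1D[OF bd0_deg1[OF a(1)]]
    have "\<exists>c\<in>hom_set C (part E n) (part V (n + 1)). c \<cdot> q n = bd0 C E V a n" for n
      by (rule fac) (use bd0_comp_chain_right[OF \<iota> a(1), of n] chain_bd0[OF g] in \<open>simp_all add: a(2) in_hom_set\<close>)
    then obtain c where c: "\<And>n. c n \<in> hom_set C (part E n) (part V (n + 1))" "\<And>n. c n \<cdot> q n = bd0 C E V a n"
      by metis
    have c1: "deg1 C E V c" using c(1) E Vc by (simp add: deg1_def)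
    note [simp] = deg1D[OF c1] deg0D[OF bd1_deg0[OF c1]]
    have ca: "anti C E V c"
      unfolding anti_iff_bd1
    proof (intro conjI c1 allI)
      fix n
      have "bd1 C E V c n \<cdot> q n = Zer C (part E n) (part V n)"
        using bd1_comp_chain_right[OF q c1, of n] anti_bd1[OF bd0_anti[OF a(1)]] by (simp add: c(2))
      then show "bd1 C E V c n = Zer C (part E n) (part V n)"
        by (intro epi_eq[of "bd1 C E V c n" n]) simp_all
    qed
    have c': "chain C (shift C E) V (\<lambda>n. c (n + 1))"
      using chain_from_shift[OF E, of V "\<lambda>n. c (n + 1)"] ca by simp
    have ap: "deg0 C R V (\<lambda>n. a n \<cdot> p n)" using deg0_comp[OF chain_deg0[OF D(3)] a(1)] .
    have cr: "deg0 C R V (\<lambda>n. c (n + 1) \<cdot> r n)" using deg0_comp[OF D(5) chain_deg0[OF c']] .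
    have cqp: "c n \<cdot> q n \<cdot> p n = bd0 C E V a n \<cdot> p n" for n
      using comp_rw[OF c(2)[of n], of "p n"] by simp
    have h: "chain C R V (\<lambda>n. a n \<cdot> p n \<boxplus> c (n + 1) \<cdot> r n)"
      unfolding chain_iff_bd0
    proof (intro conjI allI deg0_Add[OF ap cr])
      fix n
      show "bd0 C R V (\<lambda>n. a n \<cdot> p n \<boxplus> c (n + 1) \<cdot> r n) n = Zer C (part R n) (part V (n + 1))"
        unfolding bd0_Add[OF ap cr] bd0_comp_chain_right[OF D(3) a(1)] bd0_comp_chain_left[OF D(5) c'] D(12)
        by (simp add: cqp)
    qed
    have "g n = (a n \<cdot> p n \<boxplus> c (n + 1) \<cdot> r n) \<cdot> i n \<boxplus> bd1 C X V (\<lambda>n. Zer C (part X n) (part V (n + 1))) n" for n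
      by (simp add: i_def D(13,16) a(2) bd1_Zer[OF X Vc])
    then show "\<exists>h k. chain C R V h \<and> deg1 C X V k \<and> (\<forall>n. g n = h n \<cdot> i n \<boxplus> bd1 C X V k n)"
      using h deg1_Zer[OF X Vc] by blast
  next
    fix V g assume V: "tst C VV V" and "chain C R V g \<and> null C X V (\<lambda>n. g n \<cdot> i n)"
    then have g: "chain C R V g" and "null C X V (\<lambda>n. g n \<cdot> i n)" by simp_all
    then obtain s where s: "deg1 C X V s" "\<And>n. g n \<cdot> i n = bd1 C X V s n" unfolding null_def by blast
    note Vc = tst_cx[OF V]
    note [simp] = cxD[OF Vc] chainD(1-3)[OF g]
    \<comment> \<open>Injectivity: the homotopy \<open>s\<close> on \<open>X\<close> is extended to
      \<open>t\<close> on \<open>E\<close>. The difference between \<open>g\<close> on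
      \<open>E\<close> and the boundary of \<open>t\<close> vanishes on \<open>X\<close> and so
      factors through \<open>q\<close>; the factor \<open>v\<close> is the component of the null
      homotopy on the shifted copy.\<close>
    obtain t where t: "deg1 C E V t" "\<And>n. t n \<cdot> \<iota> n = s n"
      using cof_deg1_ext[OF \<iota>c tst_RI[OF V] s(1)] by blast
    define a where "a = (\<lambda>n. g n \<cdot> j n)"
    have a: "deg0 C E V a" unfolding a_def using deg0_comp[OF D(2) chain_deg0[OF g]] .
    note t' = bd1_deg0[OF t(1)]
    note [simp] = deg0D[OF a] deg1D[OF t(1)] deg0D[OF t'] deg0D[OF bd1_deg0[OF s(1)]] deg1D[OF s(1)]
    have "\<exists>v\<in>hom_set C (part E n) (part V n). v \<cdot> q n = a n \<boxplus> neg C (bd1 C E V t n)" for n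
    proof (rule fac)
      have "a n \<cdot> \<iota> n = bd1 C X V s n" using s(2)[of n] by (simp add: a_def i_def)
      moreover have "bd1 C E V t n \<cdot> \<iota> n = bd1 C X V s n"
        using bd1_comp_chain_right[OF \<iota> t(1), of n] by (simp add: t(2))
      ultimately show "(a n \<boxplus> neg C (bd1 C E V t n)) \<cdot> \<iota> n = Zer C (part X n) (part V n)" by simp
    qed (simp_all add: in_hom_set)
    then obtain v where v: "\<And>n. v n \<in> hom_set C (part E n) (part V n)" "\<And>n. v n \<cdot> q n = a n \<boxplus> neg C (bd1 C E V t n)"
      by metis
    have v0: "deg0 C E V v" using v(1) E Vc by (simp add: deg0_def)
    note [simp] = deg0D[OF v0] deg1D[OF bd0_deg1[OF v0]] deg1D[OF bd0_deg1[OF a]]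
    \<comment> \<open>After composing with \<open>q\<close>, both sides are the boundary of
      \<open>a\<close>: on one side because the boundary of \<open>t\<close> is a cycle, on the
      other because the boundary of \<open>j\<close> is \<open>k q\<close>.\<close>
    have vd: "bd0 C E V v (n + 1) = g n \<cdot> k n" for n
    proof (rule epi_eq[of _ "n + 1"])
      have "bd0 C E V v (n + 1) \<cdot> q (n + 1) = bd0 C E V (\<lambda>n. a n \<boxplus> neg C (bd1 C E V t n)) (n + 1)"
        using bd0_comp_chain_right[OF q v0, of "n + 1"] by (simp add: v(2))
      also have "\<dots> = bd0 C E V a (n + 1)"
        unfolding bd0_Add[OF a neg_deg0[OF t']] bd0_neg[OF t'] chain_bd0[OF bd1_chain[OF t(1)]] by simp
      also have "\<dots> = (g n \<cdot> k n) \<cdot> q (n + 1)"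
        unfolding a_def bd0_comp_chain_left[OF D(2) g] D(11) by simp
      finally show "bd0 C E V v (n + 1) \<cdot> q (n + 1) = (g n \<cdot> k n) \<cdot> q (n + 1)" .
    qed simp_all
    have v1: "deg1 C (shift C E) V (\<lambda>n. v (n + 1))" using SE Vc by (intro deg1I) simp_all
    have tp: "deg1 C R V (\<lambda>n. t n \<cdot> p n)" using deg1_comp_right[OF chain_deg0[OF D(3)] t(1)] .
    have vr: "deg1 C R V (\<lambda>n. v (n + 1) \<cdot> r n)" using deg1_comp_right[OF D(5) v1] .
    have "bd1 C R V (\<lambda>n. t n \<cdot> p n \<boxplus> v (n + 1) \<cdot> r n) n = g n" for n
    proof -
      have vq: "v n \<cdot> q n \<cdot> p n = a n \<cdot> p n \<boxplus> neg C (bd1 C E V t n \<cdot> p n)"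
        using comp_rw[OF v(2)[of n], of "p n"] by simp
      have "bd1 C R V (\<lambda>n. t n \<cdot> p n \<boxplus> v (n + 1) \<cdot> r n) n
          = bd1 C E V t n \<cdot> p n \<boxplus> (g n \<cdot> k n \<cdot> r n \<boxplus> (a n \<cdot> p n \<boxplus> neg C (bd1 C E V t n \<cdot> p n)))"
        unfolding bd1_Add[OF tp vr] bd1_comp_chain_right[OF D(3) t(1)] bd1_comp_right[OF D(5) v1]
          bd1_from_shift[OF v0] vd D(12)
        by (simp add: vq)
      also have "\<dots> = g n \<cdot> j n \<cdot> p n \<boxplus> g n \<cdot> k n \<cdot> r n"
        by (simp add: a_def Add_commute[of "g n \<cdot> j n \<cdot> p n" "neg C (bd1 C E V t n \<cdot> p n)"]
            Add_left_commute[of "g n \<cdot> k n \<cdot> r n"] Add_commute[of "g n \<cdot> j n \<cdot> p n"])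
      also have "\<dots> = g n" by (rule D(17)) simp_all
      finally show ?thesis .
    qed
    then show "null C R V g" unfolding null_def using deg1_Add[OF tp vr]
      by (intro exI[of _ "\<lambda>n. t n \<cdot> p n \<boxplus> v (n + 1) \<cdot> r n"]) simp
  qed
  moreover have "part R n \<in> RI" for n by (rule twist_RI[OF R]) (simp_all add: RI)
  ultimately show ?thesis using i_cof by blast
qed

text \<open>Over \<open>Y\<close>, take the homotopy pullback of \<open>Y \<rightarrow> R Y \<leftarrow> R X\<close>.\<close>

lemma factor_trivial_cof_fibr:
  assumes f: "chain C X Y f"
  shows "\<exists>Z i p. cof C VV X Z i \<and> weq C VV X Z i \<and> fibr C VV Z Y p \<and> (\<forall>n. f n = p n \<cdot> i n)"
proof -
  have X: "X \<in> Ob SC" and Y: "Y \<in> Ob SC" using chain_cx[OF f] by simp_all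
  obtain RX x where xc: "cof C VV X RX x" and xw: "weq C VV X RX x" and RIX: "\<And>n. part RX n \<in> RI"
    using fibrant_replacement[OF X] by blast
  obtain RY y where yc: "cof C VV Y RY y" and yw: "weq C VV Y RY y" and RIY: "\<And>n. part RY n \<in> RI"
    using fibrant_replacement[OF Y] by blast
  note x = cof_chain[OF xc] and y = cof_chain[OF yc]
  obtain F where F: "chain C RX RY F" "\<And>n. F n \<cdot> x n = y n \<cdot> f n"
    using fibrant_extension[OF xc xw RIY chain_comp[OF f y]] by blast
  have RX: "RX \<in> Ob SC" and RY: "RY \<in> Ob SC" using chain_cx[OF F(1)] by simp_all
  note SRY = shift_cx[OF RY]
  note [simp] = cxD[OF X] cxD[OF Y] cxD[OF RX] cxD[OF RY] chainD(1-3)[OF f] chainD(1-3)[OF x] chainD(1-3)[OF y] chainD(1-3)[OF F(1)]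
  \<comment> \<open>This sign lets the two twisting terms cancel when the map from \<open>X\<close>
    is formed.\<close>
  define u1 where "u1 = (\<lambda>n. neg C (F n))"
  have "chain C RX RY u1"
    unfolding u1_def chain_iff_bd0 using neg_deg0[OF chain_deg0[OF F(1)]] bd0_neg[OF chain_deg0[OF F(1)]] chain_bd0[OF F(1)] by simp
  from anti_to_shift[OF this] have u1: "anti C RX (shift C RY) u1" .
  \<comment> \<open>\<open>K\<close> combines \<open>RX\<close> with the shift of \<open>RY\<close>
    and serves as the fibre. As a graded object the space \<open>Z\<close> built from it has the
    three parts \<open>Y\<close>, \<open>RX\<close> and shifted \<open>RY\<close>, the last one
    recording a homotopy in \<open>RY\<close>.\<close>
  obtain K j1 p1 k1 r1 where K: "twist C RX (shift C RY) u1 K j1 p1 k1 r1" using twist_ex[OF u1] by blast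
  note D1 = twistD[OF K]
  note [simp] = deg0D[OF D1(2)] chainD(1-3)[OF D1(3)] chainD(1-3)[OF D1(4)] deg0D[OF D1(5)] cxD[OF D1(1)]
  have u1S [simp]: "u1 n \<in> Ar C" "Dom C (u1 n) = part RX n" "Cod C (u1 n) = part RY n" for n by (simp_all add: u1_def)
  define u2 where "u2 = (\<lambda>n. k1 (n + 1) \<cdot> y n)"
  have u2: "anti C Y K u2" unfolding u2_def by (rule anti_comp_left[OF anti_to_shift[OF y] D1(4)])
  note [simp] = antiD(1-3)[OF u2]
  obtain Z j2 p2 k2 r2 where Z: "twist C Y K u2 Z j2 p2 k2 r2" using twist_ex[OF u2] by blast
  note D2 = twistD[OF Z]
  note [simp] = deg0D[OF D2(2)] chainD(1-3)[OF D2(3)] chainD(1-3)[OF D2(4)] deg0D[OF D2(5)] cxD[OF D2(1)]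
  have RIK: "part K n \<in> RI" for n by (rule twist_RI[OF K]) (simp_all add: RIX RIY)
  \<comment> \<open>Together with \<open>f\<close> this defines \<open>i\<close>, with constant
    homotopy: the obstruction \<open>k1 (y f - F x)\<close> is zero.\<close>
  define b where "b = (\<lambda>n. j1 n \<cdot> x n)"
  have b: "deg0 C X K b" unfolding b_def by (rule deg0_comp[OF chain_deg0[OF x] D1(2)])
  define i where "i = (\<lambda>n. j2 n \<cdot> f n \<boxplus> k2 n \<cdot> b n)"
  have i: "chain C X Z i"
    unfolding i_def
  proof (rule twist_map[OF Z u2 f b])
    fix n
    show "u2 n \<cdot> f n \<boxplus> bd0 C X K b n = Zer C (part X n) (part K (n + 1))"
      unfolding b_def bd0_comp_chain_right[OF x D1(2)] D1(11) by (simp add: u2_def u1_def F(2))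
  qed
  note [simp] = deg0D[OF b] chainD(1-3)[OF i]
  have i_eq: "p2 n \<cdot> i n = f n" "r2 n \<cdot> i n = j1 n \<cdot> x n" for n
    by (simp_all add: i_def D2(13-16) b_def)
  have i_cof: "cof C VV X Z i"
    unfolding cof_def
  proof (intro conjI i allI)
    fix n
    have "(p1 n \<cdot> r2 n) \<cdot> i n = x n" by (simp add: i_eq D1(13))
    then have "(p1 n \<cdot> r2 n) \<cdot> i n \<in> cofibrations C VV" using xc by (simp add: cof_def)
    then show "i n \<in> cofibrations C VV" by (rule cof_comp_cancel) simp_all
  qed
  \<comment> \<open>The projection of the homotopy pullback to \<open>RX\<close>. Since
    \<open>\<pi> i = x\<close>, surjectivity for \<open>i\<close> is inherited from
    \<open>x\<close>.\<close>
  define \<pi> where "\<pi> = (\<lambda>n. p1 n \<cdot> r2 n)"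
  have \<pi>0: "deg0 C Z RX \<pi>" unfolding \<pi>_def using deg0_comp[OF D2(5) chain_deg0[OF D1(3)]] .
  have p1u2: "p1 (n + 1) \<cdot> u2 n = Zer C (part Y n) (part RX (n + 1))" for n by (simp add: u2_def D1(15))
  have \<pi>: "chain C Z RX \<pi>"
    unfolding chain_iff_bd0
  proof (intro conjI \<pi>0 allI)
    fix n
    have "bd0 C Z RX \<pi> n = neg C (p1 (n + 1) \<cdot> u2 n \<cdot> p2 n)"
      unfolding \<pi>_def bd0_comp_chain_left[OF D2(5) D1(3)] D2(12) by simp
    also have "\<dots> = Zer C (part Z n) (part RX (n + 1))"
      using comp_rw[OF p1u2[of n], of "p2 n"] by simp
    finally show "bd0 C Z RX \<pi> n = Zer C (part Z n) (part RX (n + 1))" .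
  qed
  note [simp] = chainD(1-3)[OF \<pi>]
  have \<pi>i: "\<pi> n \<cdot> i n = x n" for n by (simp add: \<pi>_def i_eq D1(13))
  \<comment> \<open>The tautological homotopy on \<open>Z\<close>: its boundary is the difference of
    the two ways to \<open>RY\<close>, through \<open>RX\<close> and through
    \<open>Y\<close>.\<close>
  define \<rho> where "\<rho> = (\<lambda>n. r1 n \<cdot> r2 n)"
  have \<rho>: "deg0 C Z (shift C RY) \<rho>" unfolding \<rho>_def using deg0_comp[OF D2(5) D1(5)] .
  note [simp] = deg0D[OF \<rho>]
  have \<rho>d: "bd0 C Z (shift C RY) \<rho> n = F n \<cdot> \<pi> n \<boxplus> neg C (y n \<cdot> p2 n)" for n
  proof -
    have "bd0 C Z (shift C RY) \<rho> n = neg C (u1 n \<cdot> p1 n) \<cdot> r2 n \<boxplus> r1 (n + 1) \<cdot> neg C (u2 n \<cdot> p2 n)"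
      unfolding \<rho>_def bd0_comp[OF D2(5) D1(5)] D1(12) D2(12) ..
    also have "\<dots> = F n \<cdot> \<pi> n \<boxplus> neg C (y n \<cdot> p2 n)" by (simp add: u2_def u1_def \<pi>_def D1(14))
    finally show ?thesis .
  qed
  have "weq C VV X Z i"
    unfolding weq_def
  proof (intro conjI i allI impI)
    fix V g assume V: "tst C VV V" and g: "chain C X V g"
    obtain h k where h: "chain C RX V h" "deg1 C X V k" "\<And>n. g n = h n \<cdot> x n \<boxplus> bd1 C X V k n"
      using weq_surj[OF xw V g] by blast
    note [simp] = chainD(1-3)[OF h(1)]
    have "g n = (h n \<cdot> \<pi> n) \<cdot> i n \<boxplus> bd1 C X V k n" for n by (simp add: \<pi>i h(3))
    then show "\<exists>h k. chain C Z V h \<and> deg1 C X V k \<and> (\<forall>n. g n = h n \<cdot> i n \<boxplus> bd1 C X V k n)"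
      using h(2) chain_comp[OF \<pi> h(1)] by blast
  next
    fix V g assume V: "tst C VV V" and "chain C Z V g \<and> null C X V (\<lambda>n. g n \<cdot> i n)"
    then have g: "chain C Z V g" and gi: "null C X V (\<lambda>n. g n \<cdot> i n)" by simp_all
    note Vc = tst_cx[OF V]
    note [simp] = cxD[OF Vc] chainD(1-3)[OF g]
    \<comment> \<open>The components \<open>a\<close>, \<open>b'\<close>, \<open>c\<close> of
      \<open>g\<close> on the three parts of \<open>Z\<close>. Since \<open>g\<close> is a chain
      map, \<open>c\<close> bounds both on \<open>Y\<close>, through \<open>a\<close>, and on
      \<open>RX\<close>, through \<open>b'\<close> up to sign.\<close>
    define a where "a = (\<lambda>n. g n \<cdot> j2 n)"
    define b' where "b' = (\<lambda>n. (g n \<cdot> k2 n) \<cdot> j1 n)"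
    define c where "c = (\<lambda>n. (g n \<cdot> k2 n) \<cdot> k1 n)"
    have gk: "chain C K V (\<lambda>n. g n \<cdot> k2 n)" by (rule chain_comp[OF D2(4) g])
    have a: "deg0 C Y V a" unfolding a_def using deg0_comp[OF D2(2) chain_deg0[OF g]] .
    have b': "deg0 C RX V b'" unfolding b'_def using deg0_comp[OF D1(2) chain_deg0[OF gk]] .
    have c: "chain C (shift C RY) V c" unfolding c_def by (rule chain_comp[OF D1(4) gk])
    note [simp] = deg0D[OF a] deg0D[OF b'] chainD(1-3)[OF c]
    have c': "anti C RY V (\<lambda>n. c (n + 1))" using c chain_from_shift[OF RY] by blast
    have ad: "bd0 C Y V a n = c (n + 1) \<cdot> y n" for n
      unfolding a_def bd0_comp_chain_left[OF D2(2) g] D2(11) by (simp add: u2_def c_def)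
    have bd: "bd0 C RX V b' n = neg C (c (n + 1) \<cdot> F n)" for n
      unfolding b'_def bd0_comp_chain_left[OF D1(2) gk] D1(11) by (simp add: u1_def c_def)
    have "anull C Y V (\<lambda>n. c (n + 1) \<cdot> y n)" unfolding anull_def using a ad by (intro exI[of _ a]) simp
    then obtain w where w: "deg0 C RY V w" "\<And>n. c (n + 1) = bd0 C RY V w n"
      using weq_inj1[OF yw V c'] unfolding anull_def by blast
    have wy: "deg0 C Y V (\<lambda>n. w n \<cdot> y n)" using deg0_comp[OF chain_deg0[OF y] w(1)] .
    have "chain C Y V (\<lambda>n. a n \<boxplus> neg C (w n \<cdot> y n))"
      by (rule chain_diff[OF a wy]) (simp add: ad w(2) bd0_comp_chain_right[OF y w(1)])
    then obtain z s where z: "chain C RY V z" and s: "deg1 C Y V s"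
      and zs: "\<And>n. a n \<boxplus> neg C (w n \<cdot> y n) = z n \<cdot> y n \<boxplus> bd1 C Y V s n"
      using weq_surj[OF yw V, of "\<lambda>n. a n \<boxplus> neg C (w n \<cdot> y n)"] by blast
    \<comment> \<open>\<open>c\<close> bounds on \<open>RY\<close> by \<open>w\<close>, as
      \<open>y\<close> is a weak equivalence. The cycle \<open>z\<close> is added to
      \<open>w\<close> so that its restriction to \<open>Y\<close> also agrees with \<open>a\<close>
      up to a homotopy \<open>s\<close>.\<close>
    define w' where "w' = (\<lambda>n. w n \<boxplus> z n)"
    note [simp] = deg0D[OF w(1)] chainD(1-3)[OF z] deg1D[OF s] deg0D[OF bd1_deg0[OF s]]
    have w': "deg0 C RY V w'" unfolding w'_def by (rule deg0_Add[OF w(1) chain_deg0[OF z]])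
    note [simp] = deg0D[OF w']
    have w'd: "bd0 C RY V w' n = c (n + 1)" for n
      unfolding w'_def bd0_Add[OF w(1) chain_deg0[OF z]] chain_bd0[OF z] w(2)[symmetric] by simp
    have a_eq: "a n = w' n \<cdot> y n \<boxplus> bd1 C Y V s n" for n
    proof -
      have "a n = w n \<cdot> y n \<boxplus> (a n \<boxplus> neg C (w n \<cdot> y n))" by (simp add: Add_left_commute[of _ "a n"])
      then show ?thesis unfolding zs by (simp add: w'_def Add_assoc)
    qed
    \<comment> \<open>The boundaries of \<open>b'\<close> and \<open>w' F\<close> cancel, so this is
      a chain map on \<open>RX\<close>; restricted to \<open>X\<close> it is null homotopic, hence
      null homotopic by \<open>t\<close> on \<open>RX\<close>.\<close>
    define b'' where "b'' = (\<lambda>n. b' n \<boxplus> w' n \<cdot> F n)"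
    have wF: "deg0 C RX V (\<lambda>n. w' n \<cdot> F n)" using deg0_comp[OF chain_deg0[OF F(1)] w'] .
    have b''0: "deg0 C RX V b''" unfolding b''_def by (rule deg0_Add[OF b' wF])
    have b'': "chain C RX V b''"
      unfolding chain_iff_bd0
    proof (intro conjI allI b''0)
      fix n show "bd0 C RX V b'' n = Zer C (part RX n) (part V (n + 1))"
        unfolding b''_def bd0_Add[OF b' wF] bd bd0_comp_chain_right[OF F(1) w'] w'd by simp
    qed
    note [simp] = chainD(1-3)[OF b'']
    obtain m where m: "deg1 C X V m" "\<And>n. g n \<cdot> i n = bd1 C X V m n" using gi unfolding null_def by blast
    note [simp] = deg1D[OF m(1)] deg0D[OF bd1_deg0[OF m(1)]]
    have sf: "deg1 C X V (\<lambda>n. s n \<cdot> f n)" using deg1_comp_right[OF chain_deg0[OF f] s] .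
    have "b'' n \<cdot> x n = bd1 C X V (\<lambda>n. m n \<boxplus> neg C (s n \<cdot> f n)) n" for n
    proof -
      have "bd1 C X V m n = a n \<cdot> f n \<boxplus> b' n \<cdot> x n"
        unfolding m(2)[symmetric] by (simp add: i_def a_def b'_def b_def)
      also have "\<dots> = bd1 C Y V s n \<cdot> f n \<boxplus> b'' n \<cdot> x n"
        by (simp add: a_eq b''_def F(2) Add_ac)
      finally have 1: "bd1 C X V m n = bd1 C Y V s n \<cdot> f n \<boxplus> b'' n \<cdot> x n" .
      show ?thesis
        unfolding bd1_Add[OF m(1) neg_deg1[OF sf]] bd1_neg[OF sf] bd1_comp_chain_right[OF f s] 1
        by (simp add: Add_commute[of "bd1 C Y V s n \<cdot> f n" "b'' n \<cdot> x n"] Add_assoc)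
    qed
    then have "null C X V (\<lambda>n. b'' n \<cdot> x n)"
      unfolding null_def using deg1_Add[OF m(1) neg_deg1[OF sf]] by blast
    from weq_inj[OF xw V b'' this] obtain t where t: "deg1 C RX V t" "\<And>n. b'' n = bd1 C RX V t n"
      unfolding null_def by blast
    have \<omega>: "deg1 C (shift C RY) V (\<lambda>n. w' (n + 1))" using SRY Vc by (intro deg1I) simp_all
    have sp: "deg1 C Z V (\<lambda>n. s n \<cdot> p2 n)" using deg1_comp_right[OF chain_deg0[OF D2(3)] s] .
    have tp: "deg1 C Z V (\<lambda>n. t n \<cdot> \<pi> n)" using deg1_comp_right[OF chain_deg0[OF \<pi>] t(1)] .
    have wr: "deg1 C Z V (\<lambda>n. w' (n + 1) \<cdot> \<rho> n)" using deg1_comp_right[OF \<rho> \<omega>] .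
    note st = deg1_Add[OF sp tp]
    note H = deg1_Add[OF st wr]
    \<comment> \<open>The null homotopy collects \<open>s\<close> on \<open>Y\<close>,
      \<open>t\<close> on \<open>RX\<close> and \<open>w'\<close> along \<open>\<rho>\<close>; the
      boundary of \<open>\<rho>\<close> produces the terms \<open>w' y\<close> and
      \<open>w' F\<close> by which \<open>a\<close> and \<open>b'\<close> differ from
      boundaries.\<close>
    have "bd1 C Z V (\<lambda>n. (s n \<cdot> p2 n \<boxplus> t n \<cdot> \<pi> n) \<boxplus> w' (n + 1) \<cdot> \<rho> n) n = g n" for n
    proof -
      have "bd1 C Z V (\<lambda>n. (s n \<cdot> p2 n \<boxplus> t n \<cdot> \<pi> n) \<boxplus> w' (n + 1) \<cdot> \<rho> n) n
          = (bd1 C Y V s n \<cdot> p2 n \<boxplus> b'' n \<cdot> \<pi> n) \<boxplus> (c n \<cdot> \<rho> n \<boxplus> neg C (w' n \<cdot> (F n \<cdot> \<pi> n \<boxplus> neg C (y n \<cdot> p2 n))))"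
        unfolding bd1_Add[OF st wr] bd1_Add[OF sp tp] bd1_comp_chain_right[OF D2(3) s]
          bd1_comp_chain_right[OF \<pi> t(1)] bd1_comp_right[OF \<rho> \<omega>] bd1_from_shift[OF w'] w'd \<rho>d t(2)[symmetric]
        by simp
      also have "\<dots> = (w' n \<cdot> y n \<boxplus> bd1 C Y V s n) \<cdot> p2 n \<boxplus> (c n \<cdot> \<rho> n \<boxplus> b' n \<cdot> \<pi> n)"
      proof -
        let ?A = "w' n \<cdot> F n \<cdot> \<pi> n" and ?P = "bd1 C Y V s n \<cdot> p2 n" and ?Q = "b' n \<cdot> \<pi> n" and ?R = "c n \<cdot> \<rho> n" and ?S = "w' n \<cdot> y n \<cdot> p2 n"
        have "(?P \<boxplus> (?Q \<boxplus> ?A)) \<boxplus> (?R \<boxplus> (neg C ?A \<boxplus> ?S)) = (?A \<boxplus> neg C ?A) \<boxplus> ((?S \<boxplus> ?P) \<boxplus> (?R \<boxplus> ?Q))"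
          by (simp add: Add_ac del: Add_neg Add_neg_cancel)
        also have "\<dots> = (?S \<boxplus> ?P) \<boxplus> (?R \<boxplus> ?Q)" by simp
        finally show ?thesis by (simp add: b''_def)
      qed
      also have "\<dots> = g n \<cdot> j2 n \<cdot> p2 n \<boxplus> ((g n \<cdot> k2 n) \<cdot> j1 n \<cdot> p1 n \<boxplus> (g n \<cdot> k2 n) \<cdot> k1 n \<cdot> r1 n) \<cdot> r2 n"
        unfolding a_eq[symmetric] by (simp add: a_def b'_def c_def \<pi>_def \<rho>_def Add_commute)
      also have "\<dots> = g n \<cdot> j2 n \<cdot> p2 n \<boxplus> g n \<cdot> k2 n \<cdot> r2 n"
        by (subst D1(17)) simp_all
      also have "\<dots> = g n" by (rule D2(17)) simp_all
      finally show ?thesis .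
    qed
    then have "\<forall>n. g n = bd1 C Z V (\<lambda>n. (s n \<cdot> p2 n \<boxplus> t n \<cdot> \<pi> n) \<boxplus> w' (n + 1) \<cdot> \<rho> n) n" by (intro allI) (rule sym)
    with H show "null C Z V g" unfolding null_def by blast
  qed
  moreover have "fibr C VV Z Y p2" by (rule twist_fibr[OF Z RIK])
  moreover have "f n = p2 n \<cdot> i n" for n by (simp add: i_eq)
  ultimately show ?thesis using i_cof by blast
qed

end

section \<open>Finite limits in additive categories with kernels\<close>

definition has_kernels :: "('o, 'm, 'x) addcat_scheme \<Rightarrow> bool" where
  "has_kernels C \<longleftrightarrow> (\<forall>f\<in>Ar C. \<exists>K k. is_kernel C f K k)"

text \<open>\<open>opposite\<close> forgets the addition; here it is kept, so that cokernels can be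
  treated as kernels of the opposite category.\<close>

definition opadd :: "('o, 'm, 'x) addcat_scheme \<Rightarrow> ('o, 'm) addcat" where
  "opadd C = \<lparr>Ob = Ob C, Ar = Ar C, Dom = Cod C, Cod = Dom C, Id = Id C,
                 Comp = (\<lambda>g f. f \<cdot>\<^bsub>C\<^esub> g), Add = Add C, Zer = (\<lambda>a b. Zer C b a)\<rparr>"

lemma opadd_simps [simp]:
  "Ob (opadd C) = Ob C" "Ar (opadd C) = Ar C" "Dom (opadd C) = Cod C" "Cod (opadd C) = Dom C"
  "Id (opadd C) = Id C" "g \<cdot>\<^bsub>opadd C\<^esub> f = f \<cdot>\<^bsub>C\<^esub> g" "Add (opadd C) = Add C" "Zer (opadd C) a b = Zer C b a"
  by (simp_all add: opadd_def)

lemma hom_set_opadd [simp]: "hom_set (opadd C) a b = hom_set C b a"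
  by (auto simp: hom_set_def)

lemma hom_group_opadd: "hom_group (opadd C) a b = hom_group C b a"
  by (simp add: hom_group_def)

lemma has_finite_limits_opadd: "has_finite_limits (opadd C) \<longleftrightarrow> has_finite_limits (opposite C)"
proof -
  have "is_functor I (opposite C) F G \<longleftrightarrow> is_functor I (opadd C) F G" for I :: "(nat, nat) cat" and F G
    by (simp add: is_functor_def hom_set_def opposite_def)
  moreover have "is_limit I (opposite C) F G c t \<longleftrightarrow> is_limit I (opadd C) F G c t" for I :: "(nat, nat) cat" and F G c t
    by (simp add: is_limit_def is_cone_def hom_set_def opposite_def)
  ultimately show ?thesis by (simp add: has_finite_limits_def)
qed

lemma (in preadditive_category) opadd_preadditive: "preadditive_category (opadd C)"
proof (intro preadditive_category.intro preadditive_category_axioms.intro)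
  show "category (opadd C)" by unfold_locales (auto simp: in_hom_set)
qed (auto simp: in_hom_set hom_group_opadd hom_comm_group)

lemma (in additive_category) opadd_additive: "additive_category (opadd C)"
proof -
  interpret op: preadditive_category "opadd C" by (rule opadd_preadditive)
  show ?thesis
  proof
    show "\<exists>z\<in>Ob (opadd C). \<forall>a\<in>Ob (opadd C). (\<exists>!f. f \<in> hom_set (opadd C) z a) \<and> (\<exists>!f. f \<in> hom_set (opadd C) a z)"
    proof -
      obtain z where "z \<in> Ob C" "\<forall>a\<in>Ob C. (\<exists>!f. f \<in> hom_set C z a) \<and> (\<exists>!f. f \<in> hom_set C a z)"
        using zero_object by (rule bexE)
      then show ?thesis by (intro bexI[of _ z]) simp_all
    qed
    fix a b assume "a \<in> Ob (opadd C)" "b \<in> Ob (opadd C)"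
    then have "a \<in> Ob C" "b \<in> Ob C" by simp_all
    from biproducts[OF this]
    obtain s i j p q where "s \<in> Ob C" "i \<in> hom_set C a s" "j \<in> hom_set C b s" "p \<in> hom_set C s a" "q \<in> hom_set C s b"
      "p \<cdot> i = Id C a" "q \<cdot> j = Id C b" "p \<cdot> j = Zer C b a" "q \<cdot> i = Zer C a b" "Add C (i \<cdot> p) (j \<cdot> q) = Id C s"
      by blast
    then show "\<exists>s\<in>Ob (opadd C). \<exists>i\<in>hom_set (opadd C) a s. \<exists>j\<in>hom_set (opadd C) b s. \<exists>p\<in>hom_set (opadd C) s a. \<exists>q\<in>hom_set (opadd C) s b.
           p \<cdot>\<^bsub>opadd C\<^esub> i = Id (opadd C) a \<and> q \<cdot>\<^bsub>opadd C\<^esub> j = Id (opadd C) b \<and> p \<cdot>\<^bsub>opadd C\<^esub> j = Zer (opadd C) b a \<and> q \<cdot>\<^bsub>opadd C\<^esub> i = Zer (opadd C) a b \<and>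
           Add (opadd C) (i \<cdot>\<^bsub>opadd C\<^esub> p) (j \<cdot>\<^bsub>opadd C\<^esub> q) = Id (opadd C) s"
      by (intro bexI[of _ s] bexI[of _ p] bexI[of _ q] bexI[of _ i] bexI[of _ j]) simp_all
  qed
qed

definition is_product :: "('o, 'm, 'x) addcat_scheme \<Rightarrow> 'i set \<Rightarrow> ('i \<Rightarrow> 'o) \<Rightarrow> 'o \<Rightarrow> ('i \<Rightarrow> 'm) \<Rightarrow> bool" where
  "is_product C S F P pr \<longleftrightarrow> P \<in> Ob C \<and> (\<forall>i\<in>S. pr i \<in> Ar C \<and> Dom C (pr i) = P \<and> Cod C (pr i) = F i) \<and>
    (\<forall>T\<in>Ob C. \<forall>f. (\<forall>i\<in>S. f i \<in> Ar C \<and> Dom C (f i) = T \<and> Cod C (f i) = F i) \<longrightarrow>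
        (\<exists>h. h \<in> Ar C \<and> Dom C h = T \<and> Cod C h = P \<and> (\<forall>i\<in>S. pr i \<cdot>\<^bsub>C\<^esub> h = f i))) \<and>
    (\<forall>h h'. h \<in> Ar C \<longrightarrow> h' \<in> Ar C \<longrightarrow> Dom C h = Dom C h' \<longrightarrow> Cod C h = P \<longrightarrow> Cod C h' = P \<longrightarrow>
        (\<forall>i\<in>S. pr i \<cdot>\<^bsub>C\<^esub> h = pr i \<cdot>\<^bsub>C\<^esub> h') \<longrightarrow> h = h')"

lemma is_productD:
  assumes "is_product C S F P pr"
  shows "P \<in> Ob C" "i \<in> S \<Longrightarrow> pr i \<in> Ar C \<and> Dom C (pr i) = P \<and> Cod C (pr i) = F i"
    "\<lbrakk>T \<in> Ob C; \<forall>i\<in>S. f i \<in> Ar C \<and> Dom C (f i) = T \<and> Cod C (f i) = F i\<rbrakk> \<Longrightarrow>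
        \<exists>h. h \<in> Ar C \<and> Dom C h = T \<and> Cod C h = P \<and> (\<forall>i\<in>S. pr i \<cdot>\<^bsub>C\<^esub> h = f i)"
    "\<lbrakk>h \<in> Ar C; h' \<in> Ar C; Dom C h = Dom C h'; Cod C h = P; Cod C h' = P; \<forall>i\<in>S. pr i \<cdot>\<^bsub>C\<^esub> h = pr i \<cdot>\<^bsub>C\<^esub> h'\<rbrakk> \<Longrightarrow> h = h'"
  using assms unfolding is_product_def by blast+

text \<open>Induction on the index set: the zero object is the empty product, and each new factor is
  attached by a biproduct.\<close>

lemma (in additive_category) finite_product:
  assumes "finite S" "\<And>i. i \<in> S \<Longrightarrow> F i \<in> Ob C"
  shows "\<exists>P pr. is_product C S F P pr"
  using assms
proof (induction S rule: finite_induct)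
  case empty
  obtain z where z: "z \<in> Ob C" and z': "\<forall>a\<in>Ob C. (\<exists>!f. f \<in> hom_set C z a) \<and> (\<exists>!f. f \<in> hom_set C a z)"
    using zero_object by (rule bexE)
  have "h = h'" if "h \<in> Ar C" "h' \<in> Ar C" "Dom C h = Dom C h'" "Cod C h = z" "Cod C h' = z" for h h'
  proof -
    have "\<exists>!f. f \<in> hom_set C (Dom C h) z" using z' that(1) by simp
    moreover have "h \<in> hom_set C (Dom C h) z" "h' \<in> hom_set C (Dom C h) z" using that by (simp_all add: in_hom_set)
    ultimately show ?thesis by blast
  qed
  moreover have "\<exists>h. h \<in> Ar C \<and> Dom C h = T \<and> Cod C h = z" if "T \<in> Ob C" for T
  proof -
    have "\<exists>!f. f \<in> hom_set C T z" using z' that by simp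
    then show ?thesis by (auto simp: in_hom_set)
  qed
  ultimately have "is_product C {} F z (\<lambda>_. Id C z)" using z unfolding is_product_def by blast
  then show ?case by blast
next
  case (insert x S)
  have "\<exists>P pr. is_product C S F P pr" by (rule insert.IH) (simp add: insert.prems)
  then obtain P pr where prod: "is_product C S F P pr" by blast
  note P = is_productD(1,2)[OF prod] and ex = is_productD(3)[OF prod] and mono = is_productD(4)[OF prod]
  have x: "F x \<in> Ob C" using insert.prems by simp
  obtain s i j p q where s: "s \<in> Ob C" "i \<in> hom_set C (F x) s" "j \<in> hom_set C P s" "p \<in> hom_set C s (F x)" "q \<in> hom_set C s P"
      "p \<cdot> i = Id C (F x)" "q \<cdot> j = Id C P" "p \<cdot> j = Zer C P (F x)" "q \<cdot> i = Zer C (F x) P" "Add C (i \<cdot> p) (j \<cdot> q) = Id C s"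
    using biproducts[OF x P(1)] by blast
  note [simp] = s(1,6-9) P(1) x
  have [simp]: "i \<in> Ar C" "Dom C i = F x" "Cod C i = s" "j \<in> Ar C" "Dom C j = P" "Cod C j = s"
    "p \<in> Ar C" "Dom C p = s" "Cod C p = F x" "q \<in> Ar C" "Dom C q = s" "Cod C q = P"
    using s(2-5) by (simp_all add: in_hom_set)
  have Pr: "pr y \<in> Ar C" "Dom C (pr y) = P" "Cod C (pr y) = F y" if "y \<in> S" for y using P(2)[OF that] by simp_all
  define pr' where "pr' = (\<lambda>y. if y = x then p else pr y \<cdot> q)"
  have pr'_x: "pr' x = p" and pr'_S: "y \<in> S \<Longrightarrow> pr' y = pr y \<cdot> q" for y using insert.hyps by (auto simp: pr'_def)
  have ij: "p \<cdot> i \<cdot> t = t" "q \<cdot> i \<cdot> t = Zer C (Dom C t) P" if "t \<in> Ar C" "Cod C t = F x" for t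
    using comp_rw[OF s(6), of t] comp_rw[OF s(9), of t] that by simp_all
  have ij': "q \<cdot> j \<cdot> t = t" "p \<cdot> j \<cdot> t = Zer C (Dom C t) (F x)" if "t \<in> Ar C" "Cod C t = P" for t
    using comp_rw[OF s(7), of t] comp_rw[OF s(8), of t] that by simp_all
  have "\<forall>y\<in>insert x S. pr' y \<in> Ar C \<and> Dom C (pr' y) = s \<and> Cod C (pr' y) = F y"
    by (auto simp: pr'_x pr'_S Pr)
  moreover have "\<exists>h. h \<in> Ar C \<and> Dom C h = T \<and> Cod C h = s \<and> (\<forall>y\<in>insert x S. pr' y \<cdot> h = f y)"
    if T: "T \<in> Ob C" and f: "\<forall>y\<in>insert x S. f y \<in> Ar C \<and> Dom C (f y) = T \<and> Cod C (f y) = F y" for T f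
  proof -
    obtain h where h: "h \<in> Ar C" "Dom C h = T" "Cod C h = P" "\<forall>y\<in>S. pr y \<cdot> h = f y"
      using ex[OF T, of f] f by auto
    have fx: "f x \<in> Ar C" "Dom C (f x) = T" "Cod C (f x) = F x" using f by auto
    show ?thesis
      using T f fx h by (intro exI[of _ "i \<cdot> f x \<boxplus> j \<cdot> h"]) (auto simp: pr'_x pr'_S ij ij' Pr)
  qed
  moreover have "h = h'" if h: "h \<in> Ar C" "h' \<in> Ar C" "Dom C h = Dom C h'" "Cod C h = s" "Cod C h' = s"
     "\<forall>y\<in>insert x S. pr' y \<cdot> h = pr' y \<cdot> h'" for h h'
  proof -
    have "p \<cdot> h = p \<cdot> h'" using h(6) by (simp add: pr'_x)
    moreover have "q \<cdot> h = q \<cdot> h'"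
      by (rule mono) (use h pr'_S in \<open>auto simp: Pr\<close>)
    ultimately have "i \<cdot> p \<cdot> h \<boxplus> j \<cdot> q \<cdot> h = i \<cdot> p \<cdot> h' \<boxplus> j \<cdot> q \<cdot> h'" by simp
    moreover have "i \<cdot> p \<cdot> h \<boxplus> j \<cdot> q \<cdot> h = h" "i \<cdot> p \<cdot> h' \<boxplus> j \<cdot> q \<cdot> h' = h'"
      using arg_cong[OF s(10), of "\<lambda>x. x \<cdot> h"] arg_cong[OF s(10), of "\<lambda>x. x \<cdot> h'"] h(1-5) by simp_all
    ultimately show ?thesis by simp
  qed
  ultimately have "is_product C (insert x S) F s pr'" using s(1) unfolding is_product_def by blast
  then show ?case by blast
qed

text \<open>A limit is the kernel of the map from the product over objects to the product over
  arrows whose component at \<open>u\<close> is the difference of the two sides of the cone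
  condition at \<open>u\<close>.\<close>

lemma (in additive_category) finite_limits_if_kernels:
  assumes ker: "has_kernels C"
  shows "has_finite_limits C"
  unfolding has_finite_limits_def
proof (intro allI impI, elim conjE)
  fix I :: "(nat, nat) cat" and F G
  assume I: "category I" "finite (Ob I)" "finite (Ar I)" and FG: "is_functor I C F G"
  interpret I: category I by fact
  have F [simp]: "F i \<in> Ob C" if "i \<in> Ob I" for i using FG that by (auto simp: is_functor_def)
  have G [simp]: "G u \<in> Ar C" "Dom C (G u) = F (Dom I u)" "Cod C (G u) = F (Cod I u)" if "u \<in> Ar I" for u
    using FG that by (auto simp: is_functor_def in_hom_set)
  have "\<exists>P pr. is_product C (Ob I) F P pr" by (rule finite_product[OF I(2) F])
  then obtain P pr where P': "is_product C (Ob I) F P pr" by blast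
  note P = is_productD(1,2)[OF P'] and P_ex = is_productD(3)[OF P'] and P_mono = is_productD(4)[OF P']
  have "\<exists>Q qr. is_product C (Ar I) (\<lambda>u. F (Cod I u)) Q qr" by (rule finite_product[OF I(3)]) simp
  then obtain Q qr where Q': "is_product C (Ar I) (\<lambda>u. F (Cod I u)) Q qr" by blast
  note Q = is_productD(1,2)[OF Q'] and Q_ex = is_productD(3)[OF Q'] and Q_mono = is_productD(4)[OF Q']
  have pr [simp]: "pr i \<in> Ar C" "Dom C (pr i) = P" "Cod C (pr i) = F i" if "i \<in> Ob I" for i using P(2)[OF that] by auto
  have qr [simp]: "qr u \<in> Ar C" "Dom C (qr u) = Q" "Cod C (qr u) = F (Cod I u)" if "u \<in> Ar I" for u using Q(2)[OF that] by auto
  obtain \<phi> where \<phi> [simp]: "\<phi> \<in> Ar C" "Dom C \<phi> = P" "Cod C \<phi> = Q"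
    and \<phi>': "\<forall>u\<in>Ar I. qr u \<cdot> \<phi> = G u \<cdot> pr (Dom I u) \<boxplus> neg C (pr (Cod I u))"
    using Q_ex[OF P(1), of "\<lambda>u. G u \<cdot> pr (Dom I u) \<boxplus> neg C (pr (Cod I u))"] by auto
  have \<phi>0: "\<phi> \<cdot> h = Zer C (Dom C h) Q \<longleftrightarrow> (\<forall>u\<in>Ar I. G u \<cdot> pr (Dom I u) \<cdot> h = pr (Cod I u) \<cdot> h)"
    if h: "h \<in> Ar C" "Cod C h = P" for h
  proof -
    have *: "qr u \<cdot> \<phi> \<cdot> h = G u \<cdot> pr (Dom I u) \<cdot> h \<boxplus> neg C (pr (Cod I u) \<cdot> h)" if "u \<in> Ar I" for u
      using arg_cong[OF \<phi>'[rule_format, OF that], of "\<lambda>x. x \<cdot> h"] h that by simp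
    have **: "qr u \<cdot> \<phi> \<cdot> h = Zer C (Dom C h) (F (Cod I u)) \<longleftrightarrow> G u \<cdot> pr (Dom I u) \<cdot> h = pr (Cod I u) \<cdot> h" if "u \<in> Ar I" for u
      using *[OF that] eq_iff_diff[of "G u \<cdot> pr (Dom I u) \<cdot> h" "pr (Cod I u) \<cdot> h"] that h by simp
    have "\<phi> \<cdot> h = Zer C (Dom C h) Q \<longleftrightarrow> (\<forall>u\<in>Ar I. qr u \<cdot> \<phi> \<cdot> h = qr u \<cdot> Zer C (Dom C h) Q)"
      using Q_mono[of "\<phi> \<cdot> h" "Zer C (Dom C h) Q"] h Q(1) by (auto simp del: comp_Zer)
    then show ?thesis using ** h Q(1) by simp
  qed
  obtain K k where K: "is_kernel C \<phi> K k" using ker unfolding has_kernels_def by (metis \<phi>(1))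
  note [simp] = kernelD[OF K \<phi>(1), unfolded \<phi>]
  define t where "t = (\<lambda>i. pr i \<cdot> k)"
  have "is_cone I C F G K t"
    unfolding is_cone_def t_def using \<phi>0[of k] by (simp add: in_hom_set)
  moreover have "\<exists>!h. h \<in> hom_set C c' K \<and> (\<forall>i\<in>Ob I. t i \<cdot> h = t' i)" if cone: "is_cone I C F G c' t'" for c' t'
  proof -
    have c' [simp]: "c' \<in> Ob C" and t': "\<forall>i\<in>Ob I. t' i \<in> Ar C \<and> Dom C (t' i) = c' \<and> Cod C (t' i) = F i"
      and Gt: "\<forall>u\<in>Ar I. G u \<cdot> t' (Dom I u) = t' (Cod I u)"
      using cone by (auto simp: is_cone_def in_hom_set)
    obtain h where h: "h \<in> Ar C" "Dom C h = c'" "Cod C h = P" "\<forall>i\<in>Ob I. pr i \<cdot> h = t' i"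
      using P_ex[OF c' t'] by auto
    have "\<phi> \<cdot> h = Zer C (Dom C h) Q" using \<phi>0[OF h(1,3)] h(4) Gt by simp
    then obtain g where g: "g \<in> Ar C" "Dom C g = c'" "Cod C g = K" "k \<cdot> g = h"
      using kernel_lift[OF K \<phi>(1), of h] h by auto
    show ?thesis
    proof (rule ex1I[of _ g])
      show "g \<in> hom_set C c' K \<and> (\<forall>i\<in>Ob I. t i \<cdot> g = t' i)"
        using g h by (simp add: in_hom_set t_def)
      fix g' assume g': "g' \<in> hom_set C c' K \<and> (\<forall>i\<in>Ob I. t i \<cdot> g' = t' i)"
      then have *: "g' \<in> Ar C" "Dom C g' = c'" "Cod C g' = K" by (auto simp: in_hom_set)
      have "pr i \<cdot> k \<cdot> g' = pr i \<cdot> k \<cdot> g" if i: "i \<in> Ob I" for i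
      proof -
        have "pr i \<cdot> k \<cdot> g' = t' i" using g' i * by (simp add: t_def)
        also have "\<dots> = pr i \<cdot> k \<cdot> g" using h(4) i by (simp add: g(4))
        finally show ?thesis .
      qed
      then have "k \<cdot> g' = k \<cdot> g"
        by (intro P_mono) (use * g(1-3) in simp_all)
      then show "g' = g" by (rule kernel_mono[OF K \<phi>(1)]) (use * g in simp_all)
    qed
  qed
  ultimately show "\<exists>c t. is_limit I C F G c t" unfolding is_limit_def by blast
qed

lemma is_limitD:
  assumes "is_limit I C F G c t" "is_cone I C F G c' t'"
  shows "\<exists>!h. h \<in> hom_set C c' c \<and> (\<forall>i\<in>Ob I. t i \<cdot>\<^bsub>C\<^esub> h = t' i)"
  using assms unfolding is_limit_def by simp

text \<open>The arrows 0 and 1 are the identities of the two objects, and 2 and 3 are the pair from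
  0 to 1.\<close>

definition parallel_pair :: "(nat, nat) cat" where
  "parallel_pair = \<lparr>Ob = {0, 1}, Ar = {0, 1, 2, 3}, Dom = (\<lambda>u. if u = 1 then 1 else 0),
     Cod = (\<lambda>u. if u = 0 then 0 else 1), Id = id, Comp = (\<lambda>v u. if v = 0 \<or> v = 1 then u else v)\<rparr>"

lemma category_parallel_pair: "category parallel_pair"
  by unfold_locales (auto simp: parallel_pair_def in_hom_set)

text \<open>A kernel is the equalizer of \<open>f\<close> and the zero map.\<close>

lemma (in preadditive_category) kernels_if_finite_limits:
  assumes lim: "has_finite_limits C"
  shows "has_kernels C"
  unfolding has_kernels_def
proof
  fix f assume f [simp]: "f \<in> Ar C"
  define F where "F = (\<lambda>i::nat. if i = 0 then Dom C f else Cod C f)"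
  define G where "G = (\<lambda>u::nat. if u = 0 then Id C (Dom C f) else if u = 1 then Id C (Cod C f) else if u = 2 then f
      else Zer C (Dom C f) (Cod C f))"
  have "is_functor parallel_pair C F G"
    unfolding is_functor_def by (auto simp: parallel_pair_def F_def G_def in_hom_set)
  then obtain K t where K: "is_limit parallel_pair C F G K t"
    using lim category_parallel_pair unfolding has_finite_limits_def
    by (metis (no_types, lifting) cat.select_convs(1,2) finite.emptyI finite.insertI parallel_pair_def)
  have t: "K \<in> Ob C" "t 0 \<in> Ar C" "Dom C (t 0) = K" "Cod C (t 0) = Dom C f"
     "t 1 \<in> Ar C" "Dom C (t 1) = K" "Cod C (t 1) = Cod C f" "f \<cdot> t 0 = t 1" "Zer C (Dom C f) (Cod C f) \<cdot> t 0 = t 1"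
    using K by (auto simp: is_limit_def is_cone_def parallel_pair_def F_def G_def in_hom_set)
  have univ: "\<exists>!h. h \<in> hom_set C (Dom C g) K \<and> (\<forall>i\<in>{0,1}. t i \<cdot> h = (if i = 0 then g else Zer C (Dom C g) (Cod C f)))"
    if "g \<in> Ar C" "Cod C g = Dom C f" "f \<cdot> g = Zer C (Dom C g) (Cod C f)" for g
  proof -
    have "is_cone parallel_pair C F G (Dom C g) (\<lambda>i. if i = 0 then g else Zer C (Dom C g) (Cod C f))"
      using that by (auto simp: is_cone_def parallel_pair_def F_def G_def in_hom_set)
    from is_limitD[OF K this] show ?thesis by (simp only: parallel_pair_def cat.select_convs)
  qed
  have "is_kernel C f K (t 0)"
  proof (rule kernelI)
    show "f \<cdot> t 0 = Zer C K (Cod C f)" using t by simp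
  next
    fix g assume g: "g \<in> Ar C" "Cod C g = Dom C f" "f \<cdot> g = Zer C (Dom C g) (Cod C f)"
    show "\<exists>h. h \<in> Ar C \<and> Dom C h = Dom C g \<and> Cod C h = K \<and> t 0 \<cdot> h = g"
      using univ[OF g] by (auto simp: in_hom_set)
  next
    fix h h' assume h: "h \<in> Ar C" "h' \<in> Ar C" "Dom C h = Dom C h'" "Cod C h = K" "Cod C h' = K" "t 0 \<cdot> h = t 0 \<cdot> h'"
    have t1: "t 1 \<cdot> x = Zer C (Dom C x) (Cod C f)" if "x \<in> Ar C" "Cod C x = K" for x
      using that t(1-4) unfolding t(9)[symmetric] by simp
    have "f \<cdot> t 0 \<cdot> h = Zer C (Dom C h) (Cod C f)"
      using comp_rw[OF t(8), of h] t(1-4) h t1 by simp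
    then have "\<exists>!x. x \<in> hom_set C (Dom C h) K \<and> (\<forall>i\<in>{0,1}. t i \<cdot> x = (if i = 0 then t 0 \<cdot> h else Zer C (Dom C h) (Cod C f)))"
      using univ[of "t 0 \<cdot> h"] t h by simp
    moreover have "h \<in> hom_set C (Dom C h) K \<and> (\<forall>i\<in>{0,1}. t i \<cdot> h = (if i = 0 then t 0 \<cdot> h else Zer C (Dom C h) (Cod C f)))"
      using h t1 by (simp add: in_hom_set)
    moreover have "h' \<in> hom_set C (Dom C h) K \<and> (\<forall>i\<in>{0,1}. t i \<cdot> h' = (if i = 0 then t 0 \<cdot> h else Zer C (Dom C h) (Cod C f)))"
      using h t1 by (simp add: in_hom_set)
    ultimately show "h = h'" by blast
  qed (use t in auto)
  then show "\<exists>K k. is_kernel C f K k" by blast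
qed

section \<open>Cokernels as kernels in the opposite category\<close>

context preadditive_category
begin

abbreviation is_cokernel where "is_cokernel f \<equiv> is_kernel (opadd C) f"

lemma cokernelD:
  assumes "is_cokernel f Q q" "f \<in> Ar C"
  shows "Q \<in> Ob C" "q \<in> Ar C" "Cod C q = Q" "Dom C q = Cod C f" "q \<cdot> f = Zer C (Dom C f) Q"
  using preadditive_category.kernelD[OF opadd_preadditive assms(1)] assms(2) by simp_all

lemma cokernel_epi:
  assumes "is_cokernel f Q q" "f \<in> Ar C" "h \<cdot> q = h' \<cdot> q" "h \<in> Ar C" "h' \<in> Ar C"
    "Cod C h = Cod C h'" "Dom C h = Q" "Dom C h' = Q"
  shows "h = h'"
  using preadditive_category.kernel_mono[OF opadd_preadditive assms(1), of h h'] assms(2-8) by simp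

lemma cokernel_desc:
  assumes "is_cokernel f Q q" "f \<in> Ar C" "g \<cdot> f = Zer C (Dom C f) (Cod C g)" "g \<in> Ar C" "Dom C g = Cod C f"
  shows "\<exists>h. h \<in> Ar C \<and> Cod C h = Cod C g \<and> Dom C h = Q \<and> h \<cdot> q = g"
  using preadditive_category.kernel_lift[OF opadd_preadditive assms(1), of g] assms(2-5) by simp

lemma cokernelI:
  assumes "Q \<in> Ob C" "q \<in> Ar C" "Cod C q = Q" "Dom C q = Cod C f" "q \<cdot> f = Zer C (Dom C f) Q"
    and "\<And>g. \<lbrakk>g \<in> Ar C; Dom C g = Cod C f; g \<cdot> f = Zer C (Dom C f) (Cod C g)\<rbrakk> \<Longrightarrow>
        \<exists>h. h \<in> Ar C \<and> Cod C h = Cod C g \<and> Dom C h = Q \<and> h \<cdot> q = g"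
    and "\<And>h h'. \<lbrakk>h \<in> Ar C; h' \<in> Ar C; Cod C h = Cod C h'; Dom C h = Q; Dom C h' = Q; h \<cdot> q = h' \<cdot> q\<rbrakk> \<Longrightarrow> h = h'"
  shows "is_cokernel f Q q"
  by (rule preadditive_category.kernelI[OF opadd_preadditive]) (simp_all add: assms)

end

section \<open>Supercomplexes in an additive category\<close>

lemma Sup_cat_simps [simp]:
  "Dom (Sup_cat C) = src" "Cod (Sup_cat C) = tgt" "Id (Sup_cat C) X = Arrow X X (\<lambda>i. Id C (part X i))"
  "g \<cdot>\<^bsub>Sup_cat C\<^esub> f = Arrow (src f) (tgt g) (\<lambda>i. body g i \<cdot>\<^bsub>C\<^esub> body f i)"
  "Add (Sup_cat C) f g = Arrow (src f) (tgt f) (\<lambda>i. Add C (body f i) (body g i))"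
  "Zer (Sup_cat C) X Y = Arrow X Y (\<lambda>i. Zer C (part X i) (part Y i))"
  by (simp_all add: Sup_cat_def Let_def)

lemma bit_all_iff: "(\<forall>p :: bit. P p) \<longleftrightarrow> P 0 \<and> P 1"
  by (metis bit.exhaust)

text \<open>Supercomplexes of the opposite category: since \<open>-1 = 1\<close> in \<open>\<int>/2\<close>, only the differential is reindexed.\<close>

definition op_cx where
  "op_cx X = Supercx (part X) (\<lambda>i. bdry X (i + 1))"

lemma op_cx_simps [simp]: "part (op_cx X) = part X" "bdry (op_cx X) i = bdry X (i + 1)" "op_cx (op_cx X) = X"
  by (simp_all add: op_cx_def)

lemma Sup_Ar: "f \<in> Ar (Sup_cat C) \<longleftrightarrow> chain C (src f) (tgt f) (body f)"
proof -
  have "f \<in> Ar (Sup_cat C) \<longleftrightarrow> src f \<in> Ob (Sup_cat C) \<and> tgt f \<in> Ob (Sup_cat C) \<and>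
    (\<forall>i. body f i \<in> hom_set C (part (src f) i) (part (tgt f) i) \<and> bdry (tgt f) i \<cdot>\<^bsub>C\<^esub> body f i = body f (i + 1) \<cdot>\<^bsub>C\<^esub> bdry (src f) i)"
    by (cases f) (auto simp: Sup_cat_def Let_def)
  then show ?thesis by (auto simp: chain_def deg0_def)
qed

context preadd
begin

lemma Sup_preadditive: "preadditive_category SC"
proof -
  have D: "chain C (src f) (tgt f) (body f)" "src f = X" "tgt f = Y" if "f \<in> hom_set SC X Y" for f X Y
    using that by (auto simp: in_hom_set Sup_Ar)
  have I: "Arrow X Y f \<in> hom_set SC X Y" if "chain C X Y f" for X Y f
    using that by (auto simp: in_hom_set Sup_Ar)
  have eq: "f = g" if "src f = src g" "tgt f = tgt g" "\<And>i. body f i = body g i" for f g :: "('o, 'm) sup_arrow"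
    using that by (cases f; cases g) auto
  show ?thesis
  proof (intro preadditive_category.intro preadditive_category_axioms.intro category.intro)
    fix f assume "f \<in> Ar SC" then show "Dom SC f \<in> Ob SC" "Cod SC f \<in> Ob SC"
      using chain_cx by (auto simp: Sup_Ar)
  next
    fix X assume "X \<in> Ob SC" then show "Id SC X \<in> hom_set SC X X"
      using chain_Id I by simp
  next
    fix f g X Y Z assume "f \<in> hom_set SC X Y" "g \<in> hom_set SC Y Z"
    then show "g \<cdot>\<^bsub>SC\<^esub> f \<in> hom_set SC X Z" using D I chain_comp by simp metis
  next
    fix f g h X Y Z V assume "f \<in> hom_set SC X Y" "g \<in> hom_set SC Y Z" "h \<in> hom_set SC Z V"
    note fgh = D[OF this(1)] D[OF this(2)] D[OF this(3)]
    show "(h \<cdot>\<^bsub>SC\<^esub> g) \<cdot>\<^bsub>SC\<^esub> f = h \<cdot>\<^bsub>SC\<^esub> g \<cdot>\<^bsub>SC\<^esub> f"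
      using chainD(1-3)[OF fgh(1)] chainD(1-3)[OF fgh(4)] chainD(1-3)[OF fgh(7)] fgh(2,3,5,6,8,9) by simp
  next
    fix f X Y assume "f \<in> hom_set SC X Y"
    note f = D[OF this] show "Id SC Y \<cdot>\<^bsub>SC\<^esub> f = f" "f \<cdot>\<^bsub>SC\<^esub> Id SC X = f"
      using f chainD(1-3)[OF f(1)] by (auto intro!: eq)
  next
    fix X Y assume X: "X \<in> Ob SC" and Y: "Y \<in> Ob SC"
    show "comm_group (hom_group SC X Y)"
    proof (rule comm_groupI)
      fix f g h assume "f \<in> carrier (hom_group SC X Y)" "g \<in> carrier (hom_group SC X Y)" "h \<in> carrier (hom_group SC X Y)"
      then have "f \<in> hom_set SC X Y" "g \<in> hom_set SC X Y" "h \<in> hom_set SC X Y" by simp_all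
      note f = D[OF this(1)] and g = D[OF this(2)] and h = D[OF this(3)]
      note [simp] = f(2,3) g(2,3) h(2,3) chainD(1-3)[OF f(1)] chainD(1-3)[OF g(1)] chainD(1-3)[OF h(1)]
      show "f \<otimes>\<^bsub>hom_group SC X Y\<^esub> g \<otimes>\<^bsub>hom_group SC X Y\<^esub> h = f \<otimes>\<^bsub>hom_group SC X Y\<^esub> (g \<otimes>\<^bsub>hom_group SC X Y\<^esub> h)"
        by (simp add: Add_assoc)
    next
      fix f g assume "f \<in> carrier (hom_group SC X Y)" "g \<in> carrier (hom_group SC X Y)"
      then have "f \<in> hom_set SC X Y" "g \<in> hom_set SC X Y" by simp_all
      note f = D[OF this(1)] and g = D[OF this(2)]
      note [simp] = f(2,3) g(2,3) chainD(1-3)[OF f(1)] chainD(1-3)[OF g(1)]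
      show "f \<otimes>\<^bsub>hom_group SC X Y\<^esub> g \<in> carrier (hom_group SC X Y)"
        using f(1) g(1) by (simp add: I chain_Add)
      show "f \<otimes>\<^bsub>hom_group SC X Y\<^esub> g = g \<otimes>\<^bsub>hom_group SC X Y\<^esub> f"
        by (simp add: Add_commute)
    next
      show "\<one>\<^bsub>hom_group SC X Y\<^esub> \<in> carrier (hom_group SC X Y)"
        using chain_Zer[OF X Y] I by simp
      fix f assume "f \<in> carrier (hom_group SC X Y)"
      then have "f \<in> hom_set SC X Y" by simp
      note f = D[OF this]
      note [simp] = f(2,3) chainD(1-3)[OF f(1)] cxD[OF X] cxD[OF Y]
      show "\<one>\<^bsub>hom_group SC X Y\<^esub> \<otimes>\<^bsub>hom_group SC X Y\<^esub> f = f"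
        by (rule eq) simp_all
      have n: "chain C X Y (\<lambda>i. neg C (body f i))"
        using f(1) neg_deg0[OF chain_deg0[OF f(1)]] bd0_neg[OF chain_deg0[OF f(1)]] by (simp add: chain_iff_bd0)
      show "\<exists>g\<in>carrier (hom_group SC X Y). g \<otimes>\<^bsub>hom_group SC X Y\<^esub> f = \<one>\<^bsub>hom_group SC X Y\<^esub>"
        by (rule bexI[OF _ I[OF n, folded hom_group_simps]]) simp
    qed
  next
    fix f g g' X Y Z assume "f \<in> hom_set SC X Y" "g \<in> hom_set SC Y Z" "g' \<in> hom_set SC Y Z"
    note fgh = D[OF this(1)] D[OF this(2)] D[OF this(3)]
    show "Add SC g g' \<cdot>\<^bsub>SC\<^esub> f = Add SC (g \<cdot>\<^bsub>SC\<^esub> f) (g' \<cdot>\<^bsub>SC\<^esub> f)"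
      using chainD(1-3)[OF fgh(1)] chainD(1-3)[OF fgh(4)] chainD(1-3)[OF fgh(7)] fgh(2,3,5,6,8,9) by simp
  next
    fix f f' g X Y Z assume "f \<in> hom_set SC X Y" "f' \<in> hom_set SC X Y" "g \<in> hom_set SC Y Z"
    note fgh = D[OF this(1)] D[OF this(2)] D[OF this(3)]
    show "g \<cdot>\<^bsub>SC\<^esub> Add SC f f' = Add SC (g \<cdot>\<^bsub>SC\<^esub> f) (g \<cdot>\<^bsub>SC\<^esub> f')"
      using chainD(1-3)[OF fgh(1)] chainD(1-3)[OF fgh(4)] chainD(1-3)[OF fgh(7)] fgh(2,3,5,6,8,9) by simp
  qed
qed

lemma Sup_preadd: "preadd SC"
  by (intro preadd.intro Sup_preadditive)

text \<open>Kernels are formed in each degree; the differential restricts to them because the given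
  map is a chain map, and equations are tested after the monomorphisms \<open>k\<close>.\<close>

lemma Sup_kernels:
  assumes ker: "has_kernels C" shows "has_kernels SC"
  unfolding has_kernels_def
proof
  interpret S: preadd SC by (rule Sup_preadd)
  fix f assume fS: "f \<in> Ar SC"
  obtain X Y \<phi> where f: "f = Arrow X Y \<phi>" by (cases f)
  have \<phi>: "chain C X Y \<phi>" using fS by (simp add: Sup_Ar f)
  have X: "X \<in> Ob SC" and Y: "Y \<in> Ob SC" using chain_cx[OF \<phi>] by simp_all
  note [simp] = chainD(1-3)[OF \<phi>] cxD[OF X] cxD[OF Y]
  have "\<exists>K k. is_kernel C (\<phi> i) K k" for i using ker chainD(1)[OF \<phi>] unfolding has_kernels_def by blast
  then obtain K k where K: "\<And>i. is_kernel C (\<phi> i) (K i) (k i)" by metis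
  note [simp] = kernelD[OF K chainD(1)[OF \<phi>], unfolded chainD(1-3)[OF \<phi>]]
  have "\<exists>d. d \<in> Ar C \<and> Dom C d = K i \<and> Cod C d = K (i + 1) \<and> k (i + 1) \<cdot> d = bdry X i \<cdot> k i" for i
  proof -
    have "\<phi> (i + 1) \<cdot> bdry X i \<cdot> k i = bdry Y i \<cdot> \<phi> i \<cdot> k i" by (rule chainD(5)[OF \<phi>, symmetric]) simp_all
    then show ?thesis using kernel_lift[OF K, of "i + 1" "bdry X i \<cdot> k i"] by simp
  qed
  then obtain d where d: "\<And>i. d i \<in> Ar C" "\<And>i. Dom C (d i) = K i" "\<And>i. Cod C (d i) = K (i + 1)"
    "\<And>i. k (i + 1) \<cdot> d i = bdry X i \<cdot> k i" by metis
  note [simp] = d(1-3)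
  have d': "k i \<cdot> d (i + 1) = bdry X (i + 1) \<cdot> k (i + 1)" for i using d(4)[of "i + 1"] by simp
  have Kc: "Supercx K d \<in> Ob SC"
  proof (rule cxI; simp)
    fix i
    show "d (i + 1) \<cdot> d i = Zer C (K i) (K i)"
    proof (rule kernel_mono[OF K])
      show "k i \<cdot> d (i + 1) \<cdot> d i = k i \<cdot> Zer C (K i) (K i)"
        using comp_rw[OF d'[of i], of "d i"] by (simp add: d(4))
    qed simp_all
  qed
  have kc: "chain C (Supercx K d) X k"
    using Kc X by (intro chainI deg0I) (simp_all add: d)
  have "is_kernel SC f (Supercx K d) (Arrow (Supercx K d) X k)"
  proof (rule S.kernelI)
    show "Supercx K d \<in> Ob SC" by (rule Kc)
    show "Arrow (Supercx K d) X k \<in> Ar SC" using kc by (simp add: Sup_Ar)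
  next
    fix g assume g: "g \<in> Ar SC" "Cod SC g = Dom SC f"
       "f \<cdot>\<^bsub>SC\<^esub> g = Zer SC (Dom SC g) (Cod SC f)"
    obtain L \<gamma> where gL: "g = Arrow L X \<gamma>" using g(2) by (cases g) (simp add: f)
    have \<gamma>: "chain C L X \<gamma>" using g(1) by (simp add: Sup_Ar gL)
    note [simp] = chainD(1-3)[OF \<gamma>] cxD[OF chain_cx(1)[OF \<gamma>]]
    have \<phi>\<gamma>: "\<phi> i \<cdot> \<gamma> i = Zer C (part L i) (part Y i)" for i
      using g(3) by (simp add: f gL) metis
    have "\<exists>h. h \<in> Ar C \<and> Dom C h = part L i \<and> Cod C h = K i \<and> k i \<cdot> h = \<gamma> i" for i
      using kernel_lift[OF K, of i "\<gamma> i"] \<phi>\<gamma> by simp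
    then obtain h where h: "\<And>i. h i \<in> Ar C" "\<And>i. Dom C (h i) = part L i" "\<And>i. Cod C (h i) = K i" "\<And>i. k i \<cdot> h i = \<gamma> i"
      by metis
    note [simp] = h(1-3)
    have "chain C L (Supercx K d) h"
    proof (intro chainI deg0I Kc chain_cx(1)[OF \<gamma>])
      fix i
      have "d i \<cdot> h i = h (i + 1) \<cdot> bdry L i"
      proof (rule kernel_mono[OF K])
        have "k (i + 1) \<cdot> d i \<cdot> h i = bdry X i \<cdot> \<gamma> i"
          using comp_rw[OF d(4)[of i], of "h i"] by (simp add: h(4))
        also have "\<dots> = k (i + 1) \<cdot> h (i + 1) \<cdot> bdry L i"
          using comp_rw[OF h(4)[of "i + 1"], of "bdry L i"] chainD(4)[OF \<gamma>] by simp
        finally show "k (i + 1) \<cdot> d i \<cdot> h i = k (i + 1) \<cdot> h (i + 1) \<cdot> bdry L i" .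
      qed simp_all
      then show "bdry (Supercx K d) i \<cdot> h i = h (i + 1) \<cdot> bdry L i" by simp
    qed simp_all
    then show "\<exists>h. h \<in> Ar SC \<and> Dom SC h = Dom SC g \<and> Cod SC h = Supercx K d \<and> Arrow (Supercx K d) X k \<cdot>\<^bsub>SC\<^esub> h = g"
      by (intro exI[of _ "Arrow L (Supercx K d) h"]) (simp add: Sup_Ar gL h)
  next
    fix h h' assume h: "h \<in> Ar SC" "h' \<in> Ar SC" "Dom SC h = Dom SC h'"
      "Cod SC h = Supercx K d" "Cod SC h' = Supercx K d"
      "Arrow (Supercx K d) X k \<cdot>\<^bsub>SC\<^esub> h = Arrow (Supercx K d) X k \<cdot>\<^bsub>SC\<^esub> h'"
    obtain L \<eta> \<eta>' where e: "h = Arrow L (Supercx K d) \<eta>" "h' = Arrow L (Supercx K d) \<eta>'"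
      using h(3-5) by (cases h; cases h') simp
    have \<eta>: "chain C L (Supercx K d) \<eta>" "chain C L (Supercx K d) \<eta>'" using h(1,2) by (simp_all add: Sup_Ar e)
    have ke: "(\<lambda>i. k i \<cdot> \<eta> i) = (\<lambda>i. k i \<cdot> \<eta>' i)" using h(6) by (simp add: e)
    have "\<eta> i = \<eta>' i" for i
      by (rule kernel_mono[OF K[of i]]) (use chainD(1-3)[OF \<eta>(1)] chainD(1-3)[OF \<eta>(2)] fun_cong[OF ke, of i] in simp_all)
    then show "h = h'" by (auto simp: e)
  qed (simp_all add: f)
  then show "\<exists>K k. is_kernel SC f K k" by blast
qed

text \<open>\<open>op_cx\<close> identifies supercomplexes over the opposite category with the
  opposite of supercomplexes, so that the construction of kernels also yields cokernels.\<close>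

lemma Sup_cokernels:
  assumes coker: "has_kernels (opadd C)" shows "has_kernels (opadd SC)"
  unfolding has_kernels_def
proof
  interpret S: preadd SC by (rule Sup_preadd)
  interpret O: preadd "opadd C" by (intro preadd.intro opadd_preadditive)
  interpret OS: preadd O.SC by (rule O.Sup_preadd)
  have cx: "op_cx X \<in> Ob O.SC \<longleftrightarrow> X \<in> Ob SC" for X
    by (simp add: Sup_Ob bit_all_iff in_hom_set) blast
  \<comment> \<open>A chain map has the same components in both categories; only source and target
    are exchanged.\<close>
  have ch: "chain (opadd C) (op_cx Y) (op_cx X) \<phi> \<longleftrightarrow> chain C X Y \<phi>" for X Y \<phi>
    by (simp add: chain_def deg0_def cx bit_all_iff in_hom_set) auto
  fix f assume "f \<in> Ar (opadd SC)"
  then have fS: "f \<in> Ar SC" by simp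
  obtain X Y \<phi> where f: "f = Arrow X Y \<phi>" by (cases f)
  have \<phi>: "chain C X Y \<phi>" using fS by (simp add: Sup_Ar f)
  let ?F = "Arrow (op_cx Y) (op_cx X) \<phi>"
  have F: "?F \<in> Ar O.SC" using \<phi> by (simp add: Sup_Ar ch)
  obtain K k where K: "is_kernel O.SC ?F K k" using O.Sup_kernels[OF coker] F unfolding has_kernels_def by blast
  note k = OS.kernelD[OF K F]
  obtain \<kappa> where \<kappa>: "k = Arrow K (op_cx Y) \<kappa>" using k(3,4) by (cases k) simp
  let ?Q = "op_cx K"
  have kc: "chain C Y ?Q \<kappa>" using k(2) ch[of ?Q Y \<kappa>] by (simp add: Sup_Ar \<kappa>)
  have "S.is_cokernel f ?Q (Arrow Y ?Q \<kappa>)"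
  proof (rule S.cokernelI)
    show "?Q \<in> Ob SC" using chain_cx(2)[OF kc] .
    show "Arrow Y ?Q \<kappa> \<in> Ar SC" using kc by (simp add: Sup_Ar)
    show "Arrow Y ?Q \<kappa> \<cdot>\<^bsub>SC\<^esub> f = Zer SC (Dom SC f) ?Q" using k(5) by (simp add: f \<kappa>)
  next
    fix g assume g: "g \<in> Ar SC" "Dom SC g = Cod SC f" "g \<cdot>\<^bsub>SC\<^esub> f = Zer SC (Dom SC f) (Cod SC g)"
    obtain L \<gamma> where gL: "g = Arrow Y L \<gamma>" using g(2) by (cases g) (simp add: f)
    let ?G = "Arrow (op_cx L) (op_cx Y) \<gamma>"
    have "?G \<in> Ar O.SC" using g(1) by (simp add: Sup_Ar gL ch)
    then obtain h where h: "h \<in> Ar O.SC" "Dom O.SC h = Dom O.SC ?G" "Cod O.SC h = K" "k \<cdot>\<^bsub>O.SC\<^esub> h = ?G"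
      using OS.kernel_lift[OF K F, of ?G] g(3) by (auto simp: f gL)
    obtain \<eta> where \<eta>: "h = Arrow (op_cx L) K \<eta>" using h(2,3) by (cases h) simp
    show "\<exists>h. h \<in> Ar SC \<and> Cod SC h = Cod SC g \<and> Dom SC h = ?Q \<and> h \<cdot>\<^bsub>SC\<^esub> Arrow Y ?Q \<kappa> = g"
      using h(1,4) ch[of L ?Q \<eta>] by (intro exI[of _ "Arrow ?Q L \<eta>"]) (simp add: Sup_Ar gL \<eta> \<kappa>)
  next
    fix h h' assume h: "h \<in> Ar SC" "h' \<in> Ar SC" "Cod SC h = Cod SC h'" "Dom SC h = ?Q" "Dom SC h' = ?Q"
      "h \<cdot>\<^bsub>SC\<^esub> Arrow Y ?Q \<kappa> = h' \<cdot>\<^bsub>SC\<^esub> Arrow Y ?Q \<kappa>"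
    obtain L \<eta> \<eta>' where e: "h = Arrow ?Q L \<eta>" "h' = Arrow ?Q L \<eta>'" using h(3-5) by (cases h; cases h') simp
    have "Arrow (op_cx L) K \<eta> = Arrow (op_cx L) K \<eta>'"
      by (rule OS.kernel_mono[OF K F]) (use h(1,2,6) ch[of L ?Q \<eta>] ch[of L ?Q \<eta>'] in \<open>simp_all add: Sup_Ar e \<kappa>\<close>)
    then show "h = h'" by (simp add: e)
  qed (simp_all add: f)
  then show "\<exists>K k. is_kernel (opadd SC) f K k" by blast
qed

end

text \<open>A biproduct is the twisted sum for the zero cycle, whose section and retraction are
  chain maps.\<close>

lemma (in additive) Sup_additive: "additive SC"
proof -
  interpret S: preadd SC by (rule Sup_preadd)
  have "additive_category SC"
  proof
    obtain z where z: "z \<in> Ob C" "\<forall>a\<in>Ob C. (\<exists>!f. f \<in> hom_set C z a) \<and> (\<exists>!f. f \<in> hom_set C a z)"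
      using zero_object by (rule bexE)
    have to: "f = Zer C (Dom C f) z" if "f \<in> Ar C" "Cod C f = z" for f
    proof -
      have "\<exists>!g. g \<in> hom_set C (Dom C f) z" using z(2) that(1) by simp
      moreover have "f \<in> hom_set C (Dom C f) z" "Zer C (Dom C f) z \<in> hom_set C (Dom C f) z" using that z(1) by (simp_all add: in_hom_set)
      ultimately show ?thesis by blast
    qed
    have "from": "f = Zer C z (Cod C f)" if "f \<in> Ar C" "Dom C f = z" for f
    proof -
      have "\<exists>!g. g \<in> hom_set C z (Cod C f)" using z(2) that(1) by simp
      moreover have "f \<in> hom_set C z (Cod C f)" "Zer C z (Cod C f) \<in> hom_set C z (Cod C f)" using that z(1) by (simp_all add: in_hom_set)
      ultimately show ?thesis by blast
    qed
    let ?Z = "Supercx (\<lambda>_. z) (\<lambda>_. Zer C z z)"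
    have Z: "?Z \<in> Ob SC" using z(1) by (intro cxI) simp_all
    have "(\<exists>!f. f \<in> hom_set SC ?Z X) \<and> (\<exists>!f. f \<in> hom_set SC X ?Z)" if X: "X \<in> Ob SC" for X
    proof
      show "\<exists>!f. f \<in> hom_set SC ?Z X"
      proof (rule ex1I)
        show "Zer SC ?Z X \<in> hom_set SC ?Z X" by (rule S.Zer_hom[OF Z X])
        fix f assume "f \<in> hom_set SC ?Z X"
        then obtain \<phi> where f: "f = Arrow ?Z X \<phi>" "chain C ?Z X \<phi>" by (cases f) (auto simp: in_hom_set Sup_Ar)
        have "\<phi> i = Zer C z (part X i)" for i using "from"[of "\<phi> i"] chainD(1-3)[OF f(2), of i] by simp
        then show "f = Zer SC ?Z X" by (auto simp: f(1))
      qed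
      show "\<exists>!f. f \<in> hom_set SC X ?Z"
      proof (rule ex1I)
        show "Zer SC X ?Z \<in> hom_set SC X ?Z" by (rule S.Zer_hom[OF X Z])
        fix f assume "f \<in> hom_set SC X ?Z"
        then obtain \<phi> where f: "f = Arrow X ?Z \<phi>" "chain C X ?Z \<phi>" by (cases f) (auto simp: in_hom_set Sup_Ar)
        have "\<phi> i = Zer C (part X i) z" for i using to[of "\<phi> i"] chainD(1-3)[OF f(2), of i] by simp
        then show "f = Zer SC X ?Z" by (auto simp: f(1))
      qed
    qed
    then show "\<exists>z\<in>Ob SC. \<forall>a\<in>Ob SC. (\<exists>!f. f \<in> hom_set SC z a) \<and> (\<exists>!f. f \<in> hom_set SC a z)"
      using Z by blast
  next
    fix X Y assume X: "X \<in> Ob SC" and Y: "Y \<in> Ob SC"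
    let ?u = "\<lambda>i. Zer C (part X i) (part Y (i + 1))"
    note [simp] = cxD[OF X] cxD[OF Y]
    have "anti C X Y ?u" using X Y by (intro antiI deg1I) simp_all
    from twist_ex[OF this] obtain T j p k r where T: "twist C X Y ?u T j p k r" by blast
    note D = twistD[OF T]
    note [simp] = deg0D[OF D(2)] chainD(1-3)[OF D(3)] chainD(1-3)[OF D(4)] deg0D[OF D(5)] cxD[OF D(1)]
    have j: "chain C X T j" unfolding chain_iff_bd0 using D(1,2) D(11) by simp
    have r: "chain C T Y r" unfolding chain_iff_bd0 using D(1,5) D(12) by simp
    show "\<exists>s\<in>Ob SC. \<exists>i\<in>hom_set SC X s. \<exists>j\<in>hom_set SC Y s. \<exists>p\<in>hom_set SC s X. \<exists>q\<in>hom_set SC s Y.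
           p \<cdot>\<^bsub>SC\<^esub> i = Id SC X \<and> q \<cdot>\<^bsub>SC\<^esub> j = Id SC Y \<and> p \<cdot>\<^bsub>SC\<^esub> j = Zer SC Y X \<and> q \<cdot>\<^bsub>SC\<^esub> i = Zer SC X Y \<and>
           Add SC (i \<cdot>\<^bsub>SC\<^esub> p) (j \<cdot>\<^bsub>SC\<^esub> q) = Id SC s"
      by (intro bexI[of _ T] bexI[of _ "Arrow X T j"] bexI[of _ "Arrow Y T k"] bexI[of _ "Arrow T X p"] bexI[of _ "Arrow T Y r"])
        (use D(1,3,4) j r in \<open>simp_all add: in_hom_set Sup_Ar D(6-10)\<close>)
  qed
  then show ?thesis by (intro additive.intro Sup_preadd)
qed

section \<open>The category of pro-objects\<close>

definition tow where
  "tow C = {X. \<forall>n. level X n \<in> Ob C \<and> bond X n \<in> hom_set C (level X (Suc n)) (level X n)}"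

context category
begin

lemma towD:
  assumes "X \<in> tow C"
  shows "level X n \<in> Ob C" "bond X n \<in> Ar C" "Dom C (bond X n) = level X (Suc n)" "Cod C (bond X n) = level X n"
  using assms by (auto simp: tow_def in_hom_set)

lemma towI:
  assumes "\<And>n. level X n \<in> Ob C" "\<And>n. bond X n \<in> Ar C" "\<And>n. Dom C (bond X n) = level X (Suc n)" "\<And>n. Cod C (bond X n) = level X n"
  shows "X \<in> tow C"
  using assms by (auto simp: tow_def in_hom_set)

lemma transit_refl: "transit C X n n = Id C (level X n)"
  by (cases n) auto

lemma transit_Ar:
  assumes X: "X \<in> tow C" and "m \<le> n"
  shows "transit C X n m \<in> Ar C" "Dom C (transit C X n m) = level X n" "Cod C (transit C X n m) = level X m"
proof -
  have "transit C X n m \<in> Ar C \<and> Dom C (transit C X n m) = level X n \<and> Cod C (transit C X n m) = level X m"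
    using assms(2)
  proof (induction n)
    case 0 then show ?case using towD[OF X] by simp
  next
    case (Suc n)
    then show ?case using towD[OF X] le_Suc_eq[of m n] by auto
  qed
  then show "transit C X n m \<in> Ar C" "Dom C (transit C X n m) = level X n" "Cod C (transit C X n m) = level X m"
    by auto
qed

lemma transit_Suc: "m \<le> n \<Longrightarrow> transit C X (Suc n) m = transit C X n m \<cdot> bond X n"
  by simp

lemma transit_bond: "X \<in> tow C \<Longrightarrow> transit C X (Suc n) n = bond X n"
  using towD[of X] by (simp add: transit_refl)

lemma transit_trans:
  assumes X: "X \<in> tow C" and "l \<le> m" "m \<le> n"
  shows "transit C X m l \<cdot> transit C X n m = transit C X n l"
  using assms(3)
proof (induction n)
  case 0
  then show ?case using assms towD[OF X] by simp
next
  case (Suc n)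
  show ?case
  proof (cases "m \<le> n")
    case True
    then show ?thesis using Suc.IH transit_Ar[OF X] towD[OF X] assms(2)
      by (simp add: comp_rw)
  next
    case False
    then have "m = Suc n" using Suc.prems by simp
    then show ?thesis using transit_Ar[OF X assms(2)] transit_refl[of X "Suc n"] by simp
  qed
qed

lemma bond_transit: "X \<in> tow C \<Longrightarrow> Suc m \<le> n \<Longrightarrow> bond X m \<cdot> transit C X n (Suc m) = transit C X n m"
  using transit_trans[of X m "Suc m" n] transit_bond[of X m] by simp

declare transit.simps [simp del]

lemma transit_trans':
  assumes "X \<in> tow C" "l \<le> m" "m \<le> n" "x \<in> Ar C" "Cod C x = level X n"
  shows "transit C X m l \<cdot> transit C X n m \<cdot> x = transit C X n l \<cdot> x"
  using comp_rw[OF transit_trans[OF assms(1-3)], of x] assms transit_Ar[of X] by simp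

lemma germ_rel_iff:
  "((m, f), (m', f')) \<in> germ_rel C X b \<longleftrightarrow> f \<in> hom_set C (level X m) b \<and> f' \<in> hom_set C (level X m') b \<and>
        (\<exists>k. m \<le> k \<and> m' \<le> k \<and> f \<cdot> transit C X k m = f' \<cdot> transit C X k m')"
  by (simp add: germ_rel_def)

lemma germ_rel_raise:
  assumes X: "X \<in> tow C" and f: "f \<in> hom_set C (level X m) b" and f': "f' \<in> hom_set C (level X m') b"
    and k: "m \<le> k" "m' \<le> k" "f \<cdot> transit C X k m = f' \<cdot> transit C X k m'" and "k \<le> l"
  shows "f \<cdot> transit C X l m = f' \<cdot> transit C X l m'"
proof -
  have f: "f \<in> Ar C" "Dom C f = level X m" and f': "f' \<in> Ar C" "Dom C f' = level X m'" using f f' by (auto simp: in_hom_set)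
  have "(f \<cdot> transit C X k m) \<cdot> transit C X l k = (f' \<cdot> transit C X k m') \<cdot> transit C X l k" using k by simp
  then show ?thesis
    using f f' k(1,2) assms(7) transit_Ar[OF X k(1)] transit_Ar[OF X k(2)] transit_Ar[OF X assms(7)]
      transit_trans[OF X k(1) assms(7)] transit_trans[OF X k(2) assms(7)] by simp
qed

lemma germ_rel_equiv:
  assumes X: "X \<in> tow C"
  shows "equiv (SIGMA m:UNIV. hom_set C (level X m) b) (germ_rel C X b)"
proof (rule equivI)
  show "germ_rel C X b \<subseteq> (SIGMA m:UNIV. hom_set C (level X m) b) \<times> (SIGMA m:UNIV. hom_set C (level X m) b)"
    by (auto simp: germ_rel_def)
  show "refl_on (SIGMA m:UNIV. hom_set C (level X m) b) (germ_rel C X b)"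
    by (auto simp: refl_on_def germ_rel_def)
  show "sym (germ_rel C X b)"
  proof (rule symI)
    fix x y assume xy: "(x, y) \<in> germ_rel C X b"
    obtain m f n g where e: "x = (m, f)" "y = (n, g)" by (metis surj_pair)
    obtain k where k: "m \<le> k" "n \<le> k" "f \<cdot> transit C X k m = g \<cdot> transit C X k n"
      and f: "f \<in> hom_set C (level X m) b" and g: "g \<in> hom_set C (level X n) b" using xy by (auto simp: e germ_rel_iff)
    from k f g show "(y, x) \<in> germ_rel C X b" unfolding e germ_rel_iff by (intro conjI exI[of _ k]) simp_all
  qed
  show "trans (germ_rel C X b)"
  proof (rule transI)
    fix x y z assume xy: "(x, y) \<in> germ_rel C X b" and yz: "(y, z) \<in> germ_rel C X b"
    obtain m f n g p h where e: "x = (m, f)" "y = (n, g)" "z = (p, h)" by (metis surj_pair)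
    obtain k where k: "m \<le> k" "n \<le> k" "f \<cdot> transit C X k m = g \<cdot> transit C X k n"
      and f: "f \<in> hom_set C (level X m) b" and g: "g \<in> hom_set C (level X n) b" using xy by (auto simp: e germ_rel_iff)
    obtain l where l: "n \<le> l" "p \<le> l" "g \<cdot> transit C X l n = h \<cdot> transit C X l p"
      and h: "h \<in> hom_set C (level X p) b" using yz by (auto simp: e germ_rel_iff)
    have "f \<cdot> transit C X (max k l) m = g \<cdot> transit C X (max k l) n" by (rule germ_rel_raise[OF X f g k]) simp
    also have "\<dots> = h \<cdot> transit C X (max k l) p" by (rule germ_rel_raise[OF X g h l]) simp
    finally show "(x, z) \<in> germ_rel C X b" using f h k l by (auto simp: e germ_rel_iff intro!: exI[of _ "max k l"])
  qed
qed

lemma germ_self: "f \<in> hom_set C (level X m) b \<Longrightarrow> (m, f) \<in> germ C X b m f"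
  by (auto simp: germ_def germ_rel_iff)

lemma colim_homE:
  assumes X: "X \<in> tow C" and "c \<in> colim_hom C X b"
  obtains m f where "f \<in> hom_set C (level X m) b" "c = germ C X b m f"
  using assms unfolding colim_hom_def germ_def by (auto elim!: quotientE)

lemma germ_in_colim: "f \<in> hom_set C (level X m) b \<Longrightarrow> germ C X b m f \<in> colim_hom C X b"
  unfolding colim_hom_def germ_def by (rule quotientI) simp

lemma colim_eq_germ:
  assumes X: "X \<in> tow C" and "c \<in> colim_hom C X b" "(m, f) \<in> c"
  shows "c = germ C X b m f" "f \<in> hom_set C (level X m) b"
proof -
  obtain m' f' where c: "f' \<in> hom_set C (level X m') b" "c = germ C X b m' f'" using colim_homE[OF assms(1,2)] .
  then have "((m', f'), (m, f)) \<in> germ_rel C X b" using assms(3) by (simp add: germ_def)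
  then show "c = germ C X b m f" "f \<in> hom_set C (level X m) b"
    using c equiv_class_eq[OF germ_rel_equiv[OF X]] by (auto simp: germ_def germ_rel_iff)
qed

lemma germ_eq_iff:
  assumes X: "X \<in> tow C" and f: "f \<in> hom_set C (level X m) b" and f': "f' \<in> hom_set C (level X m') b"
  shows "germ C X b m f = germ C X b m' f' \<longleftrightarrow> (\<exists>k. m \<le> k \<and> m' \<le> k \<and> f \<cdot> transit C X k m = f' \<cdot> transit C X k m')"
  unfolding germ_def
  using eq_equiv_class_iff[OF germ_rel_equiv[OF X], of "(m, f)" b "(m', f')"] f f' by (simp add: germ_rel_iff)

lemma germ_raise:
  assumes X: "X \<in> tow C" and f: "f \<in> hom_set C (level X m) b" and "m \<le> k"
  shows "germ C X b k (f \<cdot> transit C X k m) = germ C X b m f"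
proof -
  have "f \<cdot> transit C X k m \<in> hom_set C (level X k) b" using f transit_Ar[OF X assms(3)] by (simp add: in_hom_set)
  then show ?thesis
    using germ_eq_iff[OF X _ f, of "f \<cdot> transit C X k m" k] f transit_Ar[OF X] transit_trans[OF X] assms(3)
    by (auto simp: in_hom_set intro!: exI[of _ k])
qed

lemma germ_mem_iff:
  assumes X: "X \<in> tow C" and f: "f \<in> hom_set C (level X m) b"
  shows "(m', f') \<in> germ C X b m f \<longleftrightarrow> f' \<in> hom_set C (level X m') b \<and> germ C X b m' f' = germ C X b m f"
proof -
  have "(m', f') \<in> germ C X b m f \<longleftrightarrow>
      f' \<in> hom_set C (level X m') b \<and> (\<exists>k. m \<le> k \<and> m' \<le> k \<and> f \<cdot> transit C X k m = f' \<cdot> transit C X k m')"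
    using f by (simp add: germ_def germ_rel_iff)
  then show ?thesis using germ_eq_iff[OF X f, of f' m'] by metis
qed

lemma postcomp_germ:
  assumes X: "X \<in> tow C" and f: "f \<in> hom_set C (level X m) a" and g: "g \<in> hom_set C a b"
  shows "postcomp C X g (germ C X a m f) = germ C X b m (g \<cdot> f)"
proof -
  have gf: "g \<cdot> f' \<in> hom_set C (level X m') b" if "f' \<in> hom_set C (level X m') a" for f' m'
    using that g by (simp add: in_hom_set)
  have "germ C X b m' (g \<cdot> f') = germ C X b m (g \<cdot> f)" if "(m', f') \<in> germ C X a m f" for m' f'
  proof -
    have f': "f' \<in> hom_set C (level X m') a" "germ C X a m' f' = germ C X a m f" using that germ_mem_iff[OF X f] by auto
    obtain k where k: "m' \<le> k" "m \<le> k" "f' \<cdot> transit C X k m' = f \<cdot> transit C X k m" using germ_eq_iff[OF X f'(1) f] f'(2) by auto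
    then have "(g \<cdot> f') \<cdot> transit C X k m' = (g \<cdot> f) \<cdot> transit C X k m"
      using f f'(1) g transit_Ar[OF X] by (simp add: in_hom_set)
    then show ?thesis using germ_eq_iff[OF X gf[OF f'(1)] gf[OF f]] k by blast
  qed
  then have "(\<lambda>(m', f'). germ C X b m' (g \<cdot> f')) x = germ C X b m (g \<cdot> f)" if "x \<in> germ C X a m f" for x
    using that by (cases x) simp
  then have "(\<Union>x\<in>germ C X a m f. (\<lambda>(m', f'). germ C X b m' (g \<cdot> f')) x) = germ C X b m (g \<cdot> f)"
    using germ_self[OF f] by blast
  moreover have "postcomp C X g c = (\<Union>x\<in>c. (\<lambda>(m', f'). germ C X b m' (g \<cdot> f')) x)" for c
    using g by (auto simp: postcomp_def germ_def in_hom_set)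
  ultimately show ?thesis by simp
qed

end

lemma Pro_Ob [simp]: "Ob (Pro C) = tow C"
  and Pro_simps [simp]: "Dom (Pro C) = src" "Cod (Pro C) = tgt"
  by (simp_all add: Pro_def Let_def tow_def)

lemma Pro_Id: "Id (Pro C) X = Arrow X X (\<lambda>n. germ C X (level X n) n (Id C (level X n)))"
  and Pro_Comp: "G \<cdot>\<^bsub>Pro C\<^esub> F = Arrow (src F) (tgt G) (\<lambda>n. \<Union>(m, g)\<in>body G n. postcomp C (src F) g (body F m))"
  and Pro_Add: "Add (Pro C) F G = Arrow (src F) (tgt F)
                   (\<lambda>n. germ_rel C (src F) (level (tgt F) n) ``
                          {(k, Add C f g) | k f g. (k, f) \<in> body F n \<and> (k, g) \<in> body G n})"
  and Pro_Zer: "Zer (Pro C) X Y = Arrow X Y (\<lambda>n. germ C X (level Y n) 0 (Zer C (level X 0) (level Y n)))"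
  by (simp_all add: Pro_def Let_def)

lemma Pro_Ar: "F \<in> Ar (Pro C) \<longleftrightarrow> src F \<in> tow C \<and> tgt F \<in> tow C \<and>
   (\<forall>n. body F n \<in> colim_hom C (src F) (level (tgt F) n) \<and>
        postcomp C (src F) (bond (tgt F) n) (body F (Suc n)) = body F n)"
  by (cases F) (auto simp: Pro_def Let_def tow_def)

text \<open>\<open>f\<close>, defined on level \<open>m\<close> of the source, represents the component of \<open>F\<close> at level \<open>n\<close> of the target.\<close>

definition rep where "rep F n m f \<longleftrightarrow> (m, f) \<in> body F n"

text \<open>A pro-map given by chosen representatives: \<open>f n\<close>, defined on level
  \<open>m n\<close> of the source, maps to level \<open>n\<close> of the target.\<close>

definition pro_ar :: "('o, 'm, 'x) cat_scheme \<Rightarrow> ('o, 'm) tower \<Rightarrow> ('o, 'm) tower \<Rightarrow> (nat \<Rightarrow> nat) \<Rightarrow> (nat \<Rightarrow> 'm) \<Rightarrow> ('o, 'm) pro_arrow" where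
  "pro_ar C X Y m f = Arrow X Y (\<lambda>n. germ C X (level Y n) (m n) (f n))"

context preadd
begin

lemma Pro_hom_tow: "F \<in> hom_set PA X Y \<Longrightarrow> X \<in> tow C" "F \<in> hom_set PA X Y \<Longrightarrow> Y \<in> tow C"
  by (auto simp: in_hom_set Pro_Ar)

lemma rep_body:
  assumes "F \<in> hom_set PA X Y" "rep F n m f"
  shows "body F n = germ C X (level Y n) m f" "f \<in> Ar C" "Dom C f = level X m" "Cod C f = level Y n"
proof -
  have *: "X \<in> tow C" "body F n \<in> colim_hom C X (level Y n)" using assms by (auto simp: in_hom_set Pro_Ar)
  show "body F n = germ C X (level Y n) m f" "f \<in> Ar C" "Dom C f = level X m" "Cod C f = level Y n"
    using colim_eq_germ[OF * assms(2)[unfolded rep_def]] by (auto simp: in_hom_set)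
qed

lemma rep_iff:
  assumes "F \<in> hom_set PA X Y"
  shows "rep F n m f \<longleftrightarrow> f \<in> hom_set C (level X m) (level Y n) \<and> body F n = germ C X (level Y n) m f"
  using rep_body[OF assms, of n m f] germ_self[of f X m "level Y n"] by (auto simp: rep_def in_hom_set)

lemma rep_ex:
  assumes "F \<in> hom_set PA X Y" obtains m f where "rep F n m f"
proof -
  have *: "X \<in> tow C" "body F n \<in> colim_hom C X (level Y n)" using assms by (auto simp: in_hom_set Pro_Ar)
  obtain m f where "f \<in> hom_set C (level X m) (level Y n)" "body F n = germ C X (level Y n) m f" using colim_homE[OF *] .
  then show thesis using that[of m f] rep_iff[OF assms] by blast
qed

lemma rep_raise:
  assumes F: "F \<in> hom_set PA X Y" and r: "rep F n m f" and "m \<le> k"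
  shows "rep F n k (f \<cdot> tr X k m)"
  using rep_body[OF F r] transit_Ar[OF Pro_hom_tow(1)[OF F] assms(3)]
    germ_raise[OF Pro_hom_tow(1)[OF F], of f m "level Y n" k] assms(3)
  by (auto simp: rep_iff[OF F] in_hom_set)

lemma rep_eq:
  assumes F: "F \<in> hom_set PA X Y" and r: "rep F n m f" "rep F n m' f'"
  obtains k where "m \<le> k" "m' \<le> k" "f \<cdot> tr X k m = f' \<cdot> tr X k m'"
  using r germ_eq_iff[OF Pro_hom_tow(1)[OF F], of f m "level Y n" f' m'] by (auto simp: rep_iff[OF F])

lemma rep_eqI:
  assumes F: "F \<in> hom_set PA X Y" and r: "rep F n m f" and f': "f' \<in> hom_set C (level X m') (level Y n)"
    and k: "m \<le> k" "m' \<le> k" "f \<cdot> tr X k m = f' \<cdot> tr X k m'"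
  shows "rep F n m' f'"
  using r k f' germ_eq_iff[OF Pro_hom_tow(1)[OF F], of f m "level Y n" f' m'] by (auto simp: rep_iff[OF F])

lemma rep_bond:
  assumes F: "F \<in> hom_set PA X Y" and r: "rep F (Suc n) m f"
  shows "rep F n m (bond Y n \<cdot> f)"
proof -
  note X = Pro_hom_tow(1)[OF F] and Y = Pro_hom_tow(2)[OF F]
  note f = rep_body[OF F r]
  have "postcomp C X (bond Y n) (body F (Suc n)) = body F n" using F by (auto simp: in_hom_set Pro_Ar)
  then have "body F n = postcomp C X (bond Y n) (germ C X (level Y (Suc n)) m f)"
    unfolding f(1) by simp
  also have "\<dots> = germ C X (level Y n) m (bond Y n \<cdot> f)"
    by (rule postcomp_germ[OF X]) (use f towD[OF Y] in \<open>auto simp: in_hom_set\<close>)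
  finally show ?thesis using f towD[OF Y] by (auto simp: rep_iff[OF F] in_hom_set)
qed

lemma rep_transit:
  assumes F: "F \<in> hom_set PA X Y" and r: "rep F n m f" and "l \<le> n"
  shows "rep F l m (tr Y n l \<cdot> f)"
  using assms(3) r
proof (induction n arbitrary: f)
  case 0
  then show ?case using rep_body[OF F 0(2)] by (simp add: transit_refl)
next
  case (Suc n)
  note Y = Pro_hom_tow(2)[OF F]
  note f = rep_body[OF F Suc.prems(2)]
  show ?case
  proof (cases "l \<le> n")
    case True
    then show ?thesis using Suc.IH[OF True rep_bond[OF F Suc.prems(2)]] f towD[OF Y] transit_Ar[OF Y True]
      by (simp add: transit_Suc)
  next
    case False
    then have "l = Suc n" using Suc.prems by simp
    then show ?thesis using Suc.prems(2) f by (simp add: transit_refl)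
  qed
qed

text \<open>A germ class is determined by any of its members. Identities between pro-maps are
  therefore proved by exhibiting one common representative at each level.\<close>

lemma pro_eqI:
  assumes F: "F \<in> hom_set PA X Y" and G: "G \<in> hom_set PA X Y"
    and "\<And>n. \<exists>m f. rep F n m f \<and> rep G n m f"
  shows "F = G"
proof -
  have "body F n = body G n" for n using assms(3)[of n] rep_iff[OF F] rep_iff[OF G] by metis
  then show ?thesis using F G by (cases F; cases G) (auto simp: in_hom_set)
qed

lemma pro_ar_hom:
  assumes X: "X \<in> tow C" and Y: "Y \<in> tow C" and f: "\<And>n. f n \<in> Ar C" "\<And>n. Dom C (f n) = level X (m n)" "\<And>n. Cod C (f n) = level Y n"
    and c: "\<And>n. \<exists>k. m n \<le> k \<and> m (Suc n) \<le> k \<and> (bond Y n \<cdot> f (Suc n)) \<cdot> tr X k (m (Suc n)) = f n \<cdot> tr X k (m n)"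
  shows "pro_ar C X Y m f \<in> hom_set PA X Y" "rep (pro_ar C X Y m f) n (m n) (f n)"
proof -
  have f': "f n \<in> hom_set C (level X (m n)) (level Y n)" for n using f by (simp add: in_hom_set)
  have b: "bond Y n \<in> hom_set C (level Y (Suc n)) (level Y n)" for n using towD[OF Y] by (simp add: in_hom_set)
  have bf: "bond Y n \<cdot> f (Suc n) \<in> hom_set C (level X (m (Suc n))) (level Y n)" for n using f towD[OF Y] by (simp add: in_hom_set)
  show h: "pro_ar C X Y m f \<in> hom_set PA X Y"
    unfolding in_hom_set Pro_Ar pro_ar_def using X Y germ_in_colim[OF f'] postcomp_germ[OF X f' b] germ_eq_iff[OF X bf f'] c
    by simp blast
  show "rep (pro_ar C X Y m f) n (m n) (f n)" unfolding rep_iff[OF h] using f' by (simp add: pro_ar_def)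
qed

text \<open>The union in the definition of composition collapses: two representatives of
  \<open>G\<close> agree after transit to a common level, and the components of \<open>F\<close> are
  compatible with transit, so all contribute the same class.\<close>

lemma Pro_Comp_rep:
  assumes F: "F \<in> hom_set PA X Y" and G: "G \<in> hom_set PA Y Z"
  shows "G \<star> F \<in> hom_set PA X Z"
    "\<lbrakk>rep G n m g; rep F m k f\<rbrakk> \<Longrightarrow> rep (G \<star> F) n k (g \<cdot> f)"
proof -
  note X = Pro_hom_tow(1)[OF F] and Y = Pro_hom_tow(2)[OF F] and Z = Pro_hom_tow(2)[OF G]
  have src: "src F = X" "tgt F = Y" "src G = Y" "tgt G = Z" using F G by (auto simp: in_hom_set)
  have body: "body (G \<star> F) n = germ C X (level Z n) k (g \<cdot> f)" if g: "rep G n m g" and f: "rep F m k f" for n m g k f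
  proof -
    note gb = rep_body[OF G g] and fb = rep_body[OF F f]
    have gf: "g \<cdot> f \<in> hom_set C (level X k) (level Z n)" using gb fb by (simp add: in_hom_set)
    have *: "postcomp C X g' (body F m') = germ C X (level Z n) k (g \<cdot> f)" if g': "rep G n m' g'" for m' g'
    proof -
      note gb' = rep_body[OF G g']
      obtain l where l: "m \<le> l" "m' \<le> l" "g \<cdot> tr Y l m = g' \<cdot> tr Y l m'" using rep_eq[OF G g g'] .
      \<comment> \<open>A representative of \<open>F\<close> at the level \<open>l\<close> where
        \<open>g\<close> and \<open>g'\<close> agree serves both of them after transit.\<close>
      obtain k' f' where f': "rep F l k' f'" using rep_ex[OF F] .
      note fb' = rep_body[OF F f']
      note r = rep_transit[OF F f' l(1)] and r' = rep_transit[OF F f' l(2)]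
      note rb = rep_body[OF F r] and rb' = rep_body[OF F r']
      obtain k'' where k'': "k' \<le> k''" "k \<le> k''" "(tr Y l m \<cdot> f') \<cdot> tr X k'' k' = f \<cdot> tr X k'' k"
        using rep_eq[OF F r f] .
      note t = transit_Ar[OF Y l(1)] transit_Ar[OF Y l(2)] transit_Ar[OF X k''(1)] transit_Ar[OF X k''(2)]
      have "g' \<cdot> tr Y l m' \<cdot> f' = g \<cdot> tr Y l m \<cdot> f'"
        using arg_cong[OF l(3), of "\<lambda>x. x \<cdot> f'"] gb gb' fb' t by simp
      then have "(g' \<cdot> tr Y l m' \<cdot> f') \<cdot> tr X k'' k' = (g \<cdot> f) \<cdot> tr X k'' k"
        using k''(3) gb gb' fb fb' t by simp
      moreover have "g' \<cdot> tr Y l m' \<cdot> f' \<in> hom_set C (level X k') (level Z n)"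
        using gb' fb' t by (simp add: in_hom_set)
      ultimately have "germ C X (level Z n) k' (g' \<cdot> tr Y l m' \<cdot> f') = germ C X (level Z n) k (g \<cdot> f)"
        using germ_eq_iff[OF X _ gf] k''(1,2) by blast
      moreover have "postcomp C X g' (body F m') = germ C X (level Z n) k' (g' \<cdot> tr Y l m' \<cdot> f')"
        unfolding rb'(1) by (rule postcomp_germ[OF X]) (use rb' gb' in \<open>auto simp: in_hom_set\<close>)
      ultimately show ?thesis by simp
    qed
    have "body (G \<star> F) n = (\<Union>(m, g)\<in>body G n. postcomp C X g (body F m))"
      by (simp add: Pro_Comp src)
    also have "\<dots> = germ C X (level Z n) k (g \<cdot> f)" using * g unfolding rep_def by auto
    finally show ?thesis .
  qed
  have ex: "\<exists>m g k f. rep G n m g \<and> rep F m k f" for n using rep_ex[OF G] rep_ex[OF F] by metis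
  have "body (G \<star> F) n \<in> colim_hom C X (level Z n) \<and>
        postcomp C X (bond Z n) (body (G \<star> F) (Suc n)) = body (G \<star> F) n" for n
  proof -
    obtain m g k f where g: "rep G (Suc n) m g" and f: "rep F m k f" using ex by blast
    note gb = rep_body[OF G g] and fb = rep_body[OF F f] and b = towD[OF Z]
    have e: "body (G \<star> F) n = germ C X (level Z n) k ((bond Z n \<cdot> g) \<cdot> f)" by (rule body[OF rep_bond[OF G g] f])
    have "postcomp C X (bond Z n) (germ C X (level Z (Suc n)) k (g \<cdot> f)) = germ C X (level Z n) k (bond Z n \<cdot> g \<cdot> f)"
      by (rule postcomp_germ[OF X]) (use gb fb b in \<open>auto simp: in_hom_set\<close>)
    then show ?thesis
      using body[OF g f] e gb fb b by (simp add: germ_in_colim in_hom_set)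
  qed
  then show h: "G \<star> F \<in> hom_set PA X Z"
    unfolding in_hom_set Pro_Ar using X Z src by (simp add: Pro_Comp)
  show "\<lbrakk>rep G n m g; rep F m k f\<rbrakk> \<Longrightarrow> rep (G \<star> F) n k (g \<cdot> f)"
    unfolding rep_iff[OF h] using body[of n m g k f] rep_body[OF G, of n m g] rep_body[OF F, of m k f] by (auto simp: in_hom_set)
qed

lemma Pro_Id_rep:
  assumes X: "X \<in> tow C"
  shows "Id PA X \<in> hom_set PA X X" "rep (Id PA X) n n (Id C (level X n))"
proof -
  have e: "Id PA X = pro_ar C X X (\<lambda>n. n) (\<lambda>n. Id C (level X n))" by (simp add: Pro_Id pro_ar_def)
  have c: "\<exists>k. n \<le> k \<and> Suc n \<le> k \<and> (bond X n \<cdot> Id C (level X (Suc n))) \<cdot> tr X k (Suc n) = Id C (level X n) \<cdot> tr X k n" for n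
    using towD[OF X] by (intro exI[of _ "Suc n"]) (simp add: transit_refl transit_bond[OF X])
  show "Id PA X \<in> hom_set PA X X" "rep (Id PA X) n n (Id C (level X n))"
    unfolding e by (rule pro_ar_hom[OF X X]; use towD[OF X] c in simp)+
qed

lemma Pro_Zer_rep:
  assumes X: "X \<in> tow C" and Y: "Y \<in> tow C"
  shows "Zer PA X Y \<in> hom_set PA X Y" "rep (Zer PA X Y) n m (Zer C (level X m) (level Y n))"
proof -
  have e: "Zer PA X Y = pro_ar C X Y (\<lambda>n. 0) (\<lambda>n. Zer C (level X 0) (level Y n))" by (simp add: Pro_Zer pro_ar_def)
  have h: "Zer PA X Y \<in> hom_set PA X Y" "rep (Zer PA X Y) n 0 (Zer C (level X 0) (level Y n))"
    unfolding e by (rule pro_ar_hom[OF X Y]; use towD[OF X] towD[OF Y] in auto)+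
  then show "Zer PA X Y \<in> hom_set PA X Y" "rep (Zer PA X Y) n m (Zer C (level X m) (level Y n))"
    using rep_raise[OF h, of m] transit_Ar[OF X, of 0 m] towD[OF X] towD[OF Y] by simp_all
qed

lemma Pro_Add_rep:
  assumes F: "F \<in> hom_set PA X Y" and G: "G \<in> hom_set PA X Y"
  shows "Add PA F G \<in> hom_set PA X Y"
    "\<lbrakk>rep F n m f; rep G n m g\<rbrakk> \<Longrightarrow> rep (Add PA F G) n m (f \<boxplus> g)"
proof -
  note X = Pro_hom_tow(1)[OF F] and Y = Pro_hom_tow(2)[OF F]
  have src: "src F = X" "tgt F = Y" using F by (auto simp: in_hom_set)
  have body: "body (Add PA F G) n = germ C X (level Y n) m (f \<boxplus> g)" if f: "rep F n m f" and g: "rep G n m g" for n m f g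
  proof -
    note fb = rep_body[OF F f] and gb = rep_body[OF G g]
    have fg: "f \<boxplus> g \<in> hom_set C (level X m) (level Y n)" using fb gb by (simp add: in_hom_set)
    have "germ C X (level Y n) k (f' \<boxplus> g') = germ C X (level Y n) m (f \<boxplus> g)" if f': "rep F n k f'" and g': "rep G n k g'" for k f' g'
    proof -
      note fb' = rep_body[OF F f'] and gb' = rep_body[OF G g']
      have fg': "f' \<boxplus> g' \<in> hom_set C (level X k) (level Y n)" using fb' gb' by (simp add: in_hom_set)
      obtain l where l: "k \<le> l" "m \<le> l" "f' \<cdot> tr X l k = f \<cdot> tr X l m" using rep_eq[OF F f' f] .
      obtain l' where l': "k \<le> l'" "m \<le> l'" "g' \<cdot> tr X l' k = g \<cdot> tr X l' m" using rep_eq[OF G g' g] .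
      let ?l = "max l l'"
      have "f' \<cdot> tr X ?l k = f \<cdot> tr X ?l m"
        by (rule germ_rel_raise[OF X _ _ l]) (use fb fb' in \<open>auto simp: in_hom_set\<close>)
      moreover have "g' \<cdot> tr X ?l k = g \<cdot> tr X ?l m"
        by (rule germ_rel_raise[OF X _ _ l']) (use gb gb' in \<open>auto simp: in_hom_set\<close>)
      ultimately have "(f' \<boxplus> g') \<cdot> tr X ?l k = (f \<boxplus> g) \<cdot> tr X ?l m"
        using fb gb fb' gb' transit_Ar[OF X, of k ?l] transit_Ar[OF X, of m ?l] l by simp
      then show ?thesis using germ_eq_iff[OF X fg' fg] l by (meson max.coboundedI1)
    qed
    then have "body (Add PA F G) n \<subseteq> germ C X (level Y n) m (f \<boxplus> g)"
      by (fastforce simp: Pro_Add src rep_def germ_def)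
    moreover have "germ C X (level Y n) m (f \<boxplus> g) \<subseteq> body (Add PA F G) n"
      using f g by (auto simp: Pro_Add src rep_def germ_def)
    ultimately show ?thesis by blast
  qed
  have ex: "\<exists>m f g. rep F n m f \<and> rep G n m g" for n
  proof -
    obtain m f where f: "rep F n m f" using rep_ex[OF F] .
    obtain k g where g: "rep G n k g" using rep_ex[OF G] .
    show ?thesis using rep_raise[OF F f, of "max m k"] rep_raise[OF G g, of "max m k"] by auto
  qed
  have "body (Add PA F G) n \<in> colim_hom C X (level Y n) \<and>
        postcomp C X (bond Y n) (body (Add PA F G) (Suc n)) = body (Add PA F G) n" for n
  proof -
    obtain m f g where f: "rep F (Suc n) m f" and g: "rep G (Suc n) m g" using ex by blast
    note gb = rep_body[OF G g] and fb = rep_body[OF F f] and b = towD[OF Y]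
    have e: "body (Add PA F G) n = germ C X (level Y n) m (bond Y n \<cdot> f \<boxplus> bond Y n \<cdot> g)"
      by (rule body[OF rep_bond[OF F f] rep_bond[OF G g]])
    have "postcomp C X (bond Y n) (germ C X (level Y (Suc n)) m (f \<boxplus> g)) = germ C X (level Y n) m (bond Y n \<cdot> (f \<boxplus> g))"
      by (rule postcomp_germ[OF X]) (use gb fb b in \<open>auto simp: in_hom_set\<close>)
    then show ?thesis using body[OF f g] e gb fb b by (simp add: germ_in_colim in_hom_set)
  qed
  then show h: "Add PA F G \<in> hom_set PA X Y"
    unfolding in_hom_set Pro_Ar using X Y src by (simp add: Pro_Add)
  show "\<lbrakk>rep F n m f; rep G n m g\<rbrakk> \<Longrightarrow> rep (Add PA F G) n m (f \<boxplus> g)"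
    unfolding rep_iff[OF h] using body[of n m f g] rep_body[OF F, of n m f] rep_body[OF G, of n m g] by (auto simp: in_hom_set)
qed

end

declare Pro_simps [simp del] Pro_Ob [simp del]

section \<open>Constant pro-objects and the projections of a tower\<close>

definition proj :: "('o, 'm, 'x) cat_scheme \<Rightarrow> ('o, 'm) tower \<Rightarrow> nat \<Rightarrow> ('o, 'm) pro_arrow" where
  "proj C X k = pro_ar C X (const_tower C (level X k)) (\<lambda>_. k) (\<lambda>_. Id C (level X k))"

definition cmap :: "('o, 'm, 'x) cat_scheme \<Rightarrow> 'm \<Rightarrow> ('o, 'm) pro_arrow" where
  "cmap C f = pro_ar C (const_tower C (Dom C f)) (const_tower C (Cod C f)) (\<lambda>_. 0) (\<lambda>_. f)"

definition lev :: "('o, 'm, 'x) cat_scheme \<Rightarrow> ('o, 'm) tower \<Rightarrow> ('o, 'm) tower \<Rightarrow> (nat \<Rightarrow> 'm) \<Rightarrow> ('o, 'm) pro_arrow" where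
  "lev C X Y f = pro_ar C X Y (\<lambda>n. n) f"

lemma const_tower_simps [simp]: "level (const_tower C a) n = a" "bond (const_tower C a) n = Id C a"
  by (simp_all add: const_tower_def)

context preadd
begin

lemma rep2:
  assumes F: "F \<in> hom_set PA X Y" and G: "G \<in> hom_set PA X Z"
  obtains m f g where "rep F n m f" "rep G k m g"
proof -
  obtain m f where f: "rep F n m f" using rep_ex[OF F] .
  obtain m' g where g: "rep G k m' g" using rep_ex[OF G] .
  show ?thesis using that rep_raise[OF F f, of "max m m'"] rep_raise[OF G g, of "max m m'"] by auto
qed

lemma rep_choice:
  assumes F: "F \<in> hom_set PA X Y"
  obtains m f where "\<And>n. rep F n (m n) (f n)"
    "\<And>n. \<exists>k. m n \<le> k \<and> m (Suc n) \<le> k \<and> (bond Y n \<cdot> f (Suc n)) \<cdot> tr X k (m (Suc n)) = f n \<cdot> tr X k (m n)"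
proof -
  have "\<exists>m f. rep F n m f" for n using rep_ex[OF F] by metis
  then obtain m f where r: "\<And>n. rep F n (m n) (f n)" by metis
  have "\<exists>k. m n \<le> k \<and> m (Suc n) \<le> k \<and> (bond Y n \<cdot> f (Suc n)) \<cdot> tr X k (m (Suc n)) = f n \<cdot> tr X k (m n)" for n
    using rep_eq[OF F rep_bond[OF F r[of "Suc n"]] r[of n]] by metis
  with r show thesis by (rule that)
qed

lemma Pro_preadditive: "preadditive_category PA"
proof (intro preadditive_category.intro preadditive_category_axioms.intro category.intro)
  fix f assume "f \<in> Ar PA" then show "Dom PA f \<in> Ob PA" "Cod PA f \<in> Ob PA"
    by (auto simp: Pro_Ar Pro_simps Pro_Ob)
next
  fix X assume "X \<in> Ob PA" then show "Id PA X \<in> hom_set PA X X" using Pro_Id_rep(1) by (simp add: Pro_Ob)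
next
  fix f g X Y Z assume "f \<in> hom_set PA X Y" "g \<in> hom_set PA Y Z"
  then show "g \<star> f \<in> hom_set PA X Z" by (rule Pro_Comp_rep)
next
  fix F G H X Y Z V assume F: "F \<in> hom_set PA X Y" and G: "G \<in> hom_set PA Y Z" and H: "H \<in> hom_set PA Z V"
  note GF = Pro_Comp_rep[OF F G] and HG = Pro_Comp_rep[OF G H]
  note l = Pro_Comp_rep[OF F HG(1)] and r = Pro_Comp_rep[OF GF(1) H]
  show "(H \<star> G) \<star> F = H \<star> G \<star> F"
  proof (rule pro_eqI[OF l(1) r(1)])
    fix n
    obtain m h where h: "rep H n m h" using rep_ex[OF H] .
    obtain k g where g: "rep G m k g" using rep_ex[OF G] .
    obtain j f where f: "rep F k j f" using rep_ex[OF F] .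
    have "(h \<cdot> g) \<cdot> f = h \<cdot> g \<cdot> f" using rep_body[OF H h] rep_body[OF G g] rep_body[OF F f] by simp
    then show "\<exists>m f. rep ((H \<star> G) \<star> F) n m f \<and> rep (H \<star> G \<star> F) n m f"
      using l(2)[OF HG(2)[OF h g] f] r(2)[OF h GF(2)[OF g f]] by auto
  qed
next
  fix F X Y assume F: "F \<in> hom_set PA X Y"
  note X = Pro_Id_rep[OF Pro_hom_tow(1)[OF F]] and Y = Pro_Id_rep[OF Pro_hom_tow(2)[OF F]]
  show "Id PA Y \<star> F = F"
  proof (rule pro_eqI[OF Pro_Comp_rep(1)[OF F Y(1)] F])
    fix n obtain m f where f: "rep F n m f" using rep_ex[OF F] .
    show "\<exists>m f. rep (Id PA Y \<star> F) n m f \<and> rep F n m f"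
      using Pro_Comp_rep(2)[OF F Y(1) Y(2) f] rep_body[OF F f] f by auto
  qed
  show "F \<star> Id PA X = F"
  proof (rule pro_eqI[OF Pro_Comp_rep(1)[OF X(1) F] F])
    fix n obtain m f where f: "rep F n m f" using rep_ex[OF F] .
    show "\<exists>m f. rep (F \<star> Id PA X) n m f \<and> rep F n m f"
      using Pro_Comp_rep(2)[OF X(1) F f X(2)] rep_body[OF F f] f by auto
  qed
next
  fix X Y assume "X \<in> Ob PA" "Y \<in> Ob PA"
  then have X: "X \<in> tow C" and Y: "Y \<in> tow C" by (simp_all add: Pro_Ob)
  note [simp] = towD[OF X] towD[OF Y]
  show "comm_group (hom_group PA X Y)"
  proof (rule comm_groupI; simp only: hom_group_simps)
    fix F G assume F: "F \<in> hom_set PA X Y" and G: "G \<in> hom_set PA X Y"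
    note FG = Pro_Add_rep[OF F G] and GF = Pro_Add_rep[OF G F]
    show "Add PA F G \<in> hom_set PA X Y" by (rule FG(1))
    show "Add PA F G = Add PA G F"
    proof (rule pro_eqI[OF FG(1) GF(1)])
      fix n obtain m f g where f: "rep F n m f" and g: "rep G n m g" using rep2[OF F G] .
      have "f \<boxplus> g = g \<boxplus> f" using rep_body[OF F f] rep_body[OF G g] Add_commute by simp
      then show "\<exists>m f. rep (Add PA F G) n m f \<and> rep (Add PA G F) n m f"
        using FG(2)[OF f g] GF(2)[OF g f] by auto
    qed
    fix H assume H: "H \<in> hom_set PA X Y"
    note GH = Pro_Add_rep[OF G H]
    note l = Pro_Add_rep[OF FG(1) H] and r = Pro_Add_rep[OF F GH(1)]
    show "Add PA (Add PA F G) H = Add PA F (Add PA G H)"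
    proof (rule pro_eqI[OF l(1) r(1)])
      fix n obtain m f x where f: "rep F n m f" and x: "rep (Add PA G H) n m x" using rep2[OF F GH(1)] .
      obtain k g h where g: "rep G n k g" and h: "rep H n k h" using rep2[OF G H] .
      let ?k = "max m k"
      note f' = rep_raise[OF F f, of ?k] and g' = rep_raise[OF G g, of ?k] and h' = rep_raise[OF H h, of ?k]
      let ?f = "f \<cdot> tr X ?k m" and ?g = "g \<cdot> tr X ?k k" and ?h = "h \<cdot> tr X ?k k"
      have "?f \<boxplus> ?g \<boxplus> ?h = ?f \<boxplus> (?g \<boxplus> ?h)"
        using rep_body[OF F f'] rep_body[OF G g'] rep_body[OF H h'] by (simp add: Add_assoc)
      then show "\<exists>m f. rep (Add PA (Add PA F G) H) n m f \<and> rep (Add PA F (Add PA G H)) n m f"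
        using l(2)[OF FG(2)[OF f' g'] h'] r(2)[OF f' GH(2)[OF g' h']] by auto
    qed
  next
    note Z = Pro_Zer_rep[OF X Y]
    show "Zer PA X Y \<in> hom_set PA X Y" by (rule Z(1))
    fix F assume F: "F \<in> hom_set PA X Y"
    show "Add PA (Zer PA X Y) F = F"
    proof (rule pro_eqI[OF Pro_Add_rep(1)[OF Z(1) F] F])
      fix n obtain m f where f: "rep F n m f" using rep_ex[OF F] .
      then show "\<exists>m f. rep (Add PA (Zer PA X Y) F) n m f \<and> rep F n m f"
        using Pro_Add_rep(2)[OF Z(1) F Z(2) f] rep_body[OF F f] by auto
    qed
    obtain m f where r: "\<And>n. rep F n (m n) (f n)"
      and c: "\<And>n. \<exists>k. m n \<le> k \<and> m (Suc n) \<le> k \<and> (bond Y n \<cdot> f (Suc n)) \<cdot> tr X k (m (Suc n)) = f n \<cdot> tr X k (m n)"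
      by (rule rep_choice[OF F]) (rule that)
    note f = rep_body[OF F r]
    let ?N = "pro_ar C X Y m (\<lambda>n. neg C (f n))"
    have N: "?N \<in> hom_set PA X Y" "\<And>n. rep ?N n (m n) (neg C (f n))"
    proof -
      have "\<exists>k. m n \<le> k \<and> m (Suc n) \<le> k \<and> (bond Y n \<cdot> neg C (f (Suc n))) \<cdot> tr X k (m (Suc n)) = neg C (f n) \<cdot> tr X k (m n)" for n
      proof -
        obtain k where k: "m n \<le> k" "m (Suc n) \<le> k" "(bond Y n \<cdot> f (Suc n)) \<cdot> tr X k (m (Suc n)) = f n \<cdot> tr X k (m n)"
          using c by blast
        then have "(bond Y n \<cdot> neg C (f (Suc n))) \<cdot> tr X k (m (Suc n)) = neg C (f n) \<cdot> tr X k (m n)"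
          using f transit_Ar[OF X k(1)] transit_Ar[OF X k(2)] by simp
        with k show ?thesis by blast
      qed
      note c' = this
      show "?N \<in> hom_set PA X Y" "\<And>n. rep ?N n (m n) (neg C (f n))"
        by (rule pro_ar_hom[OF X Y]; (rule c')?; use f in simp)+
    qed
    have "Add PA ?N F = Zer PA X Y"
    proof (rule pro_eqI[OF Pro_Add_rep(1)[OF N(1) F] Z(1)])
      fix n
      show "\<exists>m f. rep (Add PA ?N F) n m f \<and> rep (Zer PA X Y) n m f"
        using Pro_Add_rep(2)[OF N(1) F N(2) r, of n] Z(2)[of n "m n"] f[of n] by auto
    qed
    then show "\<exists>y\<in>hom_set PA X Y. Add PA y F = Zer PA X Y" using N(1) by blast
  qed
next
  fix F G G' X Y Z assume F: "F \<in> hom_set PA X Y" and G: "G \<in> hom_set PA Y Z" and G': "G' \<in> hom_set PA Y Z"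
  note GG = Pro_Add_rep[OF G G'] and GF = Pro_Comp_rep[OF F G] and GF' = Pro_Comp_rep[OF F G']
  note l = Pro_Comp_rep[OF F GG(1)] and r = Pro_Add_rep[OF GF(1) GF'(1)]
  show "Add PA G G' \<star> F = Add PA (G \<star> F) (G' \<star> F)"
  proof (rule pro_eqI[OF l(1) r(1)])
    fix n obtain m g g' where g: "rep G n m g" and g': "rep G' n m g'" using rep2[OF G G'] .
    obtain k f where f: "rep F m k f" using rep_ex[OF F] .
    have "(g \<boxplus> g') \<cdot> f = g \<cdot> f \<boxplus> g' \<cdot> f" using rep_body[OF G g] rep_body[OF G' g'] rep_body[OF F f] by simp
    then show "\<exists>m f. rep (Add PA G G' \<star> F) n m f \<and> rep (Add PA (G \<star> F) (G' \<star> F)) n m f"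
      using l(2)[OF GG(2)[OF g g'] f] r(2)[OF GF(2)[OF g f] GF'(2)[OF g' f]] by auto
  qed
next
  fix F F' G X Y Z assume F: "F \<in> hom_set PA X Y" and F': "F' \<in> hom_set PA X Y" and G: "G \<in> hom_set PA Y Z"
  note FF = Pro_Add_rep[OF F F'] and GF = Pro_Comp_rep[OF F G] and GF' = Pro_Comp_rep[OF F' G]
  note l = Pro_Comp_rep[OF FF(1) G] and r = Pro_Add_rep[OF GF(1) GF'(1)]
  show "G \<star> Add PA F F' = Add PA (G \<star> F) (G \<star> F')"
  proof (rule pro_eqI[OF l(1) r(1)])
    fix n obtain m g where g: "rep G n m g" using rep_ex[OF G] .
    obtain k f f' where f: "rep F m k f" and f': "rep F' m k f'" using rep2[OF F F'] .
    have "g \<cdot> (f \<boxplus> f') = g \<cdot> f \<boxplus> g \<cdot> f'" using rep_body[OF G g] rep_body[OF F f] rep_body[OF F' f'] by simp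
    then show "\<exists>m f. rep (G \<star> Add PA F F') n m f \<and> rep (Add PA (G \<star> F) (G \<star> F')) n m f"
      using l(2)[OF g FF(2)[OF f f']] r(2)[OF GF(2)[OF g f] GF'(2)[OF g f']] by auto
  qed
qed

lemma Pro_preadd: "preadd PA"
  by (intro preadd.intro Pro_preadditive)

lemma const_tow: "a \<in> Ob C \<Longrightarrow> cst a \<in> tow C"
  by (rule towI) simp_all

lemma transit_const: "a \<in> Ob C \<Longrightarrow> m \<le> n \<Longrightarrow> tr (cst a) n m = Id C a"
proof (induction n)
  case 0 then show ?case by (simp add: transit_refl)
next
  case (Suc n)
  then show ?case by (cases "m = Suc n") (simp_all add: transit_refl transit_Suc)
qed

lemma cmap_hom:
  assumes f: "f \<in> Ar C"
  shows "cmap C f \<in> hom_set PA (cst (Dom C f)) (cst (Cod C f))" "rep (cmap C f) n m f"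
proof -
  note t = const_tow[OF Dom_Cod_Ob(1)[OF f]] and t' = const_tow[OF Dom_Cod_Ob(2)[OF f]]
  have h: "cmap C f \<in> hom_set PA (cst (Dom C f)) (cst (Cod C f))" "rep (cmap C f) n 0 f"
    unfolding cmap_def by (rule pro_ar_hom[OF t t']; use f in auto)+
  then show "cmap C f \<in> hom_set PA (cst (Dom C f)) (cst (Cod C f))" "rep (cmap C f) n m f"
    using rep_raise[OF h, of m] f by (simp_all add: transit_const)
qed

lemma proj_hom:
  assumes X: "X \<in> tow C"
  shows "proj C X k \<in> hom_set PA X (cst (level X k))" "rep (proj C X k) n k (Id C (level X k))"
  unfolding proj_def by (rule pro_ar_hom[OF X const_tow]; use towD[OF X] in auto)+

text \<open>The bonding maps of a constant tower are identities, so the target level carries no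
  information.\<close>

lemma rep_const:
  assumes F: "F \<in> hom_set PA X (cst b)" and r: "rep F n m f"
  shows "rep F k m f"
proof -
  have b: "b \<in> Ob C" using towD(1)[OF Pro_hom_tow(2)[OF F], of 0] by simp
  have down: "rep F 0 m f" if "rep F n m f" for n m f
    using rep_transit[OF F that, of 0] rep_body[OF F that] by (simp add: transit_const b)
  obtain m' f' where r': "rep F k m' f'" using rep_ex[OF F] .
  obtain l where l: "m' \<le> l" "m \<le> l" "f' \<cdot> tr X l m' = f \<cdot> tr X l m"
    using rep_eq[OF F down[OF r'] down[OF r]] .
  show ?thesis by (rule rep_eqI[OF F r' _ l]) (use rep_body[OF F r] in \<open>simp add: in_hom_set\<close>)
qed

lemma pro_const_eqI:
  assumes F: "F \<in> hom_set PA X (cst b)" and G: "G \<in> hom_set PA X (cst b)"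
    and "rep F n m f" "rep G k m f"
  shows "F = G"
  by (rule pro_eqI[OF F G]) (use rep_const[OF F assms(3)] rep_const[OF G assms(4)] in blast)

lemma cmap_proj:
  assumes X: "X \<in> tow C" and f: "f \<in> Ar C" "Dom C f = level X k" "Cod C f = b"
  shows "cmap C f \<star> proj C X k \<in> hom_set PA X (cst b)" "rep (cmap C f \<star> proj C X k) n k f"
  using Pro_Comp_rep[OF proj_hom(1)[OF X, of k] cmap_hom(1)[OF f(1), unfolded f(2,3)]]
    Pro_Comp_rep(2)[OF proj_hom(1)[OF X, of k] cmap_hom(1)[OF f(1), unfolded f(2,3)] cmap_hom(2)[OF f(1)] proj_hom(2)[OF X]] f
  by simp_all

lemma pro_to_const:
  assumes F: "F \<in> hom_set PA X (cst b)"
  obtains k f where "f \<in> Ar C" "Dom C f = level X k" "Cod C f = b" "F = cmap C f \<star> proj C X k" "rep F 0 k f"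
proof -
  note X = Pro_hom_tow(1)[OF F]
  obtain k f where r: "rep F 0 k f" using rep_ex[OF F] .
  note f = rep_body[OF F r]
  have "F = cmap C f \<star> proj C X k"
    by (rule pro_const_eqI[OF F cmap_proj(1)[OF X] r cmap_proj(2)[OF X]]) (use f in simp_all)
  then show thesis using that[of f k] f r by simp
qed

lemma const_to_const:
  assumes F: "F \<in> hom_set PA (cst a) (cst b)"
  obtains f where "f \<in> Ar C" "Dom C f = a" "Cod C f = b" "F = cmap C f"
proof -
  obtain k f where f: "f \<in> Ar C" "Dom C f = level (cst a) k" "Cod C f = b"
    "F = cmap C f \<star> proj C (cst a) k" "rep F 0 k f"
    by (rule pro_to_const[OF F]) (rule that)
  note f = f(1) f(2)[unfolded const_tower_simps] f(3) f(5)
  have "F = cmap C f"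
    by (rule pro_const_eqI[OF F _ f(4) cmap_hom(2)[OF f(1)]]) (use cmap_hom(1)[OF f(1)] f in simp)
  with f that show thesis by blast
qed

lemma proj_comp:
  assumes F: "F \<in> hom_set PA T X"
  shows "proj C X k \<star> F \<in> hom_set PA T (cst (level X k))"
    "rep F k m f \<Longrightarrow> rep (proj C X k \<star> F) n m f"
  using Pro_Comp_rep[OF F proj_hom(1)[OF Pro_hom_tow(2)[OF F], of k]]
    Pro_Comp_rep(2)[OF F proj_hom(1)[OF Pro_hom_tow(2)[OF F], of k] proj_hom(2)[OF Pro_hom_tow(2)[OF F]], of m f n] rep_body[OF F, of k m f]
  by auto

lemma proj_mono:
  assumes F: "F \<in> hom_set PA T X" and G: "G \<in> hom_set PA T X"
    and e: "\<And>k. proj C X k \<star> F = proj C X k \<star> G"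
  shows "F = G"
proof (rule pro_eqI[OF F G])
  fix n
  obtain m f where f: "rep F n m f" using rep_ex[OF F] .
  obtain m' g where g: "rep G n m' g" using rep_ex[OF G] .
  note h = proj_comp[OF G, of n]
  have "rep (proj C X n \<star> G) 0 m f" using proj_comp(2)[OF F f] e by simp
  then obtain l where "m' \<le> l" "m \<le> l" "g \<cdot> tr T l m' = f \<cdot> tr T l m"
    using rep_eq[OF h(1) h(2)[OF g]] by metis
  then have "rep G n m f" by (intro rep_eqI[OF G g]) (use rep_body[OF F f] in \<open>auto simp: in_hom_set\<close>)
  with f show "\<exists>m f. rep F n m f \<and> rep G n m f" by blast
qed

lemma cmap_bond_proj:
  assumes X: "X \<in> tow C" and "l \<le> k"
  shows "cmap C (tr X k l) \<star> proj C X k = proj C X l"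
proof -
  note t = transit_Ar[OF X assms(2)]
  note c = cmap_proj[OF X t]
  have "rep (proj C X l) 0 k (tr X k l)"
    using rep_raise[OF proj_hom[OF X] assms(2), of 0] t by simp
  with c(2)[of 0] show ?thesis by (intro pro_const_eqI[OF c(1) proj_hom(1)[OF X]])
qed

text \<open>Representatives of the \<open>G k\<close> are assembled level by level; the cone
  condition is what makes them compatible in the colimit.\<close>

lemma proj_lift:
  assumes X: "X \<in> tow C" and T: "T \<in> tow C" and G: "\<And>k. G k \<in> hom_set PA T (cst (level X k))"
    and c: "\<And>k. cmap C (bond X k) \<star> G (Suc k) = G k"
  shows "\<exists>F\<in>hom_set PA T X. \<forall>k. proj C X k \<star> F = G k"
proof -
  have "\<exists>m f. rep (G k) 0 m f" for k using rep_ex[OF G] by metis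
  then obtain m f where r: "\<And>k. rep (G k) 0 (m k) (f k)" by metis
  note f = rep_body(2-4)[OF G r, unfolded const_tower_simps]
  have c': "\<exists>l. m n \<le> l \<and> m (Suc n) \<le> l \<and> (bond X n \<cdot> f (Suc n)) \<cdot> tr T l (m (Suc n)) = f n \<cdot> tr T l (m n)" for n
  proof -
    note b = towD[OF X, of n]
    have "rep (cmap C (bond X n) \<star> G (Suc n)) 0 (m (Suc n)) (bond X n \<cdot> f (Suc n))"
      by (rule Pro_Comp_rep(2)[OF G cmap_hom(1)[OF b(2), unfolded b(3,4)] cmap_hom(2)[OF b(2)] r])
    then have "rep (G n) 0 (m (Suc n)) (bond X n \<cdot> f (Suc n))" by (simp add: c)
    from rep_eq[OF G this r] show ?thesis by metis
  qed
  have h: "pro_ar C T X m f \<in> hom_set PA T X" "\<And>n. rep (pro_ar C T X m f) n (m n) (f n)"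
    by (rule pro_ar_hom[OF T X]; (rule c')?; use f in simp)+
  have "proj C X k \<star> pro_ar C T X m f = G k" for k
    by (rule pro_const_eqI[OF proj_comp(1)[OF h(1)] G proj_comp(2)[OF h(1) h(2)] r])
  with h(1) show ?thesis by blast
qed

lemma cmap_comp:
  assumes "f \<in> Ar C" "g \<in> Ar C" "Dom C g = Cod C f"
  shows "cmap C g \<star> cmap C f = cmap C (g \<cdot> f)"
proof -
  note F = cmap_hom[OF assms(1)] and G = cmap_hom[OF assms(2), unfolded assms(3)] and H = cmap_hom[of "g \<cdot> f"]
  show ?thesis
    by (rule pro_const_eqI[OF Pro_Comp_rep(1)[OF F(1) G(1)] _ Pro_Comp_rep(2)[OF F(1) G(1) G(2) F(2)] H(2)])
      (use H(1) assms in simp_all)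
qed

lemma cmap_Id: "a \<in> Ob C \<Longrightarrow> cmap C (Id C a) = Id PA (cst a)"
  using cmap_hom[of "Id C a"] Pro_Id_rep(1)[OF const_tow, of a] Pro_Id_rep(2)[OF const_tow, of a 0] by (intro pro_const_eqI) auto

lemma cmap_Zer: "\<lbrakk>a \<in> Ob C; b \<in> Ob C\<rbrakk> \<Longrightarrow> cmap C (Zer C a b) = Zer PA (cst a) (cst b)"
  using cmap_hom[of "Zer C a b"] Pro_Zer_rep(1)[OF const_tow const_tow, of a b] Pro_Zer_rep(2)[OF const_tow const_tow, of a b 0 0] by (intro pro_const_eqI) auto

lemma cmap_Add:
  assumes "f \<in> Ar C" "g \<in> Ar C" "Dom C f = Dom C g" "Cod C f = Cod C g"
  shows "cmap C (f \<boxplus> g) = Add PA (cmap C f) (cmap C g)"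
proof -
  note F = cmap_hom[OF assms(1), unfolded assms(3,4)] and G = cmap_hom[OF assms(2)] and H = cmap_hom[of "f \<boxplus> g"]
  show ?thesis
    by (rule pro_const_eqI[OF _ Pro_Add_rep(1)[OF F(1) G(1)] H(2) Pro_Add_rep(2)[OF F(1) G(1) F(2) G(2)]])
      (use H(1) assms in simp_all)
qed

text \<open>A tower is the limit of its own levels, and by construction the maps to a constant
  object are the colimit of the maps out of the levels; a representative of the zero map vanishes at
  some later level.\<close>

lemma pro_limit:
  assumes X: "X \<in> tow C"
  shows "is_pro_limit PA (cst ` Ob C) X (\<lambda>k. cst (level X k)) (proj C X) (\<lambda>k. cmap C (bond X k))"
proof -
  interpret P: preadd PA by (rule Pro_preadd)
  note [simp] = towD[OF X]
  have b: "cmap C (bond X k) \<in> hom_set PA (cst (level X (Suc k))) (cst (level X k))" for k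
    using cmap_hom(1)[of "bond X k"] by simp
  have "cmap C (bond X k) \<star> proj C X (Suc k) = proj C X k" for k
    using cmap_bond_proj[OF X, of k "Suc k"] by (simp add: transit_bond[OF X])
  moreover have "\<exists>h\<in>hom_set PA T X. \<forall>k. proj C X k \<star> h = f k"
    if "\<forall>k. f k \<in> hom_set PA T (cst (level X k)) \<and> cmap C (bond X k) \<star> f (Suc k) = f k" for T f
    using proj_lift[OF X, of T f] that Pro_hom_tow(1)[of "f 0" T] by blast
  moreover have "\<exists>k. \<exists>h\<in>hom_set PA (cst (level X k)) W. g = h \<star> proj C X k"
    if W: "W \<in> cst ` Ob C" and g: "g \<in> hom_set PA X W" for W g
  proof -
    obtain w where w: "W = cst w" using W by blast
    obtain k f where f: "f \<in> Ar C" "Dom C f = level X k" "Cod C f = w" "g = cmap C f \<star> proj C X k"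
      using pro_to_const g unfolding w by blast
    show ?thesis using f(4) cmap_hom(1)[OF f(1)] unfolding f(2,3) w by blast
  qed
  moreover have "\<exists>j. pull PA (\<lambda>k. cmap C (bond X k)) k g j = Zer PA (cst (level X (k + j))) W"
    if W: "W \<in> cst ` Ob C" and g: "g \<in> hom_set PA (cst (level X k)) W"
      and g0: "g \<star> proj C X k = Zer PA X W" for W k g
  proof -
    obtain w where w: "W = cst w" "w \<in> Ob C" using W by blast
    obtain f where f: "f \<in> Ar C" "Dom C f = level X k" "Cod C f = w" "g = cmap C f"
      using const_to_const g unfolding w by blast
    have pull: "pull PA (\<lambda>k. cmap C (bond X k)) k g j = cmap C (f \<cdot> tr X (k + j) k)" for j
    proof (induction j)
      case 0 then show ?case using f by (simp add: transit_refl)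
    next
      case (Suc j)
      note t = transit_Ar[OF X, of k "k + j"]
      show ?case using Suc f t by (simp add: cmap_comp transit_Suc)
    qed
    have r: "rep (Zer PA X W) 0 k f" using cmap_proj(2)[OF X f(1-3), of 0] g0 f(4) by simp
    have tw: "W \<in> tow C" using w const_tow by simp
    obtain l where l: "k \<le> l" "f \<cdot> tr X l k = Zer C (level X k) w \<cdot> tr X l k"
      \<comment> \<open>The level \<open>l\<close> found here is at least \<open>k\<close>, and
        \<open>l - k\<close> is the number of bonding maps to pull along.\<close>
      using rep_eq[OF Pro_Zer_rep(1)[OF X tw] r Pro_Zer_rep(2)[OF X tw]] w by auto
    then have "f \<cdot> tr X (k + (l - k)) k = Zer C (level X (k + (l - k))) w"
      using transit_Ar[OF X l(1)] w(2) by simp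
    then show ?thesis using pull[of "l - k"] w by (intro exI[of _ "l - k"]) (simp add: cmap_Zer)
  qed
  ultimately show ?thesis
    unfolding is_pro_limit_def using proj_hom(1)[OF X] b proj_mono by (auto simp: Pro_Ob)
qed

end

section \<open>Straightening of pro-maps, kernels and cokernels\<close>

context preadd
begin

text \<open>Representatives are chosen one after the other, each raised until it commutes strictly
  with its predecessor. Up to the reindexing \<open>m\<close> of the source, a pro-map thus becomes
  a map of towers, to which levelwise constructions apply.\<close>

lemma straighten:
  assumes F: "F \<in> hom_set PA X Y"
  obtains m f where "\<And>n. rep F n (m n) (f n)" "\<And>n. n \<le> m n" "\<And>n l. n \<le> l \<Longrightarrow> m n \<le> m l"
    "\<And>n l. n \<le> l \<Longrightarrow> tr Y l n \<cdot> f l = f n \<cdot> tr X (m l) (m n)"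
proof -
  note X = Pro_hom_tow(1)[OF F] and Y = Pro_hom_tow(2)[OF F]
  have "\<exists>z. \<forall>n. (rep F n (fst (z n)) (snd (z n)) \<and> n \<le> fst (z n)) \<and>
     (fst (z n) \<le> fst (z (Suc n)) \<and> bond Y n \<cdot> snd (z (Suc n)) = snd (z n) \<cdot> tr X (fst (z (Suc n))) (fst (z n)))"
  proof (rule dependent_nat_choice)
    obtain m f where "rep F 0 m f" using rep_ex[OF F] .
    then show "\<exists>x. rep F 0 (fst x) (snd x) \<and> 0 \<le> fst x" by auto
  next
    fix x n assume x: "rep F n (fst x) (snd x) \<and> n \<le> fst x"
    obtain m f where e: "x = (m, f)" by (cases x)
    have r: "rep F n m f" using x by (simp add: e)
    obtain m1 f1 where r1: "rep F (Suc n) m1 f1" using rep_ex[OF F] .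
    note b = rep_body[OF F r] and b1 = rep_body[OF F r1] and r1' = rep_bond[OF F r1]
    note b1' = rep_body[OF F r1']
    obtain k where k: "m1 \<le> k" "m \<le> k" "(bond Y n \<cdot> f1) \<cdot> tr X k m1 = f \<cdot> tr X k m" using rep_eq[OF F r1' r] .
    \<comment> \<open>High enough for strict compatibility with the previous representative and for
      the bound \<open>n \<le> m n\<close> at the next index.\<close>
    let ?k = "max k (Suc n)"
    have "(bond Y n \<cdot> f1) \<cdot> tr X ?k m1 = f \<cdot> tr X ?k m"
      by (rule germ_rel_raise[OF X _ _ k]) (use b b1' in \<open>simp_all add: in_hom_set\<close>)
    then have "bond Y n \<cdot> f1 \<cdot> tr X ?k m1 = f \<cdot> tr X ?k m"
      using b1 towD[OF Y, of n] transit_Ar[OF X, of m1 ?k] k(1) by simp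
    then show "\<exists>y. (rep F (Suc n) (fst y) (snd y) \<and> Suc n \<le> fst y) \<and> fst x \<le> fst y \<and> bond Y n \<cdot> snd y = snd x \<cdot> tr X (fst y) (fst x)"
      using rep_raise[OF F r1, of ?k] k e by (intro exI[of _ "(?k, f1 \<cdot> tr X ?k m1)"]) auto
  qed
  then obtain z where z: "\<And>n. rep F n (fst (z n)) (snd (z n))" "\<And>n. n \<le> fst (z n)" "\<And>n. fst (z n) \<le> fst (z (Suc n))"
     "\<And>n. bond Y n \<cdot> snd (z (Suc n)) = snd (z n) \<cdot> tr X (fst (z (Suc n))) (fst (z n))" by blast
  define m where "m n = fst (z n)" for n
  define f where "f n = snd (z n)" for n
  have r: "rep F n (m n) (f n)" for n using z(1) by (simp add: m_def f_def)
  note fb = rep_body[OF F r]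
  have mono: "m n \<le> m l" if "n \<le> l" for n l using lift_Suc_mono_le[of m n l] z(3) that by (simp add: m_def)
  have "tr Y l n \<cdot> f l = f n \<cdot> tr X (m l) (m n)" if "n \<le> l" for n l
    using that
  proof (induction l)
    case 0 then show ?case using fb[of 0] by (simp add: transit_refl)
  next
    case (Suc l)
    show ?case
    proof (cases "n \<le> l")
      case True
      note t = transit_Ar[OF Y True] transit_Ar[OF X mono[OF True]] transit_Ar[OF X mono[of l "Suc l"]] towD[OF Y, of l]
      have "tr Y (Suc l) n \<cdot> f (Suc l) = tr Y l n \<cdot> f l \<cdot> tr X (m (Suc l)) (m l)"
        using t True fb z(4)[of l] by (simp add: transit_Suc m_def f_def)
      also have "\<dots> = (f n \<cdot> tr X (m l) (m n)) \<cdot> tr X (m (Suc l)) (m l)"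
        using t fb by (simp flip: Suc.IH[OF True])
      also have "\<dots> = f n \<cdot> tr X (m (Suc l)) (m n)"
        using t fb transit_trans[OF X mono[OF True] mono[of l "Suc l"]] by simp
      finally show ?thesis .
    next
      case False
      then have "n = Suc l" using Suc.prems by simp
      then show ?thesis using fb[of "Suc l"] by (simp add: transit_refl)
    qed
  qed
  with r z(2) mono show thesis by (intro that[of m f]) (auto simp: m_def)
qed

text \<open>The kernels of the straightened components form a tower. Its inclusion reaches
  \<open>X\<close> at the levels \<open>m n\<close>, so moving between the levels \<open>n\<close>
  and \<open>m n\<close> is the main bookkeeping.\<close>

lemma Pro_kernels:
  assumes ker: "has_kernels C"
  shows "has_kernels PA"
  unfolding has_kernels_def
proof
  interpret P: preadd PA by (rule Pro_preadd)
  fix F assume FA: "F \<in> Ar PA"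
  then obtain X Y where F: "F \<in> hom_set PA X Y" by (simp add: in_hom_set)
  note X = Pro_hom_tow(1)[OF F] and Y = Pro_hom_tow(2)[OF F]
  have FXY: "Dom PA F = X" "Cod PA F = Y" using F by (auto simp: in_hom_set)
  obtain m f where r: "\<And>n. rep F n (m n) (f n)" and nm: "\<And>n. n \<le> m n" and mono: "\<And>n l. n \<le> l \<Longrightarrow> m n \<le> m l"
    and c: "\<And>n l. n \<le> l \<Longrightarrow> tr Y l n \<cdot> f l = f n \<cdot> tr X (m l) (m n)"
    by (rule straighten[OF F]) (rule that)
  note f [simp] = rep_body(2-4)[OF F r]
  note [simp] = towD[OF X] towD[OF Y]
  have "\<exists>K k. is_kernel C (f n) K k" for n using ker f(1) unfolding has_kernels_def by blast
  then obtain K k where K: "\<And>n. is_kernel C (f n) (K n) (k n)" by metis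
  note k [simp] = kernelD[OF K f(1), unfolded f]
  have "\<exists>d. d \<in> Ar C \<and> Dom C d = K (Suc n) \<and> Cod C d = K n \<and> k n \<cdot> d = tr X (m (Suc n)) (m n) \<cdot> k (Suc n)" for n
  proof -
    note t = transit_Ar[OF X mono[of n "Suc n"]] transit_Ar[OF Y, of n "Suc n"]
    have "f n \<cdot> tr X (m (Suc n)) (m n) \<cdot> k (Suc n) = (tr Y (Suc n) n \<cdot> f (Suc n)) \<cdot> k (Suc n)"
      using c[of n "Suc n"] t by simp
    also have "\<dots> = Zer C (K (Suc n)) (level Y n)" using t by simp
    finally show ?thesis using kernel_lift[OF K, of n "tr X (m (Suc n)) (m n) \<cdot> k (Suc n)"] t by simp
  qed
  then obtain d where d: "\<And>n. d n \<in> Ar C" "\<And>n. Dom C (d n) = K (Suc n)" "\<And>n. Cod C (d n) = K n"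
    "\<And>n. k n \<cdot> d n = tr X (m (Suc n)) (m n) \<cdot> k (Suc n)" by metis
  note [simp] = d(1-3)
  define T where "T = Tower K d"
  have T [simp]: "level T n = K n" "bond T n = d n" for n by (simp_all add: T_def)
  have Tt: "T \<in> tow C" by (rule towI) simp_all
  have kt: "k n \<cdot> tr T l n = tr X (m l) (m n) \<cdot> k l" if "n \<le> l" for n l
    using that
  proof (induction l)
    case 0 then show ?case by (simp add: transit_refl)
  next
    case (Suc l)
    show ?case
    proof (cases "n \<le> l")
      case True
      note t = transit_Ar[OF Tt True] transit_Ar[OF X mono[OF True]] transit_Ar[OF X mono[of l "Suc l"]]
      have "k n \<cdot> tr T (Suc l) n = tr X (m l) (m n) \<cdot> k l \<cdot> d l"
        using comp_rw[OF Suc.IH[OF True], of "d l"] t True by (simp add: transit_Suc)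
      also have "\<dots> = tr X (m (Suc l)) (m n) \<cdot> k (Suc l)"
        using t transit_trans'[OF X mono[OF True] mono[of l "Suc l"], of "k (Suc l)"] by (simp add: d(4))
      finally show ?thesis .
    next
      case False
      then have "n = Suc l" using Suc.prems by simp
      then show ?thesis by (simp add: transit_refl)
    qed
  qed
  \<comment> \<open>\<open>k l\<close> lands in level \<open>m l\<close> of \<open>X\<close>;
    transit brings it down to level \<open>l\<close>.\<close>
  define \<kappa> where "\<kappa> = pro_ar C T X (\<lambda>l. l) (\<lambda>l. tr X (m l) l \<cdot> k l)"
  have c': "\<exists>j. n \<le> j \<and> Suc n \<le> j \<and> (bond X n \<cdot> tr X (m (Suc n)) (Suc n) \<cdot> k (Suc n)) \<cdot> tr T j (Suc n) = (tr X (m n) n \<cdot> k n) \<cdot> tr T j n" for n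
  proof -
    note t = transit_Ar[OF X nm[of n]] transit_Ar[OF X mono[of n "Suc n"]] transit_Ar[OF X nm[of "Suc n"]]
    have "bond X n \<cdot> tr X (m (Suc n)) (Suc n) \<cdot> k (Suc n) = tr X (m (Suc n)) n \<cdot> k (Suc n)"
      using comp_rw[OF bond_transit[OF X nm[of "Suc n"]], of "k (Suc n)"] t by simp
    also have "\<dots> = tr X (m n) n \<cdot> tr X (m (Suc n)) (m n) \<cdot> k (Suc n)"
      using transit_trans'[OF X nm[of n] mono[of n "Suc n"], of "k (Suc n)"] by simp
    also have "\<dots> = (tr X (m n) n \<cdot> k n) \<cdot> d n" using t by (simp add: d(4))
    finally show ?thesis
      by (intro exI[of _ "Suc n"]) (simp add: transit_refl transit_bond[OF Tt] t)
  qed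
  have \<kappa>: "\<kappa> \<in> hom_set PA T X" "\<And>l. rep \<kappa> l l (tr X (m l) l \<cdot> k l)"
    unfolding \<kappa>_def by (rule pro_ar_hom[OF Tt X]; (rule c')?; use transit_Ar[OF X nm] in simp)+
  \<comment> \<open>Seen at level \<open>m n\<close> of the target, the inclusion is represented
    through the kernel \<open>k n\<close> itself; monicity of \<open>k n\<close> becomes available
    there.\<close>
  have \<kappa>m: "rep \<kappa> (m n) l (k n \<cdot> tr T l n)" if "m n \<le> l" for n l
  proof -
    have nl: "n \<le> l" using nm[of n] that by simp
    note t = transit_Ar[OF X that] transit_Ar[OF X nm[of l]] transit_Ar[OF X mono[OF nl]]
    have "rep \<kappa> (m n) l (tr X l (m n) \<cdot> tr X (m l) l \<cdot> k l)"
      by (rule rep_transit[OF \<kappa> that])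
    then show ?thesis using transit_trans'[OF X that nm[of l], of "k l"] kt[OF nl] by simp
  qed
  have "is_kernel PA F T \<kappa>"
  proof (rule P.kernelI; (unfold FXY)?)
    show "T \<in> Ob PA" using Tt by (simp add: Pro_Ob)
    show "\<kappa> \<in> Ar PA" "Dom PA \<kappa> = T" "Cod PA \<kappa> = X" using \<kappa>(1) by (auto simp: in_hom_set)
    show "F \<star> \<kappa> = Zer PA T Y"
    proof (rule pro_eqI[OF Pro_Comp_rep(1)[OF \<kappa>(1) F] Pro_Zer_rep(1)[OF Tt Y]])
      fix n
      note t = transit_Ar[OF Tt nm[of n]]
      have "f n \<cdot> k n \<cdot> tr T (m n) n = Zer C (K (m n)) (level Y n)"
        using comp_rw[OF k(5)[of n], of "tr T (m n) n"] t by simp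
      then show "\<exists>j h. rep (F \<star> \<kappa>) n j h \<and> rep (Zer PA T Y) n j h"
        using Pro_Comp_rep(2)[OF \<kappa>(1) F r \<kappa>m, of n "m n"] Pro_Zer_rep(2)[OF Tt Y, of n "m n"] by auto
    qed
  next
    fix G assume G': "G \<in> Ar PA" "Cod PA G = X" "F \<star> G = Zer PA (Dom PA G) Y"
    define L where "L = Dom PA G"
    have G: "G \<in> hom_set PA L X" using G' by (simp add: in_hom_set L_def)
    note L = Pro_hom_tow(1)[OF G]
    note [simp] = towD[OF L]
    have "\<exists>l h. h \<in> Ar C \<and> Dom C h = level L l \<and> Cod C h = K n \<and> rep G (m n) l (k n \<cdot> h)" for n
    proof -
      obtain l g where g: "rep G (m n) l g" using rep_ex[OF G] .
      note gb = rep_body[OF G g]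
      have FG: "F \<star> G \<in> hom_set PA L Y" by (rule Pro_Comp_rep[OF G F])
      have "rep (F \<star> G) n l (f n \<cdot> g)" by (rule Pro_Comp_rep(2)[OF G F r g])
      moreover have "rep (F \<star> G) n l (Zer C (level L l) (level Y n))"
        using Pro_Zer_rep(2)[OF L Y] by (simp add: G'(3) L_def)
      \<comment> \<open>\<open>F \<star> G\<close> vanishes only as a germ; from level
        \<open>j\<close> on the composite is strictly zero and lifts to the kernel.\<close>
      ultimately obtain j where j: "l \<le> j" "(f n \<cdot> g) \<cdot> tr L j l = Zer C (level L l) (level Y n) \<cdot> tr L j l"
        using rep_eq[OF FG] by metis
      note t = transit_Ar[OF L j(1)]
      have "f n \<cdot> g \<cdot> tr L j l = Zer C (level L j) (level Y n)" using j(2) gb t by simp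
      then obtain h where "h \<in> Ar C" "Dom C h = level L j" "Cod C h = K n" "k n \<cdot> h = g \<cdot> tr L j l"
        using kernel_lift[OF K f(1), of n "g \<cdot> tr L j l"] gb t by auto
      then show ?thesis using rep_raise[OF G g j(1)] by (intro exI[of _ j] exI[of _ h]) simp
    qed
    then obtain l h where h: "\<And>n. h n \<in> Ar C" "\<And>n. Dom C (h n) = level L (l n)" "\<And>n. Cod C (h n) = K n"
      "\<And>n. rep G (m n) (l n) (k n \<cdot> h n)" by metis
    note [simp] = h(1-3)
    have ch: "\<exists>j. l n \<le> j \<and> l (Suc n) \<le> j \<and> (bond T n \<cdot> h (Suc n)) \<cdot> tr L j (l (Suc n)) = h n \<cdot> tr L j (l n)" for n
    proof -
      note t = transit_Ar[OF X mono[of n "Suc n"]]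
      have "rep G (m n) (l (Suc n)) (tr X (m (Suc n)) (m n) \<cdot> k (Suc n) \<cdot> h (Suc n))"
        by (rule rep_transit[OF G h(4) mono]) simp
      then have "rep G (m n) (l (Suc n)) (k n \<cdot> d n \<cdot> h (Suc n))"
        using comp_rw[OF d(4)[of n], of "h (Suc n)"] t by simp
      then obtain j where j: "l (Suc n) \<le> j" "l n \<le> j" "(k n \<cdot> d n \<cdot> h (Suc n)) \<cdot> tr L j (l (Suc n)) = (k n \<cdot> h n) \<cdot> tr L j (l n)"
        using rep_eq[OF G _ h(4)] by metis
      note t = transit_Ar[OF L j(1)] transit_Ar[OF L j(2)]
      have "(d n \<cdot> h (Suc n)) \<cdot> tr L j (l (Suc n)) = h n \<cdot> tr L j (l n)"
        by (rule kernel_mono[OF K f(1)]) (use j(3) t in simp_all)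
      then show ?thesis using j by auto
    qed
    let ?H = "pro_ar C L T l h"
    have H: "?H \<in> hom_set PA L T" "\<And>n. rep ?H n (l n) (h n)"
      by (rule pro_ar_hom[OF L Tt]; (rule ch)?; simp)+
    have "\<kappa> \<star> ?H = G"
    proof (rule pro_eqI[OF Pro_Comp_rep(1)[OF H(1) \<kappa>(1)] G])
      fix n
      note t = transit_Ar[OF X nm[of n]]
      have "rep G n (l n) (tr X (m n) n \<cdot> k n \<cdot> h n)" by (rule rep_transit[OF G h(4) nm])
      then show "\<exists>j g. rep (\<kappa> \<star> ?H) n j g \<and> rep G n j g"
        using Pro_Comp_rep(2)[OF H(1) \<kappa>(1) \<kappa>(2) H(2), of n] t by auto
    qed
    then show "\<exists>H. H \<in> Ar PA \<and> Dom PA H = Dom PA G \<and> Cod PA H = T \<and> \<kappa> \<star> H = G"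
      using H(1) by (auto simp: in_hom_set L_def)
  next
    fix H H' assume HH: "H \<in> Ar PA" "H' \<in> Ar PA" "Dom PA H = Dom PA H'" "Cod PA H = T" "Cod PA H' = T"
      "\<kappa> \<star> H = \<kappa> \<star> H'"
    define L where "L = Dom PA H"
    have H: "H \<in> hom_set PA L T" and H': "H' \<in> hom_set PA L T" using HH by (auto simp: in_hom_set L_def)
    note L = Pro_hom_tow(1)[OF H]
    show "H = H'"
    proof (rule pro_eqI[OF H H'])
      fix n
      \<comment> \<open>The comparison starts at level \<open>m n\<close> of \<open>T\<close>:
        composing with \<open>k n\<close> and cancelling it determines the two maps only at level
        \<open>n\<close>.\<close>
      obtain j h h' where h: "rep H (m n) j h" and h': "rep H' (m n) j h'" using rep2[OF H H'] .
      note hb = rep_body[OF H h] rep_body[OF H' h']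
      note t = transit_Ar[OF Tt nm[of n]]
      have "rep (\<kappa> \<star> H) (m n) j ((k n \<cdot> tr T (m n) n) \<cdot> h)" by (rule Pro_Comp_rep(2)[OF H \<kappa>(1) \<kappa>m h]) simp
      moreover have "rep (\<kappa> \<star> H) (m n) j ((k n \<cdot> tr T (m n) n) \<cdot> h')" unfolding HH(6) by (rule Pro_Comp_rep(2)[OF H' \<kappa>(1) \<kappa>m h']) simp
      ultimately obtain i where i: "j \<le> i" "((k n \<cdot> tr T (m n) n) \<cdot> h) \<cdot> tr L i j = ((k n \<cdot> tr T (m n) n) \<cdot> h') \<cdot> tr L i j"
        using rep_eq[OF Pro_Comp_rep(1)[OF H \<kappa>(1)]] by metis
      note t = t transit_Ar[OF L i(1)]
      have e: "(tr T (m n) n \<cdot> h) \<cdot> tr L i j = (tr T (m n) n \<cdot> h') \<cdot> tr L i j"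
        by (rule kernel_mono[OF K f(1)]) (use i(2) t hb in simp_all)
      have "rep H n j (tr T (m n) n \<cdot> h)" "rep H' n j (tr T (m n) n \<cdot> h')"
        using rep_transit[OF H h nm] rep_transit[OF H' h' nm] .
      then show "\<exists>j h. rep H n j h \<and> rep H' n j h"
        using rep_raise[OF H _ i(1)] rep_raise[OF H' _ i(1)] e by metis
    qed
  qed
  then show "\<exists>K k. is_kernel PA F K k" by blast
qed

text \<open>The dual of the kernel construction; as straightening reindexes only the source, the
  cokernels form a tower that receives \<open>Y\<close> level by level.\<close>

lemma Pro_cokernels:
  assumes coker: "has_kernels (opadd C)"
  shows "has_kernels (opadd PA)"
  unfolding has_kernels_def
proof
  interpret P: preadd PA by (rule Pro_preadd)
  fix F assume "F \<in> Ar (opadd PA)"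
  then obtain X Y where F: "F \<in> hom_set PA X Y" by (simp add: in_hom_set)
  note X = Pro_hom_tow(1)[OF F] and Y = Pro_hom_tow(2)[OF F]
  have FXY: "Dom PA F = X" "Cod PA F = Y" using F by (auto simp: in_hom_set)
  obtain m f where r: "\<And>n. rep F n (m n) (f n)" and nm: "\<And>n. n \<le> m n" and mono: "\<And>n l. n \<le> l \<Longrightarrow> m n \<le> m l"
    and c: "\<And>n l. n \<le> l \<Longrightarrow> tr Y l n \<cdot> f l = f n \<cdot> tr X (m l) (m n)"
    by (rule straighten[OF F]) (rule that)
  note f [simp] = rep_body(2-4)[OF F r]
  note [simp] = towD[OF X] towD[OF Y]
  have "\<exists>Q q. is_cokernel (f n) Q q" for n using coker f(1) unfolding has_kernels_def by simp
  then obtain Q q where Q: "\<And>n. is_cokernel (f n) (Q n) (q n)" by metis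
  note q [simp] = cokernelD[OF Q f(1), unfolded f]
  have "\<exists>d. d \<in> Ar C \<and> Cod C d = Q n \<and> Dom C d = Q (Suc n) \<and> d \<cdot> q (Suc n) = q n \<cdot> bond Y n" for n
  proof -
    note t = transit_Ar[OF X mono[of n "Suc n"]]
    have "(q n \<cdot> bond Y n) \<cdot> f (Suc n) = q n \<cdot> f n \<cdot> tr X (m (Suc n)) (m n)"
      using c[of n "Suc n"] by (simp add: transit_bond[OF Y])
    also have "\<dots> = Zer C (level X (m (Suc n))) (Q n)" using comp_rw[OF q(5)[of n], of "tr X (m (Suc n)) (m n)"] t by simp
    finally show ?thesis using cokernel_desc[OF Q, of "Suc n" "q n \<cdot> bond Y n"] by simp
  qed
  then obtain d where d: "\<And>n. d n \<in> Ar C" "\<And>n. Cod C (d n) = Q n" "\<And>n. Dom C (d n) = Q (Suc n)"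
    "\<And>n. d n \<cdot> q (Suc n) = q n \<cdot> bond Y n" by metis
  note [simp] = d(1-3)
  define T where "T = Tower Q d"
  have T [simp]: "level T n = Q n" "bond T n = d n" for n by (simp_all add: T_def)
  have Tt: "T \<in> tow C" by (rule towI) simp_all
  define \<kappa> where "\<kappa> = pro_ar C Y T (\<lambda>l. l) q"
  have c': "\<exists>j. n \<le> j \<and> Suc n \<le> j \<and> (bond T n \<cdot> q (Suc n)) \<cdot> tr Y j (Suc n) = q n \<cdot> tr Y j n" for n
    by (intro exI[of _ "Suc n"]) (simp add: transit_refl transit_bond[OF Y] d(4))
  have \<kappa>: "\<kappa> \<in> hom_set PA Y T" "\<And>l. rep \<kappa> l l (q l)"
    unfolding \<kappa>_def by (rule pro_ar_hom[OF Y Tt]; (rule c')?; simp)+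
  have qt: "q n \<cdot> tr Y l n = tr T l n \<cdot> q l" if "n \<le> l" for n l
    using that
  proof (induction l)
    case 0 then show ?case by (simp add: transit_refl)
  next
    case (Suc l)
    show ?case
    proof (cases "n \<le> l")
      case True
      note t = transit_Ar[OF Tt True] transit_Ar[OF Y True]
      have "q n \<cdot> tr Y (Suc l) n = tr T l n \<cdot> q l \<cdot> bond Y l"
        using comp_rw[OF Suc.IH[OF True], of "bond Y l"] t True by (simp add: transit_Suc)
      also have "\<dots> = tr T (Suc l) n \<cdot> q (Suc l)"
        using t True by (simp add: transit_Suc d(4))
      finally show ?thesis .
    next
      case False
      then have "n = Suc l" using Suc.prems by simp
      then show ?thesis by (simp add: transit_refl)
    qed
  qed
  have "P.is_cokernel F T \<kappa>"
  proof (rule P.cokernelI; (unfold FXY)?)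
    show "T \<in> Ob PA" using Tt by (simp add: Pro_Ob)
    show "\<kappa> \<in> Ar PA" "Cod PA \<kappa> = T" "Dom PA \<kappa> = Y" using \<kappa>(1) by (auto simp: in_hom_set)
    show "\<kappa> \<star> F = Zer PA X T"
    proof (rule pro_eqI[OF Pro_Comp_rep(1)[OF F \<kappa>(1)] Pro_Zer_rep(1)[OF X Tt]])
      fix n
      show "\<exists>j h. rep (\<kappa> \<star> F) n j h \<and> rep (Zer PA X T) n j h"
        using Pro_Comp_rep(2)[OF F \<kappa>(1) \<kappa>(2) r, of n] Pro_Zer_rep(2)[OF X Tt, of n "m n"] by auto
    qed
  next
    fix G assume G': "G \<in> Ar PA" "Dom PA G = Y" "G \<star> F = Zer PA X (Cod PA G)"
    define L where "L = Cod PA G"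
    have G: "G \<in> hom_set PA Y L" using G' by (simp add: in_hom_set L_def)
    note L = Pro_hom_tow(2)[OF G]
    note [simp] = towD[OF L]
    have "\<exists>l h. h \<in> Ar C \<and> Dom C h = Q l \<and> Cod C h = level L n \<and> rep G n l (h \<cdot> q l)" for n
    proof -
      obtain l g where g: "rep G n l g" using rep_ex[OF G] .
      note gb = rep_body[OF G g]
      have GF: "G \<star> F \<in> hom_set PA X L" by (rule Pro_Comp_rep[OF F G])
      have "rep (G \<star> F) n (m l) (g \<cdot> f l)" by (rule Pro_Comp_rep(2)[OF F G g r])
      moreover have "rep (G \<star> F) n (m l) (Zer C (level X (m l)) (level L n))"
        using Pro_Zer_rep(2)[OF X L] by (simp add: G'(3) L_def)
      ultimately obtain j where j: "m l \<le> j" "(g \<cdot> f l) \<cdot> tr X j (m l) = Zer C (level X (m l)) (level L n) \<cdot> tr X j (m l)"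
        using rep_eq[OF GF] by metis
      \<comment> \<open>Chosen so that \<open>m ?l\<close> lies beyond the level \<open>j\<close> at
        which \<open>g \<cdot> f l\<close> vanishes; moved up to level \<open>?l\<close> of
        \<open>Y\<close>, \<open>g\<close> kills \<open>f ?l\<close> and descends to its
        cokernel.\<close>
      let ?l = "max l j"
      have lj: "l \<le> ?l" "j \<le> m ?l" using nm[of ?l] by simp_all
      note t = transit_Ar[OF X j(1)] transit_Ar[OF X lj(2)] transit_Ar[OF Y lj(1)] transit_Ar[OF X mono[OF lj(1)]]
      have gf: "g \<cdot> f l \<cdot> tr X j (m l) = Zer C (level X j) (level L n)" using j(2) gb t by simp
      have "(g \<cdot> tr Y ?l l) \<cdot> f ?l = (g \<cdot> f l \<cdot> tr X j (m l)) \<cdot> tr X (m ?l) j"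
        using c[OF lj(1)] gb t transit_trans[OF X j(1) lj(2)] by simp
      also have "\<dots> = Zer C (level X (m ?l)) (level L n)" unfolding gf using t by simp
      finally obtain h where "h \<in> Ar C" "Cod C h = level L n" "Dom C h = Q ?l" "h \<cdot> q ?l = g \<cdot> tr Y ?l l"
        using cokernel_desc[OF Q f(1), of "g \<cdot> tr Y ?l l" ?l] gb t by auto
      then show ?thesis using rep_raise[OF G g lj(1)] by (intro exI[of _ ?l] exI[of _ h]) simp
    qed
    then obtain l h where h: "\<And>n. h n \<in> Ar C" "\<And>n. Dom C (h n) = Q (l n)" "\<And>n. Cod C (h n) = level L n"
      "\<And>n. rep G n (l n) (h n \<cdot> q (l n))" by metis
    note [simp] = h(1-3)
    have ch: "\<exists>j. l n \<le> j \<and> l (Suc n) \<le> j \<and> (bond L n \<cdot> h (Suc n)) \<cdot> tr T j (l (Suc n)) = h n \<cdot> tr T j (l n)" for n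
    proof -
      obtain j where j: "l (Suc n) \<le> j" "l n \<le> j" "(bond L n \<cdot> h (Suc n) \<cdot> q (l (Suc n))) \<cdot> tr Y j (l (Suc n)) = (h n \<cdot> q (l n)) \<cdot> tr Y j (l n)"
        using rep_eq[OF G rep_bond[OF G h(4)] h(4)] by metis
      note t = transit_Ar[OF Tt j(1)] transit_Ar[OF Tt j(2)] transit_Ar[OF Y j(1)] transit_Ar[OF Y j(2)]
      have "(bond L n \<cdot> h (Suc n)) \<cdot> tr T j (l (Suc n)) = h n \<cdot> tr T j (l n)"
        by (rule cokernel_epi[OF Q[of j] f(1)]) (use j(3) t qt[OF j(1)] qt[OF j(2)] in simp_all)
      then show ?thesis using j by auto
    qed
    let ?H = "pro_ar C T L l h"
    have H: "?H \<in> hom_set PA T L" "\<And>n. rep ?H n (l n) (h n)"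
      by (rule pro_ar_hom[OF Tt L]; (rule ch)?; simp)+
    have "?H \<star> \<kappa> = G"
      by (rule pro_eqI[OF Pro_Comp_rep(1)[OF \<kappa>(1) H(1)] G]) (use Pro_Comp_rep(2)[OF \<kappa>(1) H(1) H(2) \<kappa>(2)] h(4) in blast)
    then show "\<exists>H. H \<in> Ar PA \<and> Cod PA H = Cod PA G \<and> Dom PA H = T \<and> H \<star> \<kappa> = G"
      using H(1) by (auto simp: in_hom_set L_def)
  next
    fix H H' assume HH: "H \<in> Ar PA" "H' \<in> Ar PA" "Cod PA H = Cod PA H'" "Dom PA H = T" "Dom PA H' = T"
      "H \<star> \<kappa> = H' \<star> \<kappa>"
    define L where "L = Cod PA H"
    have H: "H \<in> hom_set PA T L" and H': "H' \<in> hom_set PA T L" using HH by (auto simp: in_hom_set L_def)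
    show "H = H'"
    proof (rule pro_eqI[OF H H'])
      fix n
      obtain j h h' where h: "rep H n j h" and h': "rep H' n j h'" using rep2[OF H H'] .
      note hb = rep_body[OF H h] rep_body[OF H' h']
      have "rep (H \<star> \<kappa>) n j (h \<cdot> q j)" by (rule Pro_Comp_rep(2)[OF \<kappa>(1) H h \<kappa>(2)])
      moreover have "rep (H \<star> \<kappa>) n j (h' \<cdot> q j)" unfolding HH(6) by (rule Pro_Comp_rep(2)[OF \<kappa>(1) H' h' \<kappa>(2)])
      ultimately obtain i where i: "j \<le> i" "(h \<cdot> q j) \<cdot> tr Y i j = (h' \<cdot> q j) \<cdot> tr Y i j"
        using rep_eq[OF Pro_Comp_rep(1)[OF \<kappa>(1) H]] by metis
      note t = transit_Ar[OF Y i(1)] transit_Ar[OF Tt i(1)]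
      have e: "h \<cdot> tr T i j = h' \<cdot> tr T i j"
        by (rule cokernel_epi[OF Q[of i] f(1)]) (use i(2) t hb qt[OF i(1)] in simp_all)
      show "\<exists>j h. rep H n j h \<and> rep H' n j h"
        using rep_raise[OF H h i(1)] rep_raise[OF H' h' i(1)] e by metis
    qed
  qed
  then show "\<exists>K k. is_kernel (opadd PA) F K k" by blast
qed

end

section \<open>Biproducts and countable products of pro-objects\<close>

context preadd
begin

lemma lev_hom:
  assumes X: "X \<in> tow C" and Y: "Y \<in> tow C" and f: "\<And>n. f n \<in> Ar C" "\<And>n. Dom C (f n) = level X n" "\<And>n. Cod C (f n) = level Y n"
    and c: "\<And>n. bond Y n \<cdot> f (Suc n) = f n \<cdot> bond X n"
  shows "lev C X Y f \<in> hom_set PA X Y" "rep (lev C X Y f) n n (f n)"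
proof -
  have c': "\<exists>k. n \<le> k \<and> Suc n \<le> k \<and> (bond Y n \<cdot> f (Suc n)) \<cdot> tr X k (Suc n) = f n \<cdot> tr X k n" for n
    using f towD[OF X] towD[OF Y] c by (intro exI[of _ "Suc n"]) (simp add: transit_refl transit_bond[OF X])
  show "lev C X Y f \<in> hom_set PA X Y" "rep (lev C X Y f) n n (f n)"
    unfolding lev_def by (rule pro_ar_hom[OF X Y]; (rule c')?; use f in simp)+
qed

lemma pro_eqI_level:
  assumes "F \<in> hom_set PA X Y" "G \<in> hom_set PA X Y" "\<And>n. rep F n n (f n)" "\<And>n. rep G n n (g n)" "\<And>n. f n = g n"
  shows "F = G"
  by (rule pro_eqI[OF assms(1,2)]) (use assms(3-5) in metis)

end

context additive
begin

text \<open>The data of a biproduct are packed into one tuple, so that choosing biproducts for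
  infinitely many pairs takes a single choice function.\<close>

definition is_bp where
  "is_bp a b = (\<lambda>(s, i, j, p, q). s \<in> Ob C \<and> i \<in> Ar C \<and> Dom C i = a \<and> Cod C i = s \<and> j \<in> Ar C \<and> Dom C j = b \<and> Cod C j = s \<and>
     p \<in> Ar C \<and> Dom C p = s \<and> Cod C p = a \<and> q \<in> Ar C \<and> Dom C q = s \<and> Cod C q = b \<and>
     p \<cdot> i = Id C a \<and> q \<cdot> j = Id C b \<and> p \<cdot> j = Zer C b a \<and> q \<cdot> i = Zer C a b \<and> i \<cdot> p \<boxplus> j \<cdot> q = Id C s)"

lemma bp_ex:
  assumes "a \<in> Ob C" "b \<in> Ob C" shows "\<exists>t. is_bp a b t"
proof -
  obtain s i j p q where "s \<in> Ob C" "i \<in> hom_set C a s" "j \<in> hom_set C b s" "p \<in> hom_set C s a" "q \<in> hom_set C s b"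
      "p \<cdot> i = Id C a" "q \<cdot> j = Id C b" "p \<cdot> j = Zer C b a" "q \<cdot> i = Zer C a b" "Add C (i \<cdot> p) (j \<cdot> q) = Id C s"
    using biproducts[OF assms] by blast
  then have "is_bp a b (s, i, j, p, q)" by (simp add: is_bp_def in_hom_set)
  then show ?thesis by blast
qed

lemma Pro_additive: "additive PA"
proof -
  interpret P: preadd PA by (rule Pro_preadd)
  have "additive_category PA"
  proof
    obtain z where z: "z \<in> Ob C" "\<forall>a\<in>Ob C. (\<exists>!f. f \<in> hom_set C z a) \<and> (\<exists>!f. f \<in> hom_set C a z)"
      using zero_object by (rule bexE)
    have IdZ: "Id C z = Zer C z z"
    proof -
      have "\<exists>!f. f \<in> hom_set C z z" using z by simp
      moreover have "Id C z \<in> hom_set C z z" "Zer C z z \<in> hom_set C z z" using z(1) by (simp_all add: in_hom_set)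
      ultimately show ?thesis by blast
    qed
    let ?Z = "cst z"
    note Z = const_tow[OF z(1)]
    have ZZ: "Id PA ?Z = Zer PA ?Z ?Z" using cmap_Id[OF z(1)] cmap_Zer[OF z(1) z(1)] IdZ by simp
    have "(\<exists>!f. f \<in> hom_set PA ?Z X) \<and> (\<exists>!f. f \<in> hom_set PA X ?Z)" if X: "X \<in> Ob PA" for X
    proof
      have ZO: "?Z \<in> Ob PA" using Z by (simp add: Pro_Ob)
      have "f = Zer PA ?Z X" if "f \<in> hom_set PA ?Z X" for f
      proof -
        have f: "f \<in> Ar PA" "Dom PA f = ?Z" "Cod PA f = X" using that by (auto simp: in_hom_set)
        have "f = f \<star> Zer PA ?Z ?Z" unfolding ZZ[symmetric] using f by simp
        then show ?thesis using f ZO by simp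
      qed
      then show "\<exists>!f. f \<in> hom_set PA ?Z X" using P.Zer_hom[OF ZO X] by blast
      have "f = Zer PA X ?Z" if "f \<in> hom_set PA X ?Z" for f
      proof -
        have f: "f \<in> Ar PA" "Dom PA f = X" "Cod PA f = ?Z" using that by (auto simp: in_hom_set)
        have "f = Zer PA ?Z ?Z \<star> f" unfolding ZZ[symmetric] using f by simp
        then show ?thesis using f ZO by simp
      qed
      then show "\<exists>!f. f \<in> hom_set PA X ?Z" using P.Zer_hom[OF X ZO] by blast
    qed
    then show "\<exists>z\<in>Ob PA. \<forall>a\<in>Ob PA. (\<exists>!f. f \<in> hom_set PA z a) \<and> (\<exists>!f. f \<in> hom_set PA a z)"
      using Z by (intro bexI[of _ ?Z]) (auto simp: Pro_Ob)
  next
    fix X Y assume "X \<in> Ob PA" "Y \<in> Ob PA"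
    then have X: "X \<in> tow C" and Y: "Y \<in> tow C" by (simp_all add: Pro_Ob)
    note [simp] = towD[OF X] towD[OF Y]
    have "\<exists>t. is_bp (level X n) (level Y n) t" for n by (rule bp_ex) simp_all
    then obtain t where t: "\<And>n. is_bp (level X n) (level Y n) (t n)" by metis
    define S where "S n = fst (t n)" for n
    define i where "i n = fst (snd (t n))" for n
    define j where "j n = fst (snd (snd (t n)))" for n
    define p where "p n = fst (snd (snd (snd (t n))))" for n
    define q where "q n = snd (snd (snd (snd (t n))))" for n
    have b [simp]: "S n \<in> Ob C" "i n \<in> Ar C" "Dom C (i n) = level X n" "Cod C (i n) = S n" "j n \<in> Ar C" "Dom C (j n) = level Y n" "Cod C (j n) = S n"
      "p n \<in> Ar C" "Dom C (p n) = S n" "Cod C (p n) = level X n" "q n \<in> Ar C" "Dom C (q n) = S n" "Cod C (q n) = level Y n"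
      and pi [simp]: "p n \<cdot> i n = Id C (level X n)" and qj [simp]: "q n \<cdot> j n = Id C (level Y n)"
      and pj [simp]: "p n \<cdot> j n = Zer C (level Y n) (level X n)" and qi [simp]: "q n \<cdot> i n = Zer C (level X n) (level Y n)"
      and ipjq: "i n \<cdot> p n \<boxplus> j n \<cdot> q n = Id C (S n)" for n
      using t[of n] unfolding is_bp_def S_def i_def j_def p_def q_def by (simp_all add: case_prod_beta)
    have pix: "p n \<cdot> i n \<cdot> x = x" "q n \<cdot> i n \<cdot> x = Zer C (Dom C x) (level Y n)" if "x \<in> Ar C" "Cod C x = level X n" for x n
      using comp_rw[OF pi[of n], of x] comp_rw[OF qi[of n], of x] that by simp_all
    have qjx: "q n \<cdot> j n \<cdot> x = x" "p n \<cdot> j n \<cdot> x = Zer C (Dom C x) (level X n)" if "x \<in> Ar C" "Cod C x = level Y n" for x n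
      using comp_rw[OF qj[of n], of x] comp_rw[OF pj[of n], of x] that by simp_all
    define T where "T = Tower S (\<lambda>n. i n \<cdot> bond X n \<cdot> p (Suc n) \<boxplus> j n \<cdot> bond Y n \<cdot> q (Suc n))"
    have T [simp]: "level T n = S n" "bond T n = i n \<cdot> bond X n \<cdot> p (Suc n) \<boxplus> j n \<cdot> bond Y n \<cdot> q (Suc n)" for n
      by (simp_all add: T_def)
    have Tt: "T \<in> tow C" by (rule towI) simp_all
    have I: "lev C X T i \<in> hom_set PA X T" "\<And>n. rep (lev C X T i) n n (i n)"
      by (rule lev_hom[OF X Tt]; simp)+
    have J: "lev C Y T j \<in> hom_set PA Y T" "\<And>n. rep (lev C Y T j) n n (j n)"
      by (rule lev_hom[OF Y Tt]; simp)+
    have P: "lev C T X p \<in> hom_set PA T X" "\<And>n. rep (lev C T X p) n n (p n)"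
      by (rule lev_hom[OF Tt X]; simp add: pix qjx)+
    have Q: "lev C T Y q \<in> hom_set PA T Y" "\<And>n. rep (lev C T Y q) n n (q n)"
      by (rule lev_hom[OF Tt Y]; simp add: pix qjx)+
    note c = Pro_Comp_rep
    have "lev C T X p \<star> lev C X T i = Id PA X"
      by (rule pro_eqI_level[OF c(1)[OF I(1) P(1)] Pro_Id_rep(1)[OF X] c(2)[OF I(1) P(1) P(2) I(2)] Pro_Id_rep(2)[OF X]]) simp
    moreover have "lev C T Y q \<star> lev C Y T j = Id PA Y"
      by (rule pro_eqI_level[OF c(1)[OF J(1) Q(1)] Pro_Id_rep(1)[OF Y] c(2)[OF J(1) Q(1) Q(2) J(2)] Pro_Id_rep(2)[OF Y]]) simp
    moreover have "lev C T X p \<star> lev C Y T j = Zer PA Y X"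
      by (rule pro_eqI_level[OF c(1)[OF J(1) P(1)] Pro_Zer_rep(1)[OF Y X] c(2)[OF J(1) P(1) P(2) J(2)] Pro_Zer_rep(2)[OF Y X]]) simp
    moreover have "lev C T Y q \<star> lev C X T i = Zer PA X Y"
      by (rule pro_eqI_level[OF c(1)[OF I(1) Q(1)] Pro_Zer_rep(1)[OF X Y] c(2)[OF I(1) Q(1) Q(2) I(2)] Pro_Zer_rep(2)[OF X Y]]) simp
    moreover have "Add PA (lev C X T i \<star> lev C T X p) (lev C Y T j \<star> lev C T Y q) = Id PA T"
      by (rule pro_eqI_level[OF Pro_Add_rep(1)[OF c(1)[OF P(1) I(1)] c(1)[OF Q(1) J(1)]] Pro_Id_rep(1)[OF Tt]
           Pro_Add_rep(2)[OF c(1)[OF P(1) I(1)] c(1)[OF Q(1) J(1)] c(2)[OF P(1) I(1) I(2) P(2)] c(2)[OF Q(1) J(1) J(2) Q(2)]]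
           Pro_Id_rep(2)[OF Tt]]) (simp add: ipjq)
    ultimately show "\<exists>s\<in>Ob PA. \<exists>i\<in>hom_set PA X s. \<exists>j\<in>hom_set PA Y s. \<exists>p\<in>hom_set PA s X. \<exists>q\<in>hom_set PA s Y.
           p \<star> i = Id PA X \<and> q \<star> j = Id PA Y \<and> p \<star> j = Zer PA Y X \<and> q \<star> i = Zer PA X Y \<and>
           Add PA (i \<star> p) (j \<star> q) = Id PA s"
      using I(1) J(1) P(1) Q(1) Tt unfolding Pro_Ob
      by (intro bexI[of _ T] bexI[of _ "lev C X T i"] bexI[of _ "lev C Y T j"] bexI[of _ "lev C T X p"] bexI[of _ "lev C T Y q"] conjI)
  qed
  then show ?thesis by (intro additive.intro Pro_preadd)
qed

text \<open>A countable product of constants is the tower of finite partial sums. A map from it to a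
  constant factors through one stage, which is why it depends on finitely many coordinates.\<close>

lemma Pro_products:
  assumes "\<And>k. V k \<in> cst ` Ob C"
  shows "\<exists>E pr. is_pro_product PA (cst ` Ob C) E V pr"
proof -
  interpret P: preadd PA by (rule Pro_preadd)
  have "\<exists>v. V k = cst v \<and> v \<in> Ob C" for k using assms[of k] by blast
  then obtain v where v: "\<And>k. V k = cst (v k)" and vO [simp]: "\<And>k. v k \<in> Ob C" by metis
  have "\<exists>t. \<forall>a b. a \<in> Ob C \<longrightarrow> b \<in> Ob C \<longrightarrow> is_bp a b (t a b)" using bp_ex by metis
  then obtain t where t: "\<And>a b. a \<in> Ob C \<Longrightarrow> b \<in> Ob C \<Longrightarrow> is_bp a b (t a b)" by blast
  \<comment> \<open>\<open>S n\<close> is the sum of \<open>v 0\<close> to \<open>v n\<close>; the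
    maps \<open>i\<close>, \<open>j\<close>, \<open>p\<close>, \<open>q\<close> at \<open>n\<close>
    exhibit \<open>S (Suc n)\<close> as the biproduct of \<open>S n\<close> and
    \<open>v (Suc n)\<close>.\<close>
  define S where "S = rec_nat (v 0) (\<lambda>n s. fst (t s (v (Suc n))))"
  define x where "x n = t (S n) (v (Suc n))" for n
  define i where "i n = fst (snd (x n))" for n
  define j where "j n = fst (snd (snd (x n)))" for n
  define p where "p n = fst (snd (snd (snd (x n))))" for n
  define q where "q n = snd (snd (snd (snd (x n))))" for n
  have S0: "S 0 = v 0" and SS: "S (Suc n) = fst (x n)" for n by (simp_all add: S_def x_def)
  have SO [simp]: "S n \<in> Ob C" for n
  proof (induction n)
    case (Suc n)
    then show ?case using t[of "S n" "v (Suc n)"] by (auto simp: SS x_def is_bp_def)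
  qed (simp add: S0)
  have b [simp]: "i n \<in> Ar C" "Dom C (i n) = S n" "Cod C (i n) = S (Suc n)" "j n \<in> Ar C" "Dom C (j n) = v (Suc n)" "Cod C (j n) = S (Suc n)"
      "p n \<in> Ar C" "Dom C (p n) = S (Suc n)" "Cod C (p n) = S n" "q n \<in> Ar C" "Dom C (q n) = S (Suc n)" "Cod C (q n) = v (Suc n)"
      and bp: "p n \<cdot> i n = Id C (S n)" "q n \<cdot> j n = Id C (v (Suc n))"
        "p n \<cdot> j n = Zer C (v (Suc n)) (S n)" "q n \<cdot> i n = Zer C (S n) (v (Suc n))" "i n \<cdot> p n \<boxplus> j n \<cdot> q n = Id C (S (Suc n))" for n
      using t[of "S n" "v (Suc n)"] unfolding is_bp_def i_def j_def p_def q_def SS x_def[symmetric] by (simp_all add: case_prod_beta)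
  define E where "E = Tower S p"
  have E [simp]: "level E n = S n" "bond E n = p n" for n by (simp_all add: E_def)
  have Et: "E \<in> tow C" by (rule towI) simp_all
  have vt: "cst (v k) \<in> tow C" for k by (rule const_tow) simp
  have pj: "proj C E k \<in> Ar PA" "Dom PA (proj C E k) = E" "Cod PA (proj C E k) = cst (S k)" for k
    using proj_hom(1)[OF Et, of k] by (auto simp: in_hom_set)
  have cm: "cmap C f \<in> Ar PA" "Dom PA (cmap C f) = cst (Dom C f)" "Cod PA (cmap C f) = cst (Cod C f)" if "f \<in> Ar C" for f
    using cmap_hom(1)[OF that] by (auto simp: in_hom_set)
  note [simp] = pj cm
  have EO [simp]: "E \<in> Ob PA" using Et by (simp add: Pro_Ob)
  have SvO [simp]: "cst (S n) \<in> Ob PA" "cst (v n) \<in> Ob PA" for n using const_tow by (simp_all add: Pro_Ob)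
  \<comment> \<open>Coordinate 0 is a case of its own because the recursion starts with
    \<open>v 0\<close> and not with the zero object.\<close>
  define pr where "pr k = (case k of 0 \<Rightarrow> proj C E 0 | Suc n \<Rightarrow> cmap C (q n) \<star> proj C E (Suc n))" for k
  have pr0: "pr 0 = proj C E 0" and prS: "pr (Suc n) = cmap C (q n) \<star> proj C E (Suc n)" for n by (simp_all add: pr_def)
  have pr [simp]: "pr k \<in> Ar PA" "Dom PA (pr k) = E" "Cod PA (pr k) = cst (v k)" for k
    by (cases k; simp add: pr0 prS S0)+
  have step: "cmap C (p n) \<star> proj C E (Suc n) = proj C E n" for n
    using cmap_bond_proj[OF Et, of n "Suc n"] by (simp add: transit_bond[OF Et])
  have split: "Add PA (cmap C (i n) \<star> cmap C (p n) \<star> h) (cmap C (j n) \<star> cmap C (q n) \<star> h) = h"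
    if h: "h \<in> Ar PA" "Cod PA h = cst (S (Suc n))" for h n
  proof -
    have "Add PA (cmap C (i n) \<star> cmap C (p n)) (cmap C (j n) \<star> cmap C (q n)) = Id PA (cst (S (Suc n)))"
    proof -
      have "Add PA (cmap C (i n) \<star> cmap C (p n)) (cmap C (j n) \<star> cmap C (q n)) = cmap C (i n \<cdot> p n \<boxplus> j n \<cdot> q n)"
        by (simp add: cmap_comp cmap_Add)
      then show ?thesis by (simp only: bp(5) cmap_Id SO)
    qed
    then have "Add PA (cmap C (i n) \<star> cmap C (p n)) (cmap C (j n) \<star> cmap C (q n)) \<star> h = h" using h by simp
    then show ?thesis using h by simp
  qed
  \<comment> \<open>Stage \<open>n\<close> has the coordinates 0 to \<open>n\<close>, hence the
    bound \<open>Suc n\<close>.\<close>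
  have coord: "proj C E n \<star> f = proj C E n \<star> g"
    if f: "f \<in> hom_set PA T E" "g \<in> hom_set PA T E" "\<forall>k<Suc n. pr k \<star> f = pr k \<star> g" for f g T n
    using f(3)
  proof (induction n)
    case 0 then show ?case by (simp add: pr0)
  next
    case (Suc n)
    have fg: "f \<in> Ar PA" "Dom PA f = T" "Cod PA f = E" "g \<in> Ar PA" "Dom PA g = T" "Cod PA g = E"
      using f by (auto simp: in_hom_set)
    have IH: "proj C E n \<star> f = proj C E n \<star> g" using Suc by simp
    have q: "cmap C (q n) \<star> proj C E (Suc n) \<star> f = cmap C (q n) \<star> proj C E (Suc n) \<star> g"
      using Suc.prems[rule_format, of "Suc n"] fg by (simp add: prS)
    have p: "cmap C (p n) \<star> proj C E (Suc n) \<star> f = cmap C (p n) \<star> proj C E (Suc n) \<star> g"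
      using IH P.comp_rw[OF step[of n], of f] P.comp_rw[OF step[of n], of g] fg by simp
    have "proj C E (Suc n) \<star> f = Add PA (cmap C (i n) \<star> cmap C (p n) \<star> proj C E (Suc n) \<star> f)
        (cmap C (j n) \<star> cmap C (q n) \<star> proj C E (Suc n) \<star> f)"
      by (rule split[symmetric]) (simp_all add: fg)
    also have "\<dots> = proj C E (Suc n) \<star> g"
      unfolding p q by (rule split) (simp_all add: fg)
    finally show ?case .
  qed
  have mono: "f = g" if f: "f \<in> hom_set PA T E" "g \<in> hom_set PA T E" "\<forall>k. pr k \<star> f = pr k \<star> g" for f g T
    by (rule proj_mono[OF f(1,2)]) (use coord[OF f(1,2)] f(3) in blast)
  have fin: "\<exists>n. \<forall>T. \<forall>f\<in>hom_set PA T E. \<forall>f'\<in>hom_set PA T E.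
        (\<forall>k<n. pr k \<star> f = pr k \<star> f') \<longrightarrow> g \<star> f = g \<star> f'"
    if W: "W \<in> cst ` Ob C" and g: "g \<in> hom_set PA E W" for g W
  proof -
    obtain w where w: "W = cst w" using W by blast
    obtain k h where h: "h \<in> Ar C" "Dom C h = level E k" "Cod C h = w" "g = cmap C h \<star> proj C E k"
      using pro_to_const g unfolding w by blast
    have "g \<star> f = g \<star> f'" if f: "f \<in> hom_set PA T E" "f' \<in> hom_set PA T E"
      "\<forall>l<Suc k. pr l \<star> f = pr l \<star> f'" for T f f'
      using coord[OF f] h f(1,2) by (simp add: in_hom_set)
    then show ?thesis by blast
  qed
  have ex: "\<exists>h\<in>hom_set PA T E. \<forall>k. pr k \<star> h = f k" if T: "T \<in> Ob PA"
    and f: "\<forall>k. f k \<in> hom_set PA T (cst (v k))" for T f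
  proof -
    have f' [simp]: "f k \<in> Ar PA" "Dom PA (f k) = T" "Cod PA (f k) = cst (v k)" for k
      using f by (auto simp: in_hom_set)
    \<comment> \<open>The map to stage \<open>n\<close> with the prescribed first coordinates; the
      projection from the next stage gives it back, so the \<open>G n\<close> form a cone over the
      tower.\<close>
    define G where "G = rec_nat (f 0) (\<lambda>n g. Add PA (cmap C (i n) \<star> g) (cmap C (j n) \<star> f (Suc n)))"
    have G0: "G 0 = f 0" and GS: "G (Suc n) = Add PA (cmap C (i n) \<star> G n) (cmap C (j n) \<star> f (Suc n))" for n
      by (simp_all add: G_def)
    have G: "G n \<in> Ar PA \<and> Dom PA (G n) = T \<and> Cod PA (G n) = cst (S n)" for n
      by (induction n) (simp_all add: G0 GS S0)
    note [simp] = conjunct1[OF G] conjunct1[OF conjunct2[OF G]] conjunct2[OF conjunct2[OF G]]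
    have bpc: "cmap C (p n) \<star> cmap C (i n) = Id PA (cst (S n))"
      "cmap C (q n) \<star> cmap C (j n) = Id PA (cst (v (Suc n)))"
      "cmap C (p n) \<star> cmap C (j n) = Zer PA (cst (v (Suc n))) (cst (S n))"
      "cmap C (q n) \<star> cmap C (i n) = Zer PA (cst (S n)) (cst (v (Suc n)))" for n
      by (simp_all add: cmap_comp bp cmap_Id cmap_Zer)
    have pG: "cmap C (p n) \<star> G (Suc n) = G n" and qG: "cmap C (q n) \<star> G (Suc n) = f (Suc n)" for n
      using P.comp_rw[OF bpc(1)[of n], of "G n"] P.comp_rw[OF bpc(2)[of n], of "f (Suc n)"]
        P.comp_rw[OF bpc(3)[of n], of "f (Suc n)"] P.comp_rw[OF bpc(4)[of n], of "G n"] T by (simp_all add: GS)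
    have "\<exists>F\<in>hom_set PA T E. \<forall>k. proj C E k \<star> F = G k"
      by (rule proj_lift[OF Et]) (use T pG in \<open>simp_all add: in_hom_set Pro_Ob\<close>)
    then obtain F where F: "F \<in> Ar PA" "Dom PA F = T" "Cod PA F = E" "\<And>k. proj C E k \<star> F = G k"
      by (auto simp: in_hom_set)
    have "pr k \<star> F = f k" for k
      by (cases k) (use F in \<open>simp_all add: pr0 prS G0 qG\<close>)
    moreover have "F \<in> hom_set PA T E" using F(1-3) by (simp add: in_hom_set)
    ultimately show ?thesis by blast
  qed
  have "is_pro_product PA (cst ` Ob C) E V pr"
    unfolding is_pro_product_def v
  proof (intro conjI)
    show "E \<in> Ob PA" by (rule EO)
    show "\<forall>k. pr k \<in> hom_set PA E (cst (v k))" by (simp add: in_hom_set)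
  qed ((intro ballI allI impI; rule ex; assumption) | (intro ballI allI impI; rule mono; assumption) | (intro ballI; rule fin; assumption))+
  then show ?thesis by blast
qed

end

section \<open>Pro-supercomplexes as supercomplexes of pro-objects\<close>

declare Sup_cat_simps [simp del]

text \<open>The comparison functor on objects; on arrows it is
  \<open>pro_part_arrow\<close>.\<close>

definition Phi where
  "Phi C X = Supercx (pro_part X) (pro_bdry C X)"

text \<open>The complex with the identity of \<open>T\<close> as differential from degree \<open>i\<close> to \<open>i + 1\<close>; it is free on \<open>T\<close> in
  degree \<open>i\<close> and cofree on \<open>T\<close> in degree \<open>i + 1\<close>.\<close>

definition free_cx where
  "free_cx C a i = Supercx (\<lambda>_. a) (\<lambda>j. if j = i then Id C a else Zer C a a)"

definition free_tower where
  "free_tower C T i = Tower (\<lambda>n. free_cx C (level T n) i)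
     (\<lambda>n. Arrow (free_cx C (level T (Suc n)) i) (free_cx C (level T n) i) (\<lambda>_ :: bit. bond T n))"

lemma Phi_simps [simp]: "part (Phi C X) i = pro_part X i" "bdry (Phi C X) i = pro_bdry C X i"
  by (simp_all add: Phi_def)

lemma pro_part_simps [simp]: "level (pro_part X i) n = part (level X n) i" "bond (pro_part X i) n = body (bond X n) i"
  by (simp_all add: pro_part_def)

lemma bit_not_eq: "(j::bit) \<noteq> i \<longleftrightarrow> j = i + 1"
  by (cases i; cases j) (simp_all add: add_bit_eq_xor)

text \<open>Indexing the summands by bits lets one argument treat both degrees, with
  \<open>j + 1\<close> naming the other summand.\<close>

lemma (in additive) bit_biproduct:
  fixes c :: "bit \<Rightarrow> 'o"
  assumes "\<And>j. c j \<in> Ob C"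
  obtains D inj prj where "D \<in> Ob C" "\<And>j. inj j \<in> hom_set C (c j) D" "\<And>j. prj j \<in> hom_set C D (c j)"
    "\<And>j. prj j \<cdot> inj j = Id C (c j)" "\<And>j. prj (j + 1) \<cdot> inj j = Zer C (c j) (c (j + 1))"
    "\<And>j. inj j \<cdot> prj j \<boxplus> inj (j + 1) \<cdot> prj (j + 1) = Id C D"
proof -
  obtain s i j p q where s: "s \<in> Ob C" "i \<in> hom_set C (c 0) s" "j \<in> hom_set C (c 1) s" "p \<in> hom_set C s (c 0)" "q \<in> hom_set C s (c 1)"
      "p \<cdot> i = Id C (c 0)" "q \<cdot> j = Id C (c 1)" "p \<cdot> j = Zer C (c 1) (c 0)" "q \<cdot> i = Zer C (c 0) (c 1)" "Add C (i \<cdot> p) (j \<cdot> q) = Id C s"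
    using biproducts[of "c 0" "c 1"] assms by blast
  have "j \<cdot> q \<boxplus> i \<cdot> p = Id C s" using s(10) Add_commute[of "j \<cdot> q" "i \<cdot> p"] s(2-5) by (simp add: in_hom_set)
  note s = s this
  have b: "(1::bit) + 1 = 0" by simp
  define inj where "inj k = (if k = 0 then i else j)" for k :: bit
  define prj where "prj k = (if k = 0 then p else q)" for k :: bit
  have e: "inj 0 = i" "inj 1 = j" "prj 0 = p" "prj 1 = q" by (simp_all add: inj_def prj_def)
  have "inj k \<in> hom_set C (c k) s \<and> prj k \<in> hom_set C s (c k) \<and>
    prj k \<cdot> inj k = Id C (c k) \<and> prj (k + 1) \<cdot> inj k = Zer C (c k) (c (k + 1)) \<and> inj k \<cdot> prj k \<boxplus> inj (k + 1) \<cdot> prj (k + 1) = Id C s" for k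
    by (cases k) (simp_all add: e s b)
  then show thesis using s(1) by (intro that[of s inj prj]) auto
qed

context preadd
begin

interpretation S: preadd SC by (rule Sup_preadd)
interpretation P: preadd PA by (rule Pro_preadd)


lemma Sup_towD:
  assumes "X \<in> tow SC"
  shows "level X n \<in> Ob SC" "chain C (level X (Suc n)) (level X n) (body (bond X n))"
proof -
  show "level X n \<in> Ob SC" by (rule S.towD[OF assms])
  show "chain C (level X (Suc n)) (level X n) (body (bond X n))"
    using S.towD[OF assms] by (simp add: Sup_Ar Sup_cat_simps)
qed

lemma pro_part_tow:
  assumes X: "X \<in> tow SC" shows "pro_part X i \<in> tow C"
  by (rule towI) (use cxD(1)[OF Sup_towD(1)[OF X]] chainD(1-3)[OF Sup_towD(2)[OF X]] in simp_all)

lemma transit_part: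
  assumes X: "X \<in> tow SC" and "m \<le> n"
  shows "body (transit SC X n m) i = tr (pro_part X i) n m"
  using assms(2)
proof (induction n)
  case 0
  then show ?case by (simp add: S.transit_refl transit_refl Sup_cat_simps)
next
  case (Suc n)
  show ?case
  proof (cases "m \<le> n")
    case True
    then show ?thesis using Suc.IH by (simp add: S.transit_Suc transit_Suc Sup_cat_simps)
  next
    case False
    then have "m = Suc n" using Suc.prems by simp
    then show ?thesis by (simp add: S.transit_refl transit_refl Sup_cat_simps)
  qed
qed

lemma rep_chain:
  assumes F: "F \<in> hom_set PS X Y" and r: "rep F n m f"
  shows "chain C (level X m) (level Y n) (body f)" "f = Arrow (level X m) (level Y n) (body f)"
proof -
  note f = S.rep_body(2-4)[OF F r]
  show "chain C (level X m) (level Y n) (body f)" using f by (auto simp: Sup_Ar Sup_cat_simps)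
  show "f = Arrow (level X m) (level Y n) (body f)" using f by (cases f) (auto simp: Sup_cat_simps)
qed

lemma pro_part_arrow:
  assumes F: "F \<in> hom_set PS X Y"
  shows "parr F i \<in> hom_set PA (pro_part X i) (pro_part Y i)"
    "rep F n m f \<Longrightarrow> rep (parr F i) n m (body f i)"
proof -
  note X = S.Pro_hom_tow(1)[OF F] and Y = S.Pro_hom_tow(2)[OF F]
  note Xi = pro_part_tow[OF X, of i] and Yi = pro_part_tow[OF Y, of i]
  have src: "src F = X" "tgt F = Y" using F by (auto simp: in_hom_set Pro_simps)
  have body: "body (parr F i) n = germ C (pro_part X i) (part (level Y n) i) m (body f i)" if f: "rep F n m f" for n m f
  proof -
    note fc = rep_chain[OF F f]
    have fh: "body f i \<in> hom_set C (level (pro_part X i) m) (part (level Y n) i)" using chainD(1-3)[OF fc(1)] by (simp add: in_hom_set)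
    have *: "germ C (pro_part X i) (part (level Y n) i) m' (body f' i) = germ C (pro_part X i) (part (level Y n) i) m (body f i)"
      if f': "(m', f') \<in> body F n" for m' f'
    proof -
      have r': "rep F n m' f'" using f' by (simp add: rep_def)
      note fc' = rep_chain[OF F r']
      have fh': "body f' i \<in> hom_set C (level (pro_part X i) m') (part (level Y n) i)" using chainD(1-3)[OF fc'(1)] by (simp add: in_hom_set)
      obtain k where k: "m' \<le> k" "m \<le> k" "f' \<cdot>\<^bsub>SC\<^esub> transit SC X k m' = f \<cdot>\<^bsub>SC\<^esub> transit SC X k m"
        using S.rep_eq[OF F r' f] .
      have "body f' i \<cdot> tr (pro_part X i) k m' = body f i \<cdot> tr (pro_part X i) k m"
        using arg_cong[OF k(3), of "\<lambda>x. body x i"] transit_part[OF X k(1)] transit_part[OF X k(2)] by (simp add: Sup_cat_simps)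
      then show ?thesis using germ_eq_iff[OF Xi fh' fh] k(1,2) by blast
    qed
    have "body (parr F i) n = (\<Union>x\<in>body F n. germ C (pro_part X i) (part (level Y n) i) (fst x) (body (snd x) i))"
      by (auto simp: pro_part_arrow_def src germ_def)
    also have "\<dots> = germ C (pro_part X i) (part (level Y n) i) m (body f i)"
    proof -
      have "germ C (pro_part X i) (part (level Y n) i) (fst x) (body (snd x) i) = germ C (pro_part X i) (part (level Y n) i) m (body f i)" if "x \<in> body F n" for x
        using *[of "fst x" "snd x"] that by simp
      then show ?thesis using f unfolding rep_def by blast
    qed
    finally show ?thesis .
  qed
  have "body (parr F i) n \<in> colim_hom C (pro_part X i) (level (pro_part Y i) n) \<and>
        postcomp C (pro_part X i) (bond (pro_part Y i) n) (body (parr F i) (Suc n)) = body (parr F i) n" for n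
  proof -
    obtain m f where f: "rep F (Suc n) m f" using S.rep_ex[OF F] .
    note fc = rep_chain[OF F f] and fb = S.rep_bond[OF F f]
    note bc = Sup_towD(2)[OF Y, of n]
    have "body (parr F i) n = germ C (pro_part X i) (part (level Y n) i) m (body (bond Y n) i \<cdot> body f i)"
      using body[OF fb] by (simp add: Sup_cat_simps)
    moreover have "postcomp C (pro_part X i) (body (bond Y n) i) (germ C (pro_part X i) (part (level Y (Suc n)) i) m (body f i)) = germ C (pro_part X i) (part (level Y n) i) m (body (bond Y n) i \<cdot> body f i)"
      by (rule postcomp_germ[OF Xi]) (use chainD(1-3)[OF fc(1)] chainD(1-3)[OF bc] in \<open>simp_all add: in_hom_set\<close>)
    ultimately show ?thesis
      using body[OF f] chainD(1-3)[OF fc(1)] chainD(1-3)[OF bc] by (simp add: germ_in_colim in_hom_set)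
  qed
  then show h: "parr F i \<in> hom_set PA (pro_part X i) (pro_part Y i)"
    unfolding in_hom_set Pro_Ar Pro_simps using Xi Yi by (simp add: pro_part_arrow_def src)
  show "rep F n m f \<Longrightarrow> rep (parr F i) n m (body f i)"
    unfolding rep_iff[OF h] using body[of n m f] rep_chain[OF F, of n m f] chainD(1-3)[of "level X m" "level Y n" "body f" i] by (auto simp: in_hom_set)
qed

lemma pro_bdry:
  assumes X: "X \<in> tow SC"
  shows "pro_bdry C X i \<in> hom_set PA (pro_part X i) (pro_part X (i + 1))" "rep (pro_bdry C X i) n n (bdry (level X n) i)"
proof -
  have e: "pro_bdry C X i = lev C (pro_part X i) (pro_part X (i + 1)) (\<lambda>n. bdry (level X n) i)"
    by (simp add: pro_bdry_def lev_def pro_ar_def)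
  note b = cxD[OF Sup_towD(1)[OF X]] and c = chainD[OF Sup_towD(2)[OF X]]
  show "pro_bdry C X i \<in> hom_set PA (pro_part X i) (pro_part X (i + 1))" "rep (pro_bdry C X i) n n (bdry (level X n) i)"
    unfolding e by (rule lev_hom[OF pro_part_tow[OF X] pro_part_tow[OF X]]; use b c in simp)+
qed

lemma Phi_cx:
  assumes X: "X \<in> tow SC" shows "Phi C X \<in> Ob (Sup_cat PA)"
proof -
  note b = pro_bdry[OF X]
  show ?thesis
  proof (rule P.cxI)
    show "part (Phi C X) i \<in> Ob PA" for i using pro_part_tow[OF X] by (simp add: Pro_Ob)
    show "bdry (Phi C X) i \<in> Ar PA" "Dom PA (bdry (Phi C X) i) = part (Phi C X) i" "Cod PA (bdry (Phi C X) i) = part (Phi C X) (i + 1)" for i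
      using b(1)[of i] by (simp_all add: in_hom_set)
    show "bdry (Phi C X) (i + 1) \<star> bdry (Phi C X) i = Zer PA (part (Phi C X) i) (part (Phi C X) i)" for i
    proof -
      have b': "pro_bdry C X (i + 1) \<in> hom_set PA (pro_part X (i + 1)) (pro_part X i)" using b(1)[of "i + 1"] by simp
      note z = Pro_Zer_rep[OF pro_part_tow[OF X, of i] pro_part_tow[OF X, of i]]
      have "pro_bdry C X (i + 1) \<star> pro_bdry C X i = Zer PA (pro_part X i) (pro_part X i)"
        by (rule pro_eqI_level[OF Pro_Comp_rep(1)[OF b(1) b'] z(1) Pro_Comp_rep(2)[OF b(1) b' b(2) b(2)] z(2)])
          (use cxD[OF Sup_towD(1)[OF X]] in simp)
      then show ?thesis by simp
    qed
  qed
qed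

lemma Phi_chain:
  assumes F: "F \<in> hom_set PS X Y" shows "chain PA (Phi C X) (Phi C Y) (parr F)"
proof -
  note X = S.Pro_hom_tow(1)[OF F] and Y = S.Pro_hom_tow(2)[OF F]
  note p = pro_part_arrow[OF F] and bX = pro_bdry[OF X] and bY = pro_bdry[OF Y]
  show ?thesis
  proof (rule P.chainI)
    show "deg0 PA (Phi C X) (Phi C Y) (parr F)" using Phi_cx[OF X] Phi_cx[OF Y] p(1) by (simp add: deg0_def)
    fix i
    have "pro_bdry C Y i \<star> parr F i = parr F (i + 1) \<star> pro_bdry C X i"
    proof (rule pro_eqI[OF Pro_Comp_rep(1)[OF p(1) bY(1)] Pro_Comp_rep(1)[OF bX(1) p(1)]])
      fix n
      obtain m f where f: "rep F n m f" using S.rep_ex[OF F] .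
      show "\<exists>m f. rep (pro_bdry C Y i \<star> parr F i) n m f \<and> rep (parr F (i + 1) \<star> pro_bdry C X i) n m f"
      proof (intro exI conjI)
        show "rep (pro_bdry C Y i \<star> parr F i) n m (bdry (level Y n) i \<cdot> body f i)"
          by (rule Pro_Comp_rep(2)[OF p(1) bY(1) bY(2) p(2)[OF f]])
        show "rep (parr F (i + 1) \<star> pro_bdry C X i) n m (bdry (level Y n) i \<cdot> body f i)"
          unfolding chainD(4)[OF rep_chain(1)[OF F f], of i] by (rule Pro_Comp_rep(2)[OF bX(1) p(1) p(2)[OF f] bX(2)])
      qed
    qed
    then show "bdry (Phi C Y) i \<star> parr F i = parr F (i + 1) \<star> bdry (Phi C X) i" by simp
  qed
qed

lemma Phi_comp:
  assumes F: "F \<in> hom_set PS X Y" and G: "G \<in> hom_set PS Y Z"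
  shows "parr (G \<cdot>\<^bsub>PS\<^esub> F) i = parr G i \<star> parr F i"
proof -
  note GF = S.Pro_Comp_rep[OF F G]
  note f = pro_part_arrow[OF F] and g = pro_part_arrow[OF G] and gf = pro_part_arrow[OF GF(1)]
  show ?thesis
  proof (rule pro_eqI[OF gf(1) Pro_Comp_rep(1)[OF f(1) g(1)]])
    fix n
    obtain m h where h: "rep G n m h" using S.rep_ex[OF G] .
    obtain k l where l: "rep F m k l" using S.rep_ex[OF F] .
    show "\<exists>m f. rep (parr (G \<cdot>\<^bsub>PS\<^esub> F) i) n m f \<and> rep (parr G i \<star> parr F i) n m f"
      using gf(2)[OF GF(2)[OF h l], of i] Pro_Comp_rep(2)[OF f(1) g(1) g(2)[OF h] f(2)[OF l], of i] by (auto simp: Sup_cat_simps)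
  qed
qed

lemma Phi_Id:
  assumes X: "X \<in> tow SC" shows "parr (Id PS X) i = Id PA (pro_part X i)"
proof -
  note I = S.Pro_Id_rep[OF X] and I' = Pro_Id_rep[OF pro_part_tow[OF X, of i]]
  show ?thesis
    by (rule pro_eqI_level[OF pro_part_arrow(1)[OF I(1)] I'(1) pro_part_arrow(2)[OF I(1) I(2)] I'(2)]) (simp add: Sup_cat_simps)
qed

lemma Phi_Zer:
  assumes X: "X \<in> tow SC" and Y: "Y \<in> tow SC"
  shows "parr (Zer PS X Y) i = Zer PA (pro_part X i) (pro_part Y i)"
proof -
  note I = S.Pro_Zer_rep[OF X Y] and I' = Pro_Zer_rep[OF pro_part_tow[OF X, of i] pro_part_tow[OF Y, of i]]
  show ?thesis
    by (rule pro_eqI_level[OF pro_part_arrow(1)[OF I(1)] I'(1) pro_part_arrow(2)[OF I(1) I(2)] I'(2)]) (simp add: Sup_cat_simps)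
qed

lemma Phi_Add:
  assumes F: "F \<in> hom_set PS X Y" and G: "G \<in> hom_set PS X Y"
  shows "parr (Add PS F G) i = Add PA (parr F i) (parr G i)"
proof -
  note FG = S.Pro_Add_rep[OF F G]
  note f = pro_part_arrow[OF F] and g = pro_part_arrow[OF G] and fg = pro_part_arrow[OF FG(1)]
  show ?thesis
  proof (rule pro_eqI[OF fg(1) Pro_Add_rep(1)[OF f(1) g(1)]])
    fix n
    obtain m h l where h: "rep F n m h" and l: "rep G n m l" using S.rep2[OF F G] .
    show "\<exists>m f. rep (parr (Add PS F G) i) n m f \<and> rep (Add PA (parr F i) (parr G i)) n m f"
      using fg(2)[OF FG(2)[OF h l], of i] Pro_Add_rep(2)[OF f(1) g(1) f(2)[OF h] g(2)[OF l], of i] by (auto simp: Sup_cat_simps)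
  qed
qed

text \<open>There are only two degrees, so conditions that hold in each degree from some level on
  hold in both at a common level. Faithfulness and fullness of the comparison functor rest on
  this.\<close>

lemma bit_all_large:
  assumes "\<And>i :: bit. \<exists>k. m \<le> k \<and> (\<forall>l\<ge>k. Q i l)"
  shows "\<exists>k\<ge>m. \<forall>i. Q i (k :: nat)"
proof -
  obtain k where k: "\<And>i :: bit. m \<le> k i \<and> (\<forall>l\<ge>k i. Q i l)" using assms by metis
  have "Q i (max (k 0) (k 1))" for i using k[of i] by (cases i) auto
  then show ?thesis using k[of 0] by (intro exI[of _ "max (k 0) (k 1)"]) auto
qed

lemma rep_eq_all:
  assumes F: "F \<in> hom_set PA X Y" and r: "rep F n m f" "rep F n m' f'"
  shows "\<exists>k. max m m' \<le> k \<and> (\<forall>l\<ge>k. f \<cdot> tr X l m = f' \<cdot> tr X l m')"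
proof -
  obtain k where k: "m \<le> k" "m' \<le> k" "f \<cdot> tr X k m = f' \<cdot> tr X k m'" using rep_eq[OF F r] .
  have "f \<cdot> tr X l m = f' \<cdot> tr X l m'" if "k \<le> l" for l
    by (rule germ_rel_raise[OF Pro_hom_tow(1)[OF F] _ _ k that]) (use rep_body[OF F r(1)] rep_body[OF F r(2)] in \<open>simp_all add: in_hom_set\<close>)
  then show ?thesis using k by (intro exI[of _ k]) simp
qed

text \<open>Representatives of the two maps agree in each degree after a change of level, and one
  level works for both degrees.\<close>

lemma Phi_faithful:
  assumes F: "F \<in> hom_set PS X Y" and G: "G \<in> hom_set PS X Y"
    and e: "\<And>i. parr F i = parr G i"
  shows "F = G"
proof -
  note X = S.Pro_hom_tow(1)[OF F]
  show ?thesis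
  proof (rule S.pro_eqI[OF F G])
    fix n
    obtain m f g where f: "rep F n m f" and g: "rep G n m g" using S.rep2[OF F G] .
    have "\<exists>k. m \<le> k \<and> (\<forall>l\<ge>k. body f i \<cdot> tr (pro_part X i) l m = body g i \<cdot> tr (pro_part X i) l m)" for i
    proof -
      have "rep (parr F i) n m (body g i)" unfolding e by (rule pro_part_arrow(2)[OF G g])
      from rep_eq_all[OF pro_part_arrow(1)[OF F] pro_part_arrow(2)[OF F f] this] show ?thesis by simp
    qed
    then have "\<exists>k\<ge>m. \<forall>i. body f i \<cdot> tr (pro_part X i) k m = body g i \<cdot> tr (pro_part X i) k m"
      by (rule bit_all_large)
    then obtain k where k: "m \<le> k" "\<And>i. body f i \<cdot> tr (pro_part X i) k m = body g i \<cdot> tr (pro_part X i) k m"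
      by blast
    have "body (f \<cdot>\<^bsub>SC\<^esub> transit SC X k m) i = body (g \<cdot>\<^bsub>SC\<^esub> transit SC X k m) i" for i
      using k(2) transit_part[OF X k(1)] by (simp add: Sup_cat_simps)
    moreover have "tgt f = tgt g" using rep_chain(2)[OF F f] rep_chain(2)[OF G g] by (metis arrow.sel(2))
    ultimately have "f \<cdot>\<^bsub>SC\<^esub> transit SC X k m = g \<cdot>\<^bsub>SC\<^esub> transit SC X k m"
      by (auto simp: Sup_cat_simps)
    then show "\<exists>m f. rep F n m f \<and> rep G n m f"
      using S.rep_raise[OF F f k(1)] S.rep_raise[OF G g k(1)] by auto
  qed
qed

text \<open>Representatives of the two components are brought to one level. They commute with the
  differentials as germs, hence strictly at a higher level common to both degrees; strictness makes
  them a chain map.\<close>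

lemma Phi_full:
  assumes X: "X \<in> tow SC" and Y: "Y \<in> tow SC" and \<phi>: "chain PA (Phi C X) (Phi C Y) \<phi>"
  obtains F where "F \<in> hom_set PS X Y" "\<And>i. parr F i = \<phi> i"
proof -
  have \<phi>h: "\<phi> i \<in> hom_set PA (pro_part X i) (pro_part Y i)" for i
    using P.chainD(1-3)[OF \<phi>, of i] by (simp add: in_hom_set)
  note bX = pro_bdry[OF X] and bY = pro_bdry[OF Y]
  have Yb: "chain C (level Y (Suc n)) (level Y n) (body (bond Y n))" for n by (rule Sup_towD(2)[OF Y])
  have "\<exists>m f. chain C (level X m) (level Y n) f \<and> (\<forall>i. rep (\<phi> i) n m (f i))" for n
  proof -
    obtain m0 g0 where g0: "rep (\<phi> 0) n m0 g0" using rep_ex[OF \<phi>h] .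
    obtain m1 g1 where g1: "rep (\<phi> 1) n m1 g1" using rep_ex[OF \<phi>h] .
    let ?m = "max m0 m1"
    define g where "g i = (if i = 0 then g0 \<cdot> tr (pro_part X 0) ?m m0 else g1 \<cdot> tr (pro_part X 1) ?m m1)" for i :: bit
    have g: "rep (\<phi> i) n ?m (g i)" for i
      by (cases i) (use rep_raise[OF \<phi>h g0, of ?m] rep_raise[OF \<phi>h g1, of ?m] in \<open>simp_all add: g_def\<close>)
    note gb = rep_body(2-4)[OF \<phi>h g]
    note [simp] = cxD[OF Sup_towD(1)[OF X]] cxD[OF Sup_towD(1)[OF Y]]
    have "\<exists>k. ?m \<le> k \<and> (\<forall>l\<ge>k. (bdry (level Y n) i \<cdot> g i) \<cdot> tr (pro_part X i) l ?m = (g (i + 1) \<cdot> bdry (level X ?m) i) \<cdot> tr (pro_part X i) l ?m)" for i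
    proof -
      have l: "rep (pro_bdry C Y i \<star> \<phi> i) n ?m (bdry (level Y n) i \<cdot> g i)"
        by (rule Pro_Comp_rep(2)[OF \<phi>h bY(1) bY(2) g])
      have "rep (\<phi> (i + 1) \<star> pro_bdry C X i) n ?m (g (i + 1) \<cdot> bdry (level X ?m) i)"
        by (rule Pro_Comp_rep(2)[OF bX(1) \<phi>h g bX(2)])
      then have r: "rep (pro_bdry C Y i \<star> \<phi> i) n ?m (g (i + 1) \<cdot> bdry (level X ?m) i)"
        using P.chainD(4)[OF \<phi>, of i] by simp
      show ?thesis using rep_eq_all[OF Pro_Comp_rep(1)[OF \<phi>h bY(1)] l r] by simp
    qed
    then have "\<exists>k\<ge>?m. \<forall>i. (bdry (level Y n) i \<cdot> g i) \<cdot> tr (pro_part X i) k ?m = (g (i + 1) \<cdot> bdry (level X ?m) i) \<cdot> tr (pro_part X i) k ?m"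
      by (rule bit_all_large)
    then obtain k where k: "?m \<le> k"
      "\<And>i. (bdry (level Y n) i \<cdot> g i) \<cdot> tr (pro_part X i) k ?m = (g (i + 1) \<cdot> bdry (level X ?m) i) \<cdot> tr (pro_part X i) k ?m" by blast
    define f where "f i = g i \<cdot> tr (pro_part X i) k ?m" for i
    note t = transit_Ar[OF pro_part_tow[OF X] k(1)]
    have tc: "chain C (level X k) (level X ?m) (\<lambda>i. tr (pro_part X i) k ?m)"
    proof -
      have "chain C (level X k) (level X ?m) (body (transit SC X k ?m))"
        using S.transit_Ar[OF X k(1)] by (simp add: Sup_Ar Sup_cat_simps)
      moreover have "body (transit SC X k ?m) = (\<lambda>i. tr (pro_part X i) k ?m)"
        using transit_part[OF X k(1)] by auto
      ultimately show ?thesis by simp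
    qed
    have f: "f i \<in> Ar C" "Dom C (f i) = part (level X k) i" "Cod C (f i) = part (level Y n) i" for i
      using gb t by (simp_all add: f_def)
    have "chain C (level X k) (level Y n) f"
    proof (intro chainI deg0I Sup_towD(1)[OF X] Sup_towD(1)[OF Y] f)
      fix i show "bdry (level Y n) i \<cdot> f i = f (i + 1) \<cdot> bdry (level X k) i"
        using k(2)[of i] gb t chainD(4)[OF tc, of i] by (simp add: f_def)
    qed
    moreover have "rep (\<phi> i) n k (f i)" for i unfolding f_def by (rule rep_raise[OF \<phi>h g k(1)])
    ultimately show ?thesis by blast
  qed
  then obtain m f where f: "\<And>n. chain C (level X (m n)) (level Y n) (f n)" and r: "\<And>n i. rep (\<phi> i) n (m n) (f n i)" by metis
  let ?f = "\<lambda>n. Arrow (level X (m n)) (level Y n) (f n)"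
  have c: "\<exists>k. m n \<le> k \<and> m (Suc n) \<le> k \<and> (bond Y n \<cdot>\<^bsub>SC\<^esub> ?f (Suc n)) \<cdot>\<^bsub>SC\<^esub> transit SC X k (m (Suc n))
      = ?f n \<cdot>\<^bsub>SC\<^esub> transit SC X k (m n)" for n
  proof -
    have "\<exists>k. max (m (Suc n)) (m n) \<le> k \<and> (\<forall>l\<ge>k. (body (bond Y n) i \<cdot> f (Suc n) i) \<cdot> tr (pro_part X i) l (m (Suc n)) = f n i \<cdot> tr (pro_part X i) l (m n))" for i
      using rep_eq_all[OF \<phi>h rep_bond[OF \<phi>h r] r, of n i] by simp
    then have "\<exists>k\<ge>max (m (Suc n)) (m n). \<forall>i. (body (bond Y n) i \<cdot> f (Suc n) i) \<cdot> tr (pro_part X i) k (m (Suc n)) = f n i \<cdot> tr (pro_part X i) k (m n)"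
      by (rule bit_all_large)
    then obtain k where k: "max (m (Suc n)) (m n) \<le> k"
      "\<And>i. (body (bond Y n) i \<cdot> f (Suc n) i) \<cdot> tr (pro_part X i) k (m (Suc n)) = f n i \<cdot> tr (pro_part X i) k (m n)" by blast
    have le: "m n \<le> k" "m (Suc n) \<le> k" using k(1) by simp_all
    have "tgt (bond Y n) = level Y n" using S.towD(4)[OF Y, of n] by (simp add: Sup_cat_simps)
    moreover have "src (transit SC X k (m n)) = level X k" "src (transit SC X k (m (Suc n))) = level X k"
      using S.transit_Ar(2)[OF X le(1)] S.transit_Ar(2)[OF X le(2)] by (simp_all add: Sup_cat_simps)
    ultimately show ?thesis using k(2) le transit_part[OF X le(1)] transit_part[OF X le(2)]
      by (intro exI[of _ k]) (simp add: Sup_cat_simps)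
  qed
  let ?F = "pro_ar SC X Y m ?f"
  have F: "?F \<in> hom_set PS X Y" "\<And>n. rep ?F n (m n) (?f n)"
    by (rule S.pro_ar_hom[OF X Y]; (rule c)?; use f in \<open>simp add: Sup_Ar Sup_cat_simps\<close>)+
  have "parr ?F i = \<phi> i" for i
    by (rule pro_eqI[OF pro_part_arrow(1)[OF F(1)] \<phi>h]) (use pro_part_arrow(2)[OF F(1) F(2), where i = i] r[where i = i] in \<open>auto intro!: exI\<close>)
  with F(1) show thesis by (rule that)
qed

end

section \<open>Free and cofree complexes, components of kernels\<close>

context preadd
begin

interpretation S: preadd SC by (rule Sup_preadd)
interpretation P: preadd PA by (rule Pro_preadd)

lemma free_tower_tow:
  assumes T: "T \<in> tow C" shows "free_tower C T i \<in> tow SC"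
proof -
  note [simp] = towD[OF T]
  have [simp]: "part (free_cx C a i) j = a" "bdry (free_cx C a i) j = (if j = i then Id C a else Zer C a a)" for a j
    by (simp_all add: free_cx_def)
  have cx: "free_cx C a i \<in> Ob SC" if "a \<in> Ob C" for a
    using that by (intro cxI) (simp_all add: bit_not_eq)
  have ch: "chain C (free_cx C (level T (Suc n)) i) (free_cx C (level T n) i) (\<lambda>_. bond T n)" for n
    by (intro chainI deg0I cx) simp_all
  show ?thesis
    by (rule S.towI) (use cx ch in \<open>simp_all add: free_tower_def Sup_Ar Sup_cat_simps\<close>)
qed

lemma pro_part_free: "pro_part (free_tower C T i) j = T"
  by (cases T) (simp add: pro_part_def free_tower_def free_cx_def)

lemma pro_bdry_free:
  assumes T: "T \<in> tow C"
  shows "pro_bdry C (free_tower C T i) i = Id PA T" "pro_bdry C (free_tower C T i) (i + 1) = Zer PA T T"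
proof -
  show "pro_bdry C (free_tower C T i) i = Id PA T"
    unfolding pro_bdry_def pro_part_free Pro_Id by (simp add: free_tower_def free_cx_def)
  have b: "pro_bdry C (free_tower C T i) (i + 1) \<in> hom_set PA T T" "rep (pro_bdry C (free_tower C T i) (i + 1)) n n (Zer C (level T n) (level T n))" for n
    using pro_bdry[OF free_tower_tow[OF T, of i], of "i + 1"] pro_bdry(2)[OF free_tower_tow[OF T, of i], where i = "i + 1" and n = n]
    by (simp_all only: pro_part_free) (simp add: free_tower_def free_cx_def)
  show "pro_bdry C (free_tower C T i) (i + 1) = Zer PA T T"
    by (rule pro_eqI_level[OF b(1) Pro_Zer_rep(1)[OF T T] b(2) Pro_Zer_rep(2)[OF T T]]) simp
qed

text \<open>With \<open>free_map_unique\<close> this makes the free complexes a left adjoint of the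
  component functor in degree \<open>i\<close>; in the other degree the map is forced to be the
  differential after \<open>g\<close>.\<close>

lemma free_map:
  assumes X: "X \<in> tow SC" and g: "g \<in> hom_set PA T (pro_part X i)"
  shows "\<exists>G\<in>hom_set PS (free_tower C T i) X. parr G i = g"
proof -
  note T = Pro_hom_tow(1)[OF g]
  note FT = free_tower_tow[OF T]
  have gA: "g \<in> Ar PA" "Dom PA g = T" "Cod PA g = pro_part X i" using g by (auto simp: in_hom_set)
  have TO: "T \<in> Ob PA" using T by (simp add: Pro_Ob)
  note X' = P.cxD[OF Phi_cx[OF X], unfolded Phi_simps]
  let ?\<phi> = "\<lambda>j. if j = i then g else pro_bdry C X i \<star> g"
  have "chain PA (Phi C (free_tower C T i)) (Phi C X) ?\<phi>"
  proof (intro P.chainI P.deg0I Phi_cx FT X)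
    fix j
    have j: "j = i \<or> j = i + 1" using bit_not_eq by blast
    show "?\<phi> j \<in> Ar PA" "Dom PA (?\<phi> j) = part (Phi C (free_tower C T i)) j" "Cod PA (?\<phi> j) = part (Phi C X) j"
      using gA X' j by (auto simp: pro_part_free)
    show "bdry (Phi C X) j \<star> ?\<phi> j = ?\<phi> (j + 1) \<star> bdry (Phi C (free_tower C T i)) j"
      using j by (elim disjE) (simp_all add: gA X' TO pro_bdry_free[OF T])
  qed
  then obtain G where "G \<in> hom_set PS (free_tower C T i) X" "\<And>j. parr G j = ?\<phi> j" using Phi_full[OF FT X] by blast
  then show ?thesis by (intro bexI[of _ G]) simp_all
qed

lemma free_map_unique:
  assumes G: "G \<in> hom_set PS (free_tower C T i) X" and H: "H \<in> hom_set PS (free_tower C T i) X" and T: "T \<in> tow C"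
    and e: "parr G i = parr H i"
  shows "G = H"
proof (rule Phi_faithful[OF G H])
  have *: "parr G (i + 1) = pro_bdry C X i \<star> parr G i" if G: "G \<in> hom_set PS (free_tower C T i) X" for G
    using P.chainD(4)[OF Phi_chain[OF G], of i] P.chainD(1-3)[OF Phi_chain[OF G], of "i + 1"]
    by (simp add: pro_bdry_free[OF T] pro_part_free)
  fix j have j: "j = i \<or> j = i + 1" using bit_not_eq by blast
  then show "parr G j = parr H j" using e *[OF G] *[OF H] by auto
qed

text \<open>The right adjoint side: a condition imposed in one degree extends to a map of
  pro-supercomplexes, so it can be imposed by a kernel.\<close>

lemma cofree_map:
  assumes X: "X \<in> tow SC" and T: "T \<in> tow C" and b: "b \<in> hom_set PA (pro_part X (i + 1)) T"
  shows "\<exists>G\<in>hom_set PS X (free_tower C T i). parr G (i + 1) = b \<and> parr G i = b \<star> pro_bdry C X i"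
proof -
  note FT = free_tower_tow[OF T]
  have bA: "b \<in> Ar PA" "Dom PA b = pro_part X (i + 1)" "Cod PA b = T" using b by (auto simp: in_hom_set)
  have TO: "T \<in> Ob PA" using T by (simp add: Pro_Ob)
  note X' = P.cxD[OF Phi_cx[OF X], unfolded Phi_simps]
  let ?\<phi> = "\<lambda>j. if j = i then b \<star> pro_bdry C X i else b"
  have "chain PA (Phi C X) (Phi C (free_tower C T i)) ?\<phi>"
  proof (intro P.chainI P.deg0I Phi_cx FT X)
    fix j
    have j: "j = i \<or> j = i + 1" using bit_not_eq by blast
    show "?\<phi> j \<in> Ar PA" "Dom PA (?\<phi> j) = part (Phi C X) j" "Cod PA (?\<phi> j) = part (Phi C (free_tower C T i)) j"
      using bA X' j by (auto simp: pro_part_free)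
    show "bdry (Phi C (free_tower C T i)) j \<star> ?\<phi> j = ?\<phi> (j + 1) \<star> bdry (Phi C X) j"
      using j by (elim disjE) (simp_all add: bA X' TO pro_bdry_free[OF T])
  qed
  then obtain G where "G \<in> hom_set PS X (free_tower C T i)" "\<And>j. parr G j = ?\<phi> j" using Phi_full[OF X FT] by blast
  then show ?thesis by (intro bexI[of _ G]) simp_all
qed

text \<open>The component functor has a left adjoint, the free complexes, and so it preserves
  kernels: test maps from \<open>T\<close> are converted into maps from the free complex on
  \<open>T\<close>.\<close>

lemma kernel_part:
  assumes F: "F \<in> hom_set PS X Y" and K: "is_kernel PS F K k"
  shows "is_kernel PA (parr F i) (pro_part K i) (parr k i)"
proof -
  interpret PS: preadd PS by (rule S.Pro_preadd)
  note X = S.Pro_hom_tow(1)[OF F] and Y = S.Pro_hom_tow(2)[OF F]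
  have FA: "F \<in> Ar PS" "Dom PS F = X" "Cod PS F = Y" using F by (auto simp: in_hom_set)
  note kD = PS.kernelD[OF K FA(1), unfolded FA]
  have kh: "k \<in> hom_set PS K X" using kD by (simp add: in_hom_set)
  note Kt = S.Pro_hom_tow(1)[OF kh]
  have Fi: "parr F i \<in> Ar PA" "Dom PA (parr F i) = pro_part X i" "Cod PA (parr F i) = pro_part Y i"
    using pro_part_arrow(1)[OF F, of i] by (simp_all add: in_hom_set)
  have ki: "parr k i \<in> Ar PA" "Dom PA (parr k i) = pro_part K i" "Cod PA (parr k i) = pro_part X i"
    using pro_part_arrow(1)[OF kh, of i] by (simp_all add: in_hom_set)
  show ?thesis
  proof (rule P.kernelI; (unfold Fi(2,3))?)
    show "pro_part K i \<in> Ob PA" using pro_part_tow[OF Kt] by (simp add: Pro_Ob)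
    show "parr k i \<in> Ar PA" "Dom PA (parr k i) = pro_part K i" "Cod PA (parr k i) = pro_part X i"
      by (rule ki)+
    show "parr F i \<star> parr k i = Zer PA (pro_part K i) (pro_part Y i)"
      using Phi_comp[OF kh F, of i] kD(5) Phi_Zer[OF Kt Y, of i] by simp
  next
    fix g assume g: "g \<in> Ar PA" "Cod PA g = pro_part X i" "parr F i \<star> g = Zer PA (Dom PA g) (pro_part Y i)"
    define T where "T = Dom PA g"
    have gh: "g \<in> hom_set PA T (pro_part X i)" using g by (simp add: in_hom_set T_def)
    note T = Pro_hom_tow(1)[OF gh]
    note FT = free_tower_tow[OF T, of i]
    obtain G where G: "G \<in> hom_set PS (free_tower C T i) X" "parr G i = g" using free_map[OF X gh] by blast
    have "F \<cdot>\<^bsub>PS\<^esub> G = Zer PS (free_tower C T i) Y"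
      by (rule free_map_unique[OF S.Pro_Comp_rep(1)[OF G(1) F] S.Pro_Zer_rep(1)[OF FT Y] T])
        (use g(3) in \<open>simp add: Phi_comp[OF G(1) F] Phi_Zer[OF FT Y] G(2) pro_part_free T_def[symmetric]\<close>)
    then obtain H where H: "H \<in> Ar PS" "Dom PS H = free_tower C T i" "Cod PS H = K" "k \<cdot>\<^bsub>PS\<^esub> H = G"
      using PS.kernel_lift[OF K FA(1), of G] G(1) FA by (auto simp: in_hom_set)
    have Hh: "H \<in> hom_set PS (free_tower C T i) K" using H by (simp add: in_hom_set)
    have "parr k i \<star> parr H i = g" using Phi_comp[OF Hh kh, of i] H(4) G(2) by simp
    then show "\<exists>h. h \<in> Ar PA \<and> Dom PA h = Dom PA g \<and> Cod PA h = pro_part K i \<and> parr k i \<star> h = g"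
      using pro_part_arrow(1)[OF Hh, of i] by (intro exI[of _ "parr H i"]) (simp add: in_hom_set pro_part_free T_def)
  next
    fix h h' assume h: "h \<in> Ar PA" "h' \<in> Ar PA" "Dom PA h = Dom PA h'" "Cod PA h = pro_part K i" "Cod PA h' = pro_part K i"
      "parr k i \<star> h = parr k i \<star> h'"
    define T where "T = Dom PA h"
    have hh: "h \<in> hom_set PA T (pro_part K i)" "h' \<in> hom_set PA T (pro_part K i)" using h by (simp_all add: in_hom_set T_def)
    note T = Pro_hom_tow(1)[OF hh(1)]
    obtain H where H: "H \<in> hom_set PS (free_tower C T i) K" "parr H i = h" using free_map[OF Kt hh(1)] by blast
    obtain H' where H': "H' \<in> hom_set PS (free_tower C T i) K" "parr H' i = h'" using free_map[OF Kt hh(2)] by blast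
    have "k \<cdot>\<^bsub>PS\<^esub> H = k \<cdot>\<^bsub>PS\<^esub> H'"
      by (rule free_map_unique[OF S.Pro_Comp_rep(1)[OF H(1) kh] S.Pro_Comp_rep(1)[OF H'(1) kh] T])
        (simp add: Phi_comp[OF H(1) kh] Phi_comp[OF H'(1) kh] H(2) H'(2) h(6))
    then have "H = H'" by (rule PS.kernel_mono[OF K FA(1)]) (use H(1) H'(1) in \<open>simp_all add: in_hom_set\<close>)
    then show "h = h'" using H(2) H'(2) by simp
  qed
qed

end

text \<open>A supercomplex \<open>X\<close> of pro-objects embeds into the sum \<open>D\<close> of the cofree complexes on its two components;
  there it is cut out by the equations \<open>z\<^sub>j = d z\<^sub>j\<^sub>+\<^sub>1\<close> in degree \<open>j + 1\<close>, which are maps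
  between pro-supercomplexes.\<close>

lemma (in additive) Phi_essentially_surjective:
  assumes ker: "has_kernels C" and X: "X \<in> Ob (Sup_cat PA)"
  obtains X' \<theta> \<theta>' where "X' \<in> tow SC" "chain PA X (Phi C X') \<theta>" "chain PA (Phi C X') X \<theta>'"
    "\<And>i. \<theta>' i \<star> \<theta> i = Id PA (part X i)" "\<And>i. \<theta> i \<star> \<theta>' i = Id PA (pro_part X' i)"
proof -
  interpret S: additive SC by (rule Sup_additive)
  interpret P: additive PA by (rule Pro_additive)
  interpret PS: additive PS by (rule S.Pro_additive)
  have kerS: "has_kernels PS" by (rule S.Pro_kernels[OF Sup_kernels[OF ker]])
  note Xd [simp] = P.cxD[OF X]
  have Xt: "part X j \<in> tow C" for j using P.cxD(1)[OF X] by (simp add: Pro_Ob)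
  \<comment> \<open>Its identity differential goes from degree \<open>j + 1\<close> to degree
    \<open>j\<close>, so it is cofree on \<open>part X j\<close> in degree \<open>j\<close>.\<close>
  define c where "c j = free_tower C (part X j) (j + 1)" for j
  have ct: "c j \<in> tow SC" for j unfolding c_def by (rule free_tower_tow[OF Xt])
  have cpart: "pro_part (c j) i = part X j" for i j by (simp add: c_def pro_part_free)
  have cb: "pro_bdry C (c j) (j + 1) = Id PA (part X j)" "pro_bdry C (c j) j = Zer PA (part X j) (part X j)" for j
    using pro_bdry_free[OF Xt, of j "j + 1"] by (simp_all add: c_def)
  have cb': "pro_bdry C (c (j + 1)) j = Id PA (part X (j + 1))" for j using cb(1)[of "j + 1"] by simp
  obtain D inj prj where D: "D \<in> Ob PS" and inj: "\<And>j. inj j \<in> hom_set PS (c j) D" and prj: "\<And>j. prj j \<in> hom_set PS D (c j)"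
    and pi: "\<And>j. prj j \<cdot>\<^bsub>PS\<^esub> inj j = Id PS (c j)" "\<And>j. prj (j + 1) \<cdot>\<^bsub>PS\<^esub> inj j = Zer PS (c j) (c (j + 1))"
    and ip: "\<And>j. Add PS (inj j \<cdot>\<^bsub>PS\<^esub> prj j) (inj (j + 1) \<cdot>\<^bsub>PS\<^esub> prj (j + 1)) = Id PS D"
    using PS.bit_biproduct[of c] ct by (auto simp: Pro_Ob)
  have Dt: "D \<in> tow SC" using D by (simp add: Pro_Ob)
  define I where "I j i = parr (inj j) i" for j i
  define Q where "Q j i = parr (prj j) i" for j i
  have I [simp]: "I j i \<in> Ar PA" "Dom PA (I j i) = part X j" "Cod PA (I j i) = pro_part D i" for i j
    using pro_part_arrow(1)[OF inj, of j i] by (simp_all add: in_hom_set I_def cpart)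
  have Q [simp]: "Q j i \<in> Ar PA" "Dom PA (Q j i) = pro_part D i" "Cod PA (Q j i) = part X j" for i j
    using pro_part_arrow(1)[OF prj, of j i] by (simp_all add: in_hom_set Q_def cpart)
  have QI: "Q j i \<star> I j i = Id PA (part X j)" "Q (j + 1) i \<star> I j i = Zer PA (part X j) (part X (j + 1))" for i j
    using Phi_comp[OF inj prj, of j j i] Phi_comp[OF inj prj, of "j + 1" j i] pi[of j] Phi_Id[OF ct, of j i] Phi_Zer[OF ct ct, of j "j + 1" i]
    by (simp_all add: I_def Q_def cpart)
  have QI': "Q j i \<star> I (j + 1) i = Zer PA (part X (j + 1)) (part X j)" for i j using QI(2)[of "j + 1" i] by simp
  have IQ: "Add PA (I j i \<star> Q j i) (I (j + 1) i \<star> Q (j + 1) i) = Id PA (pro_part D i)" for i j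
    using Phi_Add[OF S.Pro_Comp_rep(1)[OF prj inj] S.Pro_Comp_rep(1)[OF prj inj], of j "j + 1" i]
      Phi_comp[OF prj inj, of j i] Phi_comp[OF prj inj, of "j + 1" i] ip[of j] Phi_Id[OF Dt, of i]
    by (simp add: I_def Q_def)
  note Dd [simp] = P.cxD[OF Phi_cx[OF Dt], unfolded Phi_simps]
  have dI: "pro_bdry C D i \<star> I j i = I j (i + 1) \<star> pro_bdry C (c j) i" for i j
    using P.chainD(4)[OF Phi_chain[OF inj], of i j] by (simp add: I_def)
  have QIx: "Q j i \<star> I j i \<star> x = x" if "x \<in> Ar PA" "Cod PA x = part X j" for i j x
    using P.comp_rw[OF QI(1)[of j i], of x] that by simp
  have QIx': "Q j i \<star> I (j + 1) i \<star> x = Zer PA (Dom PA x) (part X j)" if "x \<in> Ar PA" "Cod PA x = part X (j + 1)" for i j x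
    using P.comp_rw[OF QI'[of j i], of x] that by simp
  have QIx'': "Q (j + 1) i \<star> I j i \<star> x = Zer PA (Dom PA x) (part X (j + 1))" if "x \<in> Ar PA" "Cod PA x = part X j" for i j x
    using P.comp_rw[OF QI(2)[of j i], of x] that by simp
  \<comment> \<open>The embedding given by cofreeness: the identity into the summand of the same
    degree, the differential of \<open>X\<close> into the other one.\<close>
  define \<epsilon> where "\<epsilon> i = Add PA (I i i) (I (i + 1) i \<star> bdry X i)" for i
  have \<epsilon> [simp]: "\<epsilon> i \<in> Ar PA" "Dom PA (\<epsilon> i) = part X i" "Cod PA (\<epsilon> i) = pro_part D i" for i by (simp_all add: \<epsilon>_def)
  have Q\<epsilon>: "Q i i \<star> \<epsilon> i = Id PA (part X i)" "Q (i + 1) i \<star> \<epsilon> i = bdry X i" for i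
    by (simp_all add: \<epsilon>_def QI QIx QIx')
  have \<epsilon>c: "pro_bdry C D i \<star> \<epsilon> i = \<epsilon> (i + 1) \<star> bdry X i" for i
  proof -
    have "pro_bdry C D i \<star> I (i + 1) i \<star> bdry X i = I (i + 1) (i + 1) \<star> bdry X i"
      using P.comp_rw[OF dI[of i "i + 1"], of "bdry X i"] by (simp add: cb')
    then show ?thesis by (simp add: \<epsilon>_def dI cb)
  qed
  \<comment> \<open>The equation in degree \<open>j + 1\<close> as a map to \<open>part X j\<close>;
    \<open>cofree_map\<close> extends it to a map of pro-supercomplexes defined on
    \<open>D\<close>.\<close>
  define b where "b j = Add PA (Q j (j + 1)) (neg PA (bdry X (j + 1) \<star> Q (j + 1) (j + 1)))" for j
  have b [simp]: "b j \<in> Ar PA" "Dom PA (b j) = pro_part D (j + 1)" "Cod PA (b j) = part X j" for j by (simp_all add: b_def)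
  have "\<exists>G\<in>hom_set PS D (free_tower C (part X j) j). parr G (j + 1) = b j \<and> parr G j = b j \<star> pro_bdry C D j" for j
    by (rule cofree_map[OF Dt Xt]) (simp add: in_hom_set)
  then obtain \<Psi> where \<Psi>: "\<And>j. \<Psi> j \<in> hom_set PS D (free_tower C (part X j) j)"
    and \<Psi>b: "\<And>j. parr (\<Psi> j) (j + 1) = b j" "\<And>j. parr (\<Psi> j) j = b j \<star> pro_bdry C D j" by metis
  define \<psi> where "\<psi> j i = parr (\<Psi> j) i" for j i
  have \<psi> [simp]: "\<psi> j i \<in> Ar PA" "Dom PA (\<psi> j i) = pro_part D i" "Cod PA (\<psi> j i) = part X j" for i j
    using pro_part_arrow(1)[OF \<Psi>, of j i] by (simp_all add: in_hom_set \<psi>_def pro_part_free)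
  have b\<epsilon>: "b j \<star> \<epsilon> (j + 1) = Zer PA (part X (j + 1)) (part X j)" for j
    using Q\<epsilon>[of "j + 1"] by (simp add: b_def)
  have \<psi>\<epsilon>: "\<psi> j i \<star> \<epsilon> i = Zer PA (part X i) (part X j)" for i j
  proof -
    have i: "i = j + 1 \<or> i = j" using bit_not_eq by blast
    have "(b j \<star> pro_bdry C D j) \<star> \<epsilon> j = Zer PA (part X j) (part X j)"
      using P.comp_rw[OF b\<epsilon>[of j], of "bdry X j"] by (simp add: \<epsilon>c)
    then show ?thesis using i \<Psi>b[of j] b\<epsilon>[of j] by (auto simp: \<psi>_def)
  qed
  \<comment> \<open>Once the equation of its degree holds, the other coordinate is the differential
    of the own one, so everything comes from \<open>X\<close>.\<close>
  have cut: "\<epsilon> i \<star> Q i i \<star> g = g"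
    if g: "g \<in> Ar PA" "Cod PA g = pro_part D i" "\<psi> (i + 1) i \<star> g = Zer PA (Dom PA g) (part X (i + 1))" for g i
  proof -
    have "\<psi> (i + 1) i = Add PA (Q (i + 1) i) (neg PA (bdry X i \<star> Q i i))"
      using \<Psi>b(1)[of "i + 1"] by (simp add: \<psi>_def b_def)
    then have "Q (i + 1) i \<star> g = bdry X i \<star> Q i i \<star> g"
      using g P.eq_iff_diff[of "Q (i + 1) i \<star> g" "bdry X i \<star> Q i i \<star> g"] by simp
    then have "\<epsilon> i \<star> Q i i \<star> g = Add PA (I i i \<star> Q i i) (I (i + 1) i \<star> Q (i + 1) i) \<star> g"
      using g(1,2) by (simp add: \<epsilon>_def)
    then show ?thesis unfolding IQ using g(1,2) by simp
  qed
  \<comment> \<open>The two equations are imposed one after the other, the second on the kernel of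
    the first.\<close>
  have \<Psi>0A: "\<Psi> 0 \<in> Ar PS" "Dom PS (\<Psi> 0) = D" using \<Psi>[of 0] by (auto simp: in_hom_set)
  obtain K1 k1 where K1: "is_kernel PS (\<Psi> 0) K1 k1" using kerS \<Psi>0A(1) unfolding has_kernels_def by blast
  note k1 = PS.kernelD[OF K1 \<Psi>0A(1)]
  have k1h: "k1 \<in> hom_set PS K1 D" using k1 \<Psi>0A by (simp add: in_hom_set)
  have \<Psi>1h: "\<Psi> 1 \<cdot>\<^bsub>PS\<^esub> k1 \<in> hom_set PS K1 (free_tower C (part X 1) 1)" by (rule S.Pro_Comp_rep(1)[OF k1h \<Psi>])
  then have \<Psi>1A: "\<Psi> 1 \<cdot>\<^bsub>PS\<^esub> k1 \<in> Ar PS" "Dom PS (\<Psi> 1 \<cdot>\<^bsub>PS\<^esub> k1) = K1" by (auto simp: in_hom_set)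
  obtain K k2 where K: "is_kernel PS (\<Psi> 1 \<cdot>\<^bsub>PS\<^esub> k1) K k2" using kerS \<Psi>1A(1) unfolding has_kernels_def by blast
  note k2 = PS.kernelD[OF K \<Psi>1A(1)]
  have k2h: "k2 \<in> hom_set PS K K1" using k2 \<Psi>1A by (simp add: in_hom_set)
  note Kt = S.Pro_hom_tow(1)[OF k2h]
  note K1i = kernel_part[OF \<Psi> K1, folded \<psi>_def] and Ki = kernel_part[OF \<Psi>1h K]
  have p\<Psi>1: "parr (\<Psi> 1 \<cdot>\<^bsub>PS\<^esub> k1) i = \<psi> 1 i \<star> parr k1 i" for i
    using Phi_comp[OF k1h \<Psi>, of 1 i] by (simp add: \<psi>_def)
  define \<kappa>1 where "\<kappa>1 i = parr k1 i" for i
  define \<kappa>2 where "\<kappa>2 i = parr k2 i" for i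
  note K1i = K1i[folded \<kappa>1_def] and Ki = Ki[unfolded p\<Psi>1, folded \<kappa>1_def \<kappa>2_def]
  note \<kappa>1 [simp] = P.kernelD[OF K1i \<psi>(1), unfolded \<psi>]
  have \<psi>\<kappa>A [simp]: "\<psi> 1 i \<star> \<kappa>1 i \<in> Ar PA" for i by simp
  have \<psi>\<kappa>D: "Dom PA (\<psi> 1 i \<star> \<kappa>1 i) = pro_part K1 i" "Cod PA (\<psi> 1 i \<star> \<kappa>1 i) = part X 1" for i by simp_all
  note \<kappa>2' = P.kernelD[OF Ki \<psi>\<kappa>A, unfolded \<psi>\<kappa>D]
  note \<kappa>2 [simp] = \<kappa>2'(1-4)
  define \<kappa> where "\<kappa> i = \<kappa>1 i \<star> \<kappa>2 i" for i
  have \<kappa> [simp]: "\<kappa> i \<in> Ar PA" "Dom PA (\<kappa> i) = pro_part K i" "Cod PA (\<kappa> i) = pro_part D i" for i by (simp_all add: \<kappa>_def)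
  have \<psi>\<kappa>: "\<psi> j i \<star> \<kappa> i = Zer PA (pro_part K i) (part X j)" for i j
  proof (cases j)
    case zero
    then show ?thesis using P.comp_rw[OF \<kappa>1(5)[of i], of "\<kappa>2 i"] by (simp add: \<kappa>_def)
  next
    case one
    then show ?thesis using \<kappa>2'(5)[of i] by (simp add: \<kappa>_def)
  qed
  have \<kappa>mono: "h = h'" if "\<kappa> i \<star> h = \<kappa> i \<star> h'" "h \<in> Ar PA" "h' \<in> Ar PA" "Dom PA h = Dom PA h'" "Cod PA h = pro_part K i" "Cod PA h' = pro_part K i" for h h' i
  proof (rule P.kernel_mono[OF Ki \<psi>\<kappa>A])
    show "\<kappa>2 i \<star> h = \<kappa>2 i \<star> h'"
      by (rule P.kernel_mono[OF K1i \<psi>(1)]) (use that in \<open>simp_all add: \<kappa>_def\<close>)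
  qed (use that in simp_all)
  have "\<exists>h. h \<in> Ar PA \<and> Dom PA h = part X i \<and> Cod PA h = pro_part K i \<and> \<kappa> i \<star> h = \<epsilon> i" for i
  proof -
    obtain h where h: "h \<in> Ar PA" "Dom PA h = part X i" "Cod PA h = pro_part K1 i" "\<kappa>1 i \<star> h = \<epsilon> i"
      using P.kernel_lift[OF K1i \<psi>(1), of i "\<epsilon> i"] \<psi>\<epsilon>[of 0 i] by auto
    have "(\<psi> 1 i \<star> \<kappa>1 i) \<star> h = Zer PA (part X i) (part X 1)" using h(1-3) \<psi>\<epsilon>[of 1 i] by (simp add: h(4))
    then obtain h' where "h' \<in> Ar PA" "Dom PA h' = part X i" "Cod PA h' = pro_part K i" "\<kappa>2 i \<star> h' = h"
      using P.kernel_lift[OF Ki \<psi>\<kappa>A, of i h] h by auto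
    then show ?thesis using h by (intro exI[of _ h']) (simp add: \<kappa>_def)
  qed
  then obtain \<theta> where \<theta>: "\<And>i. \<theta> i \<in> Ar PA" "\<And>i. Dom PA (\<theta> i) = part X i" "\<And>i. Cod PA (\<theta> i) = pro_part K i" "\<And>i. \<kappa> i \<star> \<theta> i = \<epsilon> i"
    by metis
  note [simp] = \<theta>(1-3)
  define \<theta>' where "\<theta>' i = Q i i \<star> \<kappa> i" for i
  have \<theta>' [simp]: "\<theta>' i \<in> Ar PA" "Dom PA (\<theta>' i) = pro_part K i" "Cod PA (\<theta>' i) = part X i" for i by (simp_all add: \<theta>'_def)
  have 1: "\<theta>' i \<star> \<theta> i = Id PA (part X i)" for i by (simp add: \<theta>'_def \<theta>(4) Q\<epsilon>)
  have KO [simp]: "pro_part K i \<in> Ob PA" for i using pro_part_tow[OF Kt] by (simp add: Pro_Ob)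
  have 2: "\<theta> i \<star> \<theta>' i = Id PA (pro_part K i)" for i
  proof (rule \<kappa>mono)
    have "\<kappa> i \<star> \<theta> i \<star> \<theta>' i = \<epsilon> i \<star> Q i i \<star> \<kappa> i"
      using P.comp_rw[OF \<theta>(4)[of i], of "\<theta>' i"] by (simp add: \<theta>'_def)
    also have "\<dots> = \<kappa> i" by (rule cut) (simp_all add: \<psi>\<kappa>)
    finally show "\<kappa> i \<star> \<theta> i \<star> \<theta>' i = \<kappa> i \<star> Id PA (pro_part K i)" by simp
  qed simp_all
  note Kd [simp] = P.cxD[OF Phi_cx[OF Kt], unfolded Phi_simps]
  have \<kappa>c: "pro_bdry C D i \<star> \<kappa> i = \<kappa> (i + 1) \<star> pro_bdry C K i" for i
  proof -
    have "chain PA (Phi C K) (Phi C D) (\<lambda>i. parr k1 i \<star> parr k2 i)"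
      by (rule P.chain_comp[OF Phi_chain[OF k2h] Phi_chain[OF k1h]])
    from P.chainD(4)[OF this, of i] show ?thesis by (simp add: \<kappa>_def \<kappa>1_def \<kappa>2_def)
  qed
  have \<kappa>cx: "pro_bdry C D i \<star> \<kappa> i \<star> x = \<kappa> (i + 1) \<star> pro_bdry C K i \<star> x" if "x \<in> Ar PA" "Cod PA x = pro_part K i" for x i
    using P.comp_rw[OF \<kappa>c[of i], of x] that by simp
  have th: "pro_bdry C K i \<star> \<theta> i = \<theta> (i + 1) \<star> bdry X i" for i
  proof (rule \<kappa>mono)
    have "\<kappa> (i + 1) \<star> pro_bdry C K i \<star> \<theta> i = \<epsilon> (i + 1) \<star> bdry X i"
      using \<kappa>cx[of "\<theta> i" i] by (simp add: \<theta>(4) \<epsilon>c)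
    then show "\<kappa> (i + 1) \<star> pro_bdry C K i \<star> \<theta> i = \<kappa> (i + 1) \<star> \<theta> (i + 1) \<star> bdry X i"
      using P.comp_rw[OF \<theta>(4)[of "i + 1"], of "bdry X i"] by simp
  qed simp_all
  have th': "bdry X i \<star> \<theta>' i = \<theta>' (i + 1) \<star> pro_bdry C K i" for i
  proof -
    have "bdry X i \<star> \<theta>' i = (\<theta>' (i + 1) \<star> \<theta> (i + 1)) \<star> bdry X i \<star> \<theta>' i" unfolding 1 by simp
    also have "\<dots> = \<theta>' (i + 1) \<star> (pro_bdry C K i \<star> \<theta> i) \<star> \<theta>' i" unfolding th by simp
    also have "\<dots> = \<theta>' (i + 1) \<star> pro_bdry C K i" by (simp add: 2)
    finally show ?thesis .
  qed
  have "chain PA X (Phi C K) \<theta>" using X Phi_cx[OF Kt] by (intro P.chainI P.deg0I) (simp_all add: th)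
  moreover have "chain PA (Phi C K) X \<theta>'" using X Phi_cx[OF Kt] by (intro P.chainI P.deg0I) (simp_all add: th')
  ultimately show thesis using that[OF Kt _ _ 1 2] by blast
qed

lemma (in preadditive_category) pro_limit_transport:
  assumes lim: "is_pro_limit C VV X V s t" and VV: "VV \<subseteq> Ob C"
    and a: "a \<in> Ar C" "Dom C a = X'" "Cod C a = X" and b: "b \<in> Ar C" "Dom C b = X" "Cod C b = X'"
    and ab: "a \<cdot> b = Id C X" and ba: "b \<cdot> a = Id C X'"
  shows "is_pro_limit C VV X' V (\<lambda>k. s k \<cdot> a) t"
proof -
  note L = is_pro_limitD[OF lim]
  have st: "s k \<in> Ar C" "Dom C (s k) = X" "Cod C (s k) = V k" "t k \<in> Ar C" "Dom C (t k) = V (Suc k)" "Cod C (t k) = V k" for k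
    using L(2,3)[of k] by (simp_all add: in_hom_set)
  note [simp] = st a b
  have ba': "b \<cdot> a \<cdot> x = x" if "x \<in> Ar C" "Cod C x = X'" for x using comp_rw[OF ba, of x] that by simp
  have ab': "a \<cdot> b \<cdot> x = x" if "x \<in> Ar C" "Cod C x = X" for x using comp_rw[OF ab, of x] that by simp
  have ts: "t k \<cdot> s (Suc k) \<cdot> a = s k \<cdot> a" for k using comp_rw[OF L(4)[of k], of a] by simp
  have 1: "f = g" if "f \<in> hom_set C T X'" "g \<in> hom_set C T X'" "\<forall>k. (s k \<cdot> a) \<cdot> f = (s k \<cdot> a) \<cdot> g" for T f g
  proof -
    have f: "f \<in> Ar C" "Dom C f = T" "Cod C f = X'" "g \<in> Ar C" "Dom C g = T" "Cod C g = X'" using that by (simp_all add: in_hom_set)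
    have "a \<cdot> f = a \<cdot> g"
      by (rule L(5)[of _ T]) (use that(3) f in \<open>simp_all add: in_hom_set\<close>)
    then have "b \<cdot> a \<cdot> f = b \<cdot> a \<cdot> g" by (rule arg_cong)
    then show ?thesis using f by (simp add: ba')
  qed
  have 2: "\<exists>h\<in>hom_set C T X'. \<forall>k. (s k \<cdot> a) \<cdot> h = f k" if f: "\<forall>k. f k \<in> hom_set C T (V k) \<and> t k \<cdot> f (Suc k) = f k" for T f
  proof -
    obtain h where h: "h \<in> Ar C" "Dom C h = T" "Cod C h = X" "\<And>k. s k \<cdot> h = f k" using L(6)[of f T] f unfolding Bex_def in_hom_set by blast
    then show ?thesis by (intro bexI[of _ "b \<cdot> h"]) (simp_all add: in_hom_set ab')
  qed
  have 3: "\<exists>k. \<exists>h\<in>hom_set C (V k) W. g = h \<cdot> s k \<cdot> a" if W: "W \<in> VV" and g: "g \<in> hom_set C X' W" for W g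
  proof -
    have g': "g \<in> Ar C" "Dom C g = X'" "Cod C g = W" using g by (simp_all add: in_hom_set)
    obtain k h where h: "h \<in> Ar C" "Dom C h = V k" "Cod C h = W" "g \<cdot> b = h \<cdot> s k"
      using L(7)[OF W, of "g \<cdot> b"] g' unfolding Bex_def in_hom_set by auto
    have "(g \<cdot> b) \<cdot> a = (h \<cdot> s k) \<cdot> a" unfolding h(4) ..
    then have "g = h \<cdot> s k \<cdot> a" using g' h(1-3) ba by simp
    then show ?thesis using h(1-3) by (intro exI[of _ k] bexI[of _ h]) (simp_all add: in_hom_set)
  qed
  have 4: "\<exists>j. pull C t k g j = Zer C (V (k + j)) W"
    if W: "W \<in> VV" and g: "g \<in> hom_set C (V k) W" and z: "g \<cdot> s k \<cdot> a = Zer C X' W" for W k g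
  proof (rule L(8)[OF W g])
    have g': "g \<in> Ar C" "Dom C g = V k" "Cod C g = W" "W \<in> Ob C" using g W VV by (auto simp: in_hom_set)
    have "(g \<cdot> s k \<cdot> a) \<cdot> b = Zer C X W" unfolding z using g' by simp
    then show "g \<cdot> s k = Zer C X W" using g' ab by simp
  qed
  have 0: "V k \<in> VV \<and> s k \<cdot> a \<in> hom_set C X' (V k) \<and> t k \<in> hom_set C (V (Suc k)) (V k) \<and> t k \<cdot> s (Suc k) \<cdot> a = s k \<cdot> a" for k
    using L(1) ts by (simp add: in_hom_set)
  show ?thesis
    unfolding is_pro_limit_def
    using 0 1 2 3 4 by blast
qed

section \<open>Constant complexes as test complexes\<close>

context preadd
begin

interpretation S: preadd SC by (rule Sup_preadd)
interpretation P: preadd PA by (rule Pro_preadd)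

lemma cmap_inj:
  assumes "cmap C f = cmap C g" "f \<in> Ar C" "g \<in> Ar C" "Dom C f = Dom C g" "Cod C f = Cod C g"
  shows "f = g"
proof -
  have r: "rep (cmap C f) 0 0 g" unfolding assms(1) by (rule cmap_hom(2)[OF assms(3)])
  obtain k where "f \<cdot> tr (cst (Dom C f)) k 0 = g \<cdot> tr (cst (Dom C f)) k 0"
    using rep_eq[OF cmap_hom[OF assms(2)] r] .
  then show ?thesis using assms by (simp add: transit_const)
qed

lemma pro_part_const: "pro_part (const_tower SC Y) i = cst (part Y i)"
  by (simp add: pro_part_def const_tower_def Sup_cat_simps)

lemma part_proj:
  assumes X: "X \<in> tow SC"
  shows "parr (proj SC X k) i = proj C (pro_part X i) k"
proof -
  have "parr (proj SC X k) i \<in> hom_set PA (pro_part X i) (cst (part (level X k) i))"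
    using pro_part_arrow(1)[OF S.proj_hom(1)[OF X]] by (simp add: pro_part_const)
  moreover have "proj C (pro_part X i) k \<in> hom_set PA (pro_part X i) (cst (part (level X k) i))"
    using proj_hom(1)[OF pro_part_tow[OF X], of i k] by simp
  moreover have "rep (parr (proj SC X k) i) 0 k (Id C (part (level X k) i))"
    using pro_part_arrow(2)[OF S.proj_hom[OF X], where i = i] by (simp add: Sup_cat_simps)
  moreover have "rep (proj C (pro_part X i) k) 0 k (Id C (part (level X k) i))"
    using proj_hom(2)[OF pro_part_tow[OF X], of i k 0] by simp
  ultimately show ?thesis by (rule pro_const_eqI)
qed

lemma Sup_Ar_body:
  assumes f: "f \<in> Ar SC"
  shows "body f i \<in> Ar C" "Dom C (body f i) = part (src f) i" "Cod C (body f i) = part (tgt f) i"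
  using chainD(1-3)[of "src f" "tgt f" "body f"] f by (simp_all add: Sup_Ar)

lemma part_cmap:
  assumes f: "f \<in> Ar SC"
  shows "parr (cmap SC f) i = cmap C (body f i)"
proof -
  note b = Sup_Ar_body[OF f, of i]
  have "parr (cmap SC f) i \<in> hom_set PA (cst (part (src f) i)) (cst (part (tgt f) i))"
    using pro_part_arrow(1)[OF S.cmap_hom(1)[OF f], of i] by (simp add: pro_part_const Sup_cat_simps)
  moreover have "cmap C (body f i) \<in> hom_set PA (cst (part (src f) i)) (cst (part (tgt f) i))"
    using cmap_hom(1)[OF b(1)] b by simp
  moreover have "rep (parr (cmap SC f) i) 0 0 (body f i)"
    by (rule pro_part_arrow(2)[OF S.cmap_hom[OF f]])
  moreover have "rep (cmap C (body f i)) 0 0 (body f i)" by (rule cmap_hom(2)[OF b(1)])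
  ultimately show ?thesis by (rule pro_const_eqI)
qed

lemma bdry_const:
  assumes Y: "Y \<in> Ob SC"
  shows "pro_bdry C (const_tower SC Y) i = cmap C (bdry Y i)"
proof -
  note b = cxD[OF Y]
  have "pro_bdry C (const_tower SC Y) i \<in> hom_set PA (cst (part Y i)) (cst (part Y (i + 1)))"
    using pro_bdry(1)[OF S.const_tow[OF Y], of i] by (simp add: pro_part_const)
  moreover have "cmap C (bdry Y i) \<in> hom_set PA (cst (part Y i)) (cst (part Y (i + 1)))"
    using cmap_hom(1)[OF b(2), of i] b(3,4)[of i] by simp
  moreover have "rep (pro_bdry C (const_tower SC Y) i) 0 0 (bdry Y i)"
    using pro_bdry(2)[OF S.const_tow[OF Y], where i = i and n = 0] by simp
  moreover have "rep (cmap C (bdry Y i)) 0 0 (bdry Y i)" by (rule cmap_hom(2)[OF b(2)])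
  ultimately show ?thesis by (rule pro_const_eqI)
qed

abbreviation "const_obs \<equiv> cst ` Ob C"

lemma tst_const:
  assumes Y: "Y \<in> Ob SC" shows "tst PA const_obs (Phi C (const_tower SC Y))"
proof -
  show ?thesis unfolding tst_def
    using Phi_cx[OF S.const_tow[OF Y]] cxD(1)[OF Y] by (simp add: pro_part_const)
qed

text \<open>Maps between constant pro-objects come from unique maps of the base category; so the
  differential of \<open>V\<close>, and the vanishing of its square, descend to the base.\<close>

lemma tst_constD:
  assumes V: "tst PA const_obs V"
  obtains Y where "Y \<in> Ob SC" "V = Phi C (const_tower SC Y)"
proof -
  have VO: "V \<in> Ob (Sup_cat PA)" and "\<And>i. \<exists>y. y \<in> Ob C \<and> part V i = cst y" using V unfolding tst_def by blast+
  then obtain y where y: "\<And>i. y i \<in> Ob C" "\<And>i. part V i = cst (y i)" by metis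
  note v = P.cxD[OF VO]
  have "bdry V i \<in> hom_set PA (cst (y i)) (cst (y (i + 1)))" for i
    using v(2-4)[of i] y(2) by (simp add: in_hom_set)
  then have "\<exists>f. f \<in> Ar C \<and> Dom C f = y i \<and> Cod C f = y (i + 1) \<and> bdry V i = cmap C f" for i
    using const_to_const by blast
  then obtain d where d: "\<And>i. d i \<in> Ar C" "\<And>i. Dom C (d i) = y i" "\<And>i. Cod C (d i) = y (i + 1)" "\<And>i. bdry V i = cmap C (d i)" by metis
  have Y: "Supercx y d \<in> Ob SC"
  proof (rule cxI; simp add: y d)
    fix i
    have "cmap C (d (i + 1) \<cdot> d i) = cmap C (Zer C (y i) (y i))"
      using v(5)[of i] d(1-3) y by (simp add: cmap_comp[symmetric] cmap_Zer d(4)[symmetric])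
    then show "d (i + 1) \<cdot> d i = Zer C (y i) (y i)" by (rule cmap_inj) (simp_all add: d(1-3) y)
  qed
  have p: "part V = pro_part (const_tower SC (Supercx y d))" by (simp add: pro_part_const y fun_eq_iff)
  have b: "bdry V = pro_bdry C (const_tower SC (Supercx y d))" by (simp add: bdry_const[OF Y] d(4) fun_eq_iff)
  have "V = Phi C (const_tower SC (Supercx y d))"
    unfolding Phi_def p[symmetric] b[symmetric] by simp
  with Y show thesis by (rule that)
qed

end

text \<open>A complex of pro-objects has no levels of its own. It is replaced by an isomorphic
  \<open>Phi C X'\<close>, whose levels are constant complexes, and the limit presentation is
  transported back along the isomorphism.\<close>

lemma (in additive) Pro_model:
  assumes ker: "has_kernels C"
  shows "pro_model PA const_obs"
proof -
  interpret S: additive SC by (rule Sup_additive)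
  interpret P: additive PA by (rule Pro_additive)
  show ?thesis
  proof
    show sub: "const_obs \<subseteq> Ob PA" using const_tow by (auto simp: Pro_Ob)
    show "\<exists>K k. is_kernel PA f K k" if "f \<in> Ar PA" for f
      using Pro_kernels[OF ker] that unfolding has_kernels_def by blast
    show "\<exists>E pr. is_pro_product PA const_obs E V pr" if "\<And>k. V k \<in> const_obs" for V using that by (rule Pro_products)
    fix X assume X: "X \<in> Ob (Sup_cat PA)"
    obtain X' \<theta> \<theta>' where X': "X' \<in> tow SC" and \<theta>: "chain PA X (Phi C X') \<theta>" and \<theta>': "chain PA (Phi C X') X \<theta>'"
      and \<theta>i: "\<And>i. \<theta>' i \<star> \<theta> i = Id PA (part X i)" "\<And>i. \<theta> i \<star> \<theta>' i = Id PA (pro_part X' i)"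
      using Phi_essentially_surjective[OF ker X] by metis
    note lv = S.towD[OF X']
    let ?V = "\<lambda>k. Phi C (const_tower SC (level X' k))"
    let ?s = "\<lambda>k i. parr (proj SC X' k) i \<star> \<theta> i"
    let ?t = "\<lambda>k. parr (cmap SC (bond X' k))"
    have b: "cmap SC (bond X' k) \<in> hom_set PS (const_tower SC (level X' (Suc k))) (const_tower SC (level X' k))" for k
      using S.cmap_hom(1)[of "bond X' k"] lv by simp
    have "is_pro_limit PA const_obs (part X i) (\<lambda>k. part (?V k) i) (\<lambda>k. ?s k i) (\<lambda>k. ?t k i)" for i
    proof (rule P.pro_limit_transport[OF _ sub, where X = "pro_part X' i" and b = "\<theta>' i"])
      show "is_pro_limit PA const_obs (pro_part X' i) (\<lambda>k. part (?V k) i) (\<lambda>k. parr (proj SC X' k) i) (\<lambda>k. ?t k i)"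
        using pro_limit[OF pro_part_tow[OF X'], of i] by (simp add: part_proj[OF X'] part_cmap lv pro_part_const)
    qed (use P.chainD(1-3)[OF \<theta>] P.chainD(1-3)[OF \<theta>'] \<theta>i in simp_all)
    moreover have "?V k \<in> Ob (Sup_cat PA)" for k by (rule Phi_cx[OF S.const_tow[OF lv(1)]])
    moreover have "chain PA X (?V k) (?s k)" for k by (rule P.chain_comp[OF \<theta> Phi_chain[OF S.proj_hom(1)[OF X']]])
    moreover have "chain PA (?V (Suc k)) (?V k) (?t k)" for k by (rule Phi_chain[OF b])
    ultimately show "\<exists>V s t. (\<forall>k. V k \<in> Ob (Sup_cat PA)) \<and> (\<forall>k. chain PA X (V k) (s k)) \<and> (\<forall>k. chain PA (V (Suc k)) (V k) (t k)) \<and>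
        (\<forall>i. is_pro_limit PA const_obs (part X i) (\<lambda>k. part (V k) i) (\<lambda>k. s k i) (\<lambda>k. t k i))"
      by (intro exI[of _ ?V] exI[of _ ?s] exI[of _ ?t]) blast
  qed
qed

section \<open>Homology of hom complexes\<close>

lemma subquotient_iso_iff:
  assumes G: "comm_group G" and H: "comm_group H"
    and Z: "subgroup Z G" and B: "subgroup B G" "B \<subseteq> Z" and Z': "subgroup Z' H" and B': "subgroup B' H" "B' \<subseteq> Z'"
    and \<phi>: "\<phi> \<in> hom G H" and \<phi>Z: "\<phi> ` Z \<subseteq> Z'" and \<phi>B: "\<phi> ` B \<subseteq> B'"
  shows "(\<lambda>c. \<Union>x\<in>c. B' #>\<^bsub>H\<^esub> \<phi> x) \<in> iso (G\<lparr>carrier := Z\<rparr> Mod B) (H\<lparr>carrier := Z'\<rparr> Mod B') \<longleftrightarrow>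
     (\<forall>y\<in>Z'. \<exists>x\<in>Z. \<exists>b\<in>B'. y = b \<otimes>\<^bsub>H\<^esub> \<phi> x) \<and> (\<forall>x\<in>Z. \<phi> x \<in> B' \<longrightarrow> x \<in> B)"
    (is "?M \<in> iso ?G ?H \<longleftrightarrow> ?S \<and> ?I")
proof -
  interpret G: comm_group G by fact
  interpret H: comm_group H by fact
  interpret \<phi>: group_hom G H \<phi> using \<phi> by unfold_locales
  note ZG = subgroup.mem_carrier[OF Z] and BG = subgroup.mem_carrier[OF B(1)] and Z'H = subgroup.mem_carrier[OF Z'] and B'H = subgroup.mem_carrier[OF B'(1)]
  have cG: "carrier ?G = (\<lambda>a. B #>\<^bsub>G\<^esub> a) ` Z" and cH: "carrier ?H = (\<lambda>a. B' #>\<^bsub>H\<^esub> a) ` Z'"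
    by (auto simp: FactGroup_def RCOSETS_def r_coset_def)
  have mG: "mult ?G = set_mult G" and mH: "mult ?H = set_mult H"
    by (simp_all add: FactGroup_def set_mult_def fun_eq_iff)
  have eqG: "B #>\<^bsub>G\<^esub> x = B #>\<^bsub>G\<^esub> y \<longleftrightarrow> x \<otimes>\<^bsub>G\<^esub> inv\<^bsub>G\<^esub> y \<in> B" if "x \<in> carrier G" "y \<in> carrier G" for x y
    using G.repr_independence[OF _ that(2) B(1), of x] G.rcos_self[OF that(1) B(1)] subgroup.rcos_module[OF B(1) G.is_group that(2,1)] by auto
  have eqH: "B' #>\<^bsub>H\<^esub> x = B' #>\<^bsub>H\<^esub> y \<longleftrightarrow> x \<otimes>\<^bsub>H\<^esub> inv\<^bsub>H\<^esub> y \<in> B'" if "x \<in> carrier H" "y \<in> carrier H" for x y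
    using H.repr_independence[OF _ that(2) B'(1), of x] H.rcos_self[OF that(1) B'(1)] subgroup.rcos_module[OF B'(1) H.is_group that(2,1)] by auto
  \<comment> \<open>All members of a coset have images in the same coset of \<open>B'\<close>, so
    the union collapses.\<close>
  have M: "?M (B #>\<^bsub>G\<^esub> a) = B' #>\<^bsub>H\<^esub> \<phi> a" if a: "a \<in> Z" for a
  proof -
    have "B' #>\<^bsub>H\<^esub> \<phi> x = B' #>\<^bsub>H\<^esub> \<phi> a" if x: "x \<in> B #>\<^bsub>G\<^esub> a" for x
    proof -
      obtain b where b: "b \<in> B" "x = b \<otimes>\<^bsub>G\<^esub> a" using x by (auto simp: r_coset_def)
      then have "\<phi> x \<in> B' #>\<^bsub>H\<^esub> \<phi> a" using \<phi>B BG ZG[OF a] by (auto simp: r_coset_def)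
      then show ?thesis using H.repr_independence[OF _ \<phi>.hom_closed[OF ZG[OF a]] B'(1)] by simp
    qed
    moreover have "a \<in> B #>\<^bsub>G\<^esub> a" using G.rcos_self[OF ZG[OF a] B(1)] .
    ultimately show ?thesis by blast
  qed
  have hom: "?M \<in> hom ?G ?H"
  proof (rule homI)
    fix c assume "c \<in> carrier ?G" then show "?M c \<in> carrier ?H" unfolding cG cH using M \<phi>Z by auto
  next
    fix c c' assume "c \<in> carrier ?G" "c' \<in> carrier ?G"
    then obtain a a' where a: "a \<in> Z" "c = B #>\<^bsub>G\<^esub> a" "a' \<in> Z" "c' = B #>\<^bsub>G\<^esub> a'" unfolding cG by blast
    have "?M (c <#>\<^bsub>G\<^esub> c') = ?M (B #>\<^bsub>G\<^esub> (a \<otimes>\<^bsub>G\<^esub> a'))"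
      using normal.rcos_sum[OF G.subgroup_imp_normal[OF B(1)]] a ZG by simp
    also have "\<dots> = B' #>\<^bsub>H\<^esub> (\<phi> a \<otimes>\<^bsub>H\<^esub> \<phi> a')" using M subgroup.m_closed[OF Z a(1,3)] ZG a(1,3) by simp
    also have "\<dots> = ?M c <#>\<^bsub>H\<^esub> ?M c'"
      using normal.rcos_sum[OF H.subgroup_imp_normal[OF B'(1)]] a ZG M by simp
    finally show "?M (c \<otimes>\<^bsub>?G\<^esub> c') = ?M c \<otimes>\<^bsub>?H\<^esub> ?M c'" unfolding mG mH .
  qed
  have S: "?M ` carrier ?G = carrier ?H \<longleftrightarrow> ?S"
  proof -
    have 1: "?M ` carrier ?G = (\<lambda>a. B' #>\<^bsub>H\<^esub> \<phi> a) ` Z" unfolding cG image_image using M by simp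
    have 2: "(\<lambda>a. B' #>\<^bsub>H\<^esub> \<phi> a) ` Z \<subseteq> carrier ?H" unfolding cH using \<phi>Z by auto
    have 3: "B' #>\<^bsub>H\<^esub> y \<in> (\<lambda>a. B' #>\<^bsub>H\<^esub> \<phi> a) ` Z \<longleftrightarrow> (\<exists>x\<in>Z. \<exists>b\<in>B'. y = b \<otimes>\<^bsub>H\<^esub> \<phi> x)" if y: "y \<in> Z'" for y
    proof -
      have "B' #>\<^bsub>H\<^esub> y = B' #>\<^bsub>H\<^esub> \<phi> x \<longleftrightarrow> (\<exists>b\<in>B'. y = b \<otimes>\<^bsub>H\<^esub> \<phi> x)" if x: "x \<in> Z" for x
      proof -
        have "B' #>\<^bsub>H\<^esub> y = B' #>\<^bsub>H\<^esub> \<phi> x \<longleftrightarrow> y \<in> B' #>\<^bsub>H\<^esub> \<phi> x"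
          using H.repr_independence[OF _ \<phi>.hom_closed[OF ZG[OF x]] B'(1), of y] H.rcos_self[OF Z'H[OF y] B'(1)] by auto
        then show ?thesis by (auto simp: r_coset_def)
      qed
      then show ?thesis unfolding image_iff by blast
    qed
    have "?M ` carrier ?G = carrier ?H \<longleftrightarrow> (\<forall>y\<in>Z'. B' #>\<^bsub>H\<^esub> y \<in> (\<lambda>a. B' #>\<^bsub>H\<^esub> \<phi> a) ` Z)"
      using 2 unfolding 1 cH set_eq_subset image_subset_iff[of "\<lambda>a. B' #>\<^bsub>H\<^esub> a" Z'] by (simp only: simp_thms)
    also have "\<dots> \<longleftrightarrow> ?S" using 3 by simp
    finally show ?thesis .
  qed
  have I: "inj_on ?M (carrier ?G) \<longleftrightarrow> ?I"
  proof
    assume inj: "inj_on ?M (carrier ?G)"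
    show ?I
    proof (intro ballI impI)
      fix x assume x: "x \<in> Z" "\<phi> x \<in> B'"
      have one: "\<one>\<^bsub>G\<^esub> \<in> Z" by (rule subgroup.one_closed[OF Z])
      have "?M (B #>\<^bsub>G\<^esub> x) = ?M (B #>\<^bsub>G\<^esub> \<one>\<^bsub>G\<^esub>)"
        unfolding M[OF x(1)] M[OF one] using x ZG[OF x(1)] eqH[of "\<phi> x" "\<one>\<^bsub>H\<^esub>"] by simp
      then have "B #>\<^bsub>G\<^esub> x = B #>\<^bsub>G\<^esub> \<one>\<^bsub>G\<^esub>" by (rule inj_onD[OF inj]) (use x one in \<open>simp_all add: cG\<close>)
      then show "x \<in> B" using eqG[OF ZG[OF x(1)] G.one_closed] ZG[OF x(1)] by simp
    qed
  next
    assume I: ?I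
    show "inj_on ?M (carrier ?G)"
    proof (rule inj_onI)
      fix c c' assume "c \<in> carrier ?G" "c' \<in> carrier ?G" and e: "?M c = ?M c'"
      then obtain a a' where a: "a \<in> Z" "c = B #>\<^bsub>G\<^esub> a" "a' \<in> Z" "c' = B #>\<^bsub>G\<^esub> a'" unfolding cG by blast
      have "B' #>\<^bsub>H\<^esub> \<phi> a = B' #>\<^bsub>H\<^esub> \<phi> a'" using e M a by simp
      then have "\<phi> (a \<otimes>\<^bsub>G\<^esub> inv\<^bsub>G\<^esub> a') \<in> B'" using eqH ZG a by simp
      then have "a \<otimes>\<^bsub>G\<^esub> inv\<^bsub>G\<^esub> a' \<in> B" using I subgroup.m_closed[OF Z a(1) subgroup.m_inv_closed[OF Z a(3)]] by blast
      then show "c = c'" unfolding a(2,4) using eqG ZG a by simp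
    qed
  qed
  show ?thesis unfolding iso_def bij_betw_def using hom S I by auto
qed

text \<open>\<open>HOM\<close> written for complexes in an arbitrary category, so that its cycles
  and boundaries become \<open>chain\<close>, \<open>anti\<close>, \<open>null\<close> and
  \<open>anull\<close>; through \<open>Phi\<close> the original is an instance.\<close>

definition hom_cx where
  "hom_cx C X Y = \<lparr>grp = (\<lambda>p. product_group UNIV (\<lambda>i. hom_group C (part X i) (part Y (i + p)))),
      diff = (\<lambda>p f i.
        let df = bdry Y (i + p) \<cdot>\<^bsub>C\<^esub> f i;
            fd = f (i + 1) \<cdot>\<^bsub>C\<^esub> bdry X i;
            G = hom_group C (part X i) (part Y (i + p + 1))
        in df \<otimes>\<^bsub>G\<^esub> (if p = 0 then inv\<^bsub>G\<^esub> fd else fd))\<rparr>"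

lemma HOM_eq: "HOM C X Y = hom_cx (Pro C) (Phi C X) (Phi C Y)"
  by (simp add: HOM_def hom_cx_def)

context preadd
begin

lemma hom_cx_carrier:
  assumes X: "X \<in> Ob SC" and Y: "Y \<in> Ob SC"
  shows "carrier (grp (hom_cx C X Y) 0) = {f. deg0 C X Y f}" "carrier (grp (hom_cx C X Y) 1) = {f. deg1 C X Y f}"
  using X Y by (auto simp: hom_cx_def deg0_def deg1_def PiE_UNIV_domain)

lemma hom_cx_mult: "f \<otimes>\<^bsub>grp (hom_cx C X Y) p\<^esub> g = (\<lambda>i. f i \<boxplus> g i)"
  and hom_cx_one: "\<one>\<^bsub>grp (hom_cx C X Y) p\<^esub> = (\<lambda>i. Zer C (part X i) (part Y (i + p)))"
  by (simp_all add: hom_cx_def restrict_UNIV)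

lemma hom_cx_group:
  assumes X: "X \<in> Ob SC" and Y: "Y \<in> Ob SC"
  shows "comm_group (grp (hom_cx C X Y) p)"
proof -
  have g: "group (grp (hom_cx C X Y) p)"
    unfolding hom_cx_def using hom_group cxD(1)[OF X] cxD(1)[OF Y] by simp
  show ?thesis
  proof (rule group.group_comm_groupI[OF g])
    fix f h assume "f \<in> carrier (grp (hom_cx C X Y) p)" "h \<in> carrier (grp (hom_cx C X Y) p)"
    then have "f i \<in> hom_set C (part X i) (part Y (i + p))" "h i \<in> hom_set C (part X i) (part Y (i + p))" for i
      by (auto simp: hom_cx_def PiE_UNIV_domain)
    then have "f i \<boxplus> h i = h i \<boxplus> f i" for i using Add_commute[of "f i" "h i"] by (simp add: in_hom_set)
    then show "f \<otimes>\<^bsub>grp (hom_cx C X Y) p\<^esub> h = h \<otimes>\<^bsub>grp (hom_cx C X Y) p\<^esub> f" by (simp add: hom_cx_mult)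
  qed
qed

lemma hom_cx_diff:
  "deg0 C X Y f \<Longrightarrow> diff (hom_cx C X Y) 0 f = bd0 C X Y f" "diff (hom_cx C X Y) 1 f = bd1 C X Y f"
proof -
  assume f: "deg0 C X Y f"
  show "diff (hom_cx C X Y) 0 f = bd0 C X Y f"
    using deg0D[OF f] cxD[OF deg0_cx(1)[OF f]] by (simp add: hom_cx_def bd0_def neg_def fun_eq_iff)
qed (simp add: hom_cx_def bd1_def fun_eq_iff)

lemma hom_cx_cycles:
  assumes X: "X \<in> Ob SC" and Y: "Y \<in> Ob SC"
  shows "cycles (hom_cx C X Y) 0 = {f. chain C X Y f}" "cycles (hom_cx C X Y) 1 = {f. anti C X Y f}"
  by (auto simp: cycles_def kernel_def hom_cx_carrier[OF X Y] hom_cx_diff hom_cx_one chain_iff_bd0 anti_iff_bd1 fun_eq_iff)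

lemma hom_cx_boundaries:
  assumes X: "X \<in> Ob SC" and Y: "Y \<in> Ob SC"
  shows "boundaries (hom_cx C X Y) 0 = {f. null C X Y f}" "boundaries (hom_cx C X Y) 1 = {f. anull C X Y f}"
proof -
  show "boundaries (hom_cx C X Y) 0 = {f. null C X Y f}"
    by (auto simp: boundaries_def hom_cx_carrier[OF X Y] hom_cx_diff null_def fun_eq_iff image_iff)
  show "boundaries (hom_cx C X Y) 1 = {f. anull C X Y f}"
    by (auto simp: boundaries_def hom_cx_carrier[OF X Y] hom_cx_diff anull_def fun_eq_iff image_iff)
qed

lemma hom_cx_diff_hom:
  assumes X: "X \<in> Ob SC" and Y: "Y \<in> Ob SC"
  shows "group_hom (grp (hom_cx C X Y) p) (grp (hom_cx C X Y) (p + 1)) (diff (hom_cx C X Y) p)"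
proof -
  have "diff (hom_cx C X Y) p \<in> hom (grp (hom_cx C X Y) p) (grp (hom_cx C X Y) (p + 1))"
    by (cases p) (auto intro!: homI ext simp: hom_cx_carrier[OF X Y] hom_cx_diff hom_cx_mult bd0_deg1 bd1_deg0 bd0_Add bd1_Add deg0_Add)
  then show ?thesis
    using hom_cx_group[OF X Y] by (simp add: group_hom_def group_hom_axioms_def comm_group.axioms)
qed

lemma hom_cx_subgroups:
  assumes X: "X \<in> Ob SC" and Y: "Y \<in> Ob SC"
  shows "subgroup (cycles (hom_cx C X Y) p) (grp (hom_cx C X Y) p)" "subgroup (boundaries (hom_cx C X Y) p) (grp (hom_cx C X Y) p)"
    "boundaries (hom_cx C X Y) p \<subseteq> cycles (hom_cx C X Y) p"
proof -
  show "subgroup (cycles (hom_cx C X Y) p) (grp (hom_cx C X Y) p)"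
    unfolding cycles_def by (rule group_hom.subgroup_kernel[OF hom_cx_diff_hom[OF X Y]])
  show "subgroup (boundaries (hom_cx C X Y) p) (grp (hom_cx C X Y) p)"
    using group_hom.img_is_subgroup[OF hom_cx_diff_hom[OF X Y, of "p + 1"]] by (simp add: boundaries_def)
  show "boundaries (hom_cx C X Y) p \<subseteq> cycles (hom_cx C X Y) p"
    by (cases p) (auto simp: hom_cx_boundaries[OF X Y] hom_cx_cycles[OF X Y] null_def anull_def fun_eq_iff[symmetric] bd1_chain bd0_anti)
qed

lemma anti_comp_right: "\<lbrakk>chain C X Y f; anti C Y Z g\<rbrakk> \<Longrightarrow> anti C X Z (\<lambda>i. g i \<cdot> f i)"
  unfolding anti_iff_bd1
  using deg1_comp_right[of X Y f Z g] bd1_comp_chain_right[of X Y f Z g] chainD(1-3)[of X Y f] cxD(1)[of Z] deg1_cx(2)[of Y Z g]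
  by (simp add: chain_deg0)

lemma homology_map_iso_iff:
  assumes f: "chain C X Y f" and V: "V \<in> Ob SC"
  shows "homology_map (hom_cx C X V) 0 (\<lambda>\<phi> i. \<phi> i \<cdot> f i) \<in> iso (homology (hom_cx C Y V) 0) (homology (hom_cx C X V) 0) \<longleftrightarrow>
     (\<forall>g. chain C X V g \<longrightarrow> (\<exists>h b. chain C Y V h \<and> null C X V b \<and> (\<forall>i. g i = b i \<boxplus> h i \<cdot> f i))) \<and>
     (\<forall>g. chain C Y V g \<longrightarrow> null C X V (\<lambda>i. g i \<cdot> f i) \<longrightarrow> null C Y V g)" (is ?A0)
   "homology_map (hom_cx C X V) 1 (\<lambda>\<phi> i. \<phi> i \<cdot> f i) \<in> iso (homology (hom_cx C Y V) 1) (homology (hom_cx C X V) 1) \<longleftrightarrow>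
     (\<forall>g. anti C X V g \<longrightarrow> (\<exists>h b. anti C Y V h \<and> anull C X V b \<and> (\<forall>i. g i = b i \<boxplus> h i \<cdot> f i))) \<and>
     (\<forall>g. anti C Y V g \<longrightarrow> anull C X V (\<lambda>i. g i \<cdot> f i) \<longrightarrow> anull C Y V g)" (is ?A1)
proof -
  note X = chain_cx(1)[OF f] and Y = chain_cx(2)[OF f]
  note fD = chainD(1-3)[OF f]
  note car = hom_cx_carrier[OF X V] hom_cx_carrier[OF Y V]
  let ?K = "hom_cx C Y V" and ?L = "hom_cx C X V"
  let ?\<phi> = "\<lambda>\<phi> i. \<phi> i \<cdot> f i"
  have hom: "?\<phi> \<in> hom (grp ?K p) (grp ?L p)" for p
  proof (rule homI)
    show "?\<phi> x \<in> carrier (grp ?L p)" if "x \<in> carrier (grp ?K p)" for x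
      using that by (cases p) (simp_all add: car deg0_comp[OF chain_deg0[OF f]] deg1_comp_right[OF chain_deg0[OF f]])
    fix x y assume xy: "x \<in> carrier (grp ?K p)" "y \<in> carrier (grp ?K p)"
    have "(x i \<boxplus> y i) \<cdot> f i = x i \<cdot> f i \<boxplus> y i \<cdot> f i" for i
      using xy deg0D[of Y V x i] deg0D[of Y V y i] deg1D[of Y V x i] deg1D[of Y V y i] by (cases p) (simp_all add: car fD)
    then show "?\<phi> (x \<otimes>\<^bsub>grp ?K p\<^esub> y) = ?\<phi> x \<otimes>\<^bsub>grp ?L p\<^esub> ?\<phi> y"
      unfolding hom_cx_mult by blast
  qed
  have Z: "?\<phi> ` cycles ?K p \<subseteq> cycles ?L p" for p
    by (cases p) (auto simp: hom_cx_cycles[OF X V] hom_cx_cycles[OF Y V] chain_comp[OF f] anti_comp_right[OF f])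
  have B: "?\<phi> ` boundaries ?K p \<subseteq> boundaries ?L p" for p
  proof (cases p)
    case zero
    have "null C X V (\<lambda>i. b i \<cdot> f i)" if b: "null C Y V b" for b
    proof -
      obtain h where h: "deg1 C Y V h" "\<And>i. b i = bd1 C Y V h i" using b unfolding null_def by blast
      then show ?thesis unfolding null_def
        using bd1_comp_chain_right[OF f h(1)] deg1_comp_right[OF chain_deg0[OF f] h(1)] by (intro exI[of _ "\<lambda>i. h i \<cdot> f i"]) simp
    qed
    then show ?thesis using zero by (auto simp: hom_cx_boundaries[OF X V] hom_cx_boundaries[OF Y V])
  next
    case one
    have "anull C X V (\<lambda>i. b i \<cdot> f i)" if b: "anull C Y V b" for b
    proof -
      obtain h where h: "deg0 C Y V h" "\<And>i. b i = bd0 C Y V h i" using b unfolding anull_def by blast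
      then show ?thesis unfolding anull_def
        using bd0_comp_chain_right[OF f h(1)] deg0_comp[OF chain_deg0[OF f] h(1)] by (intro exI[of _ "\<lambda>i. h i \<cdot> f i"]) simp
    qed
    then show ?thesis using one by (auto simp: hom_cx_boundaries[OF X V] hom_cx_boundaries[OF Y V])
  qed
  have *: "homology_map ?L p ?\<phi> \<in> iso (homology ?K p) (homology ?L p) \<longleftrightarrow>
     (\<forall>y\<in>cycles ?L p. \<exists>x\<in>cycles ?K p. \<exists>b\<in>boundaries ?L p. y = (\<lambda>i. b i \<boxplus> x i \<cdot> f i)) \<and>
     (\<forall>x\<in>cycles ?K p. ?\<phi> x \<in> boundaries ?L p \<longrightarrow> x \<in> boundaries ?K p)" for p
    using subquotient_iso_iff[OF hom_cx_group[OF Y V] hom_cx_group[OF X V] hom_cx_subgroups[OF Y V] hom_cx_subgroups[OF X V] hom Z B, of p]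
    unfolding homology_def homology_map_def[abs_def] hom_cx_mult .
  show ?A0 using *[of 0] unfolding hom_cx_cycles[OF X V] hom_cx_cycles[OF Y V] hom_cx_boundaries[OF X V] hom_cx_boundaries[OF Y V]
    by (auto simp: fun_eq_iff)
  show ?A1 using *[of 1] unfolding hom_cx_cycles[OF X V] hom_cx_cycles[OF Y V] hom_cx_boundaries[OF X V] hom_cx_boundaries[OF Y V]
    by (auto simp: fun_eq_iff)
qed

lemma surjective_map_iff:
  assumes f: "chain C X Y f" and V: "V \<in> Ob SC"
  shows "surjective_map (hom_cx C Y V) (hom_cx C X V) (\<lambda>\<phi> i. \<phi> i \<cdot> f i) \<longleftrightarrow>
     (\<forall>g. deg0 C X V g \<longrightarrow> (\<exists>h. deg0 C Y V h \<and> (\<forall>i. g i = h i \<cdot> f i))) \<and>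
     (\<forall>g. deg1 C X V g \<longrightarrow> (\<exists>h. deg1 C Y V h \<and> (\<forall>i. g i = h i \<cdot> f i)))"
proof -
  note X = chain_cx(1)[OF f] and Y = chain_cx(2)[OF f]
  note car = hom_cx_carrier[OF X V] hom_cx_carrier[OF Y V]
  have "(\<lambda>\<phi> i. \<phi> i \<cdot> f i) ` {h. deg0 C Y V h} \<subseteq> {g. deg0 C X V g}" "(\<lambda>\<phi> i. \<phi> i \<cdot> f i) ` {h. deg1 C Y V h} \<subseteq> {g. deg1 C X V g}"
    using deg0_comp[OF chain_deg0[OF f]] deg1_comp_right[OF chain_deg0[OF f]] by auto
  then have "surjective_map (hom_cx C Y V) (hom_cx C X V) (\<lambda>\<phi> i. \<phi> i \<cdot> f i) \<longleftrightarrow>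
      {g. deg0 C X V g} \<subseteq> (\<lambda>\<phi> i. \<phi> i \<cdot> f i) ` {h. deg0 C Y V h} \<and> {g. deg1 C X V g} \<subseteq> (\<lambda>\<phi> i. \<phi> i \<cdot> f i) ` {h. deg1 C Y V h}"
    unfolding surjective_map_def bit_all_iff car by blast
  then show ?thesis by (simp only: subset_iff mem_Collect_eq image_iff fun_eq_iff Bex_def)
qed

end

context pro_model
begin

text \<open>In degree 0 this is the definition of \<open>weq\<close>, up to the order of the
  summands; degree 1 comes along because the test complexes are closed under shift.\<close>

lemma quasi_isomorphism_iff_weq:
  assumes f: "chain C X Y f"
  shows "(\<forall>V. tst C VV V \<longrightarrow> quasi_isomorphism (hom_cx C Y V) (hom_cx C X V) (\<lambda>\<phi> i. \<phi> i \<cdot> f i)) \<longleftrightarrow> weq C VV X Y f"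
proof
  note X = chain_cx(1)[OF f] and Y = chain_cx(2)[OF f] and fD = chainD(1-3)[OF f]
  assume L: "\<forall>V. tst C VV V \<longrightarrow> quasi_isomorphism (hom_cx C Y V) (hom_cx C X V) (\<lambda>\<phi> i. \<phi> i \<cdot> f i)"
  show "weq C VV X Y f" unfolding weq_def
  proof (intro conjI f allI impI)
    fix V assume V: "tst C VV V"
    note iso = iffD1[OF homology_map_iso_iff(1)[OF f tst_cx[OF V]], OF L[unfolded quasi_isomorphism_def, rule_format, OF V]]
    {
      fix g assume "chain C X V g"
      then obtain h b where h: "chain C Y V h" "null C X V b" "\<And>i. g i = b i \<boxplus> h i \<cdot> f i" using iso by blast
      obtain k where k: "deg1 C X V k" "\<And>i. b i = bd1 C X V k i" using h(2) unfolding null_def by blast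
      have "g i = h i \<cdot> f i \<boxplus> bd1 C X V k i" for i
        using h(3)[of i] Add_commute[of "bd1 C X V k i" "h i \<cdot> f i"] deg0D[OF bd1_deg0[OF k(1)]] chainD(1-3)[OF h(1)] fD by (simp add: k(2))
      then show "\<exists>h k. chain C Y V h \<and> deg1 C X V k \<and> (\<forall>i. g i = h i \<cdot> f i \<boxplus> bd1 C X V k i)" using h(1) k(1) by blast
    next
      fix g assume "chain C Y V g \<and> null C X V (\<lambda>i. g i \<cdot> f i)"
      then show "null C Y V g" using iso by blast
    }
  qed
next
  note X = chain_cx(1)[OF f] and Y = chain_cx(2)[OF f] and fD = chainD(1-3)[OF f]
  assume R: "weq C VV X Y f"
  show "\<forall>V. tst C VV V \<longrightarrow> quasi_isomorphism (hom_cx C Y V) (hom_cx C X V) (\<lambda>\<phi> i. \<phi> i \<cdot> f i)"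
    unfolding quasi_isomorphism_def bit_all_iff
  proof (intro allI impI conjI)
    fix V assume V: "tst C VV V"
    show "homology_map (hom_cx C X V) 0 (\<lambda>\<phi> i. \<phi> i \<cdot> f i) \<in> iso (homology (hom_cx C Y V) 0) (homology (hom_cx C X V) 0)"
      unfolding homology_map_iso_iff[OF f tst_cx[OF V]]
    proof (intro conjI allI impI)
      fix g assume g: "chain C X V g"
      obtain h k where h: "chain C Y V h" "deg1 C X V k" "\<And>i. g i = h i \<cdot> f i \<boxplus> bd1 C X V k i" by (rule weq_surj[OF R V g]) (rule that)
      have "g i = bd1 C X V k i \<boxplus> h i \<cdot> f i" for i
        using h(3)[of i] Add_commute[of "bd1 C X V k i" "h i \<cdot> f i"] deg0D[OF bd1_deg0[OF h(2)]] chainD(1-3)[OF h(1)] fD by simp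
      moreover have "null C X V (bd1 C X V k)" using h(2) unfolding null_def by blast
      ultimately show "\<exists>h b. chain C Y V h \<and> null C X V b \<and> (\<forall>i. g i = b i \<boxplus> h i \<cdot> f i)" using h(1) by blast
    qed (rule weq_inj[OF R V])
    show "homology_map (hom_cx C X V) 1 (\<lambda>\<phi> i. \<phi> i \<cdot> f i) \<in> iso (homology (hom_cx C Y V) 1) (homology (hom_cx C X V) 1)"
      unfolding homology_map_iso_iff[OF f tst_cx[OF V]]
    proof (intro conjI allI impI)
      fix g assume g: "anti C X V g"
      obtain h k where h: "anti C Y V h" "deg0 C X V k" "\<And>i. g i = h i \<cdot> f i \<boxplus> bd0 C X V k i" by (rule weq_surj1[OF R V g]) (rule that)
      have "g i = bd0 C X V k i \<boxplus> h i \<cdot> f i" for i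
        using h(3)[of i] Add_commute[of "bd0 C X V k i" "h i \<cdot> f i"] deg1D[OF bd0_deg1[OF h(2)]] antiD(1-3)[OF h(1)] fD by simp
      moreover have "anull C X V (bd0 C X V k)" using h(2) unfolding anull_def by blast
      ultimately show "\<exists>h b. anti C Y V h \<and> anull C X V b \<and> (\<forall>i. g i = b i \<boxplus> h i \<cdot> f i)" using h(1) by blast
    qed (rule weq_inj1[OF R V])
  qed
qed

text \<open>The complexes with zero differential on a test object detect cofibrations.\<close>

lemma surjective_map_iff_cof:
  assumes f: "chain C X Y f"
  shows "(\<forall>V. tst C VV V \<longrightarrow> surjective_map (hom_cx C Y V) (hom_cx C X V) (\<lambda>\<phi> i. \<phi> i \<cdot> f i)) \<longleftrightarrow> cof C VV X Y f"
proof
  note X = chain_cx(1)[OF f] and Y = chain_cx(2)[OF f] and fD = chainD(1-3)[OF f]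
  assume L: "\<forall>V. tst C VV V \<longrightarrow> surjective_map (hom_cx C Y V) (hom_cx C X V) (\<lambda>\<phi> i. \<phi> i \<cdot> f i)"
  show "cof C VV X Y f" unfolding cof_def
  proof (intro conjI f allI cofI fD)
    fix i w g assume w: "w \<in> VV" and g: "g \<in> Ar C" "Dom C g = Dom C (f i)" "Cod C g = w"
    have wO: "w \<in> Ob C" using w VV_Ob by blast
    let ?V = "Supercx (\<lambda>_. w) (\<lambda>_. Zer C w w)"
    have VO: "?V \<in> Ob SC" by (intro cxI) (simp_all add: wO)
    then have V: "tst C VV ?V" using w by (simp add: tst_def)
    have g0: "deg0 C X ?V (\<lambda>j. if j = i then g else Zer C (part X j) w)"
      by (rule deg0I[OF X VO]) (use g wO fD cxD(1)[OF X] in auto)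
    note sm = iffD1[OF surjective_map_iff[OF f VO] L[rule_format, OF V]]
    obtain h where h: "deg0 C Y ?V h" "\<And>j. (if j = i then g else Zer C (part X j) w) = h j \<cdot> f j"
      using conjunct1[OF sm, rule_format, OF g0] by blast
    then show "\<exists>h. h \<in> Ar C \<and> Dom C h = Cod C (f i) \<and> Cod C h = w \<and> h \<cdot> f i = g"
      using deg0D[OF h(1), of i] h(2)[of i] fD by (intro exI[of _ "h i"]) simp
  qed
next
  assume R: "cof C VV X Y f"
  show "\<forall>V. tst C VV V \<longrightarrow> surjective_map (hom_cx C Y V) (hom_cx C X V) (\<lambda>\<phi> i. \<phi> i \<cdot> f i)"
  proof (intro allI impI)
    fix V assume V: "tst C VV V"
    show "surjective_map (hom_cx C Y V) (hom_cx C X V) (\<lambda>\<phi> i. \<phi> i \<cdot> f i)"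
      unfolding surjective_map_iff[OF f tst_cx[OF V]]
    proof (intro conjI allI impI)
      fix g assume "deg0 C X V g"
      from cof_deg0_ext[OF R tst_RI[OF V] this] show "\<exists>h. deg0 C Y V h \<and> (\<forall>i. g i = h i \<cdot> f i)" by auto
    next
      fix g assume "deg1 C X V g"
      from cof_deg1_ext[OF R tst_RI[OF V] this] show "\<exists>h. deg1 C Y V h \<and> (\<forall>i. g i = h i \<cdot> f i)" by auto
    qed
  qed
qed

end

section \<open>The model category axioms for pro-supercomplexes\<close>

locale pro_supercomplexes =
  fixes A :: "('o, 'm) addcat" and J :: "'o set"
  assumes additive: "additive_category A" and lim: "has_finite_limits A" and colim: "has_finite_colimits A"
    and RI: "\<forall>X\<in>Ob A. X \<in> rel_injectives A J"
begin

sublocale A: additive A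
  using additive by (simp add: additive_def preadd_def additive_category_def)

lemma A_kernels: "has_kernels A"
  by (rule A.kernels_if_finite_limits[OF lim])

lemma A_cokernels: "has_kernels (opadd A)"
  by (rule preadditive_category.kernels_if_finite_limits[OF A.opadd_preadditive])
    (use colim in \<open>simp add: has_finite_limits_opadd has_finite_colimits_def\<close>)

sublocale S: additive "Sup_cat A" by (rule A.Sup_additive)
sublocale PS: additive A.PS by (rule S.Pro_additive)
sublocale M: pro_model A.PA A.const_obs by (rule A.Pro_model[OF A_kernels])

abbreviation pro_comp (infixr "\<star>" 75) where "g \<star> f \<equiv> Comp A.PA g f"
abbreviation "W \<equiv> prosup_weak_equivalences A J"
abbreviation "Cof \<equiv> prosup_cofibrations A J"
abbreviation "Fib \<equiv> prosup_fibrations A J"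

lemma rel_injectives_Ob: "rel_injectives A J = Ob A"
  using RI by (auto simp: rel_injectives_def)

text \<open>As every object is relatively injective, \<open>Y\<close> ranges over all
  supercomplexes, and their constant towers correspond to the complexes with constant
  components.\<close>

lemma all_consts: "(\<forall>Y\<in>rel_injective_supercxs A J. P (Phi A (const_tower (Sup_cat A) Y))) \<longleftrightarrow> (\<forall>V. tst A.PA A.const_obs V \<longrightarrow> P V)"
proof -
  have "rel_injective_supercxs A J = Ob (Sup_cat A)"
    unfolding rel_injective_supercxs_def rel_injectives_Ob using A.cxD(1) by blast
  then show ?thesis using A.tst_const A.tst_constD by metis
qed

lemma HOM_map_eq: "HOM_map A F = (\<lambda>\<phi> i. \<phi> i \<star> pro_part_arrow A F i)"
  by (simp add: HOM_map_def fun_eq_iff)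

lemma cofibrations_iff:
  assumes F: "F \<in> hom_set A.PS X Y"
  shows "F \<in> Cof \<longleftrightarrow> cof A.PA A.const_obs (Phi A X) (Phi A Y) (pro_part_arrow A F)"
proof -
  have "F \<in> Ar A.PS" "src F = X" "tgt F = Y" using F by (auto simp: in_hom_set Pro_simps)
  then show ?thesis
    unfolding prosup_cofibrations_def M.surjective_map_iff_cof[OF A.Phi_chain[OF F], symmetric] all_consts[symmetric] HOM_eq HOM_map_eq by simp
qed

lemma weak_equivalences_iff:
  assumes F: "F \<in> hom_set A.PS X Y"
  shows "F \<in> W \<longleftrightarrow> weq A.PA A.const_obs (Phi A X) (Phi A Y) (pro_part_arrow A F)"
proof -
  have "F \<in> Ar A.PS" "src F = X" "tgt F = Y" using F by (auto simp: in_hom_set Pro_simps)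
  then show ?thesis
    unfolding prosup_weak_equivalences_def M.quasi_isomorphism_iff_weq[OF A.Phi_chain[OF F], symmetric] all_consts[symmetric] HOM_eq HOM_map_eq by simp
qed

text \<open>A kernel of \<open>F\<close> exists anyway and its components are kernels of the
  components of \<open>F\<close>; what has to be matched is relative injectivity.\<close>

lemma fibrations_iff:
  assumes F: "F \<in> hom_set A.PS X Y"
  shows "F \<in> Fib \<longleftrightarrow> fibr A.PA A.const_obs (Phi A X) (Phi A Y) (pro_part_arrow A F)"
proof -
  have FA: "F \<in> Ar A.PS" "src F = X" "tgt F = Y" using F by (auto simp: in_hom_set Pro_simps)
  have RI: "pro_rel_injectives A J = rel_injectives A.PA A.const_obs" by (simp add: pro_rel_injectives_def rel_injectives_Ob)
  note Fi = M.chainD(1-3)[OF A.Phi_chain[OF F], unfolded Phi_simps]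
  have "(\<exists>K k. is_kernel A.PS F K k \<and> prosup_fibrant A J K) \<longleftrightarrow>
      (\<forall>i. \<exists>K k. is_kernel A.PA (pro_part_arrow A F i) K k \<and> K \<in> rel_injectives A.PA A.const_obs)" (is "?L \<longleftrightarrow> ?R")
  proof
    assume ?L
    then show ?R using A.kernel_part[OF F] unfolding prosup_fibrant_def RI by blast
  next
    assume R: ?R
    have "has_kernels A.PS" by (rule S.Pro_kernels[OF A.Sup_kernels[OF A_kernels]])
    then obtain K k where K: "is_kernel A.PS F K k" using FA(1) unfolding has_kernels_def by blast
    \<comment> \<open>Two kernels of the same map factor through each other, so one is a retract of
      the other and inherits relative injectivity.\<close>
    have "pro_part K i \<in> M.RI" for i
    proof -
      note Ki = A.kernel_part[OF F K, of i]
      obtain K' k' where K': "is_kernel A.PA (pro_part_arrow A F i) K' k'" "K' \<in> M.RI" using R by blast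
      note k = M.kernelD[OF Ki Fi(1), unfolded Fi] and k' = M.kernelD[OF K'(1) Fi(1), unfolded Fi]
      obtain s where s: "s \<in> Ar A.PA" "Dom A.PA s = pro_part K i" "Cod A.PA s = K'" "k' \<star> s = pro_part_arrow A k i"
        using M.kernel_lift[OF K'(1) Fi(1), of "pro_part_arrow A k i"] k Fi by auto
      obtain r where r: "r \<in> Ar A.PA" "Dom A.PA r = K'" "Cod A.PA r = pro_part K i" "pro_part_arrow A k i \<star> r = k'"
        using M.kernel_lift[OF Ki Fi(1), of k'] k' Fi by auto
      have "r \<star> s = Id A.PA (pro_part K i)"
        by (rule M.kernel_mono[OF Ki Fi(1)]) (use M.comp_rw[OF r(4), of s] k k' r s in simp_all)
      then show ?thesis using M.RI_retract[OF K'(2) s(1,3) r(1,2)] r(3) s(2) by simp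
    qed
    moreover have "K \<in> Ob A.PS" using PS.kernelD(1)[OF K FA(1)] .
    ultimately show ?L using K unfolding prosup_fibrant_def RI by blast
  qed
  then show ?thesis
    unfolding prosup_fibrations_def fibr_def Phi_simps using FA A.Phi_chain[OF F] by auto
qed

end

context pro_model
begin

text \<open>The composite with an isomorphism is a retract of the original map, so both classes are
  inherited; this and \<open>iso_comp\<close> allow the middle object of a factorization to be
  replaced.\<close>

lemma comp_iso:
  assumes i: "chain C X Z i" and \<theta>: "chain C Z Z' \<theta>" and \<theta>': "chain C Z' Z \<theta>'"
    and 1: "\<And>n. \<theta>' n \<cdot> \<theta> n = Id C (part Z n)" and 2: "\<And>n. \<theta> n \<cdot> \<theta>' n = Id C (part Z' n)"
  shows "cof C VV X Z i \<Longrightarrow> cof C VV X Z' (\<lambda>n. \<theta> n \<cdot> i n)" "weq C VV X Z i \<Longrightarrow> weq C VV X Z' (\<lambda>n. \<theta> n \<cdot> i n)"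
proof -
  note X = chain_cx(1)[OF i]
  note [simp] = chainD(1-3)[OF i] chainD(1-3)[OF \<theta>] chainD(1-3)[OF \<theta>'] cxD(1)[OF X]
  have e: "i n \<cdot> Id C (part X n) = \<theta>' n \<cdot> \<theta> n \<cdot> i n" for n using comp_rw[OF 1[of n], of "i n"] by simp
  show "cof C VV X Z' (\<lambda>n. \<theta> n \<cdot> i n)" if "cof C VV X Z i"
    by (rule cof_retract[OF that chain_comp[OF i \<theta>] chain_Id[OF X] chain_Id[OF X] \<theta>' _ e]) simp
  show "weq C VV X Z' (\<lambda>n. \<theta> n \<cdot> i n)" if "weq C VV X Z i"
    by (rule weq_retract[OF that chain_comp[OF i \<theta>] chain_Id[OF X] chain_Id[OF X] \<theta>' \<theta> _ 2 e]) simp_all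
qed

lemma iso_comp:
  assumes p: "chain C Z Y p" and \<theta>: "chain C Z Z' \<theta>" and \<theta>': "chain C Z' Z \<theta>'"
    and 1: "\<And>n. \<theta>' n \<cdot> \<theta> n = Id C (part Z n)" and 2: "\<And>n. \<theta> n \<cdot> \<theta>' n = Id C (part Z' n)"
  shows "fibr C VV Z Y p \<Longrightarrow> fibr C VV Z' Y (\<lambda>n. p n \<cdot> \<theta>' n)" "weq C VV Z Y p \<Longrightarrow> weq C VV Z' Y (\<lambda>n. p n \<cdot> \<theta>' n)"
proof -
  note Y = chain_cx(2)[OF p]
  note [simp] = chainD(1-3)[OF p] chainD(1-3)[OF \<theta>] chainD(1-3)[OF \<theta>'] cxD(1)[OF Y]
  have e: "(p n \<cdot> \<theta>' n) \<cdot> \<theta> n = Id C (part Y n) \<cdot> p n" for n using 1[of n] by simp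
  show "fibr C VV Z' Y (\<lambda>n. p n \<cdot> \<theta>' n)" if "fibr C VV Z Y p"
    by (rule fibr_retract[OF that chain_comp[OF \<theta>' p] \<theta>' \<theta> chain_Id[OF Y] chain_Id[OF Y] 2 _ _ e]) simp_all
  show "weq C VV Z' Y (\<lambda>n. p n \<cdot> \<theta>' n)" if "weq C VV Z Y p"
    by (rule weq_retract[OF that chain_comp[OF \<theta>' p] \<theta>' \<theta> chain_Id[OF Y] chain_Id[OF Y] 2 _ _ e]) simp_all
qed

end

context pro_supercomplexes
begin

lemma homI: "F \<in> Ar A.PS \<Longrightarrow> F \<in> hom_set A.PS (Dom A.PS F) (Cod A.PS F)"
  by (simp add: in_hom_set)

lemma hom_tow: "F \<in> hom_set A.PS X Y \<Longrightarrow> X \<in> tow (Sup_cat A)" "F \<in> hom_set A.PS X Y \<Longrightarrow> Y \<in> tow (Sup_cat A)"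
  using S.Pro_hom_tow by blast+

text \<open>Kernels and cokernels pass from the base to supercomplexes and from there to
  pro-objects; with biproducts they give all finite limits and colimits.\<close>

lemma limits: "has_finite_limits A.PS" "has_finite_colimits A.PS"
proof -
  show "has_finite_limits A.PS"
    by (rule PS.finite_limits_if_kernels[OF S.Pro_kernels[OF A.Sup_kernels[OF A_kernels]]])
  have "has_finite_limits (opadd A.PS)"
    by (rule additive_category.finite_limits_if_kernels[OF PS.opadd_additive S.Pro_cokernels[OF A.Sup_cokernels[OF A_cokernels]]])
  then show "has_finite_colimits A.PS" unfolding has_finite_colimits_def has_finite_limits_opadd .
qed

lemma two_of_three:
  assumes f: "f \<in> hom_set A.PS X Y" and g: "g \<in> hom_set A.PS Y Z"
  shows "(f \<in> W \<and> g \<in> W \<longrightarrow> g \<cdot>\<^bsub>A.PS\<^esub> f \<in> W) \<and>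
        (f \<in> W \<and> g \<cdot>\<^bsub>A.PS\<^esub> f \<in> W \<longrightarrow> g \<in> W) \<and>
        (g \<in> W \<and> g \<cdot>\<^bsub>A.PS\<^esub> f \<in> W \<longrightarrow> f \<in> W)"
proof -
  have e: "pro_part_arrow A (g \<cdot>\<^bsub>A.PS\<^esub> f) = (\<lambda>i. pro_part_arrow A g i \<star> pro_part_arrow A f i)"
    by (rule ext) (rule A.Phi_comp[OF f g])
  show ?thesis
    unfolding weak_equivalences_iff[OF f] weak_equivalences_iff[OF g] weak_equivalences_iff[OF S.Pro_Comp_rep(1)[OF f g]] e
    using M.weq_two_of_three[OF A.Phi_chain[OF f] A.Phi_chain[OF g]] by blast
qed

lemma retracts:
  assumes f: "f \<in> Ar A.PS" and g: "g \<in> Ar A.PS" and ret: "is_retract A.PS f g"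
  shows "(g \<in> W \<longrightarrow> f \<in> W) \<and>
      (g \<in> Cof \<longrightarrow> f \<in> Cof) \<and> (g \<in> Fib \<longrightarrow> f \<in> Fib)"
proof -
  obtain X Y where f: "f \<in> hom_set A.PS X Y" "Dom A.PS f = X" "Cod A.PS f = Y" using homI[OF f] by blast
  obtain X' Y' where g: "g \<in> hom_set A.PS X' Y'" "Dom A.PS g = X'" "Cod A.PS g = Y'" using homI[OF g] by blast
  obtain s r s' r' where s: "s \<in> hom_set A.PS X X'" and r: "r \<in> hom_set A.PS X' X" and s': "s' \<in> hom_set A.PS Y Y'" and r': "r' \<in> hom_set A.PS Y' Y"
    and rs: "r \<cdot>\<^bsub>A.PS\<^esub> s = Id A.PS X" and rs': "r' \<cdot>\<^bsub>A.PS\<^esub> s' = Id A.PS Y" and gs: "g \<cdot>\<^bsub>A.PS\<^esub> s = s' \<cdot>\<^bsub>A.PS\<^esub> f" and fr: "f \<cdot>\<^bsub>A.PS\<^esub> r = r' \<cdot>\<^bsub>A.PS\<^esub> g"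
    using ret unfolding is_retract_def f(2,3) g(2,3) by blast
  let ?p = "pro_part_arrow A"
  have 1: "?p r i \<star> ?p s i = Id A.PA (part (Phi A X) i)" for i
    using A.Phi_comp[OF s r, of i] A.Phi_Id[OF hom_tow(1)[OF f(1)], of i] unfolding rs Phi_simps by (rule trans[OF sym])
  have 2: "?p r' i \<star> ?p s' i = Id A.PA (part (Phi A Y) i)" for i
    using A.Phi_comp[OF s' r', of i] A.Phi_Id[OF hom_tow(2)[OF f(1)], of i] unfolding rs' Phi_simps by (rule trans[OF sym])
  have 3: "?p g i \<star> ?p s i = ?p s' i \<star> ?p f i" for i
    using A.Phi_comp[OF s g(1), of i] A.Phi_comp[OF f(1) s', of i] unfolding gs by (rule trans[OF sym])
  have 4: "?p f i \<star> ?p r i = ?p r' i \<star> ?p g i" for i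
    using A.Phi_comp[OF r f(1), of i] A.Phi_comp[OF g(1) r', of i] unfolding fr by (rule trans[OF sym])
  note c = A.Phi_chain[OF f(1)] A.Phi_chain[OF s] A.Phi_chain[OF r] A.Phi_chain[OF s']
  show ?thesis
    unfolding weak_equivalences_iff[OF f(1)] weak_equivalences_iff[OF g(1)] cofibrations_iff[OF f(1)] cofibrations_iff[OF g(1)]
      fibrations_iff[OF f(1)] fibrations_iff[OF g(1)]
    by (intro conjI impI; erule M.weq_retract[OF _ c A.Phi_chain[OF r'] 1 2 3 4] M.cof_retract[OF _ c 1 3] M.fibr_retract[OF _ c A.Phi_chain[OF r'] 1 2 3 4])
qed

text \<open>The lift is found among complexes of pro-objects; fullness turns it into an arrow, and
  faithfulness checks the two triangles.\<close>

lemma lifting: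
  assumes i: "i \<in> Cof" and p: "p \<in> Fib"
    and w: "i \<in> W \<or> p \<in> W"
  shows "has_lifting A.PS i p"
  unfolding has_lifting_def
proof (intro ballI impI)
  have "i \<in> Ar A.PS" "p \<in> Ar A.PS" using i p by (simp_all add: prosup_cofibrations_def prosup_fibrations_def)
  then obtain B C X Y where ih: "i \<in> hom_set A.PS B C" "Dom A.PS i = B" "Cod A.PS i = C" and ph: "p \<in> hom_set A.PS X Y" "Dom A.PS p = X" "Cod A.PS p = Y"
    using homI by blast
  fix u v assume u: "u \<in> hom_set A.PS (Dom A.PS i) (Dom A.PS p)" and v: "v \<in> hom_set A.PS (Cod A.PS i) (Cod A.PS p)"
    and pu: "p \<cdot>\<^bsub>A.PS\<^esub> u = v \<cdot>\<^bsub>A.PS\<^esub> i"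
  note u = u[unfolded ih(2) ph(2)] and v = v[unfolded ih(3) ph(3)]
  let ?p = "pro_part_arrow A"
  have e: "?p p n \<star> ?p u n = ?p v n \<star> ?p i n" for n
    using A.Phi_comp[OF u ph(1), of n] A.Phi_comp[OF ih(1) v, of n] unfolding pu by (rule trans[OF sym])
  note c = i[unfolded cofibrations_iff[OF ih(1)]] and f = p[unfolded fibrations_iff[OF ph(1)]]
  have "\<exists>w. chain A.PA (Phi A C) (Phi A X) w \<and> (\<forall>n. w n \<star> ?p i n = ?p u n) \<and> (\<forall>n. ?p p n \<star> w n = ?p v n)"
    using w
  proof
    assume "i \<in> W"
    then have w: "weq A.PA A.const_obs (Phi A B) (Phi A C) (?p i)" unfolding weak_equivalences_iff[OF ih(1)] .
    show ?thesis by (rule M.lift_trivial_cofibration[OF c w f A.Phi_chain[OF u] A.Phi_chain[OF v] e])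
  next
    assume "p \<in> W"
    then have w: "weq A.PA A.const_obs (Phi A X) (Phi A Y) (?p p)" unfolding weak_equivalences_iff[OF ph(1)] .
    show ?thesis by (rule M.lift_trivial_fibration[OF c f w A.Phi_chain[OF u] A.Phi_chain[OF v] e])
  qed
  then obtain w where w: "chain A.PA (Phi A C) (Phi A X) w" "\<And>n. w n \<star> ?p i n = ?p u n" "\<And>n. ?p p n \<star> w n = ?p v n" by blast
  obtain h where h: "h \<in> hom_set A.PS C X" "\<And>n. ?p h n = w n"
    by (rule A.Phi_full[OF hom_tow(2)[OF ih(1)] hom_tow(1)[OF ph(1)] w(1)]) (rule that)
  have "h \<cdot>\<^bsub>A.PS\<^esub> i = u"
    by (rule A.Phi_faithful[OF S.Pro_Comp_rep(1)[OF ih(1) h(1)] u]) (simp only: A.Phi_comp[OF ih(1) h(1)] h(2) w(2))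
  moreover have "p \<cdot>\<^bsub>A.PS\<^esub> h = v"
    by (rule A.Phi_faithful[OF S.Pro_Comp_rep(1)[OF h(1) ph(1)] v]) (simp only: A.Phi_comp[OF h(1) ph(1)] h(2) w(3))
  ultimately show "\<exists>h\<in>hom_set A.PS (Cod A.PS i) (Dom A.PS p). h \<cdot>\<^bsub>A.PS\<^esub> i = u \<and> p \<cdot>\<^bsub>A.PS\<^esub> h = v"
    unfolding ih(3) ph(2) using h(1) by blast
qed

text \<open>The middle object \<open>Z\<close> need not lie in the image of \<open>Phi\<close>. It
  is replaced by an isomorphic \<open>Phi A Z'\<close>, after which fullness supplies the two
  arrows, and the classes of maps are invariant under this change.\<close>

lemma realize_factorization:
  assumes f: "f \<in> hom_set A.PS X Y" and i: "chain A.PA (Phi A X) Z i" and p: "chain A.PA Z (Phi A Y) p"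
    and fac: "\<And>n. pro_part_arrow A f n = p n \<star> i n"
  obtains Z' i' p' where "i' \<in> hom_set A.PS X Z'" "p' \<in> hom_set A.PS Z' Y" "f = p' \<cdot>\<^bsub>A.PS\<^esub> i'"
    "cof A.PA A.const_obs (Phi A X) Z i \<Longrightarrow> i' \<in> Cof"
    "weq A.PA A.const_obs (Phi A X) Z i \<Longrightarrow> i' \<in> W"
    "fibr A.PA A.const_obs Z (Phi A Y) p \<Longrightarrow> p' \<in> Fib"
    "weq A.PA A.const_obs Z (Phi A Y) p \<Longrightarrow> p' \<in> W"
proof -
  note X = hom_tow(1)[OF f] and Y = hom_tow(2)[OF f]
  obtain Z' \<theta> \<theta>' where Z': "Z' \<in> tow (Sup_cat A)" and \<theta>: "chain A.PA Z (Phi A Z') \<theta>" and \<theta>': "chain A.PA (Phi A Z') Z \<theta>'"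
      and 1: "\<And>i. \<theta>' i \<star> \<theta> i = Id A.PA (part Z i)" and 2: "\<And>i. \<theta> i \<star> \<theta>' i = Id A.PA (pro_part Z' i)"
    by (rule A.Phi_essentially_surjective[OF A_kernels M.chain_cx(2)[OF i]]) (rule that)
  have 2: "\<theta> i \<star> \<theta>' i = Id A.PA (part (Phi A Z') i)" for i unfolding Phi_simps by (rule 2)
  obtain i' where i': "i' \<in> hom_set A.PS X Z'" "\<And>n. pro_part_arrow A i' n = \<theta> n \<star> i n"
    by (rule A.Phi_full[OF X Z' M.chain_comp[OF i \<theta>]]) (rule that)
  obtain p' where p': "p' \<in> hom_set A.PS Z' Y" "\<And>n. pro_part_arrow A p' n = p n \<star> \<theta>' n"
    by (rule A.Phi_full[OF Z' Y M.chain_comp[OF \<theta>' p]]) (rule that)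
  have i'e: "pro_part_arrow A i' = (\<lambda>n. \<theta> n \<star> i n)" and p'e: "pro_part_arrow A p' = (\<lambda>n. p n \<star> \<theta>' n)"
    using i'(2) p'(2) by auto
  note D = M.chainD(1-3)[OF i] M.chainD(1-3)[OF p] M.chainD(1-3)[OF \<theta>] M.chainD(1-3)[OF \<theta>']
  have "f = p' \<cdot>\<^bsub>A.PS\<^esub> i'"
  proof (rule A.Phi_faithful[OF f S.Pro_Comp_rep(1)[OF i'(1) p'(1)]])
    fix n
    show "pro_part_arrow A f n = pro_part_arrow A (p' \<cdot>\<^bsub>A.PS\<^esub> i') n"
      unfolding A.Phi_comp[OF i'(1) p'(1)] i'(2) p'(2) fac using M.comp_rw[OF 1[of n], of "i n"] D by simp
  qed
  then show thesis
    by (rule that[OF i'(1) p'(1)])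
      (simp_all only: cofibrations_iff[OF i'(1)] weak_equivalences_iff[OF i'(1)] fibrations_iff[OF p'(1)] weak_equivalences_iff[OF p'(1)] i'e p'e
        M.comp_iso[OF i \<theta> \<theta>' 1 2] M.iso_comp[OF p \<theta> \<theta>' 1 2])
qed

lemma factorization:
  assumes f: "f \<in> hom_set A.PS X Y"
  shows "(\<exists>i\<in>Cof. \<exists>p\<in>Fib \<inter> W. Cod A.PS i = Dom A.PS p \<and> f = p \<cdot>\<^bsub>A.PS\<^esub> i) \<and>
        (\<exists>i\<in>Cof \<inter> W. \<exists>p\<in>Fib. Cod A.PS i = Dom A.PS p \<and> f = p \<cdot>\<^bsub>A.PS\<^esub> i)"
proof
  obtain Z i p where Z: "cof A.PA A.const_obs (Phi A X) Z i" "fibr A.PA A.const_obs Z (Phi A Y) p" "weq A.PA A.const_obs Z (Phi A Y) p"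
    "\<And>n. pro_part_arrow A f n = p n \<star> i n"
    using M.factor_cof_trivial_fibr[OF A.Phi_chain[OF f]] by blast
  obtain Z' i' p' where "i' \<in> hom_set A.PS X Z'" "p' \<in> hom_set A.PS Z' Y" "f = p' \<cdot>\<^bsub>A.PS\<^esub> i'"
    "i' \<in> Cof" "p' \<in> Fib" "p' \<in> W"
    by (rule realize_factorization[OF f M.cof_chain[OF Z(1)] M.fibr_chain[OF Z(2)] Z(4)]) (rule that; use Z in blast)
  then show "\<exists>i\<in>Cof. \<exists>p\<in>Fib \<inter> W. Cod A.PS i = Dom A.PS p \<and> f = p \<cdot>\<^bsub>A.PS\<^esub> i"
    by (intro bexI[of _ i'] bexI[of _ p']) (simp_all add: in_hom_set)
next
  obtain Z i p where Z: "cof A.PA A.const_obs (Phi A X) Z i" "weq A.PA A.const_obs (Phi A X) Z i" "fibr A.PA A.const_obs Z (Phi A Y) p"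
    "\<And>n. pro_part_arrow A f n = p n \<star> i n"
    using M.factor_trivial_cof_fibr[OF A.Phi_chain[OF f]] by blast
  obtain Z' i' p' where "i' \<in> hom_set A.PS X Z'" "p' \<in> hom_set A.PS Z' Y" "f = p' \<cdot>\<^bsub>A.PS\<^esub> i'"
    "i' \<in> Cof" "i' \<in> W" "p' \<in> Fib"
    by (rule realize_factorization[OF f M.cof_chain[OF Z(1)] M.fibr_chain[OF Z(3)] Z(4)]) (rule that; use Z in blast)
  then show "\<exists>i\<in>Cof \<inter> W. \<exists>p\<in>Fib. Cod A.PS i = Dom A.PS p \<and> f = p \<cdot>\<^bsub>A.PS\<^esub> i"
    by (intro bexI[of _ i'] bexI[of _ p']) (simp_all add: in_hom_set)
qed

lemma model_category:
  "closed_model_category A.PS (W) (Cof) (Fib)"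
proof (intro closed_model_category.intro closed_model_category_axioms.intro)
  show "category A.PS" by (rule PS.category_axioms)
  show "W \<subseteq> Ar A.PS" "Cof \<subseteq> Ar A.PS" "Fib \<subseteq> Ar A.PS"
    by (auto simp: prosup_weak_equivalences_def prosup_cofibrations_def prosup_fibrations_def)
qed (rule limits two_of_three[OF homI] retracts lifting factorization[OF homI]; simp add: in_hom_set)+

end

theorem theorem3p2:
  fixes A :: "('o, 'm) addcat" and J :: "'o set"
  assumes "additive_category A" and "has_finite_limits A" and "has_finite_colimits A"
    and "J \<subseteq> Ob A"
    and "\<forall>X\<in>Ob A. X \<in> rel_injectives A J"
  shows "closed_model_category (Pro (Sup_cat A))
           (prosup_weak_equivalences A J) (prosup_cofibrations A J) (prosup_fibrations A J)"
  by (rule pro_supercomplexes.model_category[OF pro_supercomplexes.intro[OF assms(1-3,5)]])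

end
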